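(* Consider the classification model with sigmoid activation, in either of the following two versions. (FCN) Let $\bm{W}^\star=[\bm{w}_1^\star,\dots,\bm{w}_K^\star]\in\mathbb{R}^{d\times K}$ with $\|\bm{w}_k^\star\|_2\le 1$ for all $k$. There exist constants $c_1,c_2,c,C>0$ such that if $$n\ge c_1\, dK^5\log^2 d\cdot\Big(\frac{\kappa^2\lambda}{\rho_{\mathrm{FCN}}(\sigma_K)}\Big)^2,$$ then with probability at least $1-d^{-10}$, for all $\bm{W}\in\mathbb{B}(\bm{W}^\star,r_{\mathrm{FCN}})$, $$c\cdot\frac{1}{K^2}\cdot\frac{\rho_{\mathrm{FCN}}(\sigma_K)}{\kappa^2\lambda}\cdot\bm{I}\preceq\nabla^2 f_n(\bm{W})\preceq C\cdot\bm{I},$$ where $r_{\mathrm{FCN}}:=\frac{c_2}{\sqrt K}\cdot\frac{\rho_{\mathrm{FCN}}(\sigma_K)}{\kappa^2\lambda}$. (CNN) Let $\bm{w}^\star\in\mathbb{R}^m$ with $\|\bm{w}^\star\|_2\le1$. There exist constants $c_3,c_4,c',C'>0$ such that if $$n\ge c_3\, dK^5\log^2 d\cdot\Big(\frac{1}{\rho_{\mathrm{CNN}}(\|\bm{w}^\star\|_2)}\Big)^2,$$ then with probability at least $1-d^{-10}$, for all $\bm{w}\in\mathbb{B}(\bm{w}^\star,r_{\mathrm{CNN}})$, $$c'\cdot\frac{1}{K}\rho_{\mathrm{CNN}}(\|\bm{w}^\star\|_2)\cdot\bm{I}\preceq\nabla^2 f_n(\bm{w})\preceq C'K\cdot\bm{I},$$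 where $r_{\mathrm{CNN}}:=\frac{c_4}{K^2}\rho_{\mathrm{CNN}}(\|\bm{w}^\star\|_2)$.
   Context: $\phi(x)=1/(1+e^{-x})$ is the sigmoid. FCN model: for $\bm{W}=[\bm{w}_1,\dots,\bm{w}_K]\in\mathbb{R}^{d\times K}$ and $\bm{x}\in\mathbb{R}^d$, $H(\bm{W},\bm{x})=\frac1K\sum_{k=1}^K\phi(\bm{w}_k^\top\bm{x})$. CNN model: $d=mK$, $\bm{x}^{(k)}=(x_{m(k-1)+1},\dots,x_{mk})^\top\in\mathbb{R}^m$, and for $\bm{w}\in\mathbb{R}^m$, $H(\bm{w},\bm{x})=\frac1K\sum_{k=1}^K\phi(\bm{w}^\top\bm{x}^{(k)})$. Data $(\bm{x}_i,y_i)$, $i=1,\dots,n$, are i.i.d. copies of $(\bm{x},y)$ where $\bm{x}\sim\mathcal{N}(\bm{0},\bm{I}_d)$ and $y\in\{0,1\}$ with $\mathbb{P}(y=1\mid\bm{x})=H(\bm{W}^\star,\bm{x})$ (resp. $H(\bm{w}^\star,\bm{x})$). The cross-entropy loss is $\ell(\bm{W};\bm{x},y)=-y\log H(\bm{W},\bm{x})-(1-y)\log(1-H(\bm{W},\bm{x}))$ and the empirical risk is $f_n(\bm{W})=\frac1n\sum_{i=1}^n\ell(\bm{W};\bm{x}_i,y_i)$ (same for $\bm{w}$ in the CNN case); Hessians are with respect to $\mathrm{vec}(\bm{W})\in\mathbb{R}^{dK}$ (resp. $\bm{w}\in\mathbb{R}^m$). $\mathbb{B}(\bm{W}^\star,r)=\{\bm{W}:\|\bm{W}-\bm{W}^\star\|_{\mathrm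 F}\le r\}$, $\mathbb{B}(\bm{w}^\star,r)=\{\bm{w}:\|\bm{w}-\bm{w}^\star\|_2\le r\}$. $\sigma_1\ge\dots\ge\sigma_K>0$ are the singular values of $\bm{W}^\star$, $\kappa=\sigma_1/\sigma_K$, $\lambda=\prod_{i=1}^K(\sigma_i/\sigma_K)$. With $z\sim\mathcal{N}(0,1)$, let $\alpha_q(\sigma)=\mathbb{E}[\phi'(\sigma z)z^q]$ ($q=0,1,2$), $\beta_q(\sigma)=\mathbb{E}[\phi'(\sigma z)^2z^q]$ ($q=0,2$), and $\rho_{\mathrm{FCN}}(\sigma)=\min\{\beta_0(\sigma)-\alpha_0^2(\sigma),\beta_2(\sigma)-\alpha_2^2(\sigma)\}-\alpha_1^2(\sigma)$. With $z\sim\mathcal{N}(0,\sigma^2)$, $\rho_{\mathrm{CNN}}(\sigma)=\min\{\mathbb{E}[(\phi'(z)z)^2],\mathbb{E}[\phi'(z)^2]\}$. *)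

theory Defs
  imports "HOL-Probability.Probability" "Jordan_Normal_Form.Char_Poly"
begin

definition sigmoid :: "real \<Rightarrow> real" where
  "sigmoid x = 1 / (1 + exp (- x))"

text \<open>FCN: W is a d x K matrix, represented as a function on index pairs (i,k), i<d, k<K;
  column k is w_k. Inputs x are functions nat => real, coordinates i<d.\<close>
definition H_fcn :: "nat \<Rightarrow> nat \<Rightarrow> (nat \<times> nat \<Rightarrow> real) \<Rightarrow> (nat \<Rightarrow> real) \<Rightarrow> real" where
  "H_fcn d K W x = (1 / real K) * (\<Sum>k<K. sigmoid (\<Sum>i<d. W (i, k) * x i))"

text \<open>CNN: d = m*K, patch k (0-based) of x is (x (m*k), ..., x (m*k + m - 1)).\<close>
definition H_cnn :: "nat \<Rightarrow> nat \<Rightarrow> (nat \<Rightarrow> real) \<Rightarrow> (nat \<Rightarrow> real) \<Rightarrow> real" where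
  "H_cnn m K w x = (1 / real K) * (\<Sum>k<K. sigmoid (\<Sum>j<m. w j * x (m * k + j)))"

definition xent :: "real \<Rightarrow> bool \<Rightarrow> real" where
  "xent h y = - of_bool y * ln h - (1 - of_bool y) * ln (1 - h)"

definition fn_fcn :: "nat \<Rightarrow> nat \<Rightarrow> nat \<Rightarrow> (nat \<Rightarrow> (nat \<Rightarrow> real) \<times> bool) \<Rightarrow> (nat \<times> nat \<Rightarrow> real) \<Rightarrow> real" where
  "fn_fcn d K n S W = (1 / real n) * (\<Sum>i<n. xent (H_fcn d K W (fst (S i))) (snd (S i)))"

definition fn_cnn :: "nat \<Rightarrow> nat \<Rightarrow> nat \<Rightarrow> (nat \<Rightarrow> (nat \<Rightarrow> real) \<times> bool) \<Rightarrow> (nat \<Rightarrow> real) \<Rightarrow> real" where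
  "fn_cnn m K n S w = (1 / real n) * (\<Sum>i<n. xent (H_cnn m K w (fst (S i))) (snd (S i)))"

definition gauss_vec :: "nat \<Rightarrow> (nat \<Rightarrow> real) measure" where
  "gauss_vec d = PiM {..<d} (\<lambda>_. density lborel std_normal_density)"

definition data_dist :: "nat \<Rightarrow> ((nat \<Rightarrow> real) \<Rightarrow> real) \<Rightarrow> ((nat \<Rightarrow> real) \<times> bool) measure" where
  "data_dist d h = density (gauss_vec d \<Otimes>\<^sub>M count_space UNIV)
      (\<lambda>(x, y). ennreal (if y then h x else 1 - h x))"

definition sample_dist :: "nat \<Rightarrow> nat \<Rightarrow> ((nat \<Rightarrow> real) \<Rightarrow> real) \<Rightarrow> (nat \<Rightarrow> (nat \<Rightarrow> real) \<times> bool) measure" where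
  "sample_dist n d h = PiM {..<n} (\<lambda>_. data_dist d h)"

text \<open>"Event E holds with probability at least p" (inner probability, so that no
  measurability of E needs to be assumed).\<close>
definition prob_at_least :: "'a measure \<Rightarrow> 'a set \<Rightarrow> real \<Rightarrow> bool" where
  "prob_at_least M E p \<longleftrightarrow> (\<exists>A \<in> sets M. A \<subseteq> E \<and> measure M A \<ge> p)"

definition partial_at :: "(('p \<Rightarrow> real) \<Rightarrow> real) \<Rightarrow> ('p \<Rightarrow> real) \<Rightarrow> 'p \<Rightarrow> real" where
  "partial_at g p a = deriv (\<lambda>t. g (p(a := p a + t))) 0"

definition hessian_at :: "(('p \<Rightarrow> real) \<Rightarrow> real) \<Rightarrow> ('p \<Rightarrow> real) \<Rightarrow> 'p \<Rightarrow> 'p \<Rightarrow> real" where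
  "hessian_at g p a b = partial_at (\<lambda>q. partial_at g q b) p a"

definition hess_between :: "real \<Rightarrow> real \<Rightarrow> (('p \<Rightarrow> real) \<Rightarrow> real) \<Rightarrow> ('p \<Rightarrow> real) \<Rightarrow> 'p set \<Rightarrow> bool" where
  "hess_between lo hi g p I \<longleftrightarrow>
     (\<forall>v :: 'p \<Rightarrow> real.
        lo * (\<Sum>a\<in>I. (v a)\<^sup>2) \<le> (\<Sum>a\<in>I. \<Sum>b\<in>I. v a * hessian_at g p a b * v b) \<and>
        (\<Sum>a\<in>I. \<Sum>b\<in>I. v a * hessian_at g p a b * v b) \<le> hi * (\<Sum>a\<in>I. (v a)\<^sup>2))"

definition sing_vals :: "nat \<Rightarrow> nat \<Rightarrow> (nat \<times> nat \<Rightarrow> real) \<Rightarrow> real multiset" where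
  "sing_vals d K W = (let A = Matrix.mat d K W in image_mset sqrt (proots (char_poly (A\<^sup>T * A))))"

definition sigma_max :: "nat \<Rightarrow> nat \<Rightarrow> (nat \<times> nat \<Rightarrow> real) \<Rightarrow> real" where
  "sigma_max d K W = Max_mset (sing_vals d K W)"

definition sigma_min :: "nat \<Rightarrow> nat \<Rightarrow> (nat \<times> nat \<Rightarrow> real) \<Rightarrow> real" where
  "sigma_min d K W = Min_mset (sing_vals d K W)"

definition cond_kappa :: "nat \<Rightarrow> nat \<Rightarrow> (nat \<times> nat \<Rightarrow> real) \<Rightarrow> real" where
  "cond_kappa d K W = sigma_max d K W / sigma_min d K W"

definition cond_lambda :: "nat \<Rightarrow> nat \<Rightarrow> (nat \<times> nat \<Rightarrow> real) \<Rightarrow> real" where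
  "cond_lambda d K W = (\<Prod>s\<in>#sing_vals d K W. s / sigma_min d K W)"

definition alpha :: "nat \<Rightarrow> real \<Rightarrow> real" where
  "alpha q \<sigma> = (LINT z|lborel. std_normal_density z * (deriv sigmoid (\<sigma> * z) * z ^ q))"

definition beta :: "nat \<Rightarrow> real \<Rightarrow> real" where
  "beta q \<sigma> = (LINT z|lborel. std_normal_density z * ((deriv sigmoid (\<sigma> * z))\<^sup>2 * z ^ q))"

definition rho_fcn :: "real \<Rightarrow> real" where
  "rho_fcn \<sigma> = min (beta 0 \<sigma> - (alpha 0 \<sigma>)\<^sup>2) (beta 2 \<sigma> - (alpha 2 \<sigma>)\<^sup>2) - (alpha 1 \<sigma>)\<^sup>2"

definition rho_cnn :: "real \<Rightarrow> real" where
  "rho_cnn \<sigma> = min (LINT z|lborel. normal_density 0 \<sigma> z * (deriv sigmoid z * z)\<^sup>2)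
                    (LINT z|lborel. normal_density 0 \<sigma> z * (deriv sigmoid z)\<^sup>2)"

end

theory Submission
  imports Defs "HOL-Real_Asymp.Real_Asymp"
begin

text \<open>As a quadratic form in \<open>v\<close>, the Hessian of the loss at one data point only involves the
  pre-activations \<open>w\<^sub>k \<cdot> x\<close> and \<open>v\<^sub>k \<cdot> x\<close> and is at most \<open>2 (\<Sum>k. (v\<^sub>k \<cdot> x)\<^sup>2)\<close> in absolute value, which
  has exponential moments. Chernoff bounds on finite grids of parameters and of directions therefore
  make the empirical Hessian close to its mean, uniformly over the ball; the upper bound follows.

  At the true parameter the mean is at least \<open>K\<^sup>-\<^sup>2 E F\<^sup>2\<close> with \<open>F = (\<Sum>k. \<phi>'(w\<^sub>k \<cdot> x) (v\<^sub>k \<cdot> x))\<close>, up to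
  an error linear in the radius elsewhere in the ball. Instead of a change of measure, \<open>E F\<^sup>2\<close> is
  bounded below by testing \<open>F\<close> against \<open>h = (\<Sum>j. :(a\<^sub>j \<cdot> x)\<^sup>2 (b\<^sub>j \<cdot> x):)\<close>, where \<open>:\<dots>:\<close> is the Wick
  product and \<open>a\<^sub>j\<close> is the basis dual to the columns \<open>w\<^sub>j\<close>. By Stein's identity the terms of \<open>E F h\<close>
  with \<open>j \<noteq> k\<close> vanish, and suitable \<open>b\<^sub>j\<close> give \<open>E F\<^sup>2 \<ge> (E F h)\<^sup>2 / E h\<^sup>2 \<ge> c (\<sigma>\<^sub>K\<^sup>4 / \<kappa>\<^sup>2) (\<Sum>j. |v\<^sub>j|\<^sup>2)\<close>. This
  suffices since \<open>\<rho>(\<sigma>) \<le> 3 \<sigma>\<^sup>4\<close> and \<open>\<lambda> \<ge> 1\<close>.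

  The convolutional model is a fully connected one with block-structured weights. Restricted to such
  directions the cross terms of \<open>E F\<^sup>2\<close> vanish by flipping the sign of one block of \<open>x\<close>, and
  splitting \<open>v\<close> along \<open>w\<close> and its orthogonal complement produces the two moments in \<open>\<rho>\<close>.\<close>

section \<open>The sigmoid and its derivatives\<close>

text \<open>Why cubic test functions: for small weights phi' is nearly constant, so to first order F
  only sees the sum of the v_k; directions with sum 0 become visible through the quadratic term of
  phi'. The lowest degree at which F tells the v_k apart is three, with amplitude of order |w_k|^2.
  Its square matches the fourth power of sigma_K in \<open>rho_fcn_le\<close>. The two copies of a_j
  isolate neuron j, and b_j reads off v_j.

  The obstacle in the empirical part is that H and 1 - H have no positive lower bound. The
  derivatives of phi up to order three are at most phi in absolute value, so the numerators in the
  Hessian are dominated by their denominators, and differences of Hessians are controlled in the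
  same relative sense. Only the mismatch between true and modelled label probability leaves a factor
  1/H, which grows at most exponentially in the pre-activations.

  Both models are instances of \<open>empirical_hessian_bounds\<close>, whose level tau has to
  satisfy tau |V|^2 \<le> E F^2 for the direction V at hand.\<close>

fun sigpoly :: "nat \<Rightarrow> real poly" where
  "sigpoly 0 = [:0, 1:]"
| "sigpoly (Suc r) = pderiv (sigpoly r) * [:0, 1, -1:]"

text \<open>The r-th derivative of phi. Since phi' = phi (1 - phi), every derivative is a polynomial
  in phi; \<open>[:0, 1, -1:]\<close> is the chain rule factor x (1 - x), and boundedness of all
  derivatives becomes compactness of [0, 1].\<close>

definition dsig :: "nat \<Rightarrow> real \<Rightarrow> real" where
  "dsig r x = poly (sigpoly r) (sigmoid x)"

lemma sigmoid_pos: "0 < sigmoid x" and sigmoid_less_1: "sigmoid x < 1"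
proof -
  have p: "1 + exp (-x) > 0" by (auto intro: add_pos_pos)
  then show "0 < sigmoid x" by (simp add: sigmoid_def)
  show "sigmoid x < 1" using p by (simp add: sigmoid_def divide_less_eq_1_pos)
qed

lemma sigmoid_uminus: "sigmoid (-x) = 1 - sigmoid x"
proof -
  have "exp (-x) * exp x = 1" by (simp flip: exp_add)
  moreover have "1 + exp x > 0" "1 + exp (-x) > 0" by (auto intro: add_pos_pos)
  ultimately show ?thesis unfolding sigmoid_def by (simp add: field_simps)
qed

lemma DERIV_sigmoid: "(sigmoid has_real_derivative sigmoid x * (1 - sigmoid x)) (at x)"
proof -
  have p: "1 + exp (-x) \<noteq> 0" by (smt (verit) exp_gt_zero)
  show ?thesis
    unfolding sigmoid_def[abs_def]
    apply (rule derivative_eq_intros refl p)+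
    using p by (simp add: field_simps power2_eq_square)
qed

lemma DERIV_dsig: "(dsig r has_real_derivative dsig (Suc r) x) (at x)"
proof -
  have "((\<lambda>x. poly (sigpoly r) (sigmoid x)) has_real_derivative
          poly (pderiv (sigpoly r)) (sigmoid x) * (sigmoid x * (1 - sigmoid x))) (at x)"
    by (rule DERIV_chain2[OF poly_DERIV DERIV_sigmoid])
  then show ?thesis by (simp add: dsig_def[abs_def] algebra_simps)
qed

lemma dsig_0: "dsig 0 x = sigmoid x"
  by (simp add: dsig_def)

lemma dsig_1: "dsig 1 x = sigmoid x * (1 - sigmoid x)"
  by (simp add: dsig_def pderiv_pCons)

lemma dsig_2: "dsig 2 x = sigmoid x * (1 - sigmoid x) * (1 - 2 * sigmoid x)"
  by (simp add: dsig_def pderiv_pCons numeral_2_eq_2 algebra_simps)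

lemma dsig_3: "dsig 3 x = sigmoid x * (1 - sigmoid x) * (1 - 6 * (sigmoid x * (1 - sigmoid x)))"
  by (simp add: dsig_def pderiv_pCons numeral_3_eq_3 algebra_simps)

lemma deriv_sigmoid: "deriv sigmoid = dsig 1"
  by (rule ext, rule DERIV_imp_deriv) (simp add: dsig_1 DERIV_sigmoid del: One_nat_def)

lemma isCont_dsig: "isCont (dsig r) x"
  using DERIV_dsig DERIV_isCont by blast

lemma continuous_on_dsig [continuous_intros]:
  "continuous_on A f \<Longrightarrow> continuous_on A (\<lambda>x. dsig r (f x))"
  by (rule continuous_on_compose2[of UNIV "dsig r"])
     (auto simp: continuous_on_eq_continuous_at isCont_dsig)

lemma measurable_dsig [measurable]: "dsig r \<in> borel_measurable borel"
  by (intro borel_measurable_continuous_onI continuous_intros)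

lemma measurable_sigmoid [measurable]: "sigmoid \<in> borel_measurable borel"
  using measurable_dsig[of 0] by (simp add: dsig_0[abs_def])

section \<open>Size, symmetry and relative variation of the derivatives of the sigmoid\<close>

lemma dsig_bounded: "\<exists>B. \<forall>x. \<bar>dsig r x\<bar> \<le> B"
proof -
  have "compact ((\<lambda>y. poly (sigpoly r) y) ` {0..1})"
    by (intro compact_continuous_image continuous_intros) auto
  then obtain B where B: "\<forall>z \<in> (\<lambda>y. poly (sigpoly r) y) ` {0..1}. norm z \<le> B"
    using compact_imp_bounded bounded_iff by blast
  have "\<bar>dsig r x\<bar> \<le> B" for x
    using B sigmoid_pos[of x] sigmoid_less_1[of x] by (auto simp: dsig_def)
  then show ?thesis by blast
qed

lemma dsig_1_pos: "0 < dsig 1 x"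
  by (metis dsig_1 mult_pos_pos sigmoid_pos sigmoid_less_1 diff_gt_0_iff_gt)

lemma dsig_1_le_sigmoid: "dsig 1 x \<le> sigmoid x"
  using sigmoid_pos[of x] sigmoid_less_1[of x] unfolding dsig_1
  by (intro mult_left_le) auto

lemma dsig_1_le_quarter: "dsig 1 x \<le> 1 / 4"
proof -
  have "0 \<le> (sigmoid x - 1/2)\<^sup>2" by simp
  then show ?thesis unfolding dsig_1 by (simp add: power2_eq_square algebra_simps)
qed

lemma dsig_1_uminus: "dsig 1 (-x) = dsig 1 x"
  by (simp add: dsig_1 sigmoid_uminus del: One_nat_def)

lemma dsig_2_uminus: "dsig 2 (-x) = - dsig 2 x"
  by (simp add: dsig_2 sigmoid_uminus algebra_simps)

lemma abs_dsig_2_le: "\<bar>dsig 2 x\<bar> \<le> dsig 1 x"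
proof -
  have "\<bar>dsig 2 x\<bar> = dsig 1 x * \<bar>1 - 2 * sigmoid x\<bar>"
    using sigmoid_pos[of x] sigmoid_less_1[of x] unfolding dsig_2 dsig_1 abs_mult by simp
  also have "\<dots> \<le> dsig 1 x * 1"
    using dsig_1_pos[of x] sigmoid_pos[of x] sigmoid_less_1[of x]
    by (intro mult_left_mono) auto
  finally show ?thesis by simp
qed

lemma abs_dsig_3_le: "\<bar>dsig 3 x\<bar> \<le> dsig 1 x"
proof -
  have "\<bar>dsig 3 x\<bar> = dsig 1 x * \<bar>1 - 6 * dsig 1 x\<bar>"
    using sigmoid_pos[of x] sigmoid_less_1[of x] unfolding dsig_3 dsig_1 abs_mult by simp
  also have "\<dots> \<le> dsig 1 x * 1"
    using dsig_1_pos[of x] dsig_1_le_quarter[of x]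
    by (intro mult_left_mono) auto
  finally show ?thesis by simp
qed

text \<open>Makes phi' an explicit decreasing function of cosh, so that comparing phi' at two points
  (\<open>dsig_1_chebyshev\<close>) becomes comparing cosh.\<close>

lemma dsig_1_eq_cosh: "dsig 1 x = 1 / (2 * (1 + cosh x))"
proof -
  have *: "exp x * exp (-x) = 1" by (simp flip: exp_add)
  then have "(1 + exp (-x)) * (1 + exp x) = 2 * (1 + cosh x)"
    unfolding cosh_field_def by (simp add: algebra_simps)
  then show ?thesis
    unfolding dsig_1 sigmoid_uminus[symmetric] by (simp only: sigmoid_def) simp
qed

text \<open>The mean value theorem with a majorant g that changes by at most the factor exp of the
  distance: the intermediate point can be traded for either endpoint, so g at y serves both for x <
  y and for y < x.\<close>

lemma DERIV_exp_lipschitz: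
  fixes f f' :: "real \<Rightarrow> real"
  assumes d: "\<And>x. (f has_real_derivative f' x) (at x)"
    and b: "\<And>x. \<bar>f' x\<bar> \<le> g x"
    and g: "\<And>x y. g x \<le> exp \<bar>x - y\<bar> * g y"
  shows "\<bar>f x - f y\<bar> \<le> \<bar>x - y\<bar> * exp \<bar>x - y\<bar> * g y"
proof -
  have gp: "0 \<le> g z" for z using b[of z] by linarith
  have main: "\<bar>f v - f u\<bar> \<le> (v - u) * (exp (v - u) * g w)" if uv: "u < v" "w \<in> {u,v}" for u v w
  proof -
    obtain z where z: "u < z" "z < v" "f v - f u = (v - u) * f' z"
      using MVT2[of u v f f'] d uv by blast
    have "\<bar>f' z\<bar> \<le> exp \<bar>z - w\<bar> * g w" using b[of z] g[of z w] by linarith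
    also have "\<dots> \<le> exp (v - u) * g w"
      using uv z gp[of w] by (intro mult_right_mono) auto
    finally show ?thesis using uv z by (auto simp: abs_mult intro!: mult_left_mono)
  qed
  consider "x < y" | "x = y" | "y < x" by linarith
  then show ?thesis
    using main[of x y y] main[of y x y] by cases (auto simp: abs_minus_commute mult.assoc)
qed

text \<open>The logarithm of phi' has derivative phi''/phi', which is at most 1 in absolute
  value.\<close>

lemma dsig_1_exp: "dsig 1 x \<le> exp \<bar>x - y\<bar> * dsig 1 y"
proof -
  have "ln (dsig 1 x) - ln (dsig 1 y) \<le> \<bar>x - y\<bar>"
  proof -
    have D: "((\<lambda>x. ln (dsig 1 x)) has_real_derivative dsig 2 z / dsig 1 z) (at z)" for z
      using DERIV_dsig[of 1 z] dsig_1_pos[of z]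
      by (auto intro!: derivative_eq_intros simp: numeral_2_eq_2 simp del: One_nat_def)
    have "norm (ln (dsig 1 x) - ln (dsig 1 y)) \<le> 1 * norm (x - y)"
    proof (rule field_differentiable_bound[where S = UNIV])
      show "norm (dsig 2 z / dsig 1 z) \<le> 1" for z
        using abs_dsig_2_le[of z] dsig_1_pos[of z] by (simp add: field_simps)
      show "((\<lambda>x. ln (dsig 1 x)) has_field_derivative dsig 2 z / dsig 1 z) (at z within UNIV)" for z
        using D[of z] by simp
    qed auto
    then show ?thesis by simp
  qed
  then have "exp (ln (dsig 1 x)) \<le> exp (\<bar>x - y\<bar> + ln (dsig 1 y))" by simp
  then show ?thesis by (simp add: exp_add dsig_1_pos del: One_nat_def)
qed

text \<open>The error is relative to \<open>sigmoid y\<close>, so it survives division by a sum of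
  sigmoids however small that sum is. The factor 3 bounds exp 1.\<close>

lemma dsig_lipschitz:
  assumes "r \<le> 2" "\<bar>x - y\<bar> \<le> \<delta>" "\<delta> \<le> 1"
  shows "\<bar>dsig r x - dsig r y\<bar> \<le> 3 * \<delta> * sigmoid y"
proof -
  have b: "\<bar>dsig (Suc r) z\<bar> \<le> dsig 1 z" for z
  proof -
    consider "r = 0" | "r = 1" | "r = 2" using assms(1) by linarith
    then show ?thesis
      using abs_dsig_2_le[of z] abs_dsig_3_le[of z] dsig_1_pos[of z]
      by cases (auto simp: numeral_2_eq_2 numeral_3_eq_3)
  qed
  have "\<bar>dsig r x - dsig r y\<bar> \<le> \<bar>x - y\<bar> * exp \<bar>x - y\<bar> * dsig 1 y"
    by (rule DERIV_exp_lipschitz[OF DERIV_dsig b dsig_1_exp])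
  also have "\<dots> \<le> (\<delta> * 3) * sigmoid y"
  proof (intro mult_mono)
    have "exp \<bar>x - y\<bar> \<le> exp 1" using assms by simp
    then show "exp \<bar>x - y\<bar> \<le> 3" using exp_le by linarith
  qed (use assms dsig_1_pos[of y] dsig_1_le_sigmoid[of y] in auto)
  finally show ?thesis by simp
qed

section \<open>The quadratic form of the Hessian of the loss in terms of the pre-activations\<close>

text \<open>With N(s) the sum of the phi(s_k), this is the second derivative of -ln N(s + e t) in e
  at e = 0. The factor 1/K inside the logarithm of the loss only adds a constant.\<close>

definition lossq1 :: "nat \<Rightarrow> (nat \<Rightarrow> real) \<Rightarrow> (nat \<Rightarrow> real) \<Rightarrow> real" where
  "lossq1 K s t = ((\<Sum>k<K. dsig 1 (s k) * t k) / (\<Sum>k<K. sigmoid (s k)))\<^sup>2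
                  - (\<Sum>k<K. dsig 2 (s k) * (t k)\<^sup>2) / (\<Sum>k<K. sigmoid (s k))"

text \<open>Because 1 - phi(s) = phi(-s), a label 0 is a label 1 at negated pre-activations; t keeps
  its sign since the form is even in t.\<close>

definition lossq :: "nat \<Rightarrow> (nat \<Rightarrow> real) \<Rightarrow> bool \<Rightarrow> (nat \<Rightarrow> real) \<Rightarrow> real" where
  "lossq K s y t = lossq1 K (\<lambda>k. if y then s k else - s k) t"

lemma sum_sigmoid_pos: "(K::nat) \<ge> 1 \<Longrightarrow> 0 < (\<Sum>k<K. sigmoid (s k))"
  by (rule sum_pos2[where i = 0]) (auto simp: sigmoid_pos less_imp_le)

lemma abs_weighted_sum_le:
  fixes t w :: "nat \<Rightarrow> real"
  assumes "\<And>k. k < K \<Longrightarrow> \<bar>w k\<bar> \<le> c * g k" "\<And>k. k < K \<Longrightarrow> 0 \<le> g k"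
    "\<And>k. k < K \<Longrightarrow> \<bar>t k\<bar> \<le> T" "0 \<le> c"
  shows "\<bar>\<Sum>k<K. w k * t k\<bar> \<le> c * (\<Sum>k<K. g k) * T"
proof -
  have "\<bar>\<Sum>k<K. w k * t k\<bar> \<le> (\<Sum>k<K. \<bar>w k * t k\<bar>)" by (rule sum_abs)
  also have "\<dots> \<le> (\<Sum>k<K. c * g k * T)"
    unfolding abs_mult using assms by (intro sum_mono mult_mono) auto
  finally show ?thesis by (simp add: sum_distrib_left sum_distrib_right mult_ac)
qed

lemma abs_le_sqrt_sum_squares:
  fixes t :: "nat \<Rightarrow> real"
  assumes "k < K" shows "\<bar>t k\<bar> \<le> sqrt (\<Sum>k<K. (t k)\<^sup>2)"
proof -
  have "(t k)\<^sup>2 \<le> (\<Sum>k<K. (t k)\<^sup>2)" using assms by (intro member_le_sum) auto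
  then show ?thesis by (metis real_sqrt_abs real_sqrt_le_mono)
qed

text \<open>Both numerators carry weights of absolute value at most \<open>sigmoid (s k)\<close>, so
  the quotients are bounded by the size of t alone, however small the denominator.\<close>

lemma abs_lossq1_le:
  assumes K: "K \<ge> 1"
  shows "\<bar>lossq1 K s t\<bar> \<le> 2 * (\<Sum>k<K. (t k)\<^sup>2)"
proof -
  define D where "D = (\<Sum>k<K. sigmoid (s k))"
  define T where "T = (\<Sum>k<K. (t k)\<^sup>2)"
  have D: "D > 0" unfolding D_def by (rule sum_sigmoid_pos[OF K])
  have T: "T \<ge> 0" unfolding T_def by (simp add: sum_nonneg)
  have "\<bar>\<Sum>k<K. dsig 1 (s k) * t k\<bar> \<le> 1 * (\<Sum>k<K. sigmoid (s k)) * sqrt T"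
    unfolding T_def using dsig_1_pos dsig_1_le_sigmoid abs_le_sqrt_sum_squares sigmoid_pos
    by (intro abs_weighted_sum_le) (auto simp: less_imp_le abs_of_pos simp del: One_nat_def)
  then have A: "\<bar>(\<Sum>k<K. dsig 1 (s k) * t k) / D\<bar> \<le> sqrt T"
    using D by (simp add: D_def[symmetric] field_simps abs_of_pos)
  have "\<bar>\<Sum>k<K. dsig 2 (s k) * (t k)\<^sup>2\<bar> \<le> 1 * (\<Sum>k<K. sigmoid (s k)) * T"
  proof (intro abs_weighted_sum_le)
    show "\<bar>dsig 2 (s k)\<bar> \<le> 1 * sigmoid (s k)" for k
      using abs_dsig_2_le[of "s k"] dsig_1_le_sigmoid[of "s k"] by linarith
    show "\<bar>(t k)\<^sup>2\<bar> \<le> T" if "k < K" for k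
      unfolding T_def using that by (auto intro!: member_le_sum)
  qed (auto simp: sigmoid_pos less_imp_le)
  then have B: "\<bar>(\<Sum>k<K. dsig 2 (s k) * (t k)\<^sup>2) / D\<bar> \<le> T"
    using D by (simp add: D_def[symmetric] field_simps abs_of_pos)
  have "((\<Sum>k<K. dsig 1 (s k) * t k) / D)\<^sup>2 \<le> (sqrt T)\<^sup>2"
    using A by (metis abs_ge_zero power2_abs power_mono)
  then have A2: "\<bar>((\<Sum>k<K. dsig 1 (s k) * t k) / D)\<^sup>2\<bar> \<le> T"
    using T by simp
  then show ?thesis using B unfolding lossq1_def D_def T_def by linarith
qed

text \<open>For \<delta> > 1 the crude bound applies, whence the cap \<open>min 1 \<delta>\<close>;
  it keeps the error below a fixed multiple of the sum of squares for arbitrarily large inputs. 18 =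
  12 + 6, for the squared quotient and for the second one.\<close>

lemma lossq1_lipschitz:
  assumes K: "K \<ge> 1" and \<delta>: "\<And>k. k < K \<Longrightarrow> \<bar>s k - s' k\<bar> \<le> \<delta>" "0 \<le> \<delta>"
  shows "\<bar>lossq1 K s t - lossq1 K s' t\<bar> \<le> 18 * min 1 \<delta> * (\<Sum>k<K. (t k)\<^sup>2)"
proof (cases "\<delta> \<le> 1")
  case False
  then have "min 1 \<delta> = 1" by simp
  moreover have "0 \<le> (\<Sum>k<K. (t k)\<^sup>2)" by (simp add: sum_nonneg)
  ultimately show ?thesis
    using abs_lossq1_le[OF K, of s t] abs_lossq1_le[OF K, of s' t] by simp
next
  case True
  define D D' where "D = (\<Sum>k<K. sigmoid (s k))" and "D' = (\<Sum>k<K. sigmoid (s' k))"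
  define T where "T = sqrt (\<Sum>k<K. (t k)\<^sup>2)"
  define A A' where "A = (\<Sum>k<K. dsig 1 (s k) * t k)" and "A' = (\<Sum>k<K. dsig 1 (s' k) * t k)"
  define B B' where "B = (\<Sum>k<K. dsig 2 (s k) * (t k)\<^sup>2)" and "B' = (\<Sum>k<K. dsig 2 (s' k) * (t k)\<^sup>2)"
  have D: "D > 0" "D' > 0" unfolding D_def D'_def by (auto intro: sum_sigmoid_pos[OF K])
  have T: "T \<ge> 0" "T\<^sup>2 = (\<Sum>k<K. (t k)\<^sup>2)" unfolding T_def by (simp_all add: sum_nonneg)
  have tk: "\<bar>t k\<bar> \<le> T" if "k < K" for k
    unfolding T_def by (rule abs_le_sqrt_sum_squares[OF that])
  have tk2: "\<bar>(t k)\<^sup>2\<bar> \<le> T\<^sup>2" if "k < K" for k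
    using tk[OF that] power_mono[of "\<bar>t k\<bar>" T 2] by simp
  have L: "\<bar>dsig r (s k) - dsig r (s' k)\<bar> \<le> 3 * \<delta> * sigmoid (s' k)" if "k < K" "r \<le> 2" for k r
    using dsig_lipschitz that \<delta> True by blast
  have dA: "\<bar>A - A'\<bar> \<le> 3 * \<delta> * D' * T"
    unfolding A_def A'_def D'_def sum_subtractf[symmetric] left_diff_distrib[symmetric]
    using L tk \<delta>(2) sigmoid_pos
    by (intro abs_weighted_sum_le) (auto simp: less_imp_le simp del: One_nat_def)
  have dB: "\<bar>B - B'\<bar> \<le> 3 * \<delta> * D' * T\<^sup>2"
    unfolding B_def B'_def D'_def sum_subtractf[symmetric] left_diff_distrib[symmetric]
    using L tk2 \<delta>(2) sigmoid_pos
    by (intro abs_weighted_sum_le) (auto simp: less_imp_le simp del: One_nat_def)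
  have dD: "\<bar>D - D'\<bar> \<le> 3 * \<delta> * D'"
    using abs_weighted_sum_le[of K "\<lambda>k. dsig 0 (s k) - dsig 0 (s' k)" "3 * \<delta>" "\<lambda>k. sigmoid (s' k)" "\<lambda>_. 1" 1]
      L[where r = 0] \<delta>(2) sigmoid_pos unfolding D_def D'_def by (auto simp: sum_subtractf dsig_0 less_imp_le)
  have "\<bar>A\<bar> \<le> 1 * (\<Sum>k<K. sigmoid (s k)) * T"
    unfolding A_def using dsig_1_pos dsig_1_le_sigmoid tk sigmoid_pos
    by (intro abs_weighted_sum_le) (auto simp: less_imp_le abs_of_pos simp del: One_nat_def)
  then have A: "\<bar>A / D\<bar> \<le> T"
    using D by (simp add: D_def[symmetric] field_simps abs_of_pos)
  have "\<bar>A'\<bar> \<le> 1 * (\<Sum>k<K. sigmoid (s' k)) * T"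
    unfolding A'_def using dsig_1_pos dsig_1_le_sigmoid tk sigmoid_pos
    by (intro abs_weighted_sum_le) (auto simp: less_imp_le abs_of_pos simp del: One_nat_def)
  then have A': "\<bar>A' / D'\<bar> \<le> T"
    using D by (simp add: D'_def[symmetric] field_simps abs_of_pos)
  have "\<bar>B\<bar> \<le> 1 * (\<Sum>k<K. sigmoid (s k)) * T\<^sup>2"
    unfolding B_def
  proof (intro abs_weighted_sum_le)
    show "\<bar>dsig 2 (s k)\<bar> \<le> 1 * sigmoid (s k)" for k
      using abs_dsig_2_le[of "s k"] dsig_1_le_sigmoid[of "s k"] by linarith
  qed (use tk2 in \<open>auto simp: sigmoid_pos less_imp_le\<close>)
  then have B: "\<bar>B / D\<bar> \<le> T\<^sup>2"
    using D by (simp add: D_def[symmetric] field_simps abs_of_pos)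
  \<comment> \<open>The error of the numerator and that of the denominator, both measured relative
    to D', contribute 3 \<delta> U each.\<close>
  have quot: "\<bar>X / D - X' / D'\<bar> \<le> 6 * \<delta> * U"
    if "\<bar>X - X'\<bar> \<le> 3 * \<delta> * D' * U" "\<bar>X / D\<bar> \<le> U" for X X' U
  proof -
    have eq: "X / D - X' / D' = (X - X') / D' + X / D * ((D' - D) / D')"
      using D by (simp add: field_simps)
    have "\<bar>(X - X') / D'\<bar> \<le> 3 * \<delta> * U" using that(1) D by (simp add: field_simps abs_of_pos)
    moreover have "\<bar>(D' - D) / D'\<bar> \<le> 3 * \<delta>" using dD D by (simp add: field_simps abs_of_pos abs_minus_commute)
    then have "\<bar>X / D * ((D' - D) / D')\<bar> \<le> U * (3 * \<delta>)"
      unfolding abs_mult using that(2) order_trans[OF abs_ge_zero that(2)] by (intro mult_mono) auto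
    moreover have "6 * \<delta> * U = 3 * \<delta> * U + U * (3 * \<delta>)" by simp
    ultimately show ?thesis unfolding eq by linarith
  qed
  have q1: "\<bar>A / D - A' / D'\<bar> \<le> 6 * \<delta> * T" using quot dA A by blast
  have q2: "\<bar>B / D - B' / D'\<bar> \<le> 6 * \<delta> * T\<^sup>2" using quot dB B by blast
  have "\<bar>a\<^sup>2 - b\<^sup>2\<bar> \<le> 12 * \<delta> * T\<^sup>2" if "\<bar>a - b\<bar> \<le> 6 * \<delta> * T" "\<bar>a\<bar> \<le> T" "\<bar>b\<bar> \<le> T" for a b
  proof -
    have "\<bar>a\<^sup>2 - b\<^sup>2\<bar> = \<bar>a - b\<bar> * \<bar>a + b\<bar>"
      by (simp add: power2_eq_square algebra_simps flip: abs_mult)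
    also have "\<dots> \<le> (6 * \<delta> * T) * (2 * T)"
      using that T \<delta> by (intro mult_mono) auto
    finally show ?thesis by (simp add: power2_eq_square)
  qed
  from this[OF q1 A A'] have "\<bar>(A / D)\<^sup>2 - (A' / D')\<^sup>2\<bar> \<le> 12 * \<delta> * T\<^sup>2" .
  then have "\<bar>lossq1 K s t - lossq1 K s' t\<bar> \<le> 18 * \<delta> * T\<^sup>2"
    using q2 unfolding lossq1_def A_def A'_def B_def B'_def D_def D'_def by linarith
  then show ?thesis using True T \<delta> by (simp add: min_absorb2)
qed

lemma abs_lossq_le: "K \<ge> 1 \<Longrightarrow> \<bar>lossq K s y t\<bar> \<le> 2 * (\<Sum>k<K. (t k)\<^sup>2)"
  unfolding lossq_def by (rule abs_lossq1_le)

lemma lossq_lipschitz: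
  assumes "K \<ge> 1" "\<And>k. k < K \<Longrightarrow> \<bar>s k - s' k\<bar> \<le> \<delta>" "0 \<le> \<delta>"
  shows "\<bar>lossq K s y t - lossq K s' y t\<bar> \<le> 18 * min 1 \<delta> * (\<Sum>k<K. (t k)\<^sup>2)"
  unfolding lossq_def
proof (rule lossq1_lipschitz[OF assms(1) _ assms(3)])
  fix k assume "k < K"
  then show "\<bar>(if y then s k else - s k) - (if y then s' k else - s' k)\<bar> \<le> \<delta>"
    using assms(2)[of k] by (auto simp: abs_minus_commute)
qed

section \<open>The Hessian of the empirical risk\<close>

lemma sum_fun_upd_mult:
  fixes p X :: "'p \<Rightarrow> real"
  assumes "finite I" "a \<in> I"
  shows "(\<Sum>c\<in>I. (p(a := p a + t)) c * X c) = (\<Sum>c\<in>I. p c * X c) + t * X a"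
proof -
  have "(\<Sum>c\<in>I. (p(a := p a + t)) c * X c) = (\<Sum>c\<in>I. p c * X c + (if c = a then t * X a else 0))"
    by (intro sum.cong) (auto simp: algebra_simps)
  also have "\<dots> = (\<Sum>c\<in>I. p c * X c) + t * X a"
    using assms by (simp add: sum.distrib)
  finally show ?thesis .
qed

text \<open>\<open>X i k c\<close> is the coefficient of parameter c in pre-activation k of sample
  i. Weight sharing is encoded in X, so both architectures are covered.\<close>

lemma hessian_quad_nll:
  fixes X :: "nat \<Rightarrow> nat \<Rightarrow> 'p \<Rightarrow> real" and I :: "'p set" and K n :: nat
  assumes I: "finite I" and K: "K \<ge> 1"
  defines "s \<equiv> (\<lambda>p i k. \<Sum>c\<in>I. p c * X i k c)"
  defines "g \<equiv> (\<lambda>p. 1 / real n * (\<Sum>i<n. - ln (1 / real K * (\<Sum>k<K. sigmoid (s p i k)))))"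
  shows "(\<Sum>a\<in>I. \<Sum>b\<in>I. v a * hessian_at g p a b * v b)
          = 1 / real n * (\<Sum>i<n. lossq1 K (s p i) (s v i))"
proof -
  have upd: "s (q(a := q a + t)) i k = s q i k + t * X i k a" if "a \<in> I" for q a t i k
    unfolding s_def using sum_fun_upd_mult[OF I that] by blast
  define G where "G = (\<lambda>b q. 1 / real n * (\<Sum>i<n. - ((\<Sum>k<K. dsig 1 (s q i k) * X i k b) /
                       (\<Sum>k<K. sigmoid (s q i k)))))"
  define E where "E = (\<lambda>a b i. (\<Sum>k<K. dsig 1 (s p i k) * X i k b) * (\<Sum>k<K. dsig 1 (s p i k) * X i k a)
        / (\<Sum>k<K. sigmoid (s p i k))\<^sup>2
       - (\<Sum>k<K. dsig 2 (s p i k) * X i k a * X i k b) / (\<Sum>k<K. sigmoid (s p i k)))"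
  have dsg: "((\<lambda>t. dsig r (s q i k + t * x)) has_real_derivative dsig (Suc r) (s q i k + t * x) * x) (at t)"
    for q i k r t x
    by (rule DERIV_chain2[OF DERIV_dsig]) (auto intro!: derivative_eq_intros)
  have dsg0: "((\<lambda>t. sigmoid (s q i k + t * x)) has_real_derivative dsig 1 (s q i k + t * x) * x) (at t)"
    for q i k t x
    using dsg[where r = 0] by (simp add: dsig_0[abs_def])
  \<comment> \<open>Proved at every point q, since \<open>hessian_at\<close> differentiates
    \<open>partial_at\<close> as a function of the point.\<close>
  have first: "partial_at g q b = G b q" if b: "b \<in> I" for q b
  proof -
    have "((\<lambda>t. 1 / real n * (\<Sum>i<n. - ln (1 / real K * (\<Sum>k<K. sigmoid (s q i k + t * X i k b)))))
         has_real_derivative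
        1 / real n * (\<Sum>i<n. - (inverse (1 / real K * (\<Sum>k<K. sigmoid (s q i k + 0 * X i k b))) *
           (1 / real K * (\<Sum>k<K. dsig 1 (s q i k + 0 * X i k b) * X i k b))))) (at 0)"
      by (intro DERIV_cmult DERIV_sum DERIV_minus DERIV_chain2[OF DERIV_ln] dsg0)
         (use K sum_sigmoid_pos[OF K] in auto)
    moreover have "1 / real n * (\<Sum>i<n. - (inverse (1 / real K * (\<Sum>k<K. sigmoid (s q i k + 0 * X i k b))) *
           (1 / real K * (\<Sum>k<K. dsig 1 (s q i k + 0 * X i k b) * X i k b)))) = G b q"
      unfolding G_def using K sum_sigmoid_pos[OF K]
      by (intro arg_cong2[where f = "(*)"] refl sum.cong) (auto simp: field_simps)
    ultimately have "((\<lambda>t. g (q(b := q b + t))) has_real_derivative G b q) (at 0)"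
      unfolding g_def upd[OF b] by simp
    then show ?thesis unfolding partial_at_def by (rule DERIV_imp_deriv)
  qed
  have second: "hessian_at g p a b = 1 / real n * (\<Sum>i<n. E a b i)" if a: "a \<in> I" and b: "b \<in> I" for a b
  proof -
    have ne: "(\<Sum>k<K. sigmoid (s p i k + 0 * X i k a)) \<noteq> 0" for i
      using sum_sigmoid_pos[OF K, of "s p i"] by simp
    have "((\<lambda>t. 1 / real n * (\<Sum>i<n. - ((\<Sum>k<K. dsig 1 (s p i k + t * X i k a) * X i k b) /
                       (\<Sum>k<K. sigmoid (s p i k + t * X i k a)))))
         has_real_derivative
        1 / real n * (\<Sum>i<n. - (((\<Sum>k<K. dsig (Suc 1) (s p i k + 0 * X i k a) * X i k a * X i k b)
             * (\<Sum>k<K. sigmoid (s p i k + 0 * X i k a))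
           - (\<Sum>k<K. dsig 1 (s p i k + 0 * X i k a) * X i k b) *
             (\<Sum>k<K. dsig 1 (s p i k + 0 * X i k a) * X i k a))
           / ((\<Sum>k<K. sigmoid (s p i k + 0 * X i k a)) * (\<Sum>k<K. sigmoid (s p i k + 0 * X i k a)))))) (at 0)"
      by (intro DERIV_cmult DERIV_sum DERIV_minus DERIV_divide DERIV_cmult_right dsg dsg0 ne)
    moreover have "1 / real n * (\<Sum>i<n. - (((\<Sum>k<K. dsig (Suc 1) (s p i k + 0 * X i k a) * X i k a * X i k b)
             * (\<Sum>k<K. sigmoid (s p i k + 0 * X i k a))
           - (\<Sum>k<K. dsig 1 (s p i k + 0 * X i k a) * X i k b) *
             (\<Sum>k<K. dsig 1 (s p i k + 0 * X i k a) * X i k a))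
           / ((\<Sum>k<K. sigmoid (s p i k + 0 * X i k a)) * (\<Sum>k<K. sigmoid (s p i k + 0 * X i k a)))))
        = 1 / real n * (\<Sum>i<n. E a b i)"
    proof (intro arg_cong2[where f = "(*)"] refl sum.cong)
      fix i
      have D: "(\<Sum>k<K. sigmoid (s p i k)) \<noteq> 0" using sum_sigmoid_pos[OF K, of "s p i"] by simp
      have gen: "- ((P * D - Q * R) / (D * D)) = Q * R / D\<^sup>2 - P / D" if "D \<noteq> 0" for P Q R D :: real
        using that by (simp add: field_simps power2_eq_square)
      show "- (((\<Sum>k<K. dsig (Suc 1) (s p i k + 0 * X i k a) * X i k a * X i k b)
             * (\<Sum>k<K. sigmoid (s p i k + 0 * X i k a))
           - (\<Sum>k<K. dsig 1 (s p i k + 0 * X i k a) * X i k b) *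
             (\<Sum>k<K. dsig 1 (s p i k + 0 * X i k a) * X i k a))
           / ((\<Sum>k<K. sigmoid (s p i k + 0 * X i k a)) * (\<Sum>k<K. sigmoid (s p i k + 0 * X i k a)))) = E a b i"
        unfolding E_def using gen[OF D] by (simp add: numeral_2_eq_2)
    qed
    ultimately have "((\<lambda>t. G b (p(a := p a + t))) has_real_derivative 1 / real n * (\<Sum>i<n. E a b i)) (at 0)"
      unfolding G_def upd[OF a] by (rule DERIV_cong)
    then have "partial_at (\<lambda>q. G b q) p a = 1 / real n * (\<Sum>i<n. E a b i)"
      unfolding partial_at_def by (rule DERIV_imp_deriv)
    moreover have "(\<lambda>q. partial_at g q b) = (\<lambda>q. G b q)" using first[OF b] by auto
    ultimately show ?thesis unfolding hessian_at_def by simp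
  qed
  have pt: "(\<Sum>a\<in>I. \<Sum>b\<in>I. v a * E a b i * v b) = lossq1 K (s p i) (s v i)" for i
  proof -
    define D where "D = (\<Sum>k<K. sigmoid (s p i k))"
    have lin: "(\<Sum>a\<in>I. v a * (\<Sum>k<K. w k * X i k a)) = (\<Sum>k<K. w k * s v i k)" for w
      unfolding s_def sum_distrib_left by (subst sum.swap) (auto intro!: sum.cong simp: mult_ac)
    have 1: "(\<Sum>a\<in>I. \<Sum>b\<in>I. v a * ((\<Sum>k<K. dsig 1 (s p i k) * X i k b) * (\<Sum>k<K. dsig 1 (s p i k) * X i k a)
        / D\<^sup>2) * v b) = (\<Sum>k<K. dsig 1 (s p i k) * s v i k)\<^sup>2 / D\<^sup>2"
    proof -
      have gen: "(\<Sum>a\<in>I. \<alpha> a) * (\<Sum>b\<in>I. \<beta> b) / c = (\<Sum>a\<in>I. \<Sum>b\<in>I. \<alpha> a * \<beta> b / c)" for \<alpha> \<beta> :: "'p \<Rightarrow> real" and c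
        by (simp add: sum_product sum_divide_distrib)
      have "(\<Sum>k<K. dsig 1 (s p i k) * s v i k)\<^sup>2 / D\<^sup>2 =
        (\<Sum>a\<in>I. v a * (\<Sum>k<K. dsig 1 (s p i k) * X i k a)) * (\<Sum>b\<in>I. v b * (\<Sum>k<K. dsig 1 (s p i k) * X i k b)) / D\<^sup>2"
        unfolding lin by (simp add: power2_eq_square)
      also have "\<dots> = (\<Sum>a\<in>I. \<Sum>b\<in>I. v a * ((\<Sum>k<K. dsig 1 (s p i k) * X i k b) * (\<Sum>k<K. dsig 1 (s p i k) * X i k a)
        / D\<^sup>2) * v b)"
        unfolding gen by (intro sum.cong refl) (simp add: mult_ac)
      finally show ?thesis by simp
    qed
    have 2: "(\<Sum>a\<in>I. \<Sum>b\<in>I. v a * ((\<Sum>k<K. dsig 2 (s p i k) * X i k a * X i k b) / D) * v b)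
        = (\<Sum>k<K. dsig 2 (s p i k) * (s v i k)\<^sup>2) / D"
    proof -
      have "(\<Sum>a\<in>I. \<Sum>b\<in>I. v a * ((\<Sum>k<K. dsig 2 (s p i k) * X i k a * X i k b) / D) * v b)
        = (\<Sum>a\<in>I. \<Sum>b\<in>I. \<Sum>k<K. dsig 2 (s p i k) * (v a * X i k a) * (v b * X i k b) / D)"
        by (simp add: sum_distrib_left sum_distrib_right sum_divide_distrib mult_ac)
      also have "\<dots> = (\<Sum>k<K. \<Sum>a\<in>I. \<Sum>b\<in>I. dsig 2 (s p i k) * (v a * X i k a) * (v b * X i k b) / D)"
        by (subst sum.swap[of _ _ "{..<K}"], intro sum.cong refl, subst sum.swap, rule refl)
      also have "\<dots> = (\<Sum>k<K. dsig 2 (s p i k) * (s v i k)\<^sup>2 / D)"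
      proof (intro sum.cong refl)
        fix k
        have "s v i k * s v i k = (\<Sum>a\<in>I. \<Sum>b\<in>I. (v a * X i k a) * (v b * X i k b))"
          unfolding s_def sum_product ..
        then show "(\<Sum>a\<in>I. \<Sum>b\<in>I. dsig 2 (s p i k) * (v a * X i k a) * (v b * X i k b) / D)
           = dsig 2 (s p i k) * (s v i k)\<^sup>2 / D"
          unfolding power2_eq_square by (simp add: sum_distrib_left sum_divide_distrib mult.assoc)
      qed
      finally show ?thesis by (simp add: sum_divide_distrib)
    qed
    have "(\<Sum>a\<in>I. \<Sum>b\<in>I. v a * E a b i * v b) =
      (\<Sum>a\<in>I. \<Sum>b\<in>I. v a * ((\<Sum>k<K. dsig 1 (s p i k) * X i k b) * (\<Sum>k<K. dsig 1 (s p i k) * X i k a) / D\<^sup>2) * v b)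
      - (\<Sum>a\<in>I. \<Sum>b\<in>I. v a * ((\<Sum>k<K. dsig 2 (s p i k) * X i k a * X i k b) / D) * v b)"
      unfolding E_def D_def sum_subtractf[symmetric]
      by (intro sum.cong refl) (simp only: left_diff_distrib right_diff_distrib)
    then show ?thesis using 1 2 unfolding lossq1_def D_def power_divide by linarith
  qed
  have "(\<Sum>a\<in>I. \<Sum>b\<in>I. v a * hessian_at g p a b * v b)
     = (\<Sum>a\<in>I. \<Sum>b\<in>I. 1 / real n * (\<Sum>i<n. v a * E a b i * v b))"
    by (intro sum.cong refl) (simp add: second sum_distrib_left sum_distrib_right mult_ac)
  also have "\<dots> = 1 / real n * (\<Sum>a\<in>I. \<Sum>b\<in>I. \<Sum>i<n. v a * E a b i * v b)"
    by (simp only: sum_distrib_left)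
  also have "(\<Sum>a\<in>I. \<Sum>b\<in>I. \<Sum>i<n. v a * E a b i * v b) = (\<Sum>i<n. \<Sum>a\<in>I. \<Sum>b\<in>I. v a * E a b i * v b)"
    by (subst sum.swap[of _ _ "{..<n}"], intro sum.cong refl, subst sum.swap, rule refl)
  finally show ?thesis unfolding pt .
qed

text \<open>Negating the inputs of the samples with label 0 turns the cross-entropy into a plain
  negative log-likelihood.\<close>

lemma hessian_quad_xent:
  fixes X :: "nat \<Rightarrow> nat \<Rightarrow> 'p \<Rightarrow> real" and I :: "'p set" and K n :: nat and y :: "nat \<Rightarrow> bool"
  assumes I: "finite I" and K: "K \<ge> 1"
  defines "s \<equiv> (\<lambda>p i k. \<Sum>c\<in>I. p c * X i k c)"
  assumes g: "\<And>p. g p = 1 / real n * (\<Sum>i<n. xent (1 / real K * (\<Sum>k<K. sigmoid (s p i k))) (y i))"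
  shows "(\<Sum>a\<in>I. \<Sum>b\<in>I. v a * hessian_at g p a b * v b)
          = 1 / real n * (\<Sum>i<n. lossq K (s p i) (y i) (s v i))"
proof -
  define X' where "X' = (\<lambda>i k c. if y i then X i k c else - X i k c)"
  have s': "(\<Sum>c\<in>I. p c * X' i k c) = (if y i then s p i k else - s p i k)" for p i k
    unfolding X'_def s_def by (simp add: sum_negf)
  have x: "xent (1 / real K * (\<Sum>k<K. sigmoid (s p i k))) (y i)
      = - ln (1 / real K * (\<Sum>k<K. sigmoid (\<Sum>c\<in>I. p c * X' i k c)))" for p i
    unfolding s' using K by (auto simp: xent_def sigmoid_uminus sum_subtractf field_simps)
  have "g = (\<lambda>p. 1 / real n * (\<Sum>i<n. - ln (1 / real K * (\<Sum>k<K. sigmoid (\<Sum>c\<in>I. p c * X' i k c)))))"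
    by (rule ext) (simp only: g x)
  then have "(\<Sum>a\<in>I. \<Sum>b\<in>I. v a * hessian_at g p a b * v b)
       = 1 / real n * (\<Sum>i<n. lossq1 K (\<lambda>k. \<Sum>c\<in>I. p c * X' i k c) (\<lambda>k. \<Sum>c\<in>I. v c * X' i k c))"
    using hessian_quad_nll[OF I K, where X = X' and n = n and v = v and p = p] by simp
  moreover have "lossq1 K (\<lambda>k. \<Sum>c\<in>I. p c * X' i k c) (\<lambda>k. \<Sum>c\<in>I. v c * X' i k c)
      = lossq K (s p i) (y i) (s v i)" for i
    unfolding s' lossq_def by (cases "y i") (auto simp: lossq1_def sum_negf)
  ultimately show ?thesis by simp
qed

section \<open>Gaussian vectors\<close>

abbreviation gauss1 :: "real measure" where
  "gauss1 \<equiv> density lborel (\<lambda>z. ennreal (std_normal_density z))"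

definition dot :: "nat \<Rightarrow> (nat \<Rightarrow> real) \<Rightarrow> (nat \<Rightarrow> real) \<Rightarrow> real" where
  "dot d u x = (\<Sum>i<d. u i * x i)"

lemma dot_commute: "dot d u x = dot d x u"
  by (simp add: dot_def mult.commute)

lemma dot_self: "dot d u u = (\<Sum>i<d. (u i)\<^sup>2)"
  by (simp add: dot_def power2_eq_square)

lemma dot_self_nonneg: "0 \<le> dot d u u"
  by (simp add: dot_self sum_nonneg)

lemma dot_add_right: "dot d u (\<lambda>i. x i + y i) = dot d u x + dot d u y"
  by (simp add: dot_def algebra_simps sum.distrib)

lemma dot_diff_right: "dot d u (\<lambda>i. x i - y i) = dot d u x - dot d u y"
  by (simp add: dot_def algebra_simps sum_subtractf)

lemma dot_scale_right: "dot d u (\<lambda>i. c * x i) = c * dot d u x"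
  by (simp add: dot_def sum_distrib_left mult_ac)

lemma dot_add_left: "dot d (\<lambda>i. x i + y i) u = dot d x u + dot d y u"
  by (simp add: dot_def algebra_simps sum.distrib)

lemma dot_diff_left: "dot d (\<lambda>i. x i - y i) u = dot d x u - dot d y u"
  by (simp add: dot_def algebra_simps sum_subtractf)

lemma dot_scale_left: "dot d (\<lambda>i. c * x i) u = c * dot d x u"
  by (simp add: dot_def sum_distrib_left mult_ac)

lemma dot_sum_left: "dot d (\<lambda>i. \<Sum>j\<in>J. c j * x j i) u = (\<Sum>j\<in>J. c j * dot d (x j) u)"
  unfolding dot_def sum_distrib_right sum_distrib_left
  by (subst sum.swap) (simp add: mult_ac)

lemma abs_dot_le: "\<bar>dot d u x\<bar> \<le> sqrt (dot d u u) * sqrt (dot d x x)"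
  using Cauchy_Schwarz_ineq_sum[of u x "{..<d}"]
  unfolding dot_self unfolding dot_def
  by (metis real_sqrt_abs real_sqrt_le_mono real_sqrt_mult)

lemma prob_space_gauss1: "prob_space gauss1"
  by (rule prob_space_normal_density) simp

lemma product_prob_space_gauss1: "product_prob_space (\<lambda>_::nat. gauss1)"
  using prob_space_gauss1 by (intro product_prob_spaceI)

lemma prob_space_gauss_vec: "prob_space (gauss_vec d)"
  unfolding gauss_vec_def by (intro prob_space_PiM prob_space_gauss1)

lemma sets_gauss_vec [measurable_cong]: "sets (gauss_vec d) = sets (PiM {..<d} (\<lambda>_. borel :: real measure))"
  unfolding gauss_vec_def by (intro sets_PiM_cong) auto

lemma measurable_gauss_component [measurable]: "i < d \<Longrightarrow> (\<lambda>x. x i) \<in> borel_measurable (gauss_vec d)"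
  unfolding measurable_cong_sets[OF sets_gauss_vec refl] by (rule measurable_component_singleton) simp

lemma measurable_dot [measurable]: "dot d u \<in> borel_measurable (gauss_vec d)"
  unfolding dot_def[abs_def] by (intro borel_measurable_sum borel_measurable_times) auto

text \<open>A sum of independent normals, restricted to the nonzero coefficients because a normal
  density needs a positive standard deviation. The right-hand side, a scaled standard normal, also
  covers l = 0, where the law is a point mass.\<close>

lemma distr_gauss_dot:
  "distr (gauss_vec d) borel (dot d l) = distr gauss1 borel (\<lambda>z. sqrt (dot d l l) * z)"
proof -
  interpret G1: prob_space gauss1 by (rule prob_space_gauss1)
  interpret G: prob_space "gauss_vec d" by (rule prob_space_gauss_vec)
  define J where "J = {i \<in> {..<d}. l i \<noteq> 0}"
  have J: "finite J" "J \<subseteq> {..<d}" unfolding J_def by auto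
  have dJ: "dot d l x = (\<Sum>i\<in>J. l i * x i)" for x
    unfolding dot_def J_def by (rule sum.mono_neutral_right) auto
  have dl: "dot d l l = (\<Sum>i\<in>J. (l i)\<^sup>2)"
    unfolding dJ by (simp add: power2_eq_square)
  show ?thesis
  proof (cases "J = {}")
    case True
    then have "dot d l = (\<lambda>_. 0)" "dot d l l = 0" by (auto simp: dJ)
    then show ?thesis
      by (simp add: G.distr_const G1.distr_const)
  next
    case False
    have comp: "distr (gauss_vec d) gauss1 (\<lambda>x. x i) = gauss1" if "i < d" for i
      using that unfolding gauss_vec_def by (intro distr_PiM_component prob_space_gauss1) auto
    have distrc: "distributed (gauss_vec d) lborel (\<lambda>x. x i) std_normal_density" if "i < d" for i
    proof -
      have "distr (gauss_vec d) lborel (\<lambda>x. x i) = distr (gauss_vec d) gauss1 (\<lambda>x. x i)"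
        by (intro distr_cong) auto
      then show ?thesis unfolding distributed_def using that comp[OF that] by simp
    qed
    have ind0: "G.indep_vars (\<lambda>_. borel) (\<lambda>i x. x i) {..<d}"
    proof -
      have ne: "{..<d} \<noteq> {}" using False J by auto
      have "distr (gauss_vec d) (\<Pi>\<^sub>M i\<in>{..<d}. borel) (\<lambda>x. \<lambda>i\<in>{..<d}. x i)
          = distr (gauss_vec d) (gauss_vec d) (\<lambda>x. x)"
      proof (rule distr_cong)
        show "sets (\<Pi>\<^sub>M i\<in>{..<d}. borel) = sets (gauss_vec d)" by (simp add: sets_gauss_vec)
        fix x assume "x \<in> space (gauss_vec d)"
        then show "(\<lambda>i\<in>{..<d}. x i) = x" by (auto simp: gauss_vec_def space_PiM)
      qed simp
      also have "\<dots> = (\<Pi>\<^sub>M i\<in>{..<d}. gauss1)" by (simp add: gauss_vec_def)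
      also have "\<dots> = (\<Pi>\<^sub>M i\<in>{..<d}. distr (gauss_vec d) borel (\<lambda>x. x i))"
      proof (intro PiM_cong refl)
        fix i assume "i \<in> {..<d}"
        then have "gauss1 = distr (gauss_vec d) gauss1 (\<lambda>x. x i)" using comp by simp
        also have "\<dots> = distr (gauss_vec d) borel (\<lambda>x. x i)" by (intro distr_cong) auto
        finally show "gauss1 = distr (gauss_vec d) borel (\<lambda>x. x i)" .
      qed
      finally show ?thesis
        by (subst G.indep_vars_iff_distr_eq_PiM') (use ne in auto)
    qed
    have ind: "G.indep_vars (\<lambda>_. borel) (\<lambda>i x. l i * x i) J"
      by (rule G.indep_vars_compose2[OF G.indep_vars_subset[OF ind0 J(2)]]) auto
    have "distributed (gauss_vec d) lborel (\<lambda>x. \<Sum>i\<in>J. l i * x i)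
           (normal_density (\<Sum>i\<in>J. 0) (sqrt (\<Sum>i\<in>J. \<bar>l i\<bar>\<^sup>2)))"
    proof (rule G.sum_indep_normal[OF J(1) False ind])
      fix i assume i: "i \<in> J"
      show "0 < \<bar>l i\<bar>" using i by (simp add: J_def)
      have "distributed (gauss_vec d) lborel (\<lambda>x. 0 + l i * x i) (normal_density (0 + l i * 0) (\<bar>l i\<bar> * 1))"
        using i J(2) by (intro G.normal_density_affine distrc) (auto simp: J_def)
      then show "distributed (gauss_vec d) lborel (\<lambda>x. l i * x i) (normal_density 0 \<bar>l i\<bar>)" by simp
    qed
    then have "distributed (gauss_vec d) lborel (dot d l) (normal_density 0 (sqrt (dot d l l)))"
      unfolding dl unfolding dJ[abs_def] by simp
    then have 1: "distr (gauss_vec d) lborel (dot d l) = density lborel (normal_density 0 (sqrt (dot d l l)))"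
      by (simp add: distributed_def)
    have pos: "0 < sqrt (dot d l l)"
      unfolding dl using False J(1) by (auto intro!: sum_pos simp: J_def)
    have "distributed gauss1 lborel (\<lambda>z. z) std_normal_density"
      unfolding distributed_def by (auto intro!: distr_id2)
    then have "distributed gauss1 lborel (\<lambda>z. 0 + sqrt (dot d l l) * z)
       (normal_density (0 + sqrt (dot d l l) * 0) (\<bar>sqrt (dot d l l)\<bar> * 1))"
      using pos by (intro G1.normal_density_affine) auto
    then have 2: "distr gauss1 lborel (\<lambda>z. sqrt (dot d l l) * z) = density lborel (normal_density 0 (sqrt (dot d l l)))"
      using pos by (simp add: distributed_def)
    have "distr (gauss_vec d) borel (dot d l) = distr (gauss_vec d) lborel (dot d l)" by (intro distr_cong) auto
    moreover have "distr gauss1 borel (\<lambda>z. sqrt (dot d l l) * z) = distr gauss1 lborel (\<lambda>z. sqrt (dot d l l) * z)"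
      by (intro distr_cong) auto
    ultimately show ?thesis using 1 2 by simp
  qed
qed

lemma integral_gauss_dot:
  fixes f :: "real \<Rightarrow> real"
  assumes [measurable]: "f \<in> borel_measurable borel"
  shows "integral\<^sup>L (gauss_vec d) (\<lambda>x. f (dot d l x)) = integral\<^sup>L gauss1 (\<lambda>z. f (sqrt (dot d l l) * z))"
proof -
  have "integral\<^sup>L (gauss_vec d) (\<lambda>x. f (dot d l x)) = integral\<^sup>L (distr (gauss_vec d) borel (dot d l)) f"
    by (subst integral_distr) auto
  also have "\<dots> = integral\<^sup>L gauss1 (\<lambda>z. f (sqrt (dot d l l) * z))"
    unfolding distr_gauss_dot by (subst integral_distr) auto
  finally show ?thesis .
qed

lemma integrable_gauss_dot:
  fixes f :: "real \<Rightarrow> real"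
  assumes [measurable]: "f \<in> borel_measurable borel"
  shows "integrable (gauss_vec d) (\<lambda>x. f (dot d l x)) \<longleftrightarrow> integrable gauss1 (\<lambda>z. f (sqrt (dot d l l) * z))"
proof -
  have "integrable (gauss_vec d) (\<lambda>x. f (dot d l x)) \<longleftrightarrow> integrable (distr (gauss_vec d) borel (dot d l)) f"
    by (subst integrable_distr_eq) auto
  also have "\<dots> \<longleftrightarrow> integrable gauss1 (\<lambda>z. f (sqrt (dot d l l) * z))"
    unfolding distr_gauss_dot by (subst integrable_distr_eq) auto
  finally show ?thesis .
qed

lemma integrable_gauss1_exp: "integrable gauss1 (\<lambda>z. exp (m * z))"
proof -
  have "integrable lborel (\<lambda>z. exp (m\<^sup>2 / 2) * normal_density m 1 z)"
    by (intro integrable_mult_right) simp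
  also have "(\<lambda>z. exp (m\<^sup>2 / 2) * normal_density m 1 z) = (\<lambda>z. std_normal_density z * exp (m * z))"
    by (auto simp: fun_eq_iff normal_density_def std_normal_density_def exp_add[symmetric] power2_eq_square field_simps)
  finally show ?thesis by (subst integrable_density) auto
qed

lemma integrable_gauss1_exp_abs: "integrable gauss1 (\<lambda>z. exp (m * \<bar>z\<bar>))"
proof (rule Bochner_Integration.integrable_bound)
  show "integrable gauss1 (\<lambda>z. exp (m * z) + exp (- m * z))"
    by (intro Bochner_Integration.integrable_add integrable_gauss1_exp)
  show "AE z in gauss1. norm (exp (m * \<bar>z\<bar>)) \<le> norm (exp (m * z) + exp (- m * z))"
  proof (rule AE_I2)
    fix z
    have "exp (m * \<bar>z\<bar>) \<le> exp (m * z) + exp (- m * z)" by (cases "z \<ge> 0") auto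
    moreover have "0 < exp (m * z) + exp (- m * z)" by (intro add_pos_pos) auto
    ultimately show "norm (exp (m * \<bar>z\<bar>)) \<le> norm (exp (m * z) + exp (- m * z))" by simp
  qed
qed auto

subsection \<open>Functions of exponential growth\<close>

text \<open>At most exponential growth in the l1 norm. The class contains the linear forms and the
  bounded functions, is closed under sums and products, and is Gaussian integrable because the bound
  factorises over the coordinates.\<close>

definition expgrow :: "nat \<Rightarrow> ((nat \<Rightarrow> real) \<Rightarrow> real) \<Rightarrow> bool" where
  "expgrow d G \<longleftrightarrow> (\<exists>C m. \<forall>x. \<bar>G x\<bar> \<le> C * exp (m * (\<Sum>i<d. \<bar>x i\<bar>)))"

lemma expgrowE:
  assumes "expgrow d G"
  obtains C m where "C \<ge> 0" "m \<ge> 0" "\<And>x. \<bar>G x\<bar> \<le> C * exp (m * (\<Sum>i<d. \<bar>x i\<bar>))"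
proof -
  obtain C m where *: "\<And>x. \<bar>G x\<bar> \<le> C * exp (m * (\<Sum>i<d. \<bar>x i\<bar>))"
    using assms unfolding expgrow_def by blast
  show thesis
  proof (rule that[of "\<bar>C\<bar>" "\<bar>m\<bar>"])
    fix x :: "nat \<Rightarrow> real"
    have "C * exp (m * (\<Sum>i<d. \<bar>x i\<bar>)) \<le> \<bar>C\<bar> * exp (\<bar>m\<bar> * (\<Sum>i<d. \<bar>x i\<bar>))"
      by (intro mult_mono) (auto intro!: mult_right_mono sum_nonneg)
    then show "\<bar>G x\<bar> \<le> \<bar>C\<bar> * exp (\<bar>m\<bar> * (\<Sum>i<d. \<bar>x i\<bar>))" using *[of x] by linarith
  qed auto
qed

lemma expgrow_mono: "expgrow d G \<Longrightarrow> (\<And>x. \<bar>F x\<bar> \<le> \<bar>G x\<bar>) \<Longrightarrow> expgrow d F"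
  unfolding expgrow_def by (meson order_trans)

lemma expgrow_bounded: "(\<And>x. \<bar>G x\<bar> \<le> B) \<Longrightarrow> expgrow d G"
  unfolding expgrow_def by (intro exI[of _ B] exI[of _ 0]) auto

lemma expgrow_const [intro]: "expgrow d (\<lambda>_. c)"
  by (rule expgrow_bounded[of _ "\<bar>c\<bar>"]) simp

lemma expgrow_add [intro]:
  assumes "expgrow d F" "expgrow d G" shows "expgrow d (\<lambda>x. F x + G x)"
proof -
  from assms(1) obtain C m where 1: "C \<ge> 0" "m \<ge> 0" "\<And>x. \<bar>F x\<bar> \<le> C * exp (m * (\<Sum>i<d. \<bar>x i\<bar>))"
    by (rule expgrowE) blast
  from assms(2) obtain C' m' where 2: "C' \<ge> 0" "m' \<ge> 0" "\<And>x. \<bar>G x\<bar> \<le> C' * exp (m' * (\<Sum>i<d. \<bar>x i\<bar>))"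
    by (rule expgrowE) blast
  have "\<bar>F x + G x\<bar> \<le> (C + C') * exp ((m + m') * (\<Sum>i<d. \<bar>x i\<bar>))" for x
  proof -
    have s: "(\<Sum>i<d. \<bar>x i\<bar>) \<ge> 0" by (simp add: sum_nonneg)
    have "C * exp (m * (\<Sum>i<d. \<bar>x i\<bar>)) \<le> C * exp ((m + m') * (\<Sum>i<d. \<bar>x i\<bar>))"
      using 1 2 s by (auto intro!: mult_left_mono mult_right_mono)
    moreover have "C' * exp (m' * (\<Sum>i<d. \<bar>x i\<bar>)) \<le> C' * exp ((m + m') * (\<Sum>i<d. \<bar>x i\<bar>))"
      using 1 2 s by (auto intro!: mult_left_mono mult_right_mono)
    ultimately show ?thesis using 1(3)[of x] 2(3)[of x] by (simp add: distrib_right)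
  qed
  then show ?thesis unfolding expgrow_def by blast
qed

lemma expgrow_mult [intro]:
  assumes "expgrow d F" "expgrow d G" shows "expgrow d (\<lambda>x. F x * G x)"
proof -
  from assms(1) obtain C m where 1: "C \<ge> 0" "m \<ge> 0" "\<And>x. \<bar>F x\<bar> \<le> C * exp (m * (\<Sum>i<d. \<bar>x i\<bar>))"
    by (rule expgrowE) blast
  from assms(2) obtain C' m' where 2: "C' \<ge> 0" "m' \<ge> 0" "\<And>x. \<bar>G x\<bar> \<le> C' * exp (m' * (\<Sum>i<d. \<bar>x i\<bar>))"
    by (rule expgrowE) blast
  have "\<bar>F x * G x\<bar> \<le> (C * C') * exp ((m + m') * (\<Sum>i<d. \<bar>x i\<bar>))" for x
  proof -
    have "\<bar>F x\<bar> * \<bar>G x\<bar> \<le> (C * exp (m * (\<Sum>i<d. \<bar>x i\<bar>))) * (C' * exp (m' * (\<Sum>i<d. \<bar>x i\<bar>)))"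
      using 1 2 by (intro mult_mono) auto
    then show ?thesis by (simp add: abs_mult distrib_right exp_add mult_ac)
  qed
  then show ?thesis unfolding expgrow_def by blast
qed

lemma expgrow_uminus [intro]: "expgrow d F \<Longrightarrow> expgrow d (\<lambda>x. - F x)"
  unfolding expgrow_def by simp

lemma expgrow_diff [intro]: "expgrow d F \<Longrightarrow> expgrow d G \<Longrightarrow> expgrow d (\<lambda>x. F x - G x)"
  using expgrow_add[of d F "\<lambda>x. - G x"] by (simp add: expgrow_uminus)

lemma expgrow_power [intro]: "expgrow d F \<Longrightarrow> expgrow d (\<lambda>x. F x ^ n)"
  by (induction n) auto

lemma expgrow_sum [intro]: "(\<And>j. j \<in> J \<Longrightarrow> expgrow d (F j)) \<Longrightarrow> expgrow d (\<lambda>x. \<Sum>j\<in>J. F j x)"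
  by (induction J rule: infinite_finite_induct) auto

lemma expgrow_component [intro]: "i < d \<Longrightarrow> expgrow d (\<lambda>x. x i)"
  unfolding expgrow_def
proof (intro exI[of _ 1] allI)
  fix x :: "nat \<Rightarrow> real" assume "i < d"
  then have "\<bar>x i\<bar> \<le> (\<Sum>i<d. \<bar>x i\<bar>)" by (intro member_le_sum) auto
  also have "\<dots> \<le> exp (\<Sum>i<d. \<bar>x i\<bar>)" using exp_ge_add_one_self[of "\<Sum>i<d. \<bar>x i\<bar>"] by linarith
  finally show "\<bar>x i\<bar> \<le> 1 * exp (1 * (\<Sum>i<d. \<bar>x i\<bar>))" by simp
qed

lemma expgrow_dot [intro]: "expgrow d (dot d u)"
  unfolding dot_def[abs_def] by (intro expgrow_sum expgrow_mult expgrow_const expgrow_component) simp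

lemma expgrow_integrable:
  assumes G: "expgrow d G" and [measurable]: "G \<in> borel_measurable (gauss_vec d)"
  shows "integrable (gauss_vec d) G"
proof -
  interpret product_prob_space "\<lambda>_::nat. gauss1" "{..<d}" by (rule product_prob_space_gauss1)
  from G obtain C m where *: "C \<ge> 0" "m \<ge> 0" "\<And>x. \<bar>G x\<bar> \<le> C * exp (m * (\<Sum>i<d. \<bar>x i\<bar>))"
    by (rule expgrowE) blast
  have "integrable (gauss_vec d) (\<lambda>x. C * (\<Prod>i<d. exp (m * \<bar>x i\<bar>)))"
    unfolding gauss_vec_def
    by (intro integrable_mult_right product_integrable_prod integrable_gauss1_exp_abs) auto
  then show ?thesis
    by (rule Bochner_Integration.integrable_bound)
       (use * in \<open>auto simp: exp_sum sum_distrib_left abs_mult prod_nonneg\<close>)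
qed

subsection \<open>Integration by parts\<close>

lemma stein_gauss1:
  fixes f f' :: "real \<Rightarrow> real"
  assumes d: "\<And>t. (f has_real_derivative f' t) (at t)" and c: "continuous_on UNIV f'"
    and bf: "\<And>t. \<bar>f t\<bar> \<le> C * exp (m * \<bar>t\<bar>)" and bf': "\<And>t. \<bar>f' t\<bar> \<le> C * exp (m * \<bar>t\<bar>)"
  shows "integral\<^sup>L gauss1 (\<lambda>t. t * f t) = integral\<^sup>L gauss1 f'"
proof -
  have [measurable]: "f' \<in> borel_measurable borel" using c by (rule borel_measurable_continuous_onI)
  have cf: "continuous_on UNIV f" using d DERIV_isCont continuous_at_imp_continuous_on by blast
  then have [measurable]: "f \<in> borel_measurable borel" by (rule borel_measurable_continuous_onI)
  have C: "C \<ge> 0" using bf[of 0] by simp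
  have i1: "integrable gauss1 f'"
    by (rule Bochner_Integration.integrable_bound[OF integrable_mult_right[OF integrable_gauss1_exp_abs[of m], of C]])
       (use bf' C in \<open>auto simp: abs_mult\<close>)
  have i2: "integrable gauss1 (\<lambda>t. t * f t)"
  proof (rule Bochner_Integration.integrable_bound[OF integrable_mult_right[OF integrable_gauss1_exp_abs[of "m+1"], of C]])
    have "\<bar>t\<bar> * \<bar>f t\<bar> \<le> C * exp ((m + 1) * \<bar>t\<bar>)" for t
    proof -
      have "\<bar>t\<bar> * \<bar>f t\<bar> \<le> exp \<bar>t\<bar> * (C * exp (m * \<bar>t\<bar>))"
        using order_trans[OF _ exp_ge_add_one_self[of "\<bar>t\<bar>"], of "\<bar>t\<bar>"] bf[of t] by (intro mult_mono) auto
      moreover have "exp ((m + 1) * \<bar>t\<bar>) = exp (m * \<bar>t\<bar>) * exp \<bar>t\<bar>"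
        by (simp add: exp_add[symmetric] distrib_right)
      ultimately show ?thesis by (simp add: mult_ac)
    qed
    then show "AE t in gauss1. norm (t * f t) \<le> norm (C * exp ((m + 1) * \<bar>t\<bar>))"
      using C by (auto simp: abs_mult)
  qed auto
  \<comment> \<open>\<open>g\<close> is the derivative of the density times f, so its integral over
    the line is the difference of the limits at both ends, which are 0.\<close>
  define g where "g = (\<lambda>t. std_normal_density t * (f' t - t * f t))"
  have dens: "((\<lambda>t. std_normal_density t) has_real_derivative (- t * std_normal_density t)) (at t)" for t
    unfolding std_normal_density_def[abs_def]
    by (auto intro!: derivative_eq_intros simp: power2_eq_square field_simps)
  have dg: "((\<lambda>t. std_normal_density t * f t) has_real_derivative g t) (at t)" for t
    unfolding g_def using DERIV_mult[OF dens d, of t] by (simp add: algebra_simps)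
  have contd: "continuous_on UNIV std_normal_density"
    using dens DERIV_isCont continuous_at_imp_continuous_on by blast
  have contg: "continuous_on UNIV g" unfolding g_def
    by (intro continuous_intros contd c cf)
  have ig: "integrable lborel g"
    using Bochner_Integration.integrable_diff[OF i1 i2] unfolding g_def by (subst (asm) integrable_density) auto
  have bnd: "\<bar>std_normal_density t * f t\<bar> \<le> C * exp (m * \<bar>t\<bar> - t\<^sup>2 / 2)" for t
  proof -
    have "std_normal_density t \<le> exp (- t\<^sup>2 / 2)"
    proof -
      have "1 \<le> sqrt (2 * pi)" using pi_gt3 by (intro real_le_rsqrt) auto
      then show ?thesis unfolding std_normal_density_def using mult_right_mono[of 1 "sqrt (2 * pi)" "exp (- (t\<^sup>2 / 2))"] pi_gt_zero by (simp add: pos_divide_le_eq mult.commute)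
    qed
    then have "\<bar>std_normal_density t * f t\<bar> \<le> exp (- t\<^sup>2 / 2) * (C * exp (m * \<bar>t\<bar>))"
      unfolding abs_mult using bf[of t] by (intro mult_mono) auto
    moreover have "exp (m * \<bar>t\<bar> - t\<^sup>2 / 2) = exp (- t\<^sup>2 / 2) * exp (m * \<bar>t\<bar>)"
      by (simp add: exp_add[symmetric])
    ultimately show ?thesis by (simp add: mult_ac)
  qed
  have lim_top: "((\<lambda>t. std_normal_density t * f t) \<longlongrightarrow> 0) at_top"
  proof (rule Lim_null_comparison)
    show "\<forall>\<^sub>F t in at_top. norm (std_normal_density t * f t) \<le> C * exp (m * \<bar>t\<bar> - t\<^sup>2 / 2)"
      using bnd by simp
    show "((\<lambda>t. C * exp (m * \<bar>t\<bar> - t\<^sup>2 / 2)) \<longlongrightarrow> 0) at_top" by real_asymp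
  qed
  have lim_bot: "((\<lambda>t. std_normal_density t * f t) \<longlongrightarrow> 0) at_bot"
  proof (rule Lim_null_comparison)
    show "\<forall>\<^sub>F t in at_bot. norm (std_normal_density t * f t) \<le> C * exp (m * \<bar>t\<bar> - t\<^sup>2 / 2)"
      using bnd by simp
    show "((\<lambda>t. C * exp (m * \<bar>t\<bar> - t\<^sup>2 / 2)) \<longlongrightarrow> 0) at_bot" by real_asymp
  qed
  have "(LBINT t=-\<infinity>..\<infinity>. g t) = 0 - 0"
  proof (rule interval_integral_FTC_integrable[where F = "\<lambda>t. std_normal_density t * f t"])
    show "((\<lambda>t. std_normal_density t * f t) has_vector_derivative g x) (at x)" for x
      using dg[of x] by (simp add: has_real_derivative_iff_has_vector_derivative)
    show "isCont g x" for x using contg by (simp add: continuous_on_eq_continuous_at)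
    show "set_integrable lborel (einterval (-\<infinity>) \<infinity>) g"
      using ig by (simp add: set_integrable_def)
    show "(((\<lambda>t. std_normal_density t * f t) \<circ> real_of_ereal) \<longlongrightarrow> 0) (at_right (-\<infinity>))"
      using lim_bot by (simp add: ereal_tendsto_simps1)
    show "(((\<lambda>t. std_normal_density t * f t) \<circ> real_of_ereal) \<longlongrightarrow> 0) (at_left \<infinity>)"
      using lim_top by (simp add: ereal_tendsto_simps1)
  qed auto
  then have "integral\<^sup>L lborel g = 0"
    by (simp add: interval_lebesgue_integral_def set_lebesgue_integral_def)
  then have "integral\<^sup>L gauss1 (\<lambda>t. f' t - t * f t) = 0"
    unfolding g_def by (subst integral_density) auto
  then show ?thesis using i1 i2 by simp
qed

lemma stein_component:
  assumes i: "i < d"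
    and [measurable]: "G \<in> borel_measurable (gauss_vec d)" "G' \<in> borel_measurable (gauss_vec d)"
    and g: "expgrow d G" and g': "expgrow d G'"
    and D: "\<And>x t. ((\<lambda>t. G (x(i := t))) has_real_derivative G' (x(i := t))) (at t)"
    and cont: "\<And>x. continuous_on UNIV (\<lambda>t. G' (x(i := t)))"
  shows "integral\<^sup>L (gauss_vec d) (\<lambda>x. x i * G x) = integral\<^sup>L (gauss_vec d) G'"
proof -
  interpret product_prob_space "\<lambda>_::nat. gauss1" "{..<d}" by (rule product_prob_space_gauss1)
  define J where "J = {..<d} - {i}"
  have J: "finite J" "i \<notin> J" "{..<d} = insert i J" using i by (auto simp: J_def)
  have ig: "integrable (gauss_vec d) (\<lambda>x. x i * G x)" "integrable (gauss_vec d) G'"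
    using i g g' by (auto intro!: expgrow_integrable)
  have inner: "integral\<^sup>L gauss1 (\<lambda>t. t * G (x(i := t))) = integral\<^sup>L gauss1 (\<lambda>t. G' (x(i := t)))" for x
  proof -
    from g obtain C m where 1: "C \<ge> 0" "m \<ge> 0" "\<And>x. \<bar>G x\<bar> \<le> C * exp (m * (\<Sum>i<d. \<bar>x i\<bar>))"
      by (rule expgrowE) blast
    from g' obtain C' m' where 2: "C' \<ge> 0" "m' \<ge> 0" "\<And>x. \<bar>G' x\<bar> \<le> C' * exp (m' * (\<Sum>i<d. \<bar>x i\<bar>))"
      by (rule expgrowE) blast
    define S where "S = (\<Sum>i\<in>J. \<bar>x i\<bar>)"
    have S: "S \<ge> 0" "(\<Sum>j<d. \<bar>(x(i := t)) j\<bar>) = \<bar>t\<bar> + S" for t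
    proof -
      show "S \<ge> 0" unfolding S_def by (simp add: sum_nonneg)
      have "(\<Sum>j\<in>J. \<bar>(x(i := t)) j\<bar>) = S" unfolding S_def using J by (intro sum.cong) auto
      then show "(\<Sum>j<d. \<bar>(x(i := t)) j\<bar>) = \<bar>t\<bar> + S" unfolding J(3) using J by simp
    qed
    \<comment> \<open>The coordinates other than i are frozen in x; their share of the growth goes
      into the constant.\<close>
    define CC where "CC = C * exp (m * S) + C' * exp (m' * S)"
    have e: "A * exp (k * (\<bar>t\<bar> + S)) \<le> CC * exp ((m + m') * \<bar>t\<bar>)"
      if "(A = C \<and> k = m) \<or> (A = C' \<and> k = m')" for A k t
    proof -
      have "A * exp (k * (\<bar>t\<bar> + S)) = (A * exp (k * S)) * exp (k * \<bar>t\<bar>)"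
        by (simp add: distrib_left exp_add mult_ac)
      also have "\<dots> \<le> CC * exp ((m + m') * \<bar>t\<bar>)"
        using that 1 2 by (intro mult_mono) (auto simp: CC_def intro!: mult_right_mono)
      finally show ?thesis .
    qed
    show ?thesis
    proof (rule stein_gauss1[OF D cont])
      show "\<bar>G (x(i := t))\<bar> \<le> CC * exp ((m + m') * \<bar>t\<bar>)" for t
        using 1(3)[of "x(i := t)"] e[of C m t] unfolding S by linarith
      show "\<bar>G' (x(i := t))\<bar> \<le> CC * exp ((m + m') * \<bar>t\<bar>)" for t
        using 2(3)[of "x(i := t)"] e[of C' m' t] unfolding S by linarith
    qed
  qed
  have "integral\<^sup>L (gauss_vec d) (\<lambda>x. x i * G x)
      = (\<integral>x. (\<integral>t. (x(i := t)) i * G (x(i := t)) \<partial>gauss1) \<partial>PiM J (\<lambda>_. gauss1))"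
    using ig(1) J unfolding gauss_vec_def J(3) by (intro product_integral_insert) auto
  also have "\<dots> = (\<integral>x. (\<integral>t. G' (x(i := t)) \<partial>gauss1) \<partial>PiM J (\<lambda>_. gauss1))"
    using inner by simp
  also have "\<dots> = integral\<^sup>L (gauss_vec d) G'"
    using ig(2) J unfolding gauss_vec_def J(3) by (intro product_integral_insert[symmetric]) auto
  finally show ?thesis .
qed

section \<open>Gaussian moments of products of linear forms with a function of one linear
  form\<close>

fun removeeach :: "'a list \<Rightarrow> ('a \<times> 'a list) list" where
  "removeeach [] = []"
| "removeeach (l # ls) = (l, ls) # map (\<lambda>(k, ms). (k, l # ms)) (removeeach ls)"

definition lprod :: "nat \<Rightarrow> (nat \<Rightarrow> real) list \<Rightarrow> (nat \<Rightarrow> real) \<Rightarrow> real" where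
  "lprod d ls x = (\<Prod>l\<leftarrow>ls. dot d l x)"

text \<open>The Leibniz rule for \<open>lprod\<close>, each factor l being replaced in turn by the
  number \<open>c l\<close>. With \<open>c l = l i\<close> it is the partial derivative in
  coordinate i; summed against b it becomes the sum of the contractions of b with the factors
  (\<open>sum_dlprod\<close>).\<close>

definition dlprod :: "nat \<Rightarrow> ((nat \<Rightarrow> real) \<Rightarrow> real) \<Rightarrow> (nat \<Rightarrow> real) list \<Rightarrow> (nat \<Rightarrow> real) \<Rightarrow> real" where
  "dlprod d c ls x = (\<Sum>(k, ms)\<leftarrow>removeeach ls. c k * lprod d ms x)"

lemma lprod_simps [simp]: "lprod d [] x = 1" "lprod d (l # ls) x = dot d l x * lprod d ls x"
  by (simp_all add: lprod_def)

lemma dlprod_simps [simp]: "dlprod d c [] x = 0"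
  "dlprod d c (l # ls) x = c l * lprod d ls x + dot d l x * dlprod d c ls x"
  by (simp_all add: dlprod_def o_def case_prod_unfold sum_list_const_mult[symmetric] mult_ac)

lemma measurable_lprod [measurable]: "lprod d ls \<in> borel_measurable (gauss_vec d)"
proof (induction ls)
  case (Cons l ls)
  have "lprod d (l # ls) = (\<lambda>x. dot d l x * lprod d ls x)" by (rule ext) simp
  then show ?case using Cons.IH by simp
qed (simp add: lprod_def[abs_def])

lemma measurable_dlprod [measurable]: "dlprod d c ls \<in> borel_measurable (gauss_vec d)"
proof (induction ls)
  case (Cons l ls)
  have "dlprod d c (l # ls) = (\<lambda>x. c l * lprod d ls x + dot d l x * dlprod d c ls x)" by (rule ext) simp
  then show ?case using Cons.IH by simp
qed (simp add: dlprod_def[abs_def])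

lemma expgrow_lprod [intro]: "expgrow d (lprod d ls)"
proof (induction ls)
  case (Cons l ls)
  have "lprod d (l # ls) = (\<lambda>x. dot d l x * lprod d ls x)" by (rule ext) simp
  then show ?case using Cons.IH by (simp add: expgrow_mult expgrow_dot)
qed (simp add: lprod_def[abs_def] expgrow_const)

lemma expgrow_dlprod [intro]: "expgrow d (dlprod d c ls)"
proof (induction ls)
  case (Cons l ls)
  have "dlprod d c (l # ls) = (\<lambda>x. c l * lprod d ls x + dot d l x * dlprod d c ls x)" by (rule ext) simp
  then show ?case using Cons.IH by (simp add: expgrow_add expgrow_const expgrow_lprod expgrow_mult expgrow_dot)
qed (simp add: dlprod_def[abs_def] expgrow_const)

lemma DERIV_dot_upd: "i < d \<Longrightarrow> ((\<lambda>t. dot d l (x(i := t))) has_real_derivative l i) (at t)"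
proof -
  assume i: "i < d"
  have "dot d l (x(i := t)) = (\<Sum>j\<in>{..<d}-{i}. l j * x j) + l i * t" for t
    unfolding dot_def using i by (subst sum.remove[of _ i]) auto
  then show ?thesis by (auto intro!: derivative_eq_intros)
qed

lemma DERIV_lprod_upd:
  "i < d \<Longrightarrow> ((\<lambda>t. lprod d ls (x(i := t))) has_real_derivative dlprod d (\<lambda>l. l i) ls (x(i := t))) (at t)"
proof (induction ls)
  case (Cons l ls)
  show ?case
    unfolding lprod_simps dlprod_simps
    by (rule DERIV_cong[OF DERIV_mult[OF DERIV_dot_upd[OF Cons.prems] Cons.IH[OF Cons.prems]]])
       (simp only: algebra_simps)
qed (simp only: lprod_simps dlprod_simps DERIV_const)

lemma continuous_dot_upd: "i < d \<Longrightarrow> continuous_on UNIV (\<lambda>t. dot d l (x(i := t)))"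
  by (intro continuous_at_imp_continuous_on ballI DERIV_isCont[OF DERIV_dot_upd])

lemma continuous_lprod_upd: "i < d \<Longrightarrow> continuous_on UNIV (\<lambda>t. lprod d ls (x(i := t)))"
proof (induction ls)
  case (Cons l ls)
  then show ?case unfolding lprod_simps by (intro continuous_on_mult continuous_dot_upd)
qed (simp only: lprod_simps continuous_on_const)

lemma continuous_dlprod_upd: "i < d \<Longrightarrow> continuous_on UNIV (\<lambda>t. dlprod d c ls (x(i := t)))"
proof (induction ls)
  case (Cons l ls)
  then show ?case unfolding dlprod_simps
    by (intro continuous_on_add continuous_on_mult continuous_on_const continuous_lprod_upd continuous_dot_upd)
qed (simp only: dlprod_simps continuous_on_const)

lemma sum_dlprod: "(\<Sum>i<d. b i * dlprod d (\<lambda>l. l i) ls x) = dlprod d (dot d b) ls x"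
proof (induction ls)
  case (Cons l ls)
  have "(\<Sum>i<d. b i * dlprod d (\<lambda>l. l i) (l # ls) x) =
     (\<Sum>i<d. (b i * l i) * lprod d ls x + dot d l x * (b i * dlprod d (\<lambda>l. l i) ls x))"
    by (simp add: algebra_simps)
  also have "\<dots> = dot d b l * lprod d ls x + dot d l x * (\<Sum>i<d. b i * dlprod d (\<lambda>l. l i) ls x)"
    by (simp add: sum.distrib dot_def sum_distrib_left sum_distrib_right)
  finally show ?case using Cons.IH by simp
qed simp

definition gmom :: "nat \<Rightarrow> (nat \<Rightarrow> real \<Rightarrow> real) \<Rightarrow> (nat \<Rightarrow> real) \<Rightarrow> (nat \<Rightarrow> real) list \<Rightarrow> nat \<Rightarrow> real" where
  "gmom d \<psi> w ls r = integral\<^sup>L (gauss_vec d) (\<lambda>x. lprod d ls x * \<psi> r (dot d w x))"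

text \<open>A function together with all its derivatives, each of them bounded. The index counts the
  derivatives taken, so that repeated integration by parts stays inside the family.\<close>

locale stein_family =
  fixes \<psi> :: "nat \<Rightarrow> real \<Rightarrow> real"
  assumes \<psi>_deriv: "\<And>r t. (\<psi> r has_real_derivative \<psi> (Suc r) t) (at t)"
    and \<psi>_bounded: "\<And>r. \<exists>B. \<forall>t. \<bar>\<psi> r t\<bar> \<le> B"
begin

lemma \<psi>_cont: "continuous_on UNIV (\<psi> r)"
  using \<psi>_deriv DERIV_isCont continuous_at_imp_continuous_on by blast

lemma \<psi>_meas [measurable]: "\<psi> r \<in> borel_measurable borel"
  using \<psi>_cont by (rule borel_measurable_continuous_onI)

lemma expgrow_\<psi> [intro]: "expgrow d (\<lambda>x. \<psi> r (f x))"
  using \<psi>_bounded[of r] by (auto intro: expgrow_bounded)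

lemma integrable_gmom: "integrable (gauss_vec d) (\<lambda>x. lprod d ls x * \<psi> r (dot d w x))"
  by (rule expgrow_integrable) auto

text \<open>Integration by parts in direction b: the factor b . x is contracted with another linear
  factor or differentiates \<psi>. As a rewrite rule it eliminates one factor at a time until only
  moments with an empty list remain.\<close>

lemma gmom_Cons:
  "gmom d \<psi> w (b # ls) r =
     (\<Sum>(k, ms)\<leftarrow>removeeach ls. dot d b k * gmom d \<psi> w ms r) + dot d b w * gmom d \<psi> w ls (Suc r)"
proof -
  define G where "G = (\<lambda>x. lprod d ls x * \<psi> r (dot d w x))"
  define G' where "G' = (\<lambda>i x. dlprod d (\<lambda>l. l i) ls x * \<psi> r (dot d w x) + lprod d ls x * (\<psi> (Suc r) (dot d w x) * w i))"
  have [measurable]: "G \<in> borel_measurable (gauss_vec d)" "\<And>i. G' i \<in> borel_measurable (gauss_vec d)"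
    unfolding G_def G'_def by measurable
  have eG: "expgrow d G" "\<And>i. expgrow d (G' i)"
    unfolding G_def G'_def by (intro expgrow_add expgrow_mult expgrow_lprod expgrow_dlprod expgrow_\<psi> expgrow_const)+
  have st: "integral\<^sup>L (gauss_vec d) (\<lambda>x. x i * G x) = integral\<^sup>L (gauss_vec d) (G' i)" if i: "i < d" for i
  proof (rule stein_component[OF i _ _ eG])
    show "((\<lambda>t. G (x(i := t))) has_real_derivative G' i (x(i := t))) (at t)" for x t
      unfolding G_def G'_def
      by (rule DERIV_cong[OF DERIV_mult[OF DERIV_lprod_upd[OF i] DERIV_chain2[OF \<psi>_deriv DERIV_dot_upd[OF i]]]])
         (simp only: algebra_simps)
    show "continuous_on UNIV (\<lambda>t. G' i (x(i := t)))" for x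
      unfolding G'_def
      by (intro continuous_intros continuous_dlprod_upd continuous_lprod_upd i
          continuous_on_compose2[OF \<psi>_cont continuous_dot_upd[OF i]]) auto
  qed auto
  have "gmom d \<psi> w (b # ls) r = integral\<^sup>L (gauss_vec d) (\<lambda>x. \<Sum>i<d. b i * (x i * G x))"
    unfolding gmom_def G_def lprod_simps dot_def[of d b] sum_distrib_right by (simp add: mult_ac)
  also have "\<dots> = (\<Sum>i<d. b i * integral\<^sup>L (gauss_vec d) (\<lambda>x. x i * G x))"
    using eG by (subst Bochner_Integration.integral_sum) (auto intro!: expgrow_integrable)
  also have "\<dots> = (\<Sum>i<d. b i * integral\<^sup>L (gauss_vec d) (G' i))" using st by simp
  also have "\<dots> = integral\<^sup>L (gauss_vec d) (\<lambda>x. \<Sum>i<d. b i * G' i x)"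
    using eG by (subst Bochner_Integration.integral_sum) (auto intro!: expgrow_integrable)
  also have "(\<lambda>x. \<Sum>i<d. b i * G' i x) = (\<lambda>x. dlprod d (dot d b) ls x * \<psi> r (dot d w x)
       + dot d b w * (lprod d ls x * \<psi> (Suc r) (dot d w x)))"
  proof
    fix x
    have "(\<Sum>i<d. b i * G' i x) = (\<Sum>i<d. (b i * dlprod d (\<lambda>l. l i) ls x) * \<psi> r (dot d w x)
        + (b i * w i) * (lprod d ls x * \<psi> (Suc r) (dot d w x)))"
      unfolding G'_def by (simp add: algebra_simps)
    then show "(\<Sum>i<d. b i * G' i x) = dlprod d (dot d b) ls x * \<psi> r (dot d w x)
       + dot d b w * (lprod d ls x * \<psi> (Suc r) (dot d w x))"
      unfolding sum.distrib sum_distrib_right[symmetric] sum_dlprod dot_def[of d b w] .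
  qed
  also have "integral\<^sup>L (gauss_vec d) \<dots> = integral\<^sup>L (gauss_vec d) (\<lambda>x. dlprod d (dot d b) ls x * \<psi> r (dot d w x))
      + dot d b w * gmom d \<psi> w ls (Suc r)"
    unfolding gmom_def
    by (subst Bochner_Integration.integral_add) (auto intro!: expgrow_integrable integrable_mult_right integrable_gmom)
  also have "integral\<^sup>L (gauss_vec d) (\<lambda>x. dlprod d (dot d b) ls x * \<psi> r (dot d w x))
      = (\<Sum>(k, ms)\<leftarrow>removeeach ls. dot d b k * gmom d \<psi> w ms r)"
  proof -
    have "integrable (gauss_vec d) (\<lambda>x. (\<Sum>(k, ms)\<leftarrow>L. dot d b k * lprod d ms x) * \<psi> r (dot d w x)) \<and>
      integral\<^sup>L (gauss_vec d) (\<lambda>x. (\<Sum>(k, ms)\<leftarrow>L. dot d b k * lprod d ms x) * \<psi> r (dot d w x))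
        = (\<Sum>(k, ms)\<leftarrow>L. dot d b k * gmom d \<psi> w ms r)" for L
    proof (induction L)
      case (Cons q L)
      obtain k ms where q: "q = (k, ms)" by (cases q)
      have i: "integrable (gauss_vec d) (\<lambda>x. dot d b k * (lprod d ms x * \<psi> r (dot d w x)))"
        by (intro integrable_mult_right integrable_gmom)
      have e: "(\<lambda>x. (\<Sum>(k, ms)\<leftarrow>q # L. dot d b k * lprod d ms x) * \<psi> r (dot d w x)) =
         (\<lambda>x. dot d b k * (lprod d ms x * \<psi> r (dot d w x)) + (\<Sum>(k, ms)\<leftarrow>L. dot d b k * lprod d ms x) * \<psi> r (dot d w x))"
        by (auto simp: q algebra_simps)
      show ?case
        unfolding e using Cons.IH i by (auto simp: q gmom_def)
    qed simp
    then show ?thesis unfolding dlprod_def by blast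
  qed
  finally show ?thesis .
qed

end

section \<open>Sub-exponential moments of the pre-activations\<close>

definition wcol :: "(nat \<times> nat \<Rightarrow> real) \<Rightarrow> nat \<Rightarrow> nat \<Rightarrow> real" where
  "wcol W k = (\<lambda>i. W (i, k))"

definition pre :: "nat \<Rightarrow> (nat \<times> nat \<Rightarrow> real) \<Rightarrow> (nat \<Rightarrow> real) \<Rightarrow> nat \<Rightarrow> real" where
  "pre d W x k = dot d (wcol W k) x"

definition fro2 :: "nat \<Rightarrow> nat \<Rightarrow> (nat \<times> nat \<Rightarrow> real) \<Rightarrow> real" where
  "fro2 d K V = (\<Sum>a\<in>{..<d} \<times> {..<K}. (V a)\<^sup>2)"

definition sqs :: "nat \<Rightarrow> nat \<Rightarrow> (nat \<times> nat \<Rightarrow> real) \<Rightarrow> (nat \<Rightarrow> real) \<Rightarrow> real" where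
  "sqs d K V x = (\<Sum>k<K. (pre d V x k)\<^sup>2)"

lemma fro2_col: "fro2 d K V = (\<Sum>k<K. dot d (wcol V k) (wcol V k))"
proof -
  have "fro2 d K V = (\<Sum>i<d. \<Sum>k<K. (V (i, k))\<^sup>2)"
    unfolding fro2_def by (simp add: sum.cartesian_product case_prod_unfold)
  then show ?thesis unfolding dot_self wcol_def by (subst (asm) sum.swap) simp
qed

lemma fro2_nonneg: "0 \<le> fro2 d K V"
  by (simp add: fro2_def sum_nonneg)

lemma sqs_nonneg: "0 \<le> sqs d K V x"
  by (simp add: sqs_def sum_nonneg)

lemma fro2_scale: "fro2 d K (\<lambda>a. c * V a) = c\<^sup>2 * fro2 d K V"
  by (simp add: fro2_def power_mult_distrib sum_distrib_left)

lemma pre_scale: "pre d (\<lambda>a. c * V a) x k = c * pre d V x k"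
  by (simp add: pre_def wcol_def dot_scale_left)

lemma pre_add: "pre d (\<lambda>a. V a + W a) x k = pre d V x k + pre d W x k"
  by (simp add: pre_def wcol_def dot_add_left)

lemma pre_diff: "pre d (\<lambda>a. V a - W a) x k = pre d V x k - pre d W x k"
  by (simp add: pre_def wcol_def dot_diff_left)

lemma sqs_scale: "sqs d K (\<lambda>a. c * V a) x = c\<^sup>2 * sqs d K V x"
  by (simp add: sqs_def pre_scale power_mult_distrib sum_distrib_left)

lemma dot_col_le_fro2: "k < K \<Longrightarrow> dot d (wcol V k) (wcol V k) \<le> fro2 d K V"
  unfolding fro2_col by (rule member_le_sum) (auto simp: dot_self_nonneg)

lemma measurable_pre [measurable]: "(\<lambda>x. pre d W x k) \<in> borel_measurable (gauss_vec d)"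
  unfolding pre_def by measurable

lemma measurable_sqs [measurable]: "sqs d K V \<in> borel_measurable (gauss_vec d)"
  unfolding sqs_def[abs_def] by measurable

lemma expgrow_pre [intro]: "expgrow d (\<lambda>x. pre d W x k)"
  unfolding pre_def by (rule expgrow_dot)

lemma expgrow_sqs [intro]: "expgrow d (sqs d K V)"
  unfolding sqs_def[abs_def] by (intro expgrow_sum expgrow_power expgrow_pre)

lemma gauss1_exp_square:
  assumes "0 \<le> c" "c \<le> 1/4"
  shows "integrable gauss1 (\<lambda>z. exp (c * z\<^sup>2))" "integral\<^sup>L gauss1 (\<lambda>z. exp (c * z\<^sup>2)) \<le> 2"
proof -
  \<comment> \<open>At c = 1/4 the weighted density is a multiple of that of N(0, 2).\<close>
  have e: "std_normal_density z * exp (z\<^sup>2 / 4) = sqrt 2 * normal_density 0 (sqrt 2) z" for z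
  proof -
    have "exp (- z\<^sup>2 / 2) * exp (z\<^sup>2 / 4) = exp (- z\<^sup>2 / 4)"
      by (simp add: exp_add[symmetric])
    then show ?thesis
      by (simp add: normal_density_def std_normal_density_def real_sqrt_mult field_simps)
  qed
  have "integrable lborel (\<lambda>z. std_normal_density z * exp (z\<^sup>2 / 4))"
    unfolding e by (intro integrable_mult_right) simp
  then have i4: "integrable gauss1 (\<lambda>z. exp (z\<^sup>2 / 4))" by (subst integrable_density) auto
  have "integral\<^sup>L gauss1 (\<lambda>z. exp (z\<^sup>2 / 4)) = sqrt 2"
    by (subst integral_density) (auto simp: e)
  moreover have "sqrt 2 \<le> 2" by (rule real_le_lsqrt) auto
  ultimately have b4: "integral\<^sup>L gauss1 (\<lambda>z. exp (z\<^sup>2 / 4)) \<le> 2" by linarith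
  have le: "exp (c * z\<^sup>2) \<le> exp (z\<^sup>2 / 4)" for z :: real
    using mult_right_mono[OF assms(2), of "z\<^sup>2"] by simp
  show i: "integrable gauss1 (\<lambda>z. exp (c * z\<^sup>2))"
    by (rule Bochner_Integration.integrable_bound[OF i4]) (use le in auto)
  show "integral\<^sup>L gauss1 (\<lambda>z. exp (c * z\<^sup>2)) \<le> 2"
    using integral_mono[OF i i4] le b4 by (meson order_trans)
qed

lemma gauss_vec_exp_square:
  assumes "dot d u u \<le> 1"
  shows "integrable (gauss_vec d) (\<lambda>x. exp ((dot d u x)\<^sup>2 / 4))"
    "integral\<^sup>L (gauss_vec d) (\<lambda>x. exp ((dot d u x)\<^sup>2 / 4)) \<le> 2"
proof -
  have e: "exp ((sqrt (dot d u u) * z)\<^sup>2 / 4) = exp (dot d u u / 4 * z\<^sup>2)" for z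
    by (simp add: power_mult_distrib dot_self_nonneg)
  have c: "0 \<le> dot d u u / 4" "dot d u u / 4 \<le> 1/4" using assms dot_self_nonneg[of d u] by auto
  show "integrable (gauss_vec d) (\<lambda>x. exp ((dot d u x)\<^sup>2 / 4))"
    by (subst integrable_gauss_dot[where f = "\<lambda>t. exp (t\<^sup>2 / 4)"])
       (use gauss1_exp_square(1)[OF c] in \<open>auto simp: e\<close>)
  show "integral\<^sup>L (gauss_vec d) (\<lambda>x. exp ((dot d u x)\<^sup>2 / 4)) \<le> 2"
    by (subst integral_gauss_dot[where f = "\<lambda>t. exp (t\<^sup>2 / 4)"])
       (use gauss1_exp_square(2)[OF c] in \<open>auto simp: e\<close>)
qed

text \<open>Jensen for weights of total mass at most 1, the missing mass sitting at 0. The proof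
  averages the tangent of exp at the mean m.\<close>

lemma exp_subconvex:
  fixes w y :: "'i \<Rightarrow> real"
  assumes "finite I" "\<And>i. i \<in> I \<Longrightarrow> 0 \<le> w i" "sum w I \<le> 1"
  shows "exp (\<Sum>i\<in>I. w i * y i) \<le> (\<Sum>i\<in>I. w i * exp (y i)) + (1 - sum w I)"
proof -
  define m where "m = (\<Sum>i\<in>I. w i * y i)"
  have t: "exp m * (1 + u - m) \<le> exp u" for u
  proof -
    have "exp m * (1 + (u - m)) \<le> exp m * exp (u - m)"
      by (intro mult_left_mono exp_ge_add_one_self) auto
    then show ?thesis by (simp add: exp_add[symmetric] add_diff_eq)
  qed
  have "exp m = exp m * ((\<Sum>i\<in>I. w i * y i) + sum w I * (1 - m) + (1 - sum w I) * (1 - m))"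
    unfolding m_def[symmetric] by (simp add: algebra_simps)
  also have "\<dots> = (\<Sum>i\<in>I. w i * (exp m * (1 + y i - m))) + (1 - sum w I) * (exp m * (1 + 0 - m))"
    by (simp add: algebra_simps sum.distrib sum_subtractf sum_distrib_left sum_distrib_right)
  also have "\<dots> \<le> (\<Sum>i\<in>I. w i * exp (y i)) + (1 - sum w I) * exp 0"
    using assms by (intro add_mono sum_mono mult_left_mono t) auto
  finally show ?thesis unfolding m_def by simp
qed

text \<open>The numbers \<open>pre d V x k\<close> are dependent Gaussians. With the squared column
  norms as weights, convexity of exp reduces the exponential moment of the sum of squares to that of
  a single normal of variance at most 1, whatever the dependence.\<close>

lemma gauss_vec_exp_sqs:
  assumes V: "fro2 d K V \<le> 1"
  shows "integrable (gauss_vec d) (\<lambda>x. exp (sqs d K V x / 4))"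
    "integral\<^sup>L (gauss_vec d) (\<lambda>x. exp (sqs d K V x / 4)) \<le> 2"
proof -
  interpret G: prob_space "gauss_vec d" by (rule prob_space_gauss_vec)
  define w where "w k = dot d (wcol V k) (wcol V k)" for k
  \<comment> \<open>For a column of norm 0 the convention 1 / 0 = 0 makes \<open>u k\<close> the
    zero vector.\<close>
  define u where "u k = (\<lambda>i. (1 / sqrt (w k)) * wcol V k i)" for k
  have w: "0 \<le> w k" for k unfolding w_def by (rule dot_self_nonneg)
  have sw: "sum w {..<K} \<le> 1" using V by (simp add: fro2_col w_def)
  have uu: "dot d (u k) (u k) \<le> 1" for k
  proof -
    have "dot d (u k) (u k) = (1 / sqrt (w k)) * ((1 / sqrt (w k)) * w k)"
      unfolding u_def dot_scale_left dot_scale_right w_def ..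
    also have "\<dots> \<le> 1" using w[of k] by (cases "w k = 0") (auto simp: field_simps)
    finally show ?thesis .
  qed
  have tk: "(pre d V x k)\<^sup>2 = w k * (dot d (u k) x)\<^sup>2" for x k
  proof (cases "w k = 0")
    case True
    then have "\<bar>pre d V x k\<bar> \<le> 0"
      using abs_dot_le[of d "wcol V k" x] unfolding pre_def w_def by simp
    then show ?thesis using True by simp
  next
    case False
    have "dot d (u k) x = 1 / sqrt (w k) * pre d V x k"
      unfolding u_def pre_def by (rule dot_scale_left)
    then show ?thesis using w[of k] False
      by (simp add: power_mult_distrib power_divide)
  qed
  have le: "exp (sqs d K V x / 4) \<le> (\<Sum>k<K. w k * exp ((dot d (u k) x)\<^sup>2 / 4)) + (1 - sum w {..<K})" for x
    using exp_subconvex[of "{..<K}" w "\<lambda>k. (dot d (u k) x)\<^sup>2 / 4"] w sw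
    by (simp add: sqs_def tk sum_divide_distrib)
  have ik: "integrable (gauss_vec d) (\<lambda>x. exp ((dot d (u k) x)\<^sup>2 / 4))" for k
    by (rule gauss_vec_exp_square(1)[OF uu])
  have ib: "integrable (gauss_vec d) (\<lambda>x. (\<Sum>k<K. w k * exp ((dot d (u k) x)\<^sup>2 / 4)) + (1 - sum w {..<K}))"
    using ik by (intro Bochner_Integration.integrable_add Bochner_Integration.integrable_sum) auto
  show i: "integrable (gauss_vec d) (\<lambda>x. exp (sqs d K V x / 4))"
    by (rule Bochner_Integration.integrable_bound[OF ib]) (auto intro!: AE_I2 order_trans[OF le abs_ge_self])
  have "integral\<^sup>L (gauss_vec d) (\<lambda>x. exp (sqs d K V x / 4))
     \<le> integral\<^sup>L (gauss_vec d) (\<lambda>x. (\<Sum>k<K. w k * exp ((dot d (u k) x)\<^sup>2 / 4)) + (1 - sum w {..<K}))"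
    using le by (intro integral_mono i ib)
  also have "\<dots> = (\<Sum>k<K. w k * integral\<^sup>L (gauss_vec d) (\<lambda>x. exp ((dot d (u k) x)\<^sup>2 / 4))) + (1 - sum w {..<K})"
    using ik by (subst Bochner_Integration.integral_add) (auto simp: Bochner_Integration.integral_sum G.prob_space)
  also have "\<dots> \<le> (\<Sum>k<K. w k * 2) + (1 - sum w {..<K})"
    using w gauss_vec_exp_square(2)[OF uu] by (intro add_mono sum_mono mult_left_mono) auto
  also have "\<dots> \<le> 2" using sw by (simp add: sum_distrib_right[symmetric])
  finally show "integral\<^sup>L (gauss_vec d) (\<lambda>x. exp (sqs d K V x / 4)) \<le> 2" .
qed

section \<open>The data distribution\<close>

lemma sigma_finite_gauss_vec: "sigma_finite_measure (gauss_vec d)"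
  using prob_space_gauss_vec prob_space_imp_sigma_finite by blast

locale label_model =
  fixes d :: nat and h :: "(nat \<Rightarrow> real) \<Rightarrow> real"
  assumes h_meas [measurable]: "h \<in> borel_measurable (gauss_vec d)"
    and h_range: "\<And>x. 0 \<le> h x" "\<And>x. h x \<le> 1"
begin

abbreviation "GC \<equiv> gauss_vec d \<Otimes>\<^sub>M (count_space UNIV :: bool measure)"

definition lw :: "(nat \<Rightarrow> real) \<times> bool \<Rightarrow> real" where
  "lw z = (if snd z then h (fst z) else 1 - h (fst z))"

lemma pair_sf: "pair_sigma_finite (gauss_vec d) (count_space UNIV :: bool measure)"
  unfolding pair_sigma_finite_def using sigma_finite_gauss_vec
  by (auto intro: sigma_finite_measure_count_space_finite)

lemma measurable_labelled:
  assumes [measurable]: "\<And>y. g y \<in> borel_measurable (gauss_vec d)"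
  shows "(\<lambda>z. g (snd z) (fst z) :: real) \<in> borel_measurable GC"
proof -
  have "(\<lambda>z. if snd z then g True (fst z) else g False (fst z)) \<in> borel_measurable GC"
    by measurable
  moreover have "(\<lambda>z. g (snd z) (fst z)) = (\<lambda>z. if snd z then g True (fst z) else g False (fst z))"
    by (auto simp: fun_eq_iff)
  ultimately show ?thesis by simp
qed

lemma lw_meas [measurable]: "lw \<in> borel_measurable GC"
  unfolding lw_def[abs_def] by measurable

lemma lw_nonneg: "0 \<le> lw z"
  using h_range by (simp add: lw_def)

lemma data_dist_eq: "data_dist d h = density GC (\<lambda>z. ennreal (lw z))"
  unfolding data_dist_def lw_def by (simp add: case_prod_unfold)

lemma sets_data_dist [measurable_cong]: "sets (data_dist d h) = sets GC"
  by (simp add: data_dist_eq)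

lemma prob_space_data_dist: "prob_space (data_dist d h)"
proof (rule prob_spaceI)
  interpret P: pair_sigma_finite "gauss_vec d" "count_space UNIV :: bool measure" by (rule pair_sf)
  interpret G: prob_space "gauss_vec d" by (rule prob_space_gauss_vec)
  have "emeasure (data_dist d h) (space (data_dist d h)) = (\<integral>\<^sup>+z. ennreal (lw z) \<partial>GC)"
    unfolding data_dist_eq by (subst emeasure_density) (auto intro!: nn_integral_cong)
  also have "\<dots> = (\<integral>\<^sup>+x. (\<integral>\<^sup>+y. ennreal (lw (x, y)) \<partial>count_space UNIV) \<partial>gauss_vec d)"
    by (rule P.M2.nn_integral_fst[symmetric]) measurable
  also have "\<dots> = (\<integral>\<^sup>+x. 1 \<partial>gauss_vec d)"
    using h_range by (intro nn_integral_cong)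
      (auto simp: nn_integral_count_space_finite UNIV_bool lw_def ennreal_plus[symmetric] simp del: ennreal_plus)
  also have "\<dots> = 1" using G.emeasure_space_1 by simp
  finally show "emeasure (data_dist d h) (space (data_dist d h)) = 1" .
qed

text \<open>Averages out the label, which leaves a Gaussian integral. One envelope B for both labels
  provides integrability.\<close>

lemma data_dist_integral:
  fixes g :: "bool \<Rightarrow> (nat \<Rightarrow> real) \<Rightarrow> real"
  assumes [measurable]: "\<And>y. g y \<in> borel_measurable (gauss_vec d)"
    and B: "integrable (gauss_vec d) B" and le: "\<And>y x. \<bar>g y x\<bar> \<le> B x"
  shows "integrable (data_dist d h) (\<lambda>z. g (snd z) (fst z))" (is ?I)
    "integral\<^sup>L (data_dist d h) (\<lambda>z. g (snd z) (fst z))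
       = integral\<^sup>L (gauss_vec d) (\<lambda>x. h x * g True x + (1 - h x) * g False x)" (is ?E)
proof -
  interpret P: pair_sigma_finite "gauss_vec d" "count_space UNIV :: bool measure" by (rule pair_sf)
  have [measurable]: "(\<lambda>z. g (snd z) (fst z)) \<in> borel_measurable GC" by (rule measurable_labelled) simp
  have int: "integrable GC (\<lambda>z. lw z * g (snd z) (fst z))"
  proof (rule P.Fubini_integrable)
    show "integrable (gauss_vec d) (\<lambda>x. \<integral>y. norm (lw (x, y) * g (snd (x, y)) (fst (x, y))) \<partial>count_space UNIV)"
    proof (rule Bochner_Integration.integrable_bound[OF B])
      have e: "(\<integral>y. norm (lw (x, y) * g (snd (x, y)) (fst (x, y))) \<partial>count_space UNIV)
         = h x * \<bar>g True x\<bar> + (1 - h x) * \<bar>g False x\<bar>" for x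
        using h_range[of x] by (subst lebesgue_integral_count_space_finite) (auto simp: UNIV_bool lw_def abs_mult)
      show "(\<lambda>x. \<integral>y. norm (lw (x, y) * g (snd (x, y)) (fst (x, y))) \<partial>count_space UNIV) \<in> borel_measurable (gauss_vec d)"
        unfolding e by measurable
      have "h x * \<bar>g True x\<bar> + (1 - h x) * \<bar>g False x\<bar> \<le> \<bar>B x\<bar>" for x
      proof -
        have "h x * \<bar>g True x\<bar> + (1 - h x) * \<bar>g False x\<bar> \<le> h x * B x + (1 - h x) * B x"
          using h_range[of x] le[of True x] le[of False x] by (intro add_mono mult_left_mono) auto
        then show ?thesis by (simp add: algebra_simps)
      qed
      moreover have "0 \<le> h x * \<bar>g True x\<bar> + (1 - h x) * \<bar>g False x\<bar>" for x
        using h_range[of x] by auto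
      ultimately show "AE x in gauss_vec d. norm (\<integral>y. norm (lw (x, y) * g (snd (x, y)) (fst (x, y))) \<partial>count_space UNIV) \<le> norm (B x)"
        unfolding e by simp
    qed
    show "AE x in gauss_vec d. integrable (count_space UNIV) (\<lambda>y. lw (x, y) * g (snd (x, y)) (fst (x, y)))"
      by (intro AE_I2 integrable_count_space) simp
  qed measurable
  show ?I unfolding data_dist_eq
    by (subst integrable_density) (use int lw_nonneg in auto)
  have "integral\<^sup>L (data_dist d h) (\<lambda>z. g (snd z) (fst z)) = integral\<^sup>L GC (\<lambda>z. lw z * g (snd z) (fst z))"
    unfolding data_dist_eq by (subst integral_density) (use lw_nonneg in auto)
  also have "\<dots> = (\<integral>x. (\<integral>y. lw (x, y) * g (snd (x, y)) (fst (x, y)) \<partial>count_space UNIV) \<partial>gauss_vec d)"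
    by (rule P.integral_fst'[OF int, symmetric])
  also have "\<dots> = integral\<^sup>L (gauss_vec d) (\<lambda>x. h x * g True x + (1 - h x) * g False x)"
    by (intro Bochner_Integration.integral_cong refl, subst lebesgue_integral_count_space_finite)
       (auto simp: UNIV_bool lw_def)
  finally show ?E .
qed

end

section \<open>The population Hessian\<close>

lemma measurable_lossq [measurable]:
  "(\<lambda>x. lossq K (pre d W x) y (pre d V x)) \<in> borel_measurable (gauss_vec d)"
  unfolding lossq_def lossq1_def by (cases y; simp; measurable)

lemma abs_lossq_pre_le: "K \<ge> 1 \<Longrightarrow> \<bar>lossq K (pre d W x) y (pre d V x)\<bar> \<le> 2 * sqs d K V x"
  unfolding sqs_def by (rule abs_lossq_le)

lemma H_fcn_pre: "H_fcn d K W x = 1 / real K * (\<Sum>k<K. sigmoid (pre d W x k))"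
  by (simp add: H_fcn_def pre_def dot_def wcol_def)

lemma H_fcn_gt_0: "K \<ge> 1 \<Longrightarrow> 0 < H_fcn d K W x"
  unfolding H_fcn_pre using sum_sigmoid_pos[of K] by simp

lemma one_minus_H_fcn: "K \<ge> 1 \<Longrightarrow> 1 - H_fcn d K W x = 1 / real K * (\<Sum>k<K. sigmoid (- pre d W x k))"
  unfolding H_fcn_pre by (simp add: sigmoid_uminus sum_subtractf field_simps)

lemma H_fcn_less_1: "K \<ge> 1 \<Longrightarrow> H_fcn d K W x < 1"
proof -
  assume K: "K \<ge> 1"
  have "0 < 1 / real K * (\<Sum>k<K. sigmoid (- pre d W x k))" using sum_sigmoid_pos[OF K] K by simp
  then show ?thesis using one_minus_H_fcn[OF K, of d W x] by linarith
qed

lemma label_model_H_fcn: "K \<ge> 1 \<Longrightarrow> label_model d (H_fcn d K W)"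
proof
  show "H_fcn d K W \<in> borel_measurable (gauss_vec d)" unfolding H_fcn_pre[abs_def] by measurable
qed (use H_fcn_gt_0 H_fcn_less_1 in \<open>auto simp: less_imp_le\<close>)

text \<open>K times the derivative of H at W in direction V; at the true parameter it is the F of
  the overview.\<close>

definition grad_sum :: "nat \<Rightarrow> nat \<Rightarrow> (nat \<times> nat \<Rightarrow> real) \<Rightarrow> (nat \<times> nat \<Rightarrow> real) \<Rightarrow> (nat \<Rightarrow> real) \<Rightarrow> real" where
  "grad_sum d K W V x = (\<Sum>k<K. dsig 1 (pre d W x k) * pre d V x k)"

lemma measurable_grad_sum [measurable]: "grad_sum d K W V \<in> borel_measurable (gauss_vec d)"
  unfolding grad_sum_def[abs_def] by measurable

lemma expgrow_dsig [intro]: "expgrow d (\<lambda>x. dsig r (f x))"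
  using dsig_bounded[of r] by (auto intro: expgrow_bounded)

lemma expgrow_grad_sum [intro]: "expgrow d (grad_sum d K W V)"
  unfolding grad_sum_def[abs_def] by (intro expgrow_sum expgrow_mult expgrow_dsig expgrow_pre)

text \<open>\<eta> is the true label probability and H the modelled one. If they agree, the
  second-derivative terms of the two labels cancel and what is left is Fisher information, at least
  F^2 / K^2 because H and 1 - H are below 1. A mismatch leaves those terms multiplied by \<eta> -
  H.\<close>

lemma lossq_mix:
  fixes W V :: "nat \<times> nat \<Rightarrow> real" and x :: "nat \<Rightarrow> real" and d K :: nat
  assumes K: "K \<ge> 1" and \<eta>: "0 \<le> \<eta>" "\<eta> \<le> 1"
  defines "H \<equiv> H_fcn d K W x"
  shows "\<eta> * lossq K (pre d W x) True (pre d V x) + (1 - \<eta>) * lossq K (pre d W x) False (pre d V x)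
    \<ge> (grad_sum d K W V x)\<^sup>2 / (real K)\<^sup>2 - \<bar>\<eta> - H\<bar> * (1 / H + 1 / (1 - H)) * (1 / real K * sqs d K V x)"
proof -
  define B where "B = (\<Sum>k<K. dsig 2 (pre d W x k) * (pre d V x k)\<^sup>2)"
  define F where "F = grad_sum d K W V x"
  have H: "0 < H" "H < 1" unfolding H_def using H_fcn_gt_0[OF K] H_fcn_less_1[OF K] by auto
  have s1: "(\<Sum>k<K. sigmoid (pre d W x k)) = real K * H"
    unfolding H_def H_fcn_pre using K by simp
  have s2: "(\<Sum>k<K. sigmoid (- pre d W x k)) = real K * (1 - H)"
    unfolding H_def one_minus_H_fcn[OF K] using K by simp
  have T: "lossq K (pre d W x) True (pre d V x) = (F / (real K * H))\<^sup>2 - B / (real K * H)"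
    unfolding lossq_def lossq1_def F_def grad_sum_def B_def by (simp add: s1)
  have Fa: "lossq K (pre d W x) False (pre d V x) = (F / (real K * (1 - H)))\<^sup>2 + B / (real K * (1 - H))"
    unfolding lossq_def lossq1_def F_def grad_sum_def B_def
    by (simp add: s2 dsig_1_uminus dsig_2_uminus sum_negf del: One_nat_def)
  have Bb: "\<bar>B\<bar> \<le> sqs d K V x"
  proof -
    have "\<bar>B\<bar> \<le> (\<Sum>k<K. \<bar>dsig 2 (pre d W x k) * (pre d V x k)\<^sup>2\<bar>)" unfolding B_def by (rule sum_abs)
    also have "\<dots> \<le> (\<Sum>k<K. 1 * (pre d V x k)\<^sup>2)"
    proof (intro sum_mono)
      fix k
      have "\<bar>dsig 2 (pre d W x k)\<bar> \<le> 1"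
        using abs_dsig_2_le[of "pre d W x k"] dsig_1_le_quarter[of "pre d W x k"] by linarith
      then show "\<bar>dsig 2 (pre d W x k) * (pre d V x k)\<^sup>2\<bar> \<le> 1 * (pre d V x k)\<^sup>2"
        unfolding abs_mult by (intro mult_mono) auto
    qed
    finally show ?thesis by (simp add: sqs_def)
  qed
  have sq: "(F / (real K * G))\<^sup>2 \<ge> F\<^sup>2 / (real K)\<^sup>2" if "0 < G" "G < 1" for G
  proof -
    have "(real K * G)\<^sup>2 \<le> (real K)\<^sup>2" using that K by (intro power_mono) (auto simp: mult_le_cancel_left1)
    then show ?thesis unfolding power_divide using that K by (intro divide_left_mono) auto
  qed
  have 1: "\<eta> * (F / (real K * H))\<^sup>2 + (1 - \<eta>) * (F / (real K * (1 - H)))\<^sup>2 \<ge> F\<^sup>2 / (real K)\<^sup>2"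
  proof -
    have "\<eta> * (F / (real K * H))\<^sup>2 + (1 - \<eta>) * (F / (real K * (1 - H)))\<^sup>2
      \<ge> \<eta> * (F\<^sup>2 / (real K)\<^sup>2) + (1 - \<eta>) * (F\<^sup>2 / (real K)\<^sup>2)"
      using \<eta> H by (intro add_mono mult_left_mono sq) auto
    moreover have e: "\<eta> * Y + (1 - \<eta>) * Y = Y" for Y :: real by (simp add: algebra_simps)
    ultimately show ?thesis using e[of "F\<^sup>2 / (real K)\<^sup>2"] by linarith
  qed
  have 2: "\<eta> * (B / (real K * H)) - (1 - \<eta>) * (B / (real K * (1 - H)))
      = (\<eta> - H) * (1 / H + 1 / (1 - H)) * (1 / real K * B)"
    using H K by (simp add: divide_simps) (simp add: algebra_simps)
  have "\<bar>(\<eta> - H) * (1 / H + 1 / (1 - H)) * (1 / real K * B)\<bar>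
     \<le> \<bar>\<eta> - H\<bar> * (1 / H + 1 / (1 - H)) * (1 / real K * sqs d K V x)"
    unfolding abs_mult using H K Bb by (intro mult_mono) (auto simp: sqs_nonneg divide_right_mono)
  then show ?thesis using 1 2 unfolding T Fa F_def[symmetric] by (simp add: algebra_simps)
qed

lemma inverse_sigmoid_le: "1 / sigmoid s \<le> 2 * exp \<bar>s\<bar>"
proof -
  have "1 / sigmoid s = 1 + exp (- s)" by (simp add: sigmoid_def)
  moreover have "1 \<le> exp \<bar>s\<bar>" "exp (- s) \<le> exp \<bar>s\<bar>" by auto
  ultimately show ?thesis by linarith
qed

text \<open>Convexity of 1/t, through its tangent at H, moves the reciprocal inside the average;
  then \<open>inverse_sigmoid_le\<close> applies termwise.\<close>

lemma inverse_avg_sigmoid_le: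
  assumes K: "K \<ge> (1::nat)" and H: "H = 1 / real K * (\<Sum>k<K. sigmoid (s k))"
  shows "1 / H \<le> 1 / real K * (\<Sum>k<K. 2 * exp \<bar>s k\<bar>)"
proof -
  have Hp: "H > 0" unfolding H using sum_sigmoid_pos[OF K] K by simp
  have "2 / H - t / H\<^sup>2 \<le> 1 / t" if "t > 0" for t
  proof -
    have "0 \<le> (t - H)\<^sup>2 / (t * H\<^sup>2)" using that by simp
    also have "\<dots> = 1 / t - (2 / H - t / H\<^sup>2)" using that Hp by (simp add: field_simps power2_eq_square)
    finally show ?thesis by simp
  qed
  then have "2 / H - sigmoid (s k) / H\<^sup>2 \<le> 2 * exp \<bar>s k\<bar>" for k
    using inverse_sigmoid_le[of "s k"] sigmoid_pos[of "s k"] order_trans by blast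
  then have "(\<Sum>k<K. 2 / H - sigmoid (s k) / H\<^sup>2) \<le> (\<Sum>k<K. 2 * exp \<bar>s k\<bar>)" by (intro sum_mono)
  also have "(\<Sum>k<K. 2 / H - sigmoid (s k) / H\<^sup>2) = real K * (2 / H) - (\<Sum>k<K. sigmoid (s k)) / H\<^sup>2"
    by (simp add: sum_subtractf sum_divide_distrib)
  also have "(\<Sum>k<K. sigmoid (s k)) = real K * H" unfolding H using K by simp
  finally have "real K * (1 / H) \<le> (\<Sum>k<K. 2 * exp \<bar>s k\<bar>)" using Hp by (simp add: power2_eq_square)
  then show ?thesis using K by (simp add: field_simps)
qed

text \<open>The exponent is y / 12 so that the cube of the bound is a multiple of exp (y / 4), the
  exponential moment that is available.\<close>

lemma le_12_exp:
  fixes y :: real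
  shows "0 \<le> y \<Longrightarrow> 1 + y \<le> 12 * exp (y / 12)" "0 \<le> y \<Longrightarrow> y \<le> 12 * exp (y / 12)"
proof -
  assume y: "0 \<le> y"
  show "1 + y \<le> 12 * exp (y / 12)" using exp_ge_add_one_self[of "y/12"] y by linarith
  then show "y \<le> 12 * exp (y / 12)" by simp
qed

text \<open>Separates three dependent factors before expectations are taken.\<close>

lemma prod3_le:
  assumes "0 \<le> (a::real)" "0 \<le> b" "0 \<le> c" shows "a * b * c \<le> a ^ 3 + b ^ 3 + c ^ 3"
proof -
  define m where "m = max a (max b c)"
  have "a * b * c \<le> m * m * m" using assms by (intro mult_mono) (auto simp: m_def)
  moreover have "m ^ 3 \<le> a ^ 3 + b ^ 3 + c ^ 3" using assms unfolding m_def max_def by auto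
  ultimately show ?thesis by (simp add: power3_eq_cube)
qed

text \<open>The remainder of order r / (K sqrt K) comes from the mismatch of the label
  probabilities. Set against a main term of order tau / K^2 it dictates a radius of order tau / sqrt
  K.\<close>

lemma population_bound:
  assumes K: "K \<ge> 1" and r: "0 < r" "r \<le> 1"
    and W0: "\<And>k. k < K \<Longrightarrow> dot d (wcol W0 k) (wcol W0 k) \<le> 1"
    and W: "fro2 d K (\<lambda>a. W a - W0 a) \<le> r\<^sup>2"
    and V: "fro2 d K V \<le> 1"
  shows "integral\<^sup>L (data_dist d (H_fcn d K W0)) (\<lambda>z. lossq K (pre d W (fst z)) (snd z) (pre d V (fst z)))
    \<ge> (1 / (real K)\<^sup>2) * (integral\<^sup>L (gauss_vec d) (\<lambda>x. (grad_sum d K W0 V x)\<^sup>2) / 2 - 64 * r\<^sup>2)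
      - 4 * (6912 + 2 * exp 36) * r / (real K * sqrt (real K))"
proof -
  interpret L: label_model d "H_fcn d K W0" by (rule label_model_H_fcn[OF K])
  interpret G: prob_space "gauss_vec d" by (rule prob_space_gauss_vec)
  \<comment> \<open>The displacement is rescaled to norm at most 1, so that its exponential moment
    is at most 2 and r appears only as an explicit factor.\<close>
  define \<Delta> where "\<Delta> = (\<lambda>a. (1 / r) * (W a - W0 a))"
  have \<Delta>: "fro2 d K \<Delta> \<le> 1"
    unfolding \<Delta>_def fro2_scale using W r by (simp add: power_divide)
  define D where "D = sqs d K \<Delta>"
  define S where "S = sqs d K V"
  have Sn: "0 \<le> S x" and Dn: "0 \<le> D x" for x unfolding S_def D_def by (auto intro: sqs_nonneg)
  have sqs\<Delta>: "sqs d K (\<lambda>a. W a - W0 a) x = r\<^sup>2 * D x" for x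
    unfolding D_def \<Delta>_def sqs_scale using r by (simp add: power_divide)
  \<comment> \<open>Halving brings the columns of W, which have norm at most 2, into the unit
    ball.\<close>
  define wn where "wn k = (\<lambda>i. (1/2) * wcol W k i)" for k
  have wn: "dot d (wn k) (wn k) \<le> 1" if "k < K" for k
  proof -
    have e: "wcol W k = (\<lambda>i. wcol W0 k i + wcol (\<lambda>a. W a - W0 a) k i)" by (simp add: wcol_def)
    have d1: "dot d (wcol (\<lambda>a. W a - W0 a) k) (wcol (\<lambda>a. W a - W0 a) k) \<le> 1"
      using dot_col_le_fro2[OF that, of d "\<lambda>a. W a - W0 a"] W power_le_one[of r 2] r by linarith
    have "dot d (\<lambda>i. a i + b i) (\<lambda>i. a i + b i) \<le> 2 * dot d a a + 2 * dot d b b" for a b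
    proof -
      have "dot d (\<lambda>i. a i + b i) (\<lambda>i. a i + b i) + dot d (\<lambda>i. a i - b i) (\<lambda>i. a i - b i) = 2 * dot d a a + 2 * dot d b b"
        by (simp add: dot_add_left dot_add_right dot_diff_left dot_diff_right)
      then show ?thesis using dot_self_nonneg[of d "\<lambda>i. a i - b i"] by linarith
    qed
    from this[of "wcol W0 k" "wcol (\<lambda>a. W a - W0 a) k"] have "dot d (wcol W k) (wcol W k) \<le> 4"
      using W0[OF that] d1 e by simp
    then show ?thesis unfolding wn_def dot_scale_left dot_scale_right by simp
  qed
  define E where "E k x = exp ((dot d (wn k) x)\<^sup>2 / 4)" for k x
  \<comment> \<open>\<open>R\<close> dominates the mismatch term and \<open>N\<close> the squared
    change of F between the two parameters. 1728 = 12^3 comes from \<open>le_12_exp\<close>, and exp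
    36 from 3 |s| \<le> 36 + s^2 / 16.\<close>
  define R where "R x = (4 * r / (real K * sqrt (real K))) * (1 / real K * (\<Sum>k<K. 1728 * exp (D x / 4) + exp 36 * E k x + 1728 * exp (S x / 4)))" for x
  define N where "N x = 16 * r\<^sup>2 * (exp (D x / 4) + exp (S x / 4))" for x
  define q where "q y x = lossq K (pre d W x) y (pre d V x)" for y x
  have iS: "integrable (gauss_vec d) (\<lambda>x. exp (S x / 4))" "integral\<^sup>L (gauss_vec d) (\<lambda>x. exp (S x / 4)) \<le> 2"
    unfolding S_def using gauss_vec_exp_sqs[OF V] by auto
  have iD: "integrable (gauss_vec d) (\<lambda>x. exp (D x / 4))" "integral\<^sup>L (gauss_vec d) (\<lambda>x. exp (D x / 4)) \<le> 2"
    unfolding D_def using gauss_vec_exp_sqs[OF \<Delta>] by auto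
  have iE: "integrable (gauss_vec d) (E k)" "integral\<^sup>L (gauss_vec d) (E k) \<le> 2" if "k < K" for k
    unfolding E_def[abs_def] using gauss_vec_exp_square[OF wn[OF that]] by auto
  have iF: "integrable (gauss_vec d) (\<lambda>x. (grad_sum d K W0 V x)\<^sup>2)"
    by (rule expgrow_integrable) auto
  have iN: "integrable (gauss_vec d) N" unfolding N_def[abs_def] using iS iD by simp
  have iR: "integrable (gauss_vec d) R" unfolding R_def[abs_def] using iS iD iE
    by (intro integrable_mult_right Bochner_Integration.integrable_sum Bochner_Integration.integrable_add) auto
  have diff: "(grad_sum d K W V x - grad_sum d K W0 V x)\<^sup>2 \<le> N x" for x
  proof -
    have "grad_sum d K W V x - grad_sum d K W0 V x = (\<Sum>k<K. (dsig 1 (pre d W x k) - dsig 1 (pre d W0 x k)) * pre d V x k)"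
      unfolding grad_sum_def by (simp add: sum_subtractf algebra_simps)
    then have "(grad_sum d K W V x - grad_sum d K W0 V x)\<^sup>2
      \<le> (\<Sum>k<K. (dsig 1 (pre d W x k) - dsig 1 (pre d W0 x k))\<^sup>2) * S x"
      unfolding S_def sqs_def using Cauchy_Schwarz_ineq_sum by metis
    also have "\<dots> \<le> (r\<^sup>2 * D x) * S x"
    proof (rule mult_right_mono[OF _ Sn])
      have "\<bar>dsig 1 a - dsig 1 b\<bar> \<le> \<bar>a - b\<bar>" for a b
      proof -
        have "norm (dsig 1 a - dsig 1 b) \<le> 1 * norm (a - b)"
        proof (rule field_differentiable_bound[where S = UNIV])
          show "(dsig 1 has_field_derivative dsig 2 z) (at z within UNIV)" for z
            using DERIV_dsig[of 1 z] by (simp add: numeral_2_eq_2)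
          show "norm (dsig 2 z) \<le> 1" for z
            using abs_dsig_2_le[of z] dsig_1_le_quarter[of z] by simp
        qed auto
        then show ?thesis by simp
      qed
      then have "(dsig 1 (pre d W x k) - dsig 1 (pre d W0 x k))\<^sup>2 \<le> (pre d (\<lambda>a. W a - W0 a) x k)\<^sup>2" for k
        unfolding pre_diff by (metis abs_le_square_iff)
      then show "(\<Sum>k<K. (dsig 1 (pre d W x k) - dsig 1 (pre d W0 x k))\<^sup>2) \<le> r\<^sup>2 * D x"
        unfolding sqs\<Delta>[symmetric] sqs_def by (intro sum_mono)
    qed
    also have "\<dots> \<le> r\<^sup>2 * (16 * (exp (D x / 4) + exp (S x / 4)))"
    proof -
      have "y\<^sup>2 \<le> 32 * exp (y / 4)" if "0 \<le> y" for y :: real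
      proof -
        have "1 + y / 4 + (y / 4)\<^sup>2 / 2 \<le> exp (y / 4)" using exp_lower_Taylor_quadratic[of "y/4"] that by simp
        then show ?thesis using that by (simp add: power_divide)
      qed
      from this[OF Dn[of x]] this[OF Sn[of x]]
      have "2 * D x * S x \<le> 32 * exp (D x / 4) + 32 * exp (S x / 4)"
        using sum_squares_bound[of "D x" "S x"] by (meson add_mono order_trans)
      then have "D x * S x \<le> 16 * (exp (D x / 4) + exp (S x / 4))" by simp
      then show ?thesis using r by (simp add: mult.assoc mult_left_mono)
    qed
    finally show ?thesis by (simp add: N_def mult_ac)
  qed
  have rem: "\<bar>H_fcn d K W0 x - H_fcn d K W x\<bar> * (1 / H_fcn d K W x + 1 / (1 - H_fcn d K W x)) * (1 / real K * S x) \<le> R x" for x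
  proof -
    \<comment> \<open>Cauchy-Schwarz over the neurons gains the factor 1 / sqrt K, since the
      displacement is bounded in Frobenius norm.\<close>
    have 1: "\<bar>H_fcn d K W0 x - H_fcn d K W x\<bar> \<le> r / sqrt (real K) * (1 + D x)"
    proof -
      have sl: "\<bar>sigmoid a - sigmoid b\<bar> \<le> \<bar>a - b\<bar>" for a b
      proof -
        have "norm (sigmoid a - sigmoid b) \<le> 1 * norm (a - b)"
        proof (rule field_differentiable_bound[where S = UNIV])
          show "(sigmoid has_field_derivative dsig 1 z) (at z within UNIV)" for z
            using DERIV_sigmoid[of z] by (simp add: dsig_1 del: One_nat_def)
          show "norm (dsig 1 z) \<le> 1" for z
            using dsig_1_pos[of z] dsig_1_le_quarter[of z] by (simp del: One_nat_def)
        qed auto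
        then show ?thesis by simp
      qed
      have "\<bar>H_fcn d K W0 x - H_fcn d K W x\<bar> = 1 / real K * \<bar>\<Sum>k<K. sigmoid (pre d W0 x k) - sigmoid (pre d W x k)\<bar>"
        unfolding H_fcn_pre by (simp add: sum_subtractf right_diff_distrib[symmetric] abs_mult diff_divide_distrib[symmetric])
      also have "\<dots> \<le> 1 / real K * (\<Sum>k<K. \<bar>pre d (\<lambda>a. W a - W0 a) x k\<bar> * 1)"
        using sl by (intro mult_left_mono order_trans[OF sum_abs] sum_mono) (auto simp: pre_diff abs_minus_commute)
      also have "\<dots> \<le> 1 / real K * (sqrt (r\<^sup>2 * D x) * sqrt (real K))"
      proof (intro mult_left_mono)
        have "(\<Sum>k<K. \<bar>pre d (\<lambda>a. W a - W0 a) x k\<bar> * 1)\<^sup>2 \<le> (r\<^sup>2 * D x) * real K"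
          using Cauchy_Schwarz_ineq_sum[of "\<lambda>k. \<bar>pre d (\<lambda>a. W a - W0 a) x k\<bar>" "\<lambda>_. 1" "{..<K}"]
          unfolding sqs\<Delta>[symmetric] sqs_def by simp
        then show "(\<Sum>k<K. \<bar>pre d (\<lambda>a. W a - W0 a) x k\<bar> * 1) \<le> sqrt (r\<^sup>2 * D x) * sqrt (real K)"
          unfolding real_sqrt_mult[symmetric] by (rule real_le_rsqrt)
      qed simp
      also have "\<dots> = r / sqrt (real K) * sqrt (D x)"
        using r K by (simp add: real_sqrt_mult real_div_sqrt field_simps)
      also have "\<dots> \<le> r / sqrt (real K) * (1 + D x)"
      proof (intro mult_left_mono)
        show "sqrt (D x) \<le> 1 + D x"
          using Dn[of x] by (intro real_le_lsqrt) (auto simp: power2_eq_square algebra_simps)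
      qed (use r in auto)
      finally show ?thesis .
    qed
    have 2: "1 / H_fcn d K W x + 1 / (1 - H_fcn d K W x) \<le> 4 * (1 / real K * (\<Sum>k<K. exp \<bar>pre d W x k\<bar>))"
    proof -
      have "1 / H_fcn d K W x \<le> 1 / real K * (\<Sum>k<K. 2 * exp \<bar>pre d W x k\<bar>)"
        by (rule inverse_avg_sigmoid_le[OF K H_fcn_pre])
      moreover have "1 / (1 - H_fcn d K W x) \<le> 1 / real K * (\<Sum>k<K. 2 * exp \<bar>- pre d W x k\<bar>)"
        by (rule inverse_avg_sigmoid_le[OF K one_minus_H_fcn[OF K]])
      ultimately show ?thesis by (simp add: sum_distrib_left[symmetric])
    qed
    have 3: "(1 + D x) * exp \<bar>pre d W x k\<bar> * S x \<le> 1728 * exp (D x / 4) + exp 36 * E k x + 1728 * exp (S x / 4)" for k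
    proof -
      have c: "(12 * exp (y / 12)) ^ 3 = 1728 * exp (y / 4)" for y :: real
        by (simp add: power_mult_distrib exp_of_nat_mult[symmetric])
      have "(1 + D x) * exp \<bar>pre d W x k\<bar> * S x \<le> (1 + D x) ^ 3 + (exp \<bar>pre d W x k\<bar>) ^ 3 + S x ^ 3"
        using Sn Dn by (intro prod3_le) (auto intro: add_nonneg_nonneg)
      moreover have "(1 + D x) ^ 3 \<le> (12 * exp (D x / 12)) ^ 3"
        using le_12_exp(1)[OF Dn] Dn by (intro power_mono) (auto intro: add_nonneg_nonneg)
      moreover have "S x ^ 3 \<le> (12 * exp (S x / 12)) ^ 3"
        using le_12_exp(2)[OF Sn] Sn by (intro power_mono) auto
      moreover have "(exp \<bar>pre d W x k\<bar>) ^ 3 \<le> exp 36 * E k x"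
      proof -
        define s where "s = pre d W x k"
        have "(exp \<bar>s\<bar>) ^ 3 = exp (3 * \<bar>s\<bar>)" by (simp add: exp_of_nat_mult[symmetric])
        also have "3 * \<bar>s\<bar> \<le> 36 + (s / 2)\<^sup>2 / 4"
        proof -
          have "0 \<le> (\<bar>s\<bar> / 4 - 6)\<^sup>2" by simp
          then show ?thesis by (simp add: power2_diff power_divide)
        qed
        also have "s / 2 = dot d (wn k) x" unfolding s_def pre_def wn_def dot_scale_left by simp
        finally show ?thesis unfolding s_def E_def by (simp add: exp_add)
      qed
      ultimately show ?thesis using c[of "D x"] c[of "S x"] by linarith
    qed
    have "\<bar>H_fcn d K W0 x - H_fcn d K W x\<bar> * (1 / H_fcn d K W x + 1 / (1 - H_fcn d K W x)) * (1 / real K * S x)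
      \<le> (r / sqrt (real K) * (1 + D x)) * (4 * (1 / real K * (\<Sum>k<K. exp \<bar>pre d W x k\<bar>))) * (1 / real K * S x)"
      using 1 2 r Sn Dn by (intro mult_mono mult_nonneg_nonneg) (auto intro!: sum_nonneg add_nonneg_nonneg divide_nonneg_nonneg simp: H_fcn_gt_0[OF K] H_fcn_less_1[OF K] less_imp_le)
    also have "\<dots> = (4 * r / (real K * sqrt (real K))) * (1 / real K * (\<Sum>k<K. (1 + D x) * exp \<bar>pre d W x k\<bar> * S x))"
      unfolding sum_distrib_left[symmetric] sum_distrib_right[symmetric] by (simp add: field_simps)
    also have "\<dots> \<le> R x" unfolding R_def
      using r 3 by (intro mult_left_mono sum_mono) auto
    finally show ?thesis .
  qed
  have pt: "H_fcn d K W0 x * q True x + (1 - H_fcn d K W0 x) * q False x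
     \<ge> (1 / (real K)\<^sup>2) * ((grad_sum d K W0 V x)\<^sup>2 / 2 - N x) - R x" for x
  proof -
    have "(grad_sum d K W0 V x)\<^sup>2 / 2 - (grad_sum d K W V x - grad_sum d K W0 V x)\<^sup>2 \<le> (grad_sum d K W V x)\<^sup>2"
    proof -
      have "a\<^sup>2 / 2 - (b - a)\<^sup>2 \<le> b\<^sup>2" for a b :: real
      proof -
        have "0 \<le> (a - 2 * b)\<^sup>2" by simp
        then show ?thesis by (simp add: power2_diff power2_eq_square algebra_simps)
      qed
      then show ?thesis by blast
    qed
    then have "(grad_sum d K W0 V x)\<^sup>2 / 2 - N x \<le> (grad_sum d K W V x)\<^sup>2" using diff[of x] by linarith
    then have "(1 / (real K)\<^sup>2) * ((grad_sum d K W0 V x)\<^sup>2 / 2 - N x) \<le> (1 / (real K)\<^sup>2) * (grad_sum d K W V x)\<^sup>2"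
      by (intro mult_left_mono) auto
    then show ?thesis
      using lossq_mix[OF K L.h_range(1)[of x] L.h_range(2)[of x], where W = W and V = V and x = x and d = d] rem[of x] unfolding q_def S_def by simp
  qed
  have B: "integrable (gauss_vec d) (\<lambda>x. 2 * S x)" unfolding S_def by (intro integrable_mult_right expgrow_integrable) auto
  have le: "\<bar>q y x\<bar> \<le> 2 * S x" for y x unfolding q_def S_def by (rule abs_lossq_pre_le[OF K])
  have qm [measurable]: "q y \<in> borel_measurable (gauss_vec d)" for y unfolding q_def[abs_def] by measurable
  have "integral\<^sup>L (data_dist d (H_fcn d K W0)) (\<lambda>z. q (snd z) (fst z))
      = integral\<^sup>L (gauss_vec d) (\<lambda>x. H_fcn d K W0 x * q True x + (1 - H_fcn d K W0 x) * q False x)"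
    by (rule L.data_dist_integral(2)[OF qm B le])
  also have "\<dots> \<ge> integral\<^sup>L (gauss_vec d) (\<lambda>x. (1 / (real K)\<^sup>2) * ((grad_sum d K W0 V x)\<^sup>2 / 2 - N x) - R x)"
  proof (rule integral_mono[OF _ _ pt])
    show "integrable (gauss_vec d) (\<lambda>x. (1 / (real K)\<^sup>2) * ((grad_sum d K W0 V x)\<^sup>2 / 2 - N x) - R x)"
      using iF iN iR by simp
    have hq: "\<bar>h * a\<bar> \<le> \<bar>a\<bar>" if "0 \<le> h" "h \<le> 1" for h a :: real
      using that by (simp add: abs_mult mult_left_le_one_le)
    have iq: "integrable (gauss_vec d) (q y)" for y
      by (rule Bochner_Integration.integrable_bound[OF B qm]) (use le Sn in auto)
    show "integrable (gauss_vec d) (\<lambda>x. H_fcn d K W0 x * q True x + (1 - H_fcn d K W0 x) * q False x)"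
      by (intro Bochner_Integration.integrable_add Bochner_Integration.integrable_bound[OF iq[of True]] Bochner_Integration.integrable_bound[OF iq[of False]])
         (use L.h_range in \<open>auto intro!: hq simp: L.h_meas\<close>)
  qed
  finally have main: "integral\<^sup>L (data_dist d (H_fcn d K W0)) (\<lambda>z. q (snd z) (fst z))
     \<ge> (1 / (real K)\<^sup>2) * (integral\<^sup>L (gauss_vec d) (\<lambda>x. (grad_sum d K W0 V x)\<^sup>2) / 2 - integral\<^sup>L (gauss_vec d) N) - integral\<^sup>L (gauss_vec d) R"
    using iF iN iR by simp
  have eN: "integral\<^sup>L (gauss_vec d) N \<le> 64 * r\<^sup>2"
  proof -
    have "integral\<^sup>L (gauss_vec d) N = 16 * r\<^sup>2 * (integral\<^sup>L (gauss_vec d) (\<lambda>x. exp (D x / 4)) + integral\<^sup>L (gauss_vec d) (\<lambda>x. exp (S x / 4)))"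
      unfolding N_def[abs_def] using iD iS by simp
    also have "\<dots> \<le> 16 * r\<^sup>2 * (2 + 2)" using iD iS by (intro mult_left_mono add_mono) auto
    finally show ?thesis by simp
  qed
  have eR: "integral\<^sup>L (gauss_vec d) R \<le> 4 * (6912 + 2 * exp 36) * r / (real K * sqrt (real K))"
  proof -
    have "integral\<^sup>L (gauss_vec d) R = (4 * r / (real K * sqrt (real K))) * (1 / real K *
       (\<Sum>k<K. 1728 * integral\<^sup>L (gauss_vec d) (\<lambda>x. exp (D x / 4)) + exp 36 * integral\<^sup>L (gauss_vec d) (E k)
           + 1728 * integral\<^sup>L (gauss_vec d) (\<lambda>x. exp (S x / 4))))"
      unfolding R_def[abs_def] using iD iS iE
      by (simp add: Bochner_Integration.integral_sum Bochner_Integration.integrable_add del: sum.distrib)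
    also have "\<dots> \<le> (4 * r / (real K * sqrt (real K))) * (1 / real K * (\<Sum>k<K. 1728 * 2 + exp 36 * 2 + 1728 * 2))"
      using iD iS iE r by (intro mult_left_mono sum_mono add_mono) auto
    also have "\<dots> = 4 * (6912 + 2 * exp 36) * r / (real K * sqrt (real K))" using K by (simp add: field_simps)
    finally show ?thesis .
  qed
  have "(1 / (real K)\<^sup>2) * (integral\<^sup>L (gauss_vec d) (\<lambda>x. (grad_sum d K W0 V x)\<^sup>2) / 2 - 64 * r\<^sup>2)
     \<le> (1 / (real K)\<^sup>2) * (integral\<^sup>L (gauss_vec d) (\<lambda>x. (grad_sum d K W0 V x)\<^sup>2) / 2 - integral\<^sup>L (gauss_vec d) N)"
    using eN by (intro mult_left_mono) auto
  then show ?thesis using main eR unfolding q_def by linarith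
qed

section \<open>Uniform concentration of quadratic forms\<close>

lemma exp_quadratic_bound: "exp u \<le> 1 + u + u\<^sup>2 * exp \<bar>u\<bar>" for u :: real
proof -
  obtain t where t: "\<bar>t\<bar> \<le> \<bar>u\<bar>" "exp u = (\<Sum>m<2. u ^ m / fact m) + exp t / fact 2 * u ^ 2"
    using Maclaurin_exp_le[of u 2] by blast
  have "exp t / 2 * u\<^sup>2 \<le> exp \<bar>u\<bar> * u\<^sup>2"
  proof (rule mult_right_mono)
    have "exp t \<le> exp \<bar>u\<bar>" using t(1) by simp
    then show "exp t / 2 \<le> exp \<bar>u\<bar>" using exp_gt_zero[of t] by linarith
  qed simp
  then show ?thesis using t(2) by (simp add: numeral_2_eq_2 mult.commute)
qed

lemma square_le_exp: "0 \<le> y \<Longrightarrow> y\<^sup>2 \<le> 128 * exp (y / 8)" for y :: real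
  using exp_lower_Taylor_quadratic[of "y / 8"] by (simp add: power_divide)

lemma subexp_integrable:
  fixes X T :: "'z \<Rightarrow> real"
  assumes "prob_space M" and [measurable]: "X \<in> borel_measurable M" "T \<in> borel_measurable M"
    and XT: "\<And>z. \<bar>X z\<bar> \<le> 2 * T z" and T: "integrable M (\<lambda>z. exp (T z / 4))" "integral\<^sup>L M (\<lambda>z. exp (T z / 4)) \<le> 2"
  shows "integrable M X" "\<bar>integral\<^sup>L M X\<bar> \<le> 16"
proof -
  have le: "\<bar>X z\<bar> \<le> 8 * exp (T z / 4)" for z
    using XT[of z] exp_ge_add_one_self[of "T z / 4"] by linarith
  show i: "integrable M X"
    by (rule Bochner_Integration.integrable_bound[OF integrable_mult_right[OF T(1), of 8]]) (use le in auto)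
  have "\<bar>integral\<^sup>L M X\<bar> \<le> integral\<^sup>L M (\<lambda>z. \<bar>X z\<bar>)" by (rule integral_abs_bound)
  also have "\<dots> \<le> integral\<^sup>L M (\<lambda>z. 8 * exp (T z / 4))"
    using i T le by (intro integral_mono) auto
  also have "\<dots> \<le> 16" using T by simp
  finally show "\<bar>integral\<^sup>L M X\<bar> \<le> 16" .
qed

lemma chernoff_upper:
  fixes X T :: "'z \<Rightarrow> real"
  assumes M: "prob_space M" and Xm [measurable]: "X \<in> borel_measurable M" and Tm [measurable]: "T \<in> borel_measurable M"
    and XT: "\<And>z. \<bar>X z\<bar> \<le> 2 * T z" and T: "integrable M (\<lambda>z. exp (T z / 4))" "integral\<^sup>L M (\<lambda>z. exp (T z / 4)) \<le> 2"
    and \<epsilon>: "0 < \<epsilon>" "\<epsilon> \<le> 1" and n: "n \<ge> 1"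
  shows "measure (PiM {..<n} (\<lambda>_. M)) {S \<in> space (PiM {..<n} (\<lambda>_. M)). \<epsilon> \<le> 1 / real n * (\<Sum>i<n. X (S i)) - integral\<^sup>L M X}
     \<le> exp (- real n * \<epsilon>\<^sup>2 / 4096)"
proof -
  interpret M0: prob_space M by (rule M)
  interpret P0: product_prob_space "\<lambda>_::nat. M" "{..<n}" by (intro product_prob_spaceI M)
  \<comment> \<open>The exponent n (1024 \<theta>^2 - \<epsilon> \<theta>) is minimal here, with
    value -n \<epsilon>^2 / 4096. As \<epsilon> \<le> 1, |\<theta> X| stays below T / 8, which
    leaves the other half of the exponential moment for the square of X.\<close>
  define \<theta> where "\<theta> = \<epsilon> / 2048"
  have \<theta>: "0 < \<theta>" "\<theta> \<le> 1/16" using \<epsilon> by (auto simp: \<theta>_def)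
  define m where "m = integral\<^sup>L M X"
  have iX: "integrable M X" using subexp_integrable[OF M Xm Tm XT T] by simp
  have Tn: "0 \<le> T z" for z using XT[of z] by linarith
  have pt: "exp (\<theta> * X z) \<le> 1 + \<theta> * X z + \<theta>\<^sup>2 * 512 * exp (T z / 4)" for z
  proof -
    have "\<bar>\<theta> * X z\<bar> \<le> (1/16) * (2 * T z)" unfolding abs_mult using \<theta> XT[of z] by (intro mult_mono) auto
    then have e: "exp \<bar>\<theta> * X z\<bar> \<le> exp (T z / 8)" by simp
    have "(X z)\<^sup>2 \<le> (2 * T z)\<^sup>2" using XT[of z] by (metis abs_ge_zero power2_abs power_mono)
    also have "\<dots> \<le> 512 * exp (T z / 8)" using square_le_exp[OF Tn, of z] by (simp add: power_mult_distrib)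
    finally have x: "(\<theta> * X z)\<^sup>2 \<le> \<theta>\<^sup>2 * (512 * exp (T z / 8))" by (simp add: power_mult_distrib mult_left_mono)
    have "(\<theta> * X z)\<^sup>2 * exp \<bar>\<theta> * X z\<bar> \<le> \<theta>\<^sup>2 * (512 * exp (T z / 8)) * exp (T z / 8)"
      using x e by (intro mult_mono) auto
    also have "\<dots> = \<theta>\<^sup>2 * 512 * exp (T z / 4)" by (simp add: exp_add[symmetric] mult.assoc)
    finally show ?thesis using exp_quadratic_bound[of "\<theta> * X z"] by linarith
  qed
  have ie: "integrable M (\<lambda>z. exp (\<theta> * X z))"
  proof (rule Bochner_Integration.integrable_bound)
    show "integrable M (\<lambda>z. 1 + \<theta> * X z + \<theta>\<^sup>2 * 512 * exp (T z / 4))" using iX T by simp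
    show "AE z in M. norm (exp (\<theta> * X z)) \<le> norm (1 + \<theta> * X z + \<theta>\<^sup>2 * 512 * exp (T z / 4))"
      using pt by (intro AE_I2) (smt (verit) exp_gt_zero real_norm_def)
  qed measurable
  define g where "g = integral\<^sup>L M (\<lambda>z. exp (\<theta> * X z))"
  have "g \<le> integral\<^sup>L M (\<lambda>z. 1 + \<theta> * X z + \<theta>\<^sup>2 * 512 * exp (T z / 4))"
    unfolding g_def using iX T by (intro integral_mono ie pt) simp
  also have "\<dots> = 1 + \<theta> * m + \<theta>\<^sup>2 * 512 * integral\<^sup>L M (\<lambda>z. exp (T z / 4))"
    unfolding m_def using iX T by (simp add: M0.prob_space)
  also have "\<dots> \<le> 1 + (\<theta> * m + 1024 * \<theta>\<^sup>2)" using T mult_left_mono[OF T(2), of "\<theta>\<^sup>2 * 512"] by simp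
  also have "\<dots> \<le> exp (\<theta> * m + 1024 * \<theta>\<^sup>2)" by (rule exp_ge_add_one_self)
  finally have g: "g \<le> exp (\<theta> * m + 1024 * \<theta>\<^sup>2)" .
  have g0: "0 \<le> g" unfolding g_def by simp
  let ?P = "PiM {..<n} (\<lambda>_. M)"
  define u where "u S = (\<Prod>i<n. exp (\<theta> * X (S i)))" for S
  have iu: "integrable ?P u" unfolding u_def by (intro P0.product_integrable_prod ie) auto
  have u0: "0 \<le> u S" for S unfolding u_def by (intro prod_nonneg) auto
  have eu: "integral\<^sup>L ?P u = g ^ n" unfolding u_def by (subst P0.product_integral_prod) (auto simp: g_def ie)
  define c where "c = exp (real n * \<theta> * (m + \<epsilon>))"
  have eq: "{S \<in> space ?P. \<epsilon> \<le> 1 / real n * (\<Sum>i<n. X (S i)) - m} = {S \<in> space ?P. c \<le> u S}"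
  proof (intro Collect_cong conj_cong refl)
    fix S
    have "u S = exp (\<theta> * (\<Sum>i<n. X (S i)))" unfolding u_def by (simp add: exp_sum sum_distrib_left)
    moreover have "\<epsilon> \<le> 1 / real n * (\<Sum>i<n. X (S i)) - m \<longleftrightarrow> real n * \<theta> * (m + \<epsilon>) \<le> \<theta> * (\<Sum>i<n. X (S i))"
    proof -
      have "\<epsilon> \<le> 1 / real n * (\<Sum>i<n. X (S i)) - m \<longleftrightarrow> real n * (m + \<epsilon>) \<le> (\<Sum>i<n. X (S i))"
        using n by (simp add: field_simps)
      also have "\<dots> \<longleftrightarrow> \<theta> * (real n * (m + \<epsilon>)) \<le> \<theta> * (\<Sum>i<n. X (S i))"
        using \<theta> by (simp only: mult_le_cancel_left_pos)
      finally show ?thesis by (simp only: mult_ac)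
    qed
    ultimately show "\<epsilon> \<le> 1 / real n * (\<Sum>i<n. X (S i)) - m \<longleftrightarrow> c \<le> u S" unfolding c_def by simp
  qed
  have "measure ?P {S \<in> space ?P. c \<le> u S} \<le> integral\<^sup>L ?P u / c"
    by (rule integral_Markov_inequality_measure[where A = "{}"])
       (use iu u0 in \<open>auto simp: c_def\<close>)
  also have "integral\<^sup>L ?P u / c \<le> exp (- real n * \<epsilon>\<^sup>2 / 4096)"
  proof -
    have "g ^ n \<le> exp (\<theta> * m + 1024 * \<theta>\<^sup>2) ^ n" using g g0 by (rule power_mono)
    also have "\<dots> = exp (real n * (\<theta> * m + 1024 * \<theta>\<^sup>2))" by (simp add: exp_of_nat_mult)
    finally have "g ^ n / c \<le> exp (real n * (\<theta> * m + 1024 * \<theta>\<^sup>2)) / c" by (simp add: c_def divide_right_mono)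
    also have "\<dots> = exp (real n * (\<theta> * m + 1024 * \<theta>\<^sup>2) - real n * \<theta> * (m + \<epsilon>))" unfolding c_def by (rule exp_diff[symmetric])
    also have "real n * (\<theta> * m + 1024 * \<theta>\<^sup>2) - real n * \<theta> * (m + \<epsilon>) = - real n * \<epsilon>\<^sup>2 / 4096"
      unfolding \<theta>_def by (simp add: field_simps power2_eq_square)
    finally show ?thesis unfolding eu .
  qed
  finally show ?thesis unfolding eq[symmetric] m_def .
qed

text \<open>A union bound over the family and both signs. The good event is the complement of a
  finite union of measurable sets, hence a measurable witness for
  \<open>prob_at_least\<close>.\<close>

lemma chernoff_family:
  fixes X T :: "'q \<Rightarrow> 'z \<Rightarrow> real"
  assumes M: "prob_space M" and Q: "finite Q"
    and Xm: "\<And>q. q \<in> Q \<Longrightarrow> X q \<in> borel_measurable M" and Tm: "\<And>q. q \<in> Q \<Longrightarrow> T q \<in> borel_measurable M"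
    and XT: "\<And>q z. q \<in> Q \<Longrightarrow> \<bar>X q z\<bar> \<le> 2 * T q z"
    and T: "\<And>q. q \<in> Q \<Longrightarrow> integrable M (\<lambda>z. exp (T q z / 4))" "\<And>q. q \<in> Q \<Longrightarrow> integral\<^sup>L M (\<lambda>z. exp (T q z / 4)) \<le> 2"
    and \<epsilon>: "0 < \<epsilon>" "\<epsilon> \<le> 1" and n: "n \<ge> 1"
  shows "\<exists>A \<in> sets (PiM {..<n} (\<lambda>_. M)). 1 - 2 * real (card Q) * exp (- real n * \<epsilon>\<^sup>2 / 4096) \<le> measure (PiM {..<n} (\<lambda>_. M)) A \<and>
     (\<forall>S\<in>A. \<forall>q\<in>Q. \<bar>1 / real n * (\<Sum>i<n. X q (S i)) - integral\<^sup>L M (X q)\<bar> \<le> \<epsilon>)"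
proof -
  let ?P = "PiM {..<n} (\<lambda>_. M)"
  interpret P: prob_space ?P by (intro prob_space_PiM M)
  define up where "up Y = {S \<in> space ?P. \<epsilon> \<le> 1 / real n * (\<Sum>i<n. Y (S i)) - integral\<^sup>L M Y}" for Y :: "'z \<Rightarrow> real"
  have upm: "up Y \<in> sets ?P" if [measurable]: "Y \<in> borel_measurable M" for Y
  proof -
    have "(\<lambda>S. Y (S i)) \<in> borel_measurable ?P" if "i < n" for i
      using that by (intro measurable_compose[OF measurable_component_singleton]) auto
    then have [measurable]: "(\<lambda>S. \<Sum>i<n. Y (S i)) \<in> borel_measurable ?P" by (intro borel_measurable_sum) auto
    show ?thesis unfolding up_def by measurable
  qed
  define Bad where "Bad = (\<Union>q\<in>Q. up (X q) \<union> up (\<lambda>z. - X q z))"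
  have m: "up (X q) \<in> sets ?P" "up (\<lambda>z. - X q z) \<in> sets ?P" if "q \<in> Q" for q
    using that Xm by (auto intro!: upm)
  have Badm: "Bad \<in> sets ?P" unfolding Bad_def using m Q by auto
  have "measure ?P Bad \<le> (\<Sum>q\<in>Q. measure ?P (up (X q) \<union> up (\<lambda>z. - X q z)))"
    unfolding Bad_def using m Q by (intro P.finite_measure_subadditive_finite) auto
  also have "\<dots> \<le> (\<Sum>q\<in>Q. exp (- real n * \<epsilon>\<^sup>2 / 4096) + exp (- real n * \<epsilon>\<^sup>2 / 4096))"
  proof (intro sum_mono)
    fix q assume q: "q \<in> Q"
    have "measure ?P (up (X q)) \<le> exp (- real n * \<epsilon>\<^sup>2 / 4096)"
      unfolding up_def using q by (intro chernoff_upper[OF M Xm Tm XT T \<epsilon> n])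
    moreover have "measure ?P (up (\<lambda>z. - X q z)) \<le> exp (- real n * \<epsilon>\<^sup>2 / 4096)"
      unfolding up_def using q Xm XT by (intro chernoff_upper[OF M _ Tm _ T \<epsilon> n]) auto
    ultimately show "measure ?P (up (X q) \<union> up (\<lambda>z. - X q z)) \<le> exp (- real n * \<epsilon>\<^sup>2 / 4096) + exp (- real n * \<epsilon>\<^sup>2 / 4096)"
      using measure_Un_le[OF m[OF q]] by linarith
  qed
  also have "\<dots> = 2 * real (card Q) * exp (- real n * \<epsilon>\<^sup>2 / 4096)" by simp
  finally have bad: "measure ?P Bad \<le> 2 * real (card Q) * exp (- real n * \<epsilon>\<^sup>2 / 4096)" .
  show ?thesis
  proof (intro bexI[of _ "space ?P - Bad"] conjI ballI)
    show "1 - 2 * real (card Q) * exp (- real n * \<epsilon>\<^sup>2 / 4096) \<le> measure ?P (space ?P - Bad)"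
      using bad P.prob_compl[OF Badm] by linarith
    fix S q assume "S \<in> space ?P - Bad" and q: "q \<in> Q"
    then have "S \<in> space ?P" "S \<notin> up (X q)" "S \<notin> up (\<lambda>z. - X q z)" by (auto simp: Bad_def)
    then show "\<bar>1 / real n * (\<Sum>i<n. X q (S i)) - integral\<^sup>L M (X q)\<bar> \<le> \<epsilon>"
      by (auto simp: up_def sum_negf)
  qed (use Badm in auto)
qed

subsection \<open>Quadratic forms\<close>

text \<open>On each line u + c w the function is a quadratic polynomial in c whose middle
  coefficient is the polarisation of M. This captures quadratic forms without matrices and passes
  directly to sums and integrals.\<close>

definition qf :: "(('p \<Rightarrow> real) \<Rightarrow> real) \<Rightarrow> bool" where
  "qf M \<longleftrightarrow> (\<forall>u w c. M (\<lambda>a. u a + c * w a) = M u + c * (M (\<lambda>a. u a + w a) - M u - M w) + c\<^sup>2 * M w)"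

lemma qfD: "qf M \<Longrightarrow> M (\<lambda>a. u a + c * w a) = M u + c * (M (\<lambda>a. u a + w a) - M u - M w) + c\<^sup>2 * M w"
  by (simp add: qf_def)

lemma qf_zero: "qf M \<Longrightarrow> M (\<lambda>_. 0) = 0"
  using qfD[of M "\<lambda>_. 0" 2 "\<lambda>_. 0"] by simp

lemma qf_scale: "qf M \<Longrightarrow> M (\<lambda>a. c * w a) = c\<^sup>2 * M w"
  using qfD[of M "\<lambda>_. 0" c w] qf_zero[of M] by simp

lemma qf_square_linear:
  assumes "\<And>u w c. L (\<lambda>a. u a + c * w a) = L u + c * L w" shows "qf (\<lambda>v. (L v)\<^sup>2)"
proof -
  have "L (\<lambda>a. u a + w a) = L u + L w" for u w using assms[of u 1 w] by simp
  then show ?thesis unfolding qf_def assms by (simp add: power2_eq_square algebra_simps)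
qed

lemma qf_cmult:
  assumes "qf M" shows "qf (\<lambda>v. c * M v)"
  unfolding qf_def
proof (intro allI)
  fix u w e
  show "c * M (\<lambda>a. u a + e * w a) = c * M u + e * (c * M (\<lambda>a. u a + w a) - c * M u - c * M w) + e\<^sup>2 * (c * M w)"
    unfolding qfD[OF assms, of u e w] by (simp add: algebra_simps)
qed

lemma qf_add:
  assumes "qf M" "qf N" shows "qf (\<lambda>v. M v + N v)"
  unfolding qf_def
proof (intro allI)
  fix u w e
  show "M (\<lambda>a. u a + e * w a) + N (\<lambda>a. u a + e * w a) = M u + N u +
      e * (M (\<lambda>a. u a + w a) + N (\<lambda>a. u a + w a) - (M u + N u) - (M w + N w)) + e\<^sup>2 * (M w + N w)"
    unfolding qfD[OF assms(1), of u e w] qfD[OF assms(2), of u e w] by (simp add: algebra_simps)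
qed

lemma qf_diff: "qf M \<Longrightarrow> qf N \<Longrightarrow> qf (\<lambda>v. M v - N v)"
  using qf_add[of M "\<lambda>v. -1 * N v"] qf_cmult[of N "-1"] by simp

lemma qf_const_0: "qf (\<lambda>_. 0)"
  by (simp add: qf_def)

lemma qf_sum: "(\<And>i. i \<in> I \<Longrightarrow> qf (M i)) \<Longrightarrow> qf (\<lambda>v. \<Sum>i\<in>I. M i v)"
  by (induction I rule: infinite_finite_induct) (auto intro: qf_add qf_const_0)

lemma qf_integral:
  fixes f :: "'z \<Rightarrow> ('p \<Rightarrow> real) \<Rightarrow> real"
  assumes q: "\<And>z. qf (f z)" and i: "\<And>v. integrable M (\<lambda>z. f z v)"
  shows "qf (\<lambda>v. integral\<^sup>L M (\<lambda>z. f z v))"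
  unfolding qf_def
proof (intro allI)
  fix u w :: "'p \<Rightarrow> real" and c :: real
  show "integral\<^sup>L M (\<lambda>z. f z (\<lambda>a. u a + c * w a)) = integral\<^sup>L M (\<lambda>z. f z u) +
     c * (integral\<^sup>L M (\<lambda>z. f z (\<lambda>a. u a + w a)) - integral\<^sup>L M (\<lambda>z. f z u) - integral\<^sup>L M (\<lambda>z. f z w)) +
     c\<^sup>2 * integral\<^sup>L M (\<lambda>z. f z w)"
    unfolding qfD[OF q, of _ u c w] using i by simp
qed

subsection \<open>Grid nets\<close>

text \<open>The lattice of mesh 1/m in the cube [-1, 1]^J. The value 0 outside J keeps the set
  finite when the index type is infinite.\<close>

definition grid :: "'p set \<Rightarrow> nat \<Rightarrow> ('p \<Rightarrow> real) set" where
  "grid J m = PiE_dflt J 0 (\<lambda>_. (\<lambda>j. real_of_int j / real m) ` {- int m..int m})"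

lemma finite_grid: "finite J \<Longrightarrow> finite (grid J m)"
  unfolding grid_def by (intro finite_PiE_dflt) auto

lemma card_grid_le: "finite J \<Longrightarrow> card (grid J m) \<le> (2 * m + 1) ^ card J"
proof -
  assume J: "finite J"
  have "card (grid J m) = (\<Prod>a\<in>J. card ((\<lambda>j. real_of_int j / real m) ` {- int m..int m}))"
    unfolding grid_def by (intro card_PiE_dflt J) auto
  also have "\<dots> \<le> (\<Prod>a\<in>J. 2 * m + 1)"
  proof (intro prod_mono conjI)
    have "card ((\<lambda>j. real_of_int j / real m) ` {- int m..int m}) \<le> card {- int m..int m}" by (rule card_image_le) simp
    then show "card ((\<lambda>j. real_of_int j / real m) ` {- int m..int m}) \<le> 2 * m + 1" by simp
  qed simp
  finally show ?thesis by simp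
qed

lemma grid_approx:
  assumes J: "finite J" and v: "(\<Sum>a\<in>J. (v a)\<^sup>2) \<le> 1" and m: "m \<ge> 1"
  shows "\<exists>v'\<in>grid J m. (\<Sum>a\<in>J. (v' a)\<^sup>2) \<le> 1 \<and> (\<Sum>a\<in>J. (v a - v' a)\<^sup>2) \<le> real (card J) / (real m)\<^sup>2"
proof -
  \<comment> \<open>rounding towards zero keeps the grid point inside the unit ball\<close>
  define tr where "tr t = (if t \<ge> 0 then \<lfloor>real m * t\<rfloor> else \<lceil>real m * t\<rceil>)" for t :: real
  define rd where "rd t = real_of_int (tr t) / real m" for t
  have mp: "real m > 0" using m by simp
  have abs_rd: "\<bar>rd t\<bar> \<le> \<bar>t\<bar>" for t
  proof (cases "t \<ge> 0")
    case True
    then have "0 \<le> \<lfloor>real m * t\<rfloor>" "real_of_int \<lfloor>real m * t\<rfloor> \<le> real m * t" using mp by auto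
    then show ?thesis using True mp unfolding rd_def tr_def by (simp add: field_simps)
  next
    case False
    then have "real m * t \<le> 0" using mp by (simp add: mult_le_0_iff)
    then have "\<lceil>real m * t\<rceil> \<le> 0" "real m * t \<le> real_of_int \<lceil>real m * t\<rceil>" by (auto simp: ceiling_le_zero)
    then show ?thesis using False mp unfolding rd_def tr_def by (simp add: field_simps abs_of_nonpos)
  qed
  have err: "(t - rd t)\<^sup>2 \<le> 1 / (real m)\<^sup>2" for t
  proof -
    have "\<bar>real m * t - real_of_int (tr t)\<bar> \<le> 1" unfolding tr_def by (auto; linarith)
    moreover have "t - rd t = (real m * t - real_of_int (tr t)) / real m" unfolding rd_def using mp by (simp add: field_simps)
    then have "\<bar>t - rd t\<bar> = \<bar>real m * t - real_of_int (tr t)\<bar> / real m" using mp by simp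
    ultimately have "\<bar>t - rd t\<bar> \<le> 1 / real m" by (simp add: divide_right_mono)
    then have "\<bar>t - rd t\<bar>\<^sup>2 \<le> (1 / real m)\<^sup>2" by (intro power_mono) auto
    then show ?thesis by (simp add: power_divide)
  qed
  define v' where "v' a = (if a \<in> J then rd (v a) else 0)" for a
  have va: "\<bar>v a\<bar> \<le> 1" if "a \<in> J" for a
  proof -
    have "(v a)\<^sup>2 \<le> (\<Sum>a\<in>J. (v a)\<^sup>2)" using that J by (intro member_le_sum) auto
    then show ?thesis using v by (simp add: abs_square_le_1[symmetric])
  qed
  have "rd (v a) \<in> (\<lambda>j. real_of_int j / real m) ` {- int m..int m}" if "a \<in> J" for a
  proof -
    have "\<bar>real_of_int (tr (v a))\<bar> \<le> real m * \<bar>v a\<bar>"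
      using abs_rd[of "v a"] mp unfolding rd_def by (simp add: field_simps)
    moreover have "real m * \<bar>v a\<bar> \<le> real m * 1" by (rule mult_left_mono[OF va[OF that]]) simp
    ultimately have "\<bar>real_of_int (tr (v a))\<bar> \<le> real m" by linarith
    then have "tr (v a) \<in> {- int m..int m}" by auto
    then show ?thesis unfolding rd_def by blast
  qed
  then have "v' \<in> grid J m" unfolding grid_def PiE_dflt_def v'_def by auto
  moreover have "(\<Sum>a\<in>J. (v' a)\<^sup>2) \<le> (\<Sum>a\<in>J. (v a)\<^sup>2)"
    using abs_rd by (intro sum_mono) (auto simp: v'_def abs_le_square_iff[symmetric])
  moreover have "(\<Sum>a\<in>J. (v a - v' a)\<^sup>2) \<le> (\<Sum>a\<in>J. 1 / (real m)\<^sup>2)"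
    using err by (intro sum_mono) (auto simp: v'_def)
  ultimately show ?thesis using v by (intro bexI[of _ v']) auto
qed

text \<open>Self-bounding: let N be the supremum of |M| over the unit ball, finite by B. Each v
  there is v' + w / 8 with v' in the grid and w in the ball, because the squared rounding error is
  at most 1 / (64 card J). Then M v = M v' + P / 8 + M w / 64 with |P| \<le> 4 N by polarisation, so
  N \<le> \<epsilon> + 33/64 N and N \<le> 3 \<epsilon>.\<close>

lemma qf_net_bound:
  assumes J: "finite J" "J \<noteq> {}" and M: "qf M"
    and B: "\<And>v. (\<Sum>a\<in>J. (v a)\<^sup>2) \<le> 1 \<Longrightarrow> \<bar>M v\<bar> \<le> B"
    and net: "\<And>v. v \<in> grid J (8 * card J) \<Longrightarrow> (\<Sum>a\<in>J. (v a)\<^sup>2) \<le> 1 \<Longrightarrow> \<bar>M v\<bar> \<le> \<epsilon>"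
  shows "\<bar>M v\<bar> \<le> 3 * \<epsilon> * (\<Sum>a\<in>J. (v a)\<^sup>2)"
proof -
  define nn where "nn v = (\<Sum>a\<in>J. (v a)\<^sup>2)" for v :: "'a \<Rightarrow> real"
  have nn_scale: "nn (\<lambda>a. c * v a) = c\<^sup>2 * nn v" for c v by (simp add: nn_def power_mult_distrib sum_distrib_left)
  have nn0: "0 \<le> nn v" for v by (simp add: nn_def sum_nonneg)
  have nn_add: "nn (\<lambda>a. u a + w a) \<le> 2 * nn u + 2 * nn w" for u w
  proof -
    have "(x + y)\<^sup>2 \<le> 2 * x\<^sup>2 + 2 * y\<^sup>2" for x y :: real
      using sum_squares_bound[of x y] by (simp add: power2_sum)
    then show ?thesis unfolding nn_def sum_distrib_left sum.distrib[symmetric] by (intro sum_mono)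
  qed
  define N where "N = (SUP v\<in>{v. nn v \<le> 1}. \<bar>M v\<bar>)"
  have bdd: "bdd_above ((\<lambda>v. \<bar>M v\<bar>) ` {v. nn v \<le> 1})"
    by (rule bdd_aboveI[of _ B]) (use B nn_def in auto)
  have N: "\<bar>M v\<bar> \<le> N" if "nn v \<le> 1" for v
    unfolding N_def using that bdd by (intro cSUP_upper) auto
  have N4: "\<bar>M v\<bar> \<le> 4 * N" if "nn v \<le> 4" for v
  proof -
    have "nn (\<lambda>a. (1/2) * v a) \<le> 1" unfolding nn_scale using that by (simp add: power2_eq_square)
    from N[OF this] show ?thesis unfolding qf_scale[OF M] by (simp add: power2_eq_square)
  qed
  have p: "card J \<ge> 1" using J by (simp add: Suc_le_eq card_gt_0_iff)
  have step: "\<bar>M v\<bar> \<le> \<epsilon> + 33 / 64 * N" if v: "nn v \<le> 1" for v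
  proof -
    obtain v' where v': "v' \<in> grid J (8 * card J)" "nn v' \<le> 1" "(\<Sum>a\<in>J. (v a - v' a)\<^sup>2) \<le> real (card J) / (real (8 * card J))\<^sup>2"
      using grid_approx[OF J(1), of v "8 * card J"] v p unfolding nn_def by auto
    define w where "w = (\<lambda>a. 8 * (v a - v' a))"
    have "nn w = 64 * (\<Sum>a\<in>J. (v a - v' a)\<^sup>2)" unfolding w_def nn_scale by (simp add: nn_def)
    also have "\<dots> \<le> 64 * (real (card J) / (real (8 * card J))\<^sup>2)" using v'(3) by simp
    also have "\<dots> = 1 / real (card J)" using p by (simp add: power2_eq_square)
    also have "\<dots> \<le> 1" using p by simp
    finally have w: "nn w \<le> 1" .
    have wm: "nn (\<lambda>a. (-1) * w a) \<le> 1" unfolding nn_scale using w by simp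
    define P where "P = M (\<lambda>a. v' a + w a) - M v' - M w"
    have e1: "M v = M v' + (1/8) * P + (1/8)\<^sup>2 * M w"
    proof -
      have "v = (\<lambda>a. v' a + (1/8) * w a)" by (simp add: w_def fun_eq_iff diff_divide_distrib)
      then have "M v = M (\<lambda>a. v' a + (1/8) * w a)" by (rule arg_cong)
      then show ?thesis unfolding qfD[OF M, of v' "1/8" w] P_def .
    qed
    have e2: "M (\<lambda>a. v' a + (-1) * w a) = M v' - P + M w"
      using qfD[OF M, of v' "-1" w] unfolding P_def by simp
    have "\<bar>M (\<lambda>a. v' a + w a)\<bar> \<le> 4 * N" using nn_add[of v' w] v'(2) w by (intro N4) linarith
    moreover have "\<bar>M (\<lambda>a. v' a + (-1) * w a)\<bar> \<le> 4 * N"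
      using nn_add[of v' "\<lambda>a. (-1) * w a"] v'(2) wm by (intro N4) linarith
    moreover have "2 * P = M (\<lambda>a. v' a + w a) - M (\<lambda>a. v' a + (-1) * w a)" unfolding e2 P_def by simp
    ultimately have "\<bar>P\<bar> \<le> 4 * N" by linarith
    moreover have "\<bar>M w\<bar> \<le> N" by (rule N[OF w])
    moreover have "\<bar>M v'\<bar> \<le> \<epsilon>" using net[OF v'(1)] v'(2) unfolding nn_def by blast
    ultimately show ?thesis using e1 unfolding power2_eq_square by linarith
  qed
  have "(SUP v\<in>{v. nn v \<le> 1}. \<bar>M v\<bar>) \<le> \<epsilon> + 33 / 64 * N"
  proof (rule cSUP_least)
    have "(\<lambda>_. 0) \<in> {v. nn v \<le> 1}" by (simp add: nn_def)
    then show "{v. nn v \<le> 1} \<noteq> {}" by blast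
  qed (use step in auto)
  then have "N \<le> \<epsilon> + 33 / 64 * N" unfolding N_def[symmetric] .
  moreover have "0 \<le> N" using N[of "\<lambda>_. 0"] by (simp add: nn_def)
  ultimately have N3: "N \<le> 3 * \<epsilon>" by linarith
  have "\<bar>M v\<bar> \<le> 3 * \<epsilon> * nn v"
  proof (cases "nn v = 0")
    \<comment> \<open>Here v vanishes on J but may be nonzero elsewhere. All multiples of v stay in
      the ball, so boundedness forces M v = 0.\<close>
    case True
    have b: "c\<^sup>2 * \<bar>M v\<bar> \<le> N" for c
      using N[of "\<lambda>a. c * v a"] True unfolding nn_scale qf_scale[OF M] by (simp add: abs_mult)
    have "M v = 0"
    proof (rule ccontr)
      assume "M v \<noteq> 0"
      then have "(sqrt ((N + 1) / \<bar>M v\<bar>))\<^sup>2 * \<bar>M v\<bar> = N + 1" using \<open>0 \<le> N\<close> by simp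
      then show False using b[of "sqrt ((N + 1) / \<bar>M v\<bar>)"] by linarith
    qed
    then show ?thesis using True by simp
  next
    case False
    then have pos: "0 < nn v" using nn0[of v] by linarith
    have "nn (\<lambda>a. (1 / sqrt (nn v)) * v a) \<le> 1" unfolding nn_scale using pos by (simp add: power_divide)
    from N[OF this] have "\<bar>M v\<bar> / nn v \<le> N" unfolding qf_scale[OF M] using pos by (simp add: power_divide abs_mult)
    then have "\<bar>M v\<bar> \<le> N * nn v" using pos by (simp add: field_simps)
    also have "\<dots> \<le> 3 * \<epsilon> * nn v" using N3 pos by (intro mult_right_mono) auto
    finally show ?thesis .
  qed
  then show ?thesis unfolding nn_def .
qed

text \<open>Chernoff bounds for all pairs of a parameter and a grid direction, extended to all
  directions by \<open>qf_net_bound\<close>. The sample-dependent bound from \<open>Tb\<close> has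
  only to make the supremum there finite.\<close>

lemma qf_concentration:
  fixes q :: "'t \<Rightarrow> 'z \<Rightarrow> ('p \<Rightarrow> real) \<Rightarrow> real" and T :: "'z \<Rightarrow> ('p \<Rightarrow> real) \<Rightarrow> real"
  assumes M: "prob_space M" and \<Theta>: "finite \<Theta>" and J: "finite J" "J \<noteq> {}"
    and q: "\<And>\<theta> z. \<theta> \<in> \<Theta> \<Longrightarrow> qf (q \<theta> z)"
    and qm: "\<And>\<theta> v. \<theta> \<in> \<Theta> \<Longrightarrow> (\<lambda>z. q \<theta> z v) \<in> borel_measurable M"
    and Tm: "\<And>v. (\<lambda>z. T z v) \<in> borel_measurable M"
    and qT: "\<And>\<theta> z v. \<theta> \<in> \<Theta> \<Longrightarrow> \<bar>q \<theta> z v\<bar> \<le> 2 * T z v"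
    and Ti: "\<And>v. (\<Sum>a\<in>J. (v a)\<^sup>2) \<le> 1 \<Longrightarrow> integrable M (\<lambda>z. exp (T z v / 4))"
      "\<And>v. (\<Sum>a\<in>J. (v a)\<^sup>2) \<le> 1 \<Longrightarrow> integral\<^sup>L M (\<lambda>z. exp (T z v / 4)) \<le> 2"
    and qi: "\<And>\<theta> v. \<theta> \<in> \<Theta> \<Longrightarrow> integrable M (\<lambda>z. q \<theta> z v)"
    and Tb: "\<And>z. \<exists>b. \<forall>v. (\<Sum>a\<in>J. (v a)\<^sup>2) \<le> 1 \<longrightarrow> T z v \<le> b"
    and \<epsilon>: "0 < \<epsilon>" "\<epsilon> \<le> 1" and n: "n \<ge> 1"
  shows "\<exists>A \<in> sets (PiM {..<n} (\<lambda>_. M)).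
      1 - 2 * (real (card \<Theta>) * real ((16 * card J + 1) ^ card J)) * exp (- real n * \<epsilon>\<^sup>2 / 4096) \<le> measure (PiM {..<n} (\<lambda>_. M)) A \<and>
     (\<forall>S\<in>A. \<forall>\<theta>\<in>\<Theta>. \<forall>v. \<bar>1 / real n * (\<Sum>i<n. q \<theta> (S i) v) - integral\<^sup>L M (\<lambda>z. q \<theta> z v)\<bar> \<le> 3 * \<epsilon> * (\<Sum>a\<in>J. (v a)\<^sup>2))"
proof -
  define G where "G = {v \<in> grid J (8 * card J). (\<Sum>a\<in>J. (v a)\<^sup>2) \<le> 1}"
  have G: "finite G" "card G \<le> (16 * card J + 1) ^ card J"
  proof -
    show "finite G" unfolding G_def using finite_grid[OF J(1)] by simp
    have "card G \<le> card (grid J (8 * card J))" unfolding G_def by (intro card_mono finite_grid[OF J(1)]) auto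
    then show "card G \<le> (16 * card J + 1) ^ card J" using card_grid_le[OF J(1), of "8 * card J"] by simp
  qed
  have "\<exists>A \<in> sets (PiM {..<n} (\<lambda>_. M)).
     1 - 2 * real (card (\<Theta> \<times> G)) * exp (- real n * \<epsilon>\<^sup>2 / 4096) \<le> measure (PiM {..<n} (\<lambda>_. M)) A \<and>
     (\<forall>S\<in>A. \<forall>p\<in>\<Theta> \<times> G. \<bar>1 / real n * (\<Sum>i<n. q (fst p) (S i) (snd p)) - integral\<^sup>L M (\<lambda>z. q (fst p) z (snd p))\<bar> \<le> \<epsilon>)"
  proof (rule chernoff_family[OF M _ _ _ _ _ _ \<epsilon> n, where T = "\<lambda>p z. T z (snd p)"])
    show "finite (\<Theta> \<times> G)" using \<Theta> G by simp
    fix p assume "p \<in> \<Theta> \<times> G"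
    then have p: "fst p \<in> \<Theta>" "(\<Sum>a\<in>J. (snd p a)\<^sup>2) \<le> 1" by (auto simp: G_def)
    show "(\<lambda>z. q (fst p) z (snd p)) \<in> borel_measurable M" by (rule qm[OF p(1)])
    show "(\<lambda>z. T z (snd p)) \<in> borel_measurable M" by (rule Tm)
    show "\<bar>q (fst p) z (snd p)\<bar> \<le> 2 * T z (snd p)" for z by (rule qT[OF p(1)])
    show "integrable M (\<lambda>z. exp (T z (snd p) / 4))" by (rule Ti(1)[OF p(2)])
    show "integral\<^sup>L M (\<lambda>z. exp (T z (snd p) / 4)) \<le> 2" by (rule Ti(2)[OF p(2)])
  qed
  then obtain A where A: "A \<in> sets (PiM {..<n} (\<lambda>_. M))"
    "1 - 2 * real (card (\<Theta> \<times> G)) * exp (- real n * \<epsilon>\<^sup>2 / 4096) \<le> measure (PiM {..<n} (\<lambda>_. M)) A"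
    "\<And>S p. S \<in> A \<Longrightarrow> p \<in> \<Theta> \<times> G \<Longrightarrow> \<bar>1 / real n * (\<Sum>i<n. q (fst p) (S i) (snd p)) - integral\<^sup>L M (\<lambda>z. q (fst p) z (snd p))\<bar> \<le> \<epsilon>"
    by blast
  show ?thesis
  proof (intro bexI[OF _ A(1)] conjI ballI allI)
    have "real (card (\<Theta> \<times> G)) \<le> real (card \<Theta>) * real ((16 * card J + 1) ^ card J)"
      unfolding card_cartesian_product of_nat_mult using G(2) by (intro mult_left_mono) (simp_all only: of_nat_le_iff of_nat_0_le_iff)
    then have "2 * real (card (\<Theta> \<times> G)) * exp (- real n * \<epsilon>\<^sup>2 / 4096)
      \<le> 2 * (real (card \<Theta>) * real ((16 * card J + 1) ^ card J)) * exp (- real n * \<epsilon>\<^sup>2 / 4096)"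
      by (intro mult_right_mono) auto
    then show "1 - 2 * (real (card \<Theta>) * real ((16 * card J + 1) ^ card J)) * exp (- real n * \<epsilon>\<^sup>2 / 4096) \<le> measure (PiM {..<n} (\<lambda>_. M)) A"
      using A(2) by linarith
    fix S \<theta> v assume S: "S \<in> A" and \<theta>: "\<theta> \<in> \<Theta>"
    define D where "D v = 1 / real n * (\<Sum>i<n. q \<theta> (S i) v) - integral\<^sup>L M (\<lambda>z. q \<theta> z v)" for v
    obtain b where b: "\<And>z v. (\<Sum>a\<in>J. (v a)\<^sup>2) \<le> 1 \<Longrightarrow> T z v \<le> b z" using Tb by metis
    have "\<bar>D v\<bar> \<le> 3 * \<epsilon> * (\<Sum>a\<in>J. (v a)\<^sup>2)"
    proof (rule qf_net_bound[OF J])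
      have "qf (\<lambda>v. integral\<^sup>L M (\<lambda>z. (if \<theta> \<in> \<Theta> then q \<theta> z else (\<lambda>_. 0)) v))"
        using q \<theta> qi by (intro qf_integral) auto
      then show "qf D" unfolding D_def using q \<theta>
        by (intro qf_diff qf_cmult qf_sum) auto
      show "\<bar>D v\<bar> \<le> 1 / real n * (\<Sum>i<n. 2 * b (S i)) + 16" if v: "(\<Sum>a\<in>J. (v a)\<^sup>2) \<le> 1" for v
      proof -
        have qb: "\<bar>q \<theta> z v\<bar> \<le> 2 * b z" for z using qT[OF \<theta>, of z v] b[OF v, of z] by linarith
        have "\<bar>1 / real n * (\<Sum>i<n. q \<theta> (S i) v)\<bar> \<le> 1 / real n * (\<Sum>i<n. 2 * b (S i))"
          unfolding abs_mult using qb by (intro mult_mono order_trans[OF sum_abs] sum_mono) auto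
        moreover have "\<bar>integral\<^sup>L M (\<lambda>z. q \<theta> z v)\<bar> \<le> 16"
          by (rule subexp_integrable(2)[OF M qm[OF \<theta>] Tm qT[OF \<theta>] Ti[OF v]])
        ultimately show ?thesis unfolding D_def by linarith
      qed
      show "\<bar>D v\<bar> \<le> \<epsilon>" if "v \<in> grid J (8 * card J)" "(\<Sum>a\<in>J. (v a)\<^sup>2) \<le> 1" for v
        using A(3)[OF S, of "(\<theta>, v)"] \<theta> that unfolding D_def G_def by simp
    qed
    then show "\<bar>1 / real n * (\<Sum>i<n. q \<theta> (S i) v) - integral\<^sup>L M (\<lambda>z. q \<theta> z v)\<bar> \<le> 3 * \<epsilon> * (\<Sum>a\<in>J. (v a)\<^sup>2)"
      unfolding D_def .
  qed
qed

section \<open>Uniform control of the empirical Hessian near the true parameter\<close>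

lemma pre_lin: "pre d (\<lambda>a. u a + c * w a) x k = pre d u x k + c * pre d w x k"
  by (simp add: pre_add pre_scale)

lemma qf_sqs: "qf (\<lambda>V. sqs d K V x)"
  unfolding sqs_def by (intro qf_sum qf_square_linear pre_lin)

lemma qf_lossq: "qf (\<lambda>V. lossq K s y (pre d V x))"
proof -
  define s' where "s' k = (if y then s k else - s k)" for k
  define D where "D = (\<Sum>k<K. sigmoid (s' k))"
  have "lossq K s y (pre d V x) = ((\<Sum>k<K. dsig 1 (s' k) * pre d V x k) / D)\<^sup>2
      - (\<Sum>k<K. (dsig 2 (s' k) / D) * (pre d V x k)\<^sup>2)" for V
    unfolding lossq_def lossq1_def s'_def D_def by (simp add: sum_divide_distrib)
  moreover have "qf (\<lambda>V. ((\<Sum>k<K. dsig 1 (s' k) * pre d V x k) / D)\<^sup>2)"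
    by (rule qf_square_linear)
       (simp add: pre_lin algebra_simps sum.distrib add_divide_distrib sum_distrib_left)
  moreover have "qf (\<lambda>V. (\<Sum>k<K. (dsig 2 (s' k) / D) * (pre d V x k)\<^sup>2))"
    by (intro qf_sum qf_cmult qf_square_linear pre_lin)
  ultimately show ?thesis by (simp add: qf_diff)
qed

text \<open>The value at V of the quadratic form of the empirical Hessian at W
  (\<open>hessian_quad_fcn\<close>).\<close>

definition avg_hess :: "nat \<Rightarrow> nat \<Rightarrow> nat \<Rightarrow> (nat \<Rightarrow> (nat \<Rightarrow> real) \<times> bool) \<Rightarrow> (nat \<times> nat \<Rightarrow> real) \<Rightarrow> (nat \<times> nat \<Rightarrow> real) \<Rightarrow> real" where
  "avg_hess d K n S W V = 1 / real n * (\<Sum>i<n. lossq K (pre d W (fst (S i))) (snd (S i)) (pre d V (fst (S i))))"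

lemma qf_avg_hess: "qf (avg_hess d K n S W)"
  unfolding avg_hess_def[abs_def] by (intro qf_cmult qf_sum qf_lossq)

lemma abs_pre_le: "\<bar>pre d V x k\<bar> \<le> sqrt (dot d (wcol V k) (wcol V k)) * sqrt (dot d x x)"
  unfolding pre_def by (rule abs_dot_le)

lemma sqs_le: "sqs d K V x \<le> fro2 d K V * dot d x x"
proof -
  have "(pre d V x k)\<^sup>2 \<le> dot d (wcol V k) (wcol V k) * dot d x x" for k
    using power_mono[OF abs_pre_le[of d V x k] abs_ge_zero, of 2]
    by (simp add: power_mult_distrib dot_self_nonneg)
  then show ?thesis unfolding sqs_def fro2_col sum_distrib_right by (intro sum_mono)
qed

text \<open>Controls the mean error of rounding W to a net, where the Lipschitz constant of the
  Hessian grows with |x|. Linear growth in d is harmless because the net is polynomially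
  fine.\<close>

lemma integral_norm_sqs_le:
  assumes V: "fro2 d K V \<le> 1" and d: "d \<ge> 1"
  shows "integral\<^sup>L (gauss_vec d) (\<lambda>x. (1 + dot d x x) * sqs d K V x) \<le> 72 * real d"
proof -
  define e where "e i = (\<lambda>j. if j = i then 1 else 0 :: real)" for i :: nat
  have e: "dot d (e i) x = x i" if "i < d" for i x
  proof -
    have "dot d (e i) x = (\<Sum>j<d. if j = i then x j else 0)" unfolding dot_def e_def by (intro sum.cong) auto
    then show ?thesis using that by simp
  qed
  have ee: "dot d (e i) (e i) \<le> 1" if "i < d" for i
    unfolding e[OF that] by (simp add: e_def)
  have sq: "y\<^sup>2 \<le> 32 * exp (y / 4)" if "0 \<le> y" for y :: real
    using exp_lower_Taylor_quadratic[of "y / 4"] that by (simp add: power_divide)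
  have pt: "(1 + dot d x x) * sqs d K V x \<le> 4 * exp (sqs d K V x / 4) + (\<Sum>i<d. 16 * (exp ((dot d (e i) x)\<^sup>2 / 4) + exp (sqs d K V x / 4)))" for x
  proof -
    have S: "0 \<le> sqs d K V x" by (rule sqs_nonneg)
    have "sqs d K V x \<le> 4 * exp (sqs d K V x / 4)" using exp_ge_add_one_self[of "sqs d K V x / 4"] by linarith
    moreover have "dot d x x * sqs d K V x \<le> (\<Sum>i<d. 16 * (exp ((dot d (e i) x)\<^sup>2 / 4) + exp (sqs d K V x / 4)))"
      unfolding dot_self sum_distrib_right
    proof (intro sum_mono)
      fix i assume "i \<in> {..<d}"
      then have ei: "dot d (e i) x = x i" by (simp add: e)
      have "2 * (x i)\<^sup>2 * sqs d K V x \<le> 32 * exp ((x i)\<^sup>2 / 4) + 32 * exp (sqs d K V x / 4)"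
        using sum_squares_bound[of "(x i)\<^sup>2" "sqs d K V x"] add_mono[OF sq[of "(x i)\<^sup>2"] sq[OF S]]
        by (meson order_trans zero_le_power2)
      then show "(x i)\<^sup>2 * sqs d K V x \<le> 16 * (exp ((dot d (e i) x)\<^sup>2 / 4) + exp (sqs d K V x / 4))"
        unfolding ei by simp
    qed
    ultimately show ?thesis by (simp add: distrib_right)
  qed
  have iS: "integrable (gauss_vec d) (\<lambda>x. exp (sqs d K V x / 4))" "integral\<^sup>L (gauss_vec d) (\<lambda>x. exp (sqs d K V x / 4)) \<le> 2"
    using gauss_vec_exp_sqs[OF V] by auto
  have iE: "integrable (gauss_vec d) (\<lambda>x. exp ((dot d (e i) x)\<^sup>2 / 4))"
     "integral\<^sup>L (gauss_vec d) (\<lambda>x. exp ((dot d (e i) x)\<^sup>2 / 4)) \<le> 2" if "i < d" for i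
    using gauss_vec_exp_square[OF ee[OF that]] by auto
  have "(\<lambda>x. dot d x x) = (\<lambda>x. \<Sum>i<d. (x i)\<^sup>2)" by (simp add: dot_self)
  then have "expgrow d (\<lambda>x. dot d x x)" "(\<lambda>x. dot d x x) \<in> borel_measurable (gauss_vec d)"
    by (auto intro!: expgrow_sum expgrow_power expgrow_component)
  then have i0: "integrable (gauss_vec d) (\<lambda>x. (1 + dot d x x) * sqs d K V x)"
    by (intro expgrow_integrable expgrow_mult expgrow_add) auto
  have "integral\<^sup>L (gauss_vec d) (\<lambda>x. (1 + dot d x x) * sqs d K V x) \<le>
    integral\<^sup>L (gauss_vec d) (\<lambda>x. 4 * exp (sqs d K V x / 4) + (\<Sum>i<d. 16 * (exp ((dot d (e i) x)\<^sup>2 / 4) + exp (sqs d K V x / 4))))"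
    using iS iE pt
    by (intro integral_mono i0 Bochner_Integration.integrable_add Bochner_Integration.integrable_sum integrable_mult_right) auto
  also have "\<dots> = 4 * integral\<^sup>L (gauss_vec d) (\<lambda>x. exp (sqs d K V x / 4)) +
     (\<Sum>i<d. 16 * (integral\<^sup>L (gauss_vec d) (\<lambda>x. exp ((dot d (e i) x)\<^sup>2 / 4)) + integral\<^sup>L (gauss_vec d) (\<lambda>x. exp (sqs d K V x / 4))))"
  proof -
    define T where "T i x = 16 * (exp ((dot d (e i) x)\<^sup>2 / 4) + exp (sqs d K V x / 4))" for i x
    have iT: "integrable (gauss_vec d) (T i)" if "i < d" for i
      unfolding T_def[abs_def] using iS(1) iE(1)[OF that] by (intro integrable_mult_right Bochner_Integration.integrable_add)
    have eT: "integral\<^sup>L (gauss_vec d) (T i)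
       = 16 * (integral\<^sup>L (gauss_vec d) (\<lambda>x. exp ((dot d (e i) x)\<^sup>2 / 4)) + integral\<^sup>L (gauss_vec d) (\<lambda>x. exp (sqs d K V x / 4)))" if "i < d" for i
      unfolding T_def[abs_def] using iS(1) iE(1)[OF that] by simp
    have sT: "integral\<^sup>L (gauss_vec d) (\<lambda>x. \<Sum>i<d. T i x) = (\<Sum>i<d. integral\<^sup>L (gauss_vec d) (T i))"
      by (rule Bochner_Integration.integral_sum) (simp add: iT)
    have "integrable (gauss_vec d) (\<lambda>x. \<Sum>i<d. T i x)"
      by (rule Bochner_Integration.integrable_sum) (simp add: iT)
    then have "integral\<^sup>L (gauss_vec d) (\<lambda>x. 4 * exp (sqs d K V x / 4) + (\<Sum>i<d. T i x))
       = 4 * integral\<^sup>L (gauss_vec d) (\<lambda>x. exp (sqs d K V x / 4)) + (\<Sum>i<d. integral\<^sup>L (gauss_vec d) (T i))"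
      using iS(1) sT by (subst Bochner_Integration.integral_add) auto
    then show ?thesis by (simp add: eT T_def del: distrib_left_numeral)
  qed
  also have "\<dots> \<le> 4 * 2 + (\<Sum>i<d. 16 * (2 + 2))"
    using iS iE by (intro add_mono mult_left_mono sum_mono) auto
  also have "\<dots> \<le> 72 * real d" using d by simp
  finally show ?thesis .
qed

text \<open>163840000000 is 40 * 4096 * 10^6. With \<epsilon> of order tau / K^2 the hypothesis on n
  makes the Chernoff exponent at least 40 p ln^2 d; of K^5, four powers pay for \<epsilon>^2 and one
  for the dimension p = d K. The number of events, with the factor 2, is at most d^(2 + 14 p), from
  51 p^4 \<le> d^14, where K \<le> d enters. Finally 12 + 14 p \<le> 20 p \<le> 40 p ln d because ln
  d \<ge> 1/2.\<close>

lemma union_bound_numeric: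
  fixes d K n :: nat and \<tau> :: real
  assumes d: "d \<ge> 2" and K: "K \<ge> 1" "K \<le> d" and \<tau>: "0 < \<tau>"
    and n: "real n \<ge> 163840000000 * real d * real K ^ 5 * (ln (real d))\<^sup>2 / \<tau>\<^sup>2"
  defines "p \<equiv> d * K" and "\<epsilon> \<equiv> \<tau> / (1000 * (real K)\<^sup>2)"
  shows "2 * ((real ((2 * p ^ 3 + 1) ^ p) + 2) * real ((16 * p + 1) ^ p)) * exp (- real n * \<epsilon>\<^sup>2 / 4096) \<le> real d powr (-10)"
proof -
  have p2: "2 \<le> p" using d K unfolding p_def by (metis mult_le_mono mult.right_neutral)
  have pd: "p \<le> d ^ 2" using K unfolding p_def by (simp add: power2_eq_square)
  have d0: "0 < real d" and ln0: "0 < ln (real d)" using d by auto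
  have ln2: "1 / 2 \<le> ln (real d)"
  proof -
    have "exp (1/2 :: real) ^ 2 = exp 1" by (simp add: exp_of_nat_mult[symmetric])
    moreover have "exp 1 \<le> (2 ^ 2 :: real)" using exp_le by simp
    ultimately have "exp (1/2 :: real) ^ 2 \<le> 2 ^ 2" by (simp only:)
    then have "exp (1/2 :: real) \<le> 2" by (rule power2_le_imp_le) simp
    then have "exp (1/2) \<le> real d" using d by linarith
    then show ?thesis by (simp only: ln_ge_iff[OF d0])
  qed
  have K0: "0 < real K" using K by simp
  have e1: "real n * \<epsilon>\<^sup>2 / 4096 \<ge> 40 * real p * (ln (real d))\<^sup>2"
  proof -
    have "40 * real p * (ln (real d))\<^sup>2 = (163840000000 * real d * real K ^ 5 * (ln (real d))\<^sup>2 / \<tau>\<^sup>2) * (\<epsilon>\<^sup>2 / 4096)"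
    proof -
      have "\<epsilon>\<^sup>2 = \<tau>\<^sup>2 / (1000000 * real K ^ 4)"
        unfolding \<epsilon>_def by (simp add: power_divide power_mult_distrib)
      moreover have "real K ^ 5 = real K ^ 4 * real K" by (simp add: power_Suc2[symmetric])
      moreover have "163840000000 * x * (y * z) * u / t * (t / (1000000 * y) / 4096) = 40 * (x * z) * u"
        if "y \<noteq> 0" "t \<noteq> 0" for x y z t u :: real
        using that by (simp add: field_simps)
      ultimately show ?thesis using K0 \<tau> unfolding p_def by simp
    qed
    also have "\<dots> \<le> real n * (\<epsilon>\<^sup>2 / 4096)" using n by (intro mult_right_mono) auto
    finally show ?thesis by simp
  qed
  have e2: "40 * real p * (ln (real d))\<^sup>2 \<ge> (12 + 14 * real p) * ln (real d)"
  proof -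
    have "12 + 14 * real p \<le> 20 * real p" using p2 by simp
    also have "\<dots> \<le> 40 * real p * ln (real d)" using mult_left_mono[OF ln2, of "40 * real p"] by simp
    finally have "(12 + 14 * real p) * ln (real d) \<le> (40 * real p * ln (real d)) * ln (real d)"
      using ln0 by (intro mult_right_mono) auto
    then show ?thesis by (simp add: power2_eq_square mult.assoc)
  qed
  have cnt: "2 * ((real ((2 * p ^ 3 + 1) ^ p) + 2) * real ((16 * p + 1) ^ p)) \<le> real (d ^ (2 + 14 * p))"
  proof -
    have "1 \<le> p ^ 3" using p2 by simp
    have "2 * p ^ 3 + 1 \<le> 3 * p ^ 3" using \<open>1 \<le> p ^ 3\<close> by linarith
    then have a: "(2 * p ^ 3 + 1) ^ p \<le> (3 * p ^ 3) ^ p" by (rule power_mono) simp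
    have "2 ^ 1 \<le> (2::nat) ^ p" using p2 by (intro power_increasing) auto
    also have "\<dots> \<le> (3 * p ^ 3) ^ p" using \<open>1 \<le> p ^ 3\<close> by (intro power_mono) auto
    finally have b: "2 \<le> (3 * p ^ 3) ^ p" by simp
    have "16 * p + 1 \<le> 17 * p" using p2 by simp
    then have c: "(16 * p + 1) ^ p \<le> (17 * p) ^ p" by (rule power_mono) simp
    have "2 * (((2 * p ^ 3 + 1) ^ p + 2) * (16 * p + 1) ^ p) \<le> 2 * ((2 * (3 * p ^ 3) ^ p) * (17 * p) ^ p)"
      using a b c by (intro mult_le_mono) auto
    also have "\<dots> = 4 * ((3 * p ^ 3) * (17 * p)) ^ p"
    proof -
      have "2 * ((2 * X ^ p) * Y ^ p) = 4 * (X * Y) ^ p" for X Y :: nat by (simp add: power_mult_distrib)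
      then show ?thesis .
    qed
    also have "(3 * p ^ 3) * (17 * p) = 51 * p ^ 4" by (simp add: power4_eq_xxxx power3_eq_cube)
    also have "4 * (51 * p ^ 4) ^ p \<le> d ^ 2 * (d ^ 14) ^ p"
    proof (rule mult_le_mono)
      show "4 \<le> d ^ 2" using power_mono[of 2 d 2] d by simp
      show "(51 * p ^ 4) ^ p \<le> (d ^ 14) ^ p"
      proof (rule power_mono)
      have "51 \<le> d ^ 6" using power_mono[of 2 d 6] d by simp
      moreover have "p ^ 4 \<le> (d ^ 2) ^ 4" using pd by (intro power_mono) auto
      ultimately have "51 * p ^ 4 \<le> d ^ 6 * (d ^ 2) ^ 4" by (rule mult_le_mono)
      also have "\<dots> = d ^ 14" by (simp add: power_mult[symmetric] power_add[symmetric])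
      finally show "51 * p ^ 4 \<le> d ^ 14" .
      qed simp
    qed
    also have "\<dots> = d ^ (2 + 14 * p)" by (simp add: power_mult power_add power2_eq_square)
    finally have "real (2 * (((2 * p ^ 3 + 1) ^ p + 2) * (16 * p + 1) ^ p)) \<le> real (d ^ (2 + 14 * p))"
      by (simp only: of_nat_le_iff)
    then show ?thesis by (simp only: of_nat_mult of_nat_add of_nat_numeral)
  qed
  have "exp (- real n * \<epsilon>\<^sup>2 / 4096) \<le> exp (- ((12 + 14 * real p) * ln (real d)))"
    using e1 e2 by simp
  also have "\<dots> = real d powr (- (12 + 14 * real p))" using d0 by (simp add: powr_def algebra_simps)
  finally have E: "exp (- real n * \<epsilon>\<^sup>2 / 4096) \<le> real d powr (- (12 + 14 * real p))" .
  have "2 * ((real ((2 * p ^ 3 + 1) ^ p) + 2) * real ((16 * p + 1) ^ p)) * exp (- real n * \<epsilon>\<^sup>2 / 4096)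
     \<le> real (d ^ (2 + 14 * p)) * real d powr (- (12 + 14 * real p))"
    using cnt E by (intro mult_mono) auto
  also have "real (d ^ (2 + 14 * p)) = real d powr (2 + 14 * real p)"
    using powr_realpow[OF d0, of "2 + 14 * p"] by simp
  also have "real d powr (2 + 14 * real p) * real d powr (- (12 + 14 * real p)) = real d powr (-10)"
    unfolding powr_add[symmetric] by simp
  finally show ?thesis .
qed

definition cpop :: real where "cpop = 4 * (6912 + 2 * exp 36)"

text \<open>\<open>cpop\<close> is the remainder constant of \<open>population_bound\<close>. This
  choice makes that remainder exactly 1/8 of tau / K^2 at the largest radius.\<close>

definition crad :: real where "crad = 1 / (8 * cpop)"

text \<open>A common core for both models. The level \<tau> is free and the lower bound is claimed
  only for directions V with \<tau> |V|^2 \<le> E F^2, so that the convolutional model can insert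
  its block-structured directions with \<tau> equal to its own rho.\<close>

theorem empirical_hessian_bounds:
  fixes d K n :: nat and \<tau> :: real and W0 :: "nat \<times> nat \<Rightarrow> real"
  assumes d: "d \<ge> 2" and K: "K \<ge> 1" "K \<le> d" and \<tau>: "0 < \<tau>" "\<tau> \<le> 1"
    and W0: "\<And>k. k < K \<Longrightarrow> dot d (wcol W0 k) (wcol W0 k) \<le> 1"
    and n: "real n \<ge> 163840000000 * real d * real K ^ 5 * (ln (real d))\<^sup>2 / \<tau>\<^sup>2"
  shows "\<exists>A \<in> sets (sample_dist n d (H_fcn d K W0)).
     1 - real d powr (-10) \<le> measure (sample_dist n d (H_fcn d K W0)) A \<and>
     (\<forall>S\<in>A. \<forall>W. fro2 d K (\<lambda>a. W a - W0 a) \<le> (crad * \<tau> / sqrt (real K))\<^sup>2 \<longrightarrow>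
        (\<forall>V. avg_hess d K n S W V \<le> 22 * fro2 d K V) \<and>
        (\<forall>V. \<tau> * fro2 d K V \<le> integral\<^sup>L (gauss_vec d) (\<lambda>x. (grad_sum d K W0 V x)\<^sup>2) \<longrightarrow>
           \<tau> / (8 * (real K)\<^sup>2) * fro2 d K V \<le> avg_hess d K n S W V))"
proof -
  interpret L: label_model d "H_fcn d K W0" by (rule label_model_H_fcn[OF K(1)])
  let ?D = "data_dist d (H_fcn d K W0)"
  define J where "J = {..<d} \<times> {..<K}"
  define p where "p = d * K"
  have J: "finite J" "J \<noteq> {}" "card J = p" using d K by (auto simp: J_def p_def lessThan_empty_iff)
  have fro2J: "fro2 d K V = (\<Sum>a\<in>J. (V a)\<^sup>2)" for V by (simp add: fro2_def J_def)
  define r where "r = crad * \<tau> / sqrt (real K)"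
  have cpop: "cpop \<ge> 27648" unfolding cpop_def by simp
  have crad: "0 < crad" "crad * 221184 \<le> 1" "cpop * crad = 1 / 8"
    using cpop unfolding crad_def by (auto simp: field_simps)
  have sK: "sqrt (real K) \<ge> 1" "0 < real K" using K by auto
  have r: "0 < r" "r \<le> crad * \<tau>" "r \<le> 1"
  proof -
    show "0 < r" unfolding r_def using crad \<tau> sK by simp
    have "crad * \<tau> / sqrt (real K) \<le> crad * \<tau> / 1" using crad \<tau> sK by (intro divide_left_mono) auto
    then show "r \<le> crad * \<tau>" unfolding r_def by simp
    moreover have "crad * \<tau> \<le> 1 * 1" using crad \<tau> by (intro mult_mono) auto
    ultimately show "r \<le> 1" by simp
  qed
  define \<epsilon> where "\<epsilon> = \<tau> / (1000 * (real K)\<^sup>2)"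
  have K2: "1 \<le> (real K)\<^sup>2" using K by simp
  have \<epsilon>: "0 < \<epsilon>" "\<epsilon> \<le> 1"
  proof -
    show "0 < \<epsilon>" unfolding \<epsilon>_def using \<tau> K by simp
    have "\<tau> \<le> 1000 * (real K)\<^sup>2" using \<tau> K2 by linarith
    then show "\<epsilon> \<le> 1" unfolding \<epsilon>_def using K by (subst divide_le_eq_1_pos) auto
  qed
  have n1: "n \<ge> 1"
  proof (rule ccontr)
    assume "\<not> n \<ge> 1"
    moreover have "0 < 163840000000 * real d * real K ^ 5 * (ln (real d))\<^sup>2 / \<tau>\<^sup>2" using d K \<tau> by simp
    ultimately show False using n by simp
  qed
  have p2: "2 \<le> p" using d K unfolding p_def by (metis mult_le_mono mult.right_neutral)
  \<comment> \<open>Bounds the distance from a point of the unit ball to the net of mesh p^-3. Since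
    t \<le> 1 / (d K^2), the mean rounding error, a multiple of r t d, is of order r / K^2.\<close>
  define t where "t = sqrt (real p) / real p ^ 3"
  have t: "0 \<le> t" "t\<^sup>2 = real p / (real (p ^ 3))\<^sup>2" "t \<le> 1 / (real d * (real K)\<^sup>2)"
  proof -
    show "0 \<le> t" "t\<^sup>2 = real p / (real (p ^ 3))\<^sup>2" unfolding t_def by (auto simp: power_divide)
    have "sqrt (real p) \<le> real p" using p2 by (intro real_le_lsqrt) (auto simp: power2_eq_square)
    then have "t \<le> real p / real p ^ 3" unfolding t_def by (intro divide_right_mono) auto
    also have "\<dots> = 1 / (real p * real p)" using p2 by (simp add: power3_eq_cube)
    also have "\<dots> \<le> 1 / (real d * (real K)\<^sup>2)"
    proof (intro divide_left_mono)
      have "real d * (real K)\<^sup>2 * 1 \<le> real d * (real K)\<^sup>2 * real d" using d by (intro mult_left_mono) auto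
      then show "real d * (real K)\<^sup>2 \<le> real p * real p" unfolding p_def by (simp add: power2_eq_square mult_ac)
      show "0 < (real p * real p) * (real d * (real K)\<^sup>2)" using d K p2 by simp
    qed simp
    finally show "t \<le> 1 / (real d * (real K)\<^sup>2)" .
  qed
  define U where "U = {u \<in> grid J (p ^ 3). fro2 d K u \<le> 1}"
  have U: "finite U" "card U \<le> (2 * p ^ 3 + 1) ^ p"
  proof -
    show "finite U" unfolding U_def using finite_grid[OF J(1)] by simp
    have "card U \<le> card (grid J (p ^ 3))" unfolding U_def by (intro card_mono finite_grid[OF J(1)]) auto
    then show "card U \<le> (2 * p ^ 3 + 1) ^ p" using card_grid_le[OF J(1), of "p ^ 3"] J(3) by simp
  qed
  \<comment> \<open>\<open>Inl u\<close>: the Hessian at a net point; \<open>Inr b\<close>: the envelope, with weight 1 or with the weight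
    controlling the rounding of \<open>W\<close> to the net\<close>
  define \<Theta> :: "((nat \<times> nat \<Rightarrow> real) + bool) set" where "\<Theta> = Inl ` U \<union> {Inr True, Inr False}"
  have \<Theta>: "finite \<Theta>" "real (card \<Theta>) \<le> real ((2 * p ^ 3 + 1) ^ p) + 2"
  proof -
    show "finite \<Theta>" unfolding \<Theta>_def using U by simp
    have "card \<Theta> \<le> card (Inl ` U :: ((nat \<times> nat \<Rightarrow> real) + bool) set) + card {Inr True, Inr False :: (nat \<times> nat \<Rightarrow> real) + bool}"
      unfolding \<Theta>_def by (rule card_Un_le)
    also have "\<dots> \<le> (2 * p ^ 3 + 1) ^ p + 2" by (intro add_mono order_trans[OF card_image_le[OF U(1)] U(2)]) (simp add: card_insert_if)
    finally have "real (card \<Theta>) \<le> real ((2 * p ^ 3 + 1) ^ p + 2)" by (simp only: of_nat_le_iff)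
    then show "real (card \<Theta>) \<le> real ((2 * p ^ 3 + 1) ^ p) + 2" by (simp only: of_nat_add of_nat_numeral)
  qed
  \<comment> \<open>The Lipschitz constant of the Hessian in W grows with |x|. The cap at 1 keeps
    the rounding error below the envelope \<open>sqs\<close>, so it concentrates like the Hessian
    itself.\<close>
  define wt where "wt x = min 1 (r * t * sqrt (dot d x x))" for x
  define g where "g \<theta> y x V = (case \<theta> of Inl u \<Rightarrow> lossq K (pre d (\<lambda>a. W0 a + r * u a) x) y (pre d V x)
      | Inr b \<Rightarrow> (if b then 1 else wt x) * sqs d K V x)" for \<theta> y x V
  have wt: "0 \<le> wt x" "wt x \<le> 1" "wt x \<le> r * t * (1 + dot d x x)" for x
  proof -
    show "0 \<le> wt x" "wt x \<le> 1" unfolding wt_def using r t by (auto simp: dot_self_nonneg)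
    have "sqrt y \<le> 1 + y" if "0 \<le> y" for y :: real
      using that by (intro real_le_lsqrt) (auto simp: power2_eq_square algebra_simps)
    from this[OF dot_self_nonneg[of d x]] show "wt x \<le> r * t * (1 + dot d x x)"
      unfolding wt_def using r t by (intro min.coboundedI2 mult_left_mono) auto
  qed
  have dxx [measurable]: "(\<lambda>x. dot d x x) \<in> borel_measurable (gauss_vec d)"
  proof -
    have "(\<lambda>x. dot d x x) = (\<lambda>x. \<Sum>i<d. (x i)\<^sup>2)" by (simp add: dot_self)
    then show ?thesis by simp
  qed
  have wtm [measurable]: "wt \<in> borel_measurable (gauss_vec d)" unfolding wt_def[abs_def] by measurable
  have gm [measurable]: "(\<lambda>x. g \<theta> y x V) \<in> borel_measurable (gauss_vec d)" for \<theta> y V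
    unfolding g_def by (cases \<theta>) simp_all
  have gle: "\<bar>g \<theta> y x V\<bar> \<le> 2 * sqs d K V x" for \<theta> y x V
  proof (cases \<theta>)
    case (Inr b)
    have "\<bar>(if b then 1 else wt x) * sqs d K V x\<bar> \<le> 1 * sqs d K V x"
      unfolding abs_mult using wt[of x] sqs_nonneg[of d K V x] by (intro mult_mono) auto
    then show ?thesis unfolding g_def Inr using sqs_nonneg[of d K V x] by simp
  qed (simp add: g_def abs_lossq_pre_le[OF K(1)])
  have gqf: "qf (g \<theta> y x)" for \<theta> y x
    unfolding g_def[abs_def] by (cases \<theta>) (auto intro!: qf_lossq qf_cmult qf_sqs simp del: mult_cancel_right)
  have iB: "integrable (gauss_vec d) (\<lambda>x. 2 * sqs d K V x)" for V
    by (intro integrable_mult_right expgrow_integrable) auto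
  have gi: "integrable ?D (\<lambda>z. g \<theta> (snd z) (fst z) V)" for \<theta> V
    by (rule L.data_dist_integral(1)[OF gm iB gle])
  have gE: "integral\<^sup>L ?D (\<lambda>z. g \<theta> (snd z) (fst z) V) = integral\<^sup>L (gauss_vec d)
     (\<lambda>x. H_fcn d K W0 x * g \<theta> True x V + (1 - H_fcn d K W0 x) * g \<theta> False x V)" for \<theta> V
    by (rule L.data_dist_integral(2)[OF gm iB gle])
  have Ti: "integrable ?D (\<lambda>z. exp (sqs d K V (fst z) / 4))" "integral\<^sup>L ?D (\<lambda>z. exp (sqs d K V (fst z) / 4)) \<le> 2"
    if "fro2 d K V \<le> 1" for V
  proof -
    have *: "(\<lambda>x. exp (sqs d K V x / 4)) \<in> borel_measurable (gauss_vec d)" by measurable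
    show "integrable ?D (\<lambda>z. exp (sqs d K V (fst z) / 4))"
      using L.data_dist_integral(1)[where g = "\<lambda>_ x. exp (sqs d K V x / 4)", OF * gauss_vec_exp_sqs(1)[OF that]] by simp
    show "integral\<^sup>L ?D (\<lambda>z. exp (sqs d K V (fst z) / 4)) \<le> 2"
      using L.data_dist_integral(2)[where g = "\<lambda>_ x. exp (sqs d K V x / 4)", OF * gauss_vec_exp_sqs(1)[OF that]]
        gauss_vec_exp_sqs(2)[OF that] by (simp add: algebra_simps)
  qed
  have fstm: "(\<lambda>z. f (fst z)) \<in> borel_measurable ?D" if "f \<in> borel_measurable (gauss_vec d)" for f :: "(nat \<Rightarrow> real) \<Rightarrow> real"
    unfolding measurable_cong_sets[OF L.sets_data_dist refl] by (rule measurable_compose[OF measurable_fst that])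
  have "\<exists>A \<in> sets (PiM {..<n} (\<lambda>_. ?D)).
      1 - 2 * (real (card \<Theta>) * real ((16 * card J + 1) ^ card J)) * exp (- real n * \<epsilon>\<^sup>2 / 4096) \<le> measure (PiM {..<n} (\<lambda>_. ?D)) A \<and>
     (\<forall>S\<in>A. \<forall>\<theta>\<in>\<Theta>. \<forall>V. \<bar>1 / real n * (\<Sum>i<n. g \<theta> (snd (S i)) (fst (S i)) V) - integral\<^sup>L ?D (\<lambda>z. g \<theta> (snd z) (fst z) V)\<bar>
         \<le> 3 * \<epsilon> * (\<Sum>a\<in>J. (V a)\<^sup>2))"
  proof (rule qf_concentration[where T = "\<lambda>z V. sqs d K V (fst z)", OF L.prob_space_data_dist \<Theta>(1) J(1,2) gqf _ _ gle _ _ gi _ \<epsilon> n1])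
    show "(\<lambda>z. g \<theta> (snd z) (fst z) V) \<in> borel_measurable ?D" for \<theta> V
      using gi[of \<theta> V] by (rule borel_measurable_integrable)
    show "(\<lambda>z. sqs d K V (fst z)) \<in> borel_measurable ?D" for V by (rule fstm) measurable
    fix V :: "nat \<times> nat \<Rightarrow> real" assume "(\<Sum>a\<in>J. (V a)\<^sup>2) \<le> 1"
    then have "fro2 d K V \<le> 1" by (simp add: fro2J)
    then show "integrable ?D (\<lambda>z. exp (sqs d K V (fst z) / 4))" "integral\<^sup>L ?D (\<lambda>z. exp (sqs d K V (fst z) / 4)) \<le> 2"
      using Ti by auto
  next
    fix z :: "(nat \<Rightarrow> real) \<times> bool"
    show "\<exists>b. \<forall>v. (\<Sum>a\<in>J. (v a)\<^sup>2) \<le> 1 \<longrightarrow> sqs d K v (fst z) \<le> b"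
    proof (intro exI allI impI)
      fix v :: "nat \<times> nat \<Rightarrow> real" assume "(\<Sum>a\<in>J. (v a)\<^sup>2) \<le> 1"
      then have "fro2 d K v * dot d (fst z) (fst z) \<le> 1 * dot d (fst z) (fst z)"
        unfolding fro2J by (intro mult_right_mono dot_self_nonneg)
      then show "sqs d K v (fst z) \<le> dot d (fst z) (fst z)" using sqs_le[of d K v "fst z"] by linarith
    qed
  qed
  then obtain A where A: "A \<in> sets (PiM {..<n} (\<lambda>_. ?D))"
    and Am: "1 - 2 * (real (card \<Theta>) * real ((16 * p + 1) ^ p)) * exp (- real n * \<epsilon>\<^sup>2 / 4096) \<le> measure (PiM {..<n} (\<lambda>_. ?D)) A"
    and conc: "\<And>S \<theta> V. S \<in> A \<Longrightarrow> \<theta> \<in> \<Theta> \<Longrightarrow>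
      \<bar>1 / real n * (\<Sum>i<n. g \<theta> (snd (S i)) (fst (S i)) V) - integral\<^sup>L ?D (\<lambda>z. g \<theta> (snd z) (fst z) V)\<bar> \<le> 3 * \<epsilon> * fro2 d K V"
    unfolding fro2J J(3) by blast
  have "2 * (real (card \<Theta>) * real ((16 * p + 1) ^ p)) * exp (- real n * \<epsilon>\<^sup>2 / 4096)
     \<le> 2 * ((real ((2 * p ^ 3 + 1) ^ p) + 2) * real ((16 * p + 1) ^ p)) * exp (- real n * \<epsilon>\<^sup>2 / 4096)"
    using \<Theta>(2) by (intro mult_right_mono mult_left_mono) auto
  also have "\<dots> \<le> real d powr (-10)"
    unfolding p_def \<epsilon>_def by (rule union_bound_numeric[OF d K \<tau>(1) n])
  finally have prob: "1 - real d powr (-10) \<le> measure (PiM {..<n} (\<lambda>_. ?D)) A" using Am by linarith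
  have unit: "avg_hess d K n S W V \<le> 22 \<and>
      (\<tau> \<le> integral\<^sup>L (gauss_vec d) (\<lambda>x. (grad_sum d K W0 V x)\<^sup>2) \<longrightarrow> \<tau> / (8 * (real K)\<^sup>2) \<le> avg_hess d K n S W V)"
    if S: "S \<in> A" and W: "fro2 d K (\<lambda>a. W a - W0 a) \<le> r\<^sup>2" and V: "fro2 d K V = 1" for S W V
  proof -
    have V1: "fro2 d K V \<le> 1" using V by simp
    have sqsm: "sqs d K V \<in> borel_measurable (gauss_vec d)" by measurable
    have E_sqs: "integral\<^sup>L ?D (\<lambda>z. g (Inr b) (snd z) (fst z) V) = integral\<^sup>L (gauss_vec d) (\<lambda>x. (if b then 1 else wt x) * sqs d K V x)" for b
      unfolding gE by (simp add: g_def algebra_simps)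
    \<comment> \<open>11 \<ge> 8 + 3 \<epsilon>, where 8 = 4 * 2 stems from the exponential moment.
      The envelope is free of W, so one event serves all W.\<close>
    have avgS: "1 / real n * (\<Sum>i<n. sqs d K V (fst (S i))) \<le> 11"
    proof -
      have "integral\<^sup>L (gauss_vec d) (sqs d K V) \<le> integral\<^sup>L (gauss_vec d) (\<lambda>x. 4 * exp (sqs d K V x / 4))"
      proof (intro integral_mono)
        show "sqs d K V x \<le> 4 * exp (sqs d K V x / 4)" for x
          using exp_ge_add_one_self[of "sqs d K V x / 4"] by linarith
      qed (use gauss_vec_exp_sqs(1)[OF V1] in \<open>auto intro!: expgrow_integrable\<close>)
      also have "\<dots> \<le> 8" using gauss_vec_exp_sqs[OF V1] by simp
      finally have "integral\<^sup>L (gauss_vec d) (sqs d K V) \<le> 8" .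
      moreover have "\<bar>1 / real n * (\<Sum>i<n. g (Inr True) (snd (S i)) (fst (S i)) V) - integral\<^sup>L ?D (\<lambda>z. g (Inr True) (snd z) (fst z) V)\<bar> \<le> 3 * \<epsilon> * 1"
        using conc[OF S, of "Inr True" V] V by (simp add: \<Theta>_def)
      ultimately show ?thesis unfolding E_sqs using \<epsilon> by (simp add: g_def)
    qed
    have upper: "avg_hess d K n S W V \<le> 22"
    proof -
      have "avg_hess d K n S W V \<le> 1 / real n * (\<Sum>i<n. 2 * sqs d K V (fst (S i)))"
        unfolding avg_hess_def using abs_lossq_pre_le[OF K(1)] by (intro mult_left_mono sum_mono) (auto intro: order_trans[OF abs_ge_self])
      then show ?thesis using avgS by (simp add: sum_distrib_left[symmetric])
    qed
    have lower: "\<tau> / (8 * (real K)\<^sup>2) \<le> avg_hess d K n S W V"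
      if F: "\<tau> \<le> integral\<^sup>L (gauss_vec d) (\<lambda>x. (grad_sum d K W0 V x)\<^sup>2)"
    proof -
      define u where "u = (\<lambda>a. (1 / r) * (W a - W0 a))"
      have u1: "fro2 d K u \<le> 1" unfolding u_def fro2_scale using W r by (simp add: power_divide)
      obtain u' where u': "u' \<in> grid J (p ^ 3)" "fro2 d K u' \<le> 1" "(\<Sum>a\<in>J. (u a - u' a)\<^sup>2) \<le> real (card J) / (real (p ^ 3))\<^sup>2"
        using grid_approx[OF J(1), of u "p ^ 3"] u1 p2 unfolding fro2J by auto
      have u'U: "Inl u' \<in> \<Theta>" using u' by (simp add: \<Theta>_def U_def)
      define W' where "W' = (\<lambda>a. W0 a + r * u' a)"
      have diffW: "fro2 d K (\<lambda>a. W a - W' a) \<le> (r * t)\<^sup>2"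
      proof -
        have "(\<lambda>a. W a - W' a) = (\<lambda>a. r * (u a - u' a))" using r by (auto simp: W'_def u_def field_simps)
        then have "fro2 d K (\<lambda>a. W a - W' a) = r\<^sup>2 * (\<Sum>a\<in>J. (u a - u' a)\<^sup>2)" by (simp only: fro2_scale) (simp add: fro2J)
        also have "\<dots> \<le> r\<^sup>2 * t\<^sup>2" using u'(3) unfolding t(2) J(3) by (intro mult_left_mono) auto
        finally show ?thesis by (simp add: power_mult_distrib)
      qed
      have lip: "lossq K (pre d W x) y (pre d V x) \<ge> g (Inl u') y x V - 18 * g (Inr False) y x V" for x y
      proof -
        have "\<bar>pre d W x k - pre d W' x k\<bar> \<le> r * t * sqrt (dot d x x)" if "k < K" for k
        proof -
          have "sqrt (dot d (wcol (\<lambda>a. W a - W' a) k) (wcol (\<lambda>a. W a - W' a) k)) \<le> r * t"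
            using dot_col_le_fro2[OF that, of d "\<lambda>a. W a - W' a"] diffW r t by (intro real_le_lsqrt) auto
          then show ?thesis unfolding pre_diff[symmetric]
            by (intro order_trans[OF abs_pre_le] mult_right_mono) (auto simp: dot_self_nonneg)
        qed
        then have "\<bar>lossq K (pre d W x) y (pre d V x) - lossq K (pre d W' x) y (pre d V x)\<bar>
            \<le> 18 * min 1 (r * t * sqrt (dot d x x)) * (\<Sum>k<K. (pre d V x k)\<^sup>2)"
          using r t by (intro lossq_lipschitz[OF K(1)]) (auto simp: dot_self_nonneg)
        then show ?thesis unfolding g_def W'_def sqs_def wt_def by simp
      qed
      have "avg_hess d K n S W V \<ge> 1 / real n * (\<Sum>i<n. g (Inl u') (snd (S i)) (fst (S i)) V - 18 * g (Inr False) (snd (S i)) (fst (S i)) V)"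
        unfolding avg_hess_def using lip by (intro mult_left_mono sum_mono) auto
      then have 1: "avg_hess d K n S W V \<ge> 1 / real n * (\<Sum>i<n. g (Inl u') (snd (S i)) (fst (S i)) V)
         - 18 * (1 / real n * (\<Sum>i<n. g (Inr False) (snd (S i)) (fst (S i)) V))"
        by (simp add: sum_subtractf sum_distrib_left[symmetric] diff_divide_distrib)
      have 2: "1 / real n * (\<Sum>i<n. g (Inl u') (snd (S i)) (fst (S i)) V) \<ge> integral\<^sup>L ?D (\<lambda>z. g (Inl u') (snd z) (fst z) V) - 3 * \<epsilon>"
        using conc[OF S u'U, of V] V by simp
      have 3: "1 / real n * (\<Sum>i<n. g (Inr False) (snd (S i)) (fst (S i)) V) \<le> integral\<^sup>L ?D (\<lambda>z. g (Inr False) (snd z) (fst z) V) + 3 * \<epsilon>"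
        using conc[OF S, of "Inr False" V] V by (simp add: \<Theta>_def)
      have 4: "integral\<^sup>L ?D (\<lambda>z. g (Inr False) (snd z) (fst z) V) \<le> r * t * (72 * real d)"
      proof -
        have "expgrow d (\<lambda>x. dot d x x)"
          unfolding dot_self by (intro expgrow_sum expgrow_power expgrow_component) simp
        then have i1: "integrable (gauss_vec d) (\<lambda>x. (1 + dot d x x) * sqs d K V x)"
          by (intro expgrow_integrable expgrow_mult expgrow_add) auto
        have "expgrow d wt" using wt by (intro expgrow_bounded[of _ 1]) auto
        then have i2: "integrable (gauss_vec d) (\<lambda>x. wt x * sqs d K V x)"
          by (intro expgrow_integrable expgrow_mult) auto
        have "integral\<^sup>L ?D (\<lambda>z. g (Inr False) (snd z) (fst z) V) = integral\<^sup>L (gauss_vec d) (\<lambda>x. wt x * sqs d K V x)"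
          unfolding E_sqs by simp
        also have "\<dots> \<le> integral\<^sup>L (gauss_vec d) (\<lambda>x. r * t * ((1 + dot d x x) * sqs d K V x))"
        proof (intro integral_mono i2 integrable_mult_right i1)
          show "wt x * sqs d K V x \<le> r * t * ((1 + dot d x x) * sqs d K V x)" for x
            using mult_right_mono[OF wt(3) sqs_nonneg] by (simp add: mult.assoc)
        qed
        also have "\<dots> = r * t * integral\<^sup>L (gauss_vec d) (\<lambda>x. (1 + dot d x x) * sqs d K V x)" by simp
        also have "\<dots> \<le> r * t * (72 * real d)"
          using r t d by (intro mult_left_mono integral_norm_sqs_le[OF V1]) auto
        finally show ?thesis .
      qed
      have 5: "integral\<^sup>L ?D (\<lambda>z. g (Inl u') (snd z) (fst z) V) \<ge> (1 / (real K)\<^sup>2) * (\<tau> / 2 - 64 * r\<^sup>2) - cpop * r / (real K * sqrt (real K))"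
      proof -
        have W': "fro2 d K (\<lambda>a. W' a - W0 a) \<le> r\<^sup>2"
          unfolding W'_def using u'(2) mult_left_mono[of "fro2 d K u'" 1 "r\<^sup>2"] by (simp add: fro2_scale)
        have "integral\<^sup>L ?D (\<lambda>z. g (Inl u') (snd z) (fst z) V) \<ge>
           (1 / (real K)\<^sup>2) * (integral\<^sup>L (gauss_vec d) (\<lambda>x. (grad_sum d K W0 V x)\<^sup>2) / 2 - 64 * r\<^sup>2) - cpop * r / (real K * sqrt (real K))"
          using population_bound[OF K(1) r(1,3) W0 W' V1] unfolding g_def W'_def cpop_def by simp
        moreover have "(1 / (real K)\<^sup>2) * (\<tau> / 2 - 64 * r\<^sup>2) \<le> (1 / (real K)\<^sup>2) * (integral\<^sup>L (gauss_vec d) (\<lambda>x. (grad_sum d K W0 V x)\<^sup>2) / 2 - 64 * r\<^sup>2)"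
          using F by (intro mult_left_mono) auto
        ultimately show ?thesis by linarith
      qed
      define q where "q = \<tau> / (real K)\<^sup>2"
      have q0: "0 \<le> q" unfolding q_def using \<tau> by simp
      have a: "(1 / (real K)\<^sup>2) * (\<tau> / 2 - 64 * r\<^sup>2) \<ge> 3 / 8 * q"
      proof -
        have "r\<^sup>2 \<le> (crad * \<tau>) * 1" unfolding power2_eq_square using r crad \<tau> by (intro mult_mono) auto
        moreover have "crad * \<tau> \<le> \<tau> / 221184" using mult_right_mono[OF crad(2), of \<tau>] \<tau> by simp
        ultimately have "\<tau> / 2 - 64 * r\<^sup>2 \<ge> 3 / 8 * \<tau>" using \<tau> by linarith
        from mult_left_mono[OF this, of "1 / (real K)\<^sup>2"] show ?thesis unfolding q_def by simp
      qed
      have b: "cpop * r / (real K * sqrt (real K)) = 1 / 8 * q"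
      proof -
        have "cpop * r / (real K * sqrt (real K)) = (cpop * crad) * \<tau> / (real K * (sqrt (real K) * sqrt (real K)))"
          by (simp only: r_def times_divide_eq_right divide_divide_eq_left mult.assoc mult.commute mult.left_commute)
        also have "sqrt (real K) * sqrt (real K) = real K" by simp
        finally show ?thesis unfolding crad(3) q_def by (simp add: power2_eq_square)
      qed
      have c: "r * t * (72 * real d) \<le> 1 / 1000 * q"
      proof -
        have "r * t * (72 * real d) \<le> (crad * \<tau>) * (1 / (real d * (real K)\<^sup>2)) * (72 * real d)"
          using r t crad \<tau> by (intro mult_right_mono mult_mono) auto
        also have "\<dots> = (crad * 72) * q" unfolding q_def using d by simp
        also have "\<dots> \<le> 1 / 1000 * q" using crad q0 by (intro mult_right_mono) auto
        finally show ?thesis .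
      qed
      have e: "\<epsilon> = q / 1000" unfolding \<epsilon>_def q_def by simp
      \<comment> \<open>In units of q: 3/8 from the mean, minus 1/8 for the radius, minus 3/1000 for
        sampling, minus 18 (1/1000 + 3/1000) for rounding; more than 1/8 remains.\<close>
      have "avg_hess d K n S W V \<ge> 1 / 8 * q" using 1 2 3 4 5 a b c e q0 by linarith
      then show ?thesis unfolding q_def by simp
    qed
    show ?thesis using upper lower by blast
  qed
  have gen: "avg_hess d K n S W V \<le> 22 * fro2 d K V \<and>
      (\<tau> * fro2 d K V \<le> integral\<^sup>L (gauss_vec d) (\<lambda>x. (grad_sum d K W0 V x)\<^sup>2) \<longrightarrow> \<tau> / (8 * (real K)\<^sup>2) * fro2 d K V \<le> avg_hess d K n S W V)"
    if S: "S \<in> A" and W: "fro2 d K (\<lambda>a. W a - W0 a) \<le> r\<^sup>2" for S W V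
  proof (cases "fro2 d K V = 0")
    case True
    have "lossq K s y (pre d V x) = 0" for s y x
    proof -
      have "sqs d K V x \<le> 0" using sqs_le[of d K V x] True by simp
      then show ?thesis using abs_lossq_le[OF K(1), of s y "pre d V x"] unfolding sqs_def by simp
    qed
    then have "avg_hess d K n S W V = 0" by (simp add: avg_hess_def)
    then show ?thesis using True by simp
  next
    case False
    define f where "f = fro2 d K V"
    have f: "0 < f" using False fro2_nonneg[of d K V] by (simp add: f_def)
    define V1 where "V1 = (\<lambda>a. (1 / sqrt f) * V a)"
    have V1: "fro2 d K V1 = 1" unfolding V1_def fro2_scale using f by (simp add: power_divide f_def)
    have h: "avg_hess d K n S W V1 = avg_hess d K n S W V / f"
      unfolding V1_def qf_scale[OF qf_avg_hess] using f by (simp add: power_divide)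
    have "grad_sum d K W0 V1 x = (1 / sqrt f) * grad_sum d K W0 V x" for x
      unfolding V1_def grad_sum_def pre_scale sum_distrib_left by (simp add: mult_ac)
    then have "(grad_sum d K W0 V1 x)\<^sup>2 = (1 / f) * (grad_sum d K W0 V x)\<^sup>2" for x
      using f by (simp add: power_mult_distrib power_divide)
    then have "integral\<^sup>L (gauss_vec d) (\<lambda>x. (grad_sum d K W0 V1 x)\<^sup>2) = (1 / f) * integral\<^sup>L (gauss_vec d) (\<lambda>x. (grad_sum d K W0 V x)\<^sup>2)"
      by simp
    then have e: "integral\<^sup>L (gauss_vec d) (\<lambda>x. (grad_sum d K W0 V1 x)\<^sup>2) = integral\<^sup>L (gauss_vec d) (\<lambda>x. (grad_sum d K W0 V x)\<^sup>2) / f"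
      by simp
    have u: "avg_hess d K n S W V / f \<le> 22"
      "\<tau> \<le> integral\<^sup>L (gauss_vec d) (\<lambda>x. (grad_sum d K W0 V x)\<^sup>2) / f \<Longrightarrow> \<tau> / (8 * (real K)\<^sup>2) \<le> avg_hess d K n S W V / f"
      using unit[OF S W V1] unfolding h e by auto
    show ?thesis unfolding f_def[symmetric]
    proof (intro conjI impI)
      show "avg_hess d K n S W V \<le> 22 * f" using u(1) by (simp only: pos_divide_le_eq[OF f])
      assume "\<tau> * f \<le> integral\<^sup>L (gauss_vec d) (\<lambda>x. (grad_sum d K W0 V x)\<^sup>2)"
      then show "\<tau> / (8 * (real K)\<^sup>2) * f \<le> avg_hess d K n S W V"
        using u(2) by (simp only: pos_le_divide_eq[OF f])
    qed
  qed
  show ?thesis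
    unfolding sample_dist_def using A prob gen unfolding r_def by (intro bexI[of _ A]) blast+
qed

section \<open>Testing against cubic Hermite polynomials\<close>

text \<open>Shifted by one because F contains phi': index r stands for the derivative of phi of
  order r + 1.\<close>

interpretation dsig_stein: stein_family "\<lambda>r. dsig (Suc r)"
  by unfold_locales (use DERIV_dsig dsig_bounded in auto)

text \<open>The constant 1 with its vanishing derivatives. For it \<open>gmom_Cons\<close> becomes
  the Wick formula for moments of Gaussian linear forms.\<close>

definition one_seq :: "nat \<Rightarrow> real \<Rightarrow> real" where
  "one_seq r t = (if r = 0 then 1 else 0)"

interpretation one_stein: stein_family one_seq
proof
  show "(one_seq r has_real_derivative one_seq (Suc r) t) (at t)" for r t
    by (simp add: one_seq_def[abs_def])
  show "\<exists>B. \<forall>t. \<bar>one_seq r t\<bar> \<le> B" for r by (intro exI[of _ 1]) (simp add: one_seq_def)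
qed

text \<open>The Wick product of \<open>a \<cdot> x\<close>, \<open>a \<cdot> x\<close> and \<open>b \<cdot> x\<close>: contractions are subtracted, so that it is
  orthogonal to all polynomials of degree at most two.\<close>

definition cubic :: "nat \<Rightarrow> (nat \<Rightarrow> real) \<Rightarrow> (nat \<Rightarrow> real) \<Rightarrow> (nat \<Rightarrow> real) \<Rightarrow> real" where
  "cubic d a b x = (dot d a x)\<^sup>2 * dot d b x - dot d a a * dot d b x - 2 * dot d a b * dot d a x"

lemma measurable_cubic [measurable]: "cubic d a b \<in> borel_measurable (gauss_vec d)"
  unfolding cubic_def[abs_def] by measurable

lemma expgrow_cubic [intro]: "expgrow d (cubic d a b)"
  unfolding cubic_def[abs_def] by (intro expgrow_diff expgrow_mult expgrow_power expgrow_dot expgrow_const)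

lemma gmom_one_Nil: "gmom d one_seq w [] r = (if r = 0 then 1 else 0)"
  using prob_space.prob_space[OF prob_space_gauss_vec] by (simp add: gmom_def one_seq_def)

lemma dot_zero_right: "dot d b (\<lambda>_. 0) = 0"
  by (simp add: dot_def)

text \<open>Contractions inside the Wick product cancel. Its factors differentiate phi', except that
  one of them may be contracted with v . x instead; if none is, v . x differentiates as well. Every
  term keeps a factor a . w, so the integral vanishes for a orthogonal to w.\<close>

lemma integral_cubic_dsig:
  fixes d :: nat
  defines "m \<equiv> (\<lambda>r w. gmom d (\<lambda>r. dsig (Suc r)) w [] r)"
  shows "integral\<^sup>L (gauss_vec d) (\<lambda>x. dsig 1 (dot d w x) * dot d v x * cubic d a b x)
    = (dot d a w)\<^sup>2 * dot d b w * dot d v w * m 4 w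
     + m 2 w * ((dot d a w)\<^sup>2 * dot d b v + 2 * dot d a w * dot d b w * dot d a v)"
proof -
  let ?g = "gmom d (\<lambda>r. dsig (Suc r)) w"
  have e: "(\<lambda>x. dsig 1 (dot d w x) * dot d v x * cubic d a b x) = (\<lambda>x.
     lprod d [a, a, b, v] x * dsig (Suc 0) (dot d w x)
     - dot d a a * (lprod d [b, v] x * dsig (Suc 0) (dot d w x))
     - 2 * dot d a b * (lprod d [a, v] x * dsig (Suc 0) (dot d w x)))"
    by (rule ext) (simp add: cubic_def power2_eq_square algebra_simps)
  have "integral\<^sup>L (gauss_vec d) (\<lambda>x. dsig 1 (dot d w x) * dot d v x * cubic d a b x)
     = ?g [a, a, b, v] 0 - dot d a a * ?g [b, v] 0 - 2 * dot d a b * ?g [a, v] 0"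
    unfolding e gmom_def
    using dsig_stein.integrable_gmom[of d "[a, a, b, v]" 0 w] dsig_stein.integrable_gmom[of d "[b, v]" 0 w]
      dsig_stein.integrable_gmom[of d "[a, v]" 0 w]
    by (simp del: lprod_simps)
  also have "\<dots> = (dot d a w)\<^sup>2 * dot d b w * dot d v w * ?g [] 4
     + ?g [] 2 * ((dot d a w)\<^sup>2 * dot d b v + 2 * dot d a w * dot d b w * dot d a v)"
    by (simp add: dsig_stein.gmom_Cons eval_nat_numeral algebra_simps)
  finally show ?thesis unfolding m_def .
qed

text \<open>Only pairings across the two Wick products survive; of the 3! = 6, two match b with b'
  and four do not.\<close>

lemma integral_cubic_cubic:
  "integral\<^sup>L (gauss_vec d) (\<lambda>x. cubic d a b x * cubic d a' b' x)
    = 2 * (dot d a a')\<^sup>2 * dot d b b' + 4 * dot d a a' * dot d a b' * dot d b a'"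
proof -
  let ?g = "\<lambda>ls. gmom d one_seq (\<lambda>_. 0) ls 0"
  let ?l = "\<lambda>ls x. lprod d ls x * one_seq 0 (dot d (\<lambda>_. 0) x)"
  have e: "(\<lambda>x. cubic d a b x * cubic d a' b' x) = (\<lambda>x.
     ?l [a, a, b, a', a', b'] x - dot d a' a' * ?l [a, a, b, b'] x - 2 * dot d a' b' * ?l [a, a, b, a'] x
     - dot d a a * ?l [b, a', a', b'] x + dot d a a * dot d a' a' * ?l [b, b'] x + 2 * dot d a a * dot d a' b' * ?l [b, a'] x
     - 2 * dot d a b * ?l [a, a', a', b'] x + 2 * dot d a b * dot d a' a' * ?l [a, b'] x + 4 * dot d a b * dot d a' b' * ?l [a, a'] x)"
    by (rule ext) (simp add: cubic_def one_seq_def power2_eq_square algebra_simps)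
  have "integral\<^sup>L (gauss_vec d) (\<lambda>x. cubic d a b x * cubic d a' b' x) =
     ?g [a, a, b, a', a', b'] - dot d a' a' * ?g [a, a, b, b'] - 2 * dot d a' b' * ?g [a, a, b, a']
     - dot d a a * ?g [b, a', a', b'] + dot d a a * dot d a' a' * ?g [b, b'] + 2 * dot d a a * dot d a' b' * ?g [b, a']
     - 2 * dot d a b * ?g [a, a', a', b'] + 2 * dot d a b * dot d a' a' * ?g [a, b'] + 4 * dot d a b * dot d a' b' * ?g [a, a']"
    unfolding e gmom_def
    using one_stein.integrable_gmom[of d _ 0 "\<lambda>_. 0"]
    by (simp del: lprod_simps)
  also have "\<dots> = 2 * (dot d a a')\<^sup>2 * dot d b b' + 4 * dot d a a' * dot d a b' * dot d b a'"
  proof -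
    have g2: "?g [p, q] = dot d p q" for p q
      by (simp add: one_stein.gmom_Cons gmom_one_Nil dot_zero_right)
    have g4: "?g [p, q, r, t] = dot d p q * dot d r t + dot d p r * dot d q t + dot d p t * dot d q r" for p q r t
      by (subst one_stein.gmom_Cons) (simp add: g2 dot_zero_right)
    have g6: "?g [p, q, r, t, u, v] = dot d p q * ?g [r, t, u, v] + dot d p r * ?g [q, t, u, v]
       + dot d p t * ?g [q, r, u, v] + dot d p u * ?g [q, r, t, v] + dot d p v * ?g [q, r, t, u]" for p q r t u v
      by (subst one_stein.gmom_Cons) (simp add: dot_zero_right)
    show ?thesis
      unfolding g6 g4 g2 dot_commute[of d b a] dot_commute[of d a' b'] power2_eq_square
      by (simp add: dot_commute[of d b' a'] algebra_simps)
  qed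
  finally show ?thesis .
qed

lemma dot_sum_right: "dot d u (\<lambda>i. \<Sum>j\<in>J. c j * x j i) = (\<Sum>j\<in>J. c j * dot d u (x j))"
  by (subst dot_commute, unfold dot_sum_left) (simp add: dot_commute[of d u])

lemma sum_swap3: "(\<Sum>q\<in>A. \<Sum>r\<in>B. \<Sum>j\<in>C. g q r j) = (\<Sum>j\<in>C. \<Sum>q\<in>A. \<Sum>r\<in>B. g q r j)"
proof -
  have "(\<Sum>q\<in>A. \<Sum>r\<in>B. \<Sum>j\<in>C. g q r j) = (\<Sum>q\<in>A. \<Sum>j\<in>C. \<Sum>r\<in>B. g q r j)"
    by (intro sum.cong refl sum.swap)
  then show ?thesis by (simp add: sum.swap[of _ C A])
qed

text \<open>Take the third-order tensor with entries sum_j a_j(p) a_j(q) b_j(r), whose fibres are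
  \<open>Z q r\<close>. X is its squared norm and Y its product with a transposed copy, so Y \<le>
  X. Applying the bound s fibre by fibre gives X \<le> s sum_j |a_j|^2 |b_j|^2, so no factor K is
  lost. 6 = 2 + 4 counts the pairings.\<close>

lemma integral_cubic_sum_le:
  fixes a b :: "nat \<Rightarrow> nat \<Rightarrow> real"
  assumes s: "\<And>c. dot d (\<lambda>i. \<Sum>j<K. c j * a j i) (\<lambda>i. \<Sum>j<K. c j * a j i) \<le> s * (\<Sum>j<K. (c j)\<^sup>2)"
    and s0: "0 \<le> s"
  shows "integral\<^sup>L (gauss_vec d) (\<lambda>x. (\<Sum>j<K. cubic d (a j) (b j) x)\<^sup>2) \<le> 6 * s\<^sup>2 * (\<Sum>j<K. dot d (b j) (b j))"
proof -
  define X where "X = (\<Sum>j<K. \<Sum>k<K. (dot d (a j) (a k))\<^sup>2 * dot d (b j) (b k))"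
  define Y where "Y = (\<Sum>j<K. \<Sum>k<K. dot d (a j) (a k) * dot d (a j) (b k) * dot d (b j) (a k))"
  define Z where "Z q r = (\<lambda>i. \<Sum>j<K. (b j r * a j q) * a j i)" for q r
  have "integral\<^sup>L (gauss_vec d) (\<lambda>x. (\<Sum>j<K. cubic d (a j) (b j) x)\<^sup>2)
    = integral\<^sup>L (gauss_vec d) (\<lambda>x. \<Sum>j<K. \<Sum>k<K. cubic d (a j) (b j) x * cubic d (a k) (b k) x)"
    by (simp add: power2_eq_square sum_product)
  also have "\<dots> = (\<Sum>j<K. \<Sum>k<K. integral\<^sup>L (gauss_vec d) (\<lambda>x. cubic d (a j) (b j) x * cubic d (a k) (b k) x))"
  proof -
    have i: "integrable (gauss_vec d) (\<lambda>x. cubic d (a j) (b j) x * cubic d (a k) (b k) x)" for j k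
      by (intro expgrow_integrable expgrow_mult expgrow_cubic) measurable
    then show ?thesis by (simp add: Bochner_Integration.integral_sum Bochner_Integration.integrable_sum)
  qed
  also have "\<dots> = 2 * X + 4 * Y"
    unfolding integral_cubic_cubic X_def Y_def by (simp add: sum_distrib_left sum.distrib mult_ac)
  finally have E: "integral\<^sup>L (gauss_vec d) (\<lambda>x. (\<Sum>j<K. cubic d (a j) (b j) x)\<^sup>2) = 2 * X + 4 * Y" .
  have ZZ: "(\<Sum>q<d. \<Sum>r<d. dot d (\<lambda>i. \<Sum>j<K. f q r j * a j i) (\<lambda>i. \<Sum>k<K. g q r k * a k i))
     = (\<Sum>j<K. \<Sum>k<K. dot d (a j) (a k) * (\<Sum>q<d. \<Sum>r<d. f q r j * g q r k))" for f g
  proof -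
    have "(\<Sum>q<d. \<Sum>r<d. dot d (\<lambda>i. \<Sum>j<K. f q r j * a j i) (\<lambda>i. \<Sum>k<K. g q r k * a k i))
      = (\<Sum>q<d. \<Sum>r<d. \<Sum>j<K. \<Sum>k<K. dot d (a j) (a k) * (f q r j * g q r k))"
      unfolding dot_sum_left dot_sum_right by (simp add: sum_distrib_left mult_ac)
    also have "\<dots> = (\<Sum>j<K. \<Sum>q<d. \<Sum>r<d. \<Sum>k<K. dot d (a j) (a k) * (f q r j * g q r k))"
      by (rule sum_swap3)
    also have "\<dots> = (\<Sum>j<K. \<Sum>k<K. \<Sum>q<d. \<Sum>r<d. dot d (a j) (a k) * (f q r j * g q r k))"
      by (intro sum.cong refl sum_swap3)
    finally show ?thesis by (simp add: sum_distrib_left)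
  qed
  have X: "X = (\<Sum>q<d. \<Sum>r<d. dot d (Z q r) (Z q r))"
  proof -
    have "(\<Sum>q<d. \<Sum>r<d. b j r * a j q * (b k r * a k q)) = dot d (a j) (a k) * dot d (b j) (b k)" for j k
      unfolding dot_def sum_product by (intro sum.cong refl) (simp add: mult_ac)
    then show ?thesis unfolding Z_def ZZ X_def by (simp add: power2_eq_square mult_ac)
  qed
  have Y: "Y = (\<Sum>q<d. \<Sum>r<d. dot d (Z q r) (Z r q))"
  proof -
    have "(\<Sum>q<d. \<Sum>r<d. b j r * a j q * (b k q * a k r)) = dot d (a j) (b k) * dot d (b j) (a k)" for j k
      unfolding dot_def sum_product by (intro sum.cong refl) (simp add: mult_ac)
    then show ?thesis unfolding Z_def ZZ Y_def by (simp add: mult_ac)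
  qed
  have YX: "Y \<le> X"
  proof -
    have le: "dot d u w \<le> (dot d u u + dot d w w) / 2" for u w
      using dot_self_nonneg[of d "\<lambda>i. u i - w i"] dot_commute[of d w u]
      by (simp add: dot_diff_left dot_diff_right)
    have "Y \<le> (\<Sum>q<d. \<Sum>r<d. (dot d (Z q r) (Z q r) + dot d (Z r q) (Z r q)) / 2)"
      unfolding Y by (intro sum_mono le)
    also have "\<dots> = X / 2 + (\<Sum>q<d. \<Sum>r<d. dot d (Z r q) (Z r q)) / 2"
      unfolding X by (simp add: sum.distrib sum_divide_distrib add_divide_distrib)
    also have "(\<Sum>q<d. \<Sum>r<d. dot d (Z r q) (Z r q)) = X" unfolding X by (rule sum.swap)
    finally show ?thesis by simp
  qed
  have aj: "dot d (a j) (a j) \<le> s" if "j < K" for j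
  proof -
    have "(\<lambda>i. \<Sum>k<K. (if k = j then 1 else 0) * a k i) = a j"
      using that by (auto simp: fun_eq_iff if_distrib[of "\<lambda>c. c * _"] cong: if_cong)
    moreover have "(\<Sum>k<K. (if k = j then 1 else 0 :: real)\<^sup>2) = 1"
      using that by (simp add: if_distrib[of "\<lambda>c. c\<^sup>2"] cong: if_cong)
    ultimately show ?thesis using s[of "\<lambda>k. if k = j then 1 else 0"] by simp
  qed
  have "X \<le> (\<Sum>q<d. \<Sum>r<d. s * (\<Sum>j<K. (b j r * a j q)\<^sup>2))"
    unfolding X Z_def by (intro sum_mono s)
  also have "\<dots> = s * (\<Sum>q<d. \<Sum>r<d. \<Sum>j<K. (b j r)\<^sup>2 * (a j q)\<^sup>2)"
    by (simp add: sum_distrib_left power_mult_distrib)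
  also have "(\<Sum>q<d. \<Sum>r<d. \<Sum>j<K. (b j r)\<^sup>2 * (a j q)\<^sup>2) = (\<Sum>j<K. \<Sum>q<d. \<Sum>r<d. (b j r)\<^sup>2 * (a j q)\<^sup>2)"
    by (rule sum_swap3)
  also have "\<dots> = (\<Sum>j<K. dot d (a j) (a j) * dot d (b j) (b j))"
    unfolding dot_self sum_product by (simp add: mult_ac)
  also have "s * \<dots> \<le> s * (\<Sum>j<K. s * dot d (b j) (b j))"
    using aj s0 by (intro mult_left_mono sum_mono mult_right_mono) (auto simp: dot_self_nonneg)
  finally have "X \<le> s\<^sup>2 * (\<Sum>j<K. dot d (b j) (b j))" by (simp add: sum_distrib_left power2_eq_square mult.assoc)
  then show ?thesis using E YX by linarith
qed

subsection \<open>The two scalar constants\<close>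

lemma sinh_ge_self: "0 \<le> t \<Longrightarrow> t \<le> sinh t" for t :: real
proof -
  assume t: "0 \<le> t"
  have "(\<lambda>t. sinh t - t) 0 \<le> (\<lambda>t. sinh t - t) t"
  proof (rule DERIV_nonneg_imp_nondecreasing[OF t])
    fix x :: real
    show "\<exists>y. ((\<lambda>t. sinh t - t) has_real_derivative y) (at x) \<and> 0 \<le> y"
      by (intro exI[of _ "cosh x - 1"] conjI) (auto intro!: derivative_eq_intros simp: cosh_real_ge_1)
  qed
  then show ?thesis by simp
qed

text \<open>On the nonnegative half-line cosh t - t^2 / 2 is nondecreasing, since its derivative is
  sinh t - t; both terms are even.\<close>

lemma cosh_minus_cosh_ge:
  fixes a b :: real
  assumes "\<bar>a\<bar> \<le> \<bar>b\<bar>" shows "(b\<^sup>2 - a\<^sup>2) / 2 \<le> cosh b - cosh a"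
proof -
  have "(\<lambda>t. cosh t - t\<^sup>2 / 2) \<bar>a\<bar> \<le> (\<lambda>t. cosh t - t\<^sup>2 / 2) \<bar>b\<bar>"
  proof (rule DERIV_nonneg_imp_nondecreasing[OF assms])
    fix x :: real assume "\<bar>a\<bar> \<le> x"
    then have "0 \<le> x" by linarith
    then show "\<exists>y. ((\<lambda>t. cosh t - t\<^sup>2 / 2) has_real_derivative y) (at x) \<and> 0 \<le> y"
      using sinh_ge_self by (intro exI[of _ "sinh x - x"] conjI) (auto intro!: derivative_eq_intros)
  qed
  moreover have "cosh \<bar>x\<bar> = cosh x" for x :: real by (simp add: abs_if)
  ultimately show ?thesis by (simp add: diff_divide_distrib)
qed

text \<open>phi' decreases in t^2, so the product is nonpositive; the cosh form of phi' makes this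
  quantitative.\<close>

lemma dsig_1_chebyshev:
  "(t\<^sup>2 - b\<^sup>2) * (dsig 1 t - dsig 1 b) \<le> - ((t\<^sup>2 - b\<^sup>2)\<^sup>2 / (4 * (1 + cosh t) * (1 + cosh b)))"
proof -
  have c: "1 + cosh t > 0" "1 + cosh b > 0" using cosh_real_ge_1[of t] cosh_real_ge_1[of b] by linarith+
  have d: "dsig 1 t - dsig 1 b = (cosh b - cosh t) / (2 * (1 + cosh t) * (1 + cosh b))"
  proof -
    have "1 / (2 * x) - 1 / (2 * y) = (y - x) / (2 * x * y)" if "0 < x" "0 < y" for x y :: real
      using that by (simp add: field_simps)
    from this[OF c] show ?thesis unfolding dsig_1_eq_cosh by simp
  qed
  define X where "X = t\<^sup>2 - b\<^sup>2"
  have n: "X * (cosh b - cosh t) \<le> - (X\<^sup>2 / 2)"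
  proof (cases "\<bar>t\<bar> \<le> \<bar>b\<bar>")
    case True
    then have "X \<le> 0" by (simp add: X_def abs_le_square_iff)
    moreover have "- X / 2 \<le> cosh b - cosh t" using cosh_minus_cosh_ge[OF True] by (simp add: X_def)
    ultimately have "X * (cosh b - cosh t) \<le> X * (- X / 2)" by (rule mult_left_mono_neg[rotated])
    then show ?thesis by (simp add: power2_eq_square)
  next
    case False
    then have "0 \<le> X" by (simp add: X_def abs_le_square_iff[symmetric])
    moreover have "X / 2 \<le> cosh t - cosh b" using cosh_minus_cosh_ge[of b t] False by (simp add: X_def)
    ultimately have "X * (X / 2) \<le> X * (cosh t - cosh b)" by (rule mult_left_mono[rotated])
    then show ?thesis by (simp add: power2_eq_square right_diff_distrib)
  qed
  have "(t\<^sup>2 - b\<^sup>2) * (dsig 1 t - dsig 1 b) = ((t\<^sup>2 - b\<^sup>2) * (cosh b - cosh t)) / (2 * (1 + cosh t) * (1 + cosh b))"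
    unfolding d by simp
  also have "\<dots> \<le> (- ((t\<^sup>2 - b\<^sup>2)\<^sup>2 / 2)) / (2 * (1 + cosh t) * (1 + cosh b))"
    using n[unfolded X_def] c by (intro divide_right_mono) auto
  also have "\<dots> = - ((t\<^sup>2 - b\<^sup>2)\<^sup>2 / (4 * (1 + cosh t) * (1 + cosh b)))"
  proof -
    have "(- (Y / 2)) / (2 * u * v) = - (Y / (4 * u * v))" for Y u v :: real by (simp add: mult.assoc)
    then show ?thesis .
  qed
  finally show ?thesis .
qed

text \<open>The Chebyshev defect of \<open>dsig_1_chebyshev\<close> at \<open>b = sqrt m\<close>, weighted by \<open>z ^ (2 * j)\<close>. By Stein's
  identity the coefficients in \<open>dsig_moment_bounds\<close> are expectations of \<open>z ^ (2 * j) * (z\<^sup>2 - m)\<close> times the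
  derivative of the sigmoid; the former has mean zero for \<open>(j, m) = (0, 1)\<close> and \<open>(1, 3)\<close>.\<close>

definition gap :: "nat \<Rightarrow> real \<Rightarrow> real \<Rightarrow> real" where
  "gap j m z = z ^ (2 * j) * (z\<^sup>2 - m)\<^sup>2 / (4 * (1 + cosh z) * (1 + cosh (sqrt m)))"

lemma one_plus_cosh_pos: "0 < 1 + cosh x" for x :: real
  using cosh_real_ge_1[of x] by linarith

lemma gap_nonneg: "0 \<le> gap j m z"
  unfolding gap_def using one_plus_cosh_pos[of z] one_plus_cosh_pos[of "sqrt m"] by (intro divide_nonneg_pos) auto

lemma measurable_gap [measurable]: "gap j m \<in> borel_measurable borel"
proof -
  have "continuous_on UNIV (gap j m)"
    unfolding gap_def[abs_def]
  proof (intro continuous_intros ballI)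
    fix z :: real
    have "0 < 4 * (1 + cosh z) * (1 + cosh (sqrt m))" using one_plus_cosh_pos[of z] one_plus_cosh_pos[of "sqrt m"] by (intro mult_pos_pos) auto
    then show "4 * (1 + cosh z) * (1 + cosh (sqrt m)) \<noteq> 0" by linarith
  qed
  then show ?thesis by (rule borel_measurable_continuous_onI)
qed

lemma integrable_gauss1_expgrow:
  assumes "expgrow 1 (\<lambda>x. f (x 0))" "f \<in> borel_measurable borel"
  shows "integrable gauss1 (f :: real \<Rightarrow> real)"
proof -
  have e: "dot 1 (\<lambda>_. 1) = (\<lambda>x. x 0)" by (rule ext) (simp add: dot_def)
  have s: "sqrt (dot 1 (\<lambda>_. 1) (\<lambda>_. 1)) = 1" by (simp add: dot_def)
  have "integrable (gauss_vec 1) (\<lambda>x. f (dot 1 (\<lambda>_. 1) x))"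
    using assms by (intro expgrow_integrable) (simp_all add: e del: One_nat_def)
  then show ?thesis using integrable_gauss_dot[OF assms(2), of 1 "\<lambda>_. 1"] unfolding s by simp
qed

lemma gap_le: "gap j m z \<le> z ^ (2 * j) * (z\<^sup>2 - m)\<^sup>2"
proof -
  have "1 * 1 * 1 \<le> 4 * (1 + cosh z) * (1 + cosh (sqrt m))"
    using cosh_real_ge_1[of z] cosh_real_ge_1[of "sqrt m"] by (intro mult_mono) auto
  moreover have "0 \<le> z ^ (2 * j) * (z\<^sup>2 - m)\<^sup>2" by (simp add: power_mult)
  ultimately have "z ^ (2 * j) * (z\<^sup>2 - m)\<^sup>2 / (4 * (1 + cosh z) * (1 + cosh (sqrt m))) \<le> z ^ (2 * j) * (z\<^sup>2 - m)\<^sup>2 / 1"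
    by (intro divide_left_mono) auto
  then show ?thesis unfolding gap_def by simp
qed

lemma expgrow_gap: "expgrow d (\<lambda>x. gap j m (f x))" if "expgrow d f" for f
proof -
  have "expgrow d (\<lambda>x. (f x) ^ (2 * j) * ((f x)\<^sup>2 - m)\<^sup>2)"
    using that by (intro expgrow_mult expgrow_power expgrow_diff expgrow_const)
  then show ?thesis
    by (rule expgrow_mono) (use gap_le gap_nonneg in \<open>auto intro: order_trans[OF _ abs_ge_self]\<close>)
qed

lemma integrable_gap: "integrable gauss1 (gap j m)"
  by (intro integrable_gauss1_expgrow expgrow_gap expgrow_component) auto

text \<open>\<open>gap j m\<close> can vanish only at 0 and at the two square roots of m, a null
  set.\<close>

lemma integral_gap_pos:
  assumes "0 \<le> m" shows "0 < integral\<^sup>L gauss1 (gap j m)"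
proof -
  have nn: "0 \<le> integral\<^sup>L gauss1 (gap j m)" using gap_nonneg by simp
  have "integral\<^sup>L gauss1 (gap j m) \<noteq> 0"
  proof
    assume "integral\<^sup>L gauss1 (gap j m) = 0"
    then have "AE z in gauss1. gap j m z = 0"
      using integral_nonneg_eq_0_iff_AE[OF integrable_gap] gap_nonneg by simp
    then have "AE z in lborel. gap j m z = 0"
      by (subst (asm) AE_density) (auto simp: std_normal_density_def)
    moreover have "AE z in lborel. z \<noteq> 0" "AE z in lborel. z \<noteq> sqrt m" "AE z in lborel. z \<noteq> - sqrt m"
      by (rule AE_lborel_singleton)+
    ultimately have "AE z in (lborel :: real measure). False"
    proof eventually_elim
      case (elim z)
      have "z\<^sup>2 \<noteq> m"
      proof
        assume "z\<^sup>2 = m"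
        then have "\<bar>z\<bar> = sqrt m" by (metis real_sqrt_abs)
        then show False using elim(3,4) by (auto simp: abs_if split: if_splits)
      qed
      then show False using elim(1,2) one_plus_cosh_pos[of z] one_plus_cosh_pos[of "sqrt m"] unfolding gap_def by auto
    qed
    then have "emeasure lborel (UNIV :: real set) = 0" by (simp add: AE_iff_measurable[OF _ refl])
    then show False by simp
  qed
  then show ?thesis using nn by simp
qed

text \<open>The absolute constant behind the fully connected lower bound; it depends on neither the
  dimensions nor the weights.\<close>

definition gap0 :: real where
  "gap0 = min (integral\<^sup>L gauss1 (gap 0 1)) (integral\<^sup>L gauss1 (gap 1 3))"

lemma gap0_pos: "0 < gap0"
  unfolding gap0_def using integral_gap_pos[of 1 0] integral_gap_pos[of 3 1] by simp

text \<open>Write w . x = s z with s \<le> 1. As cosh (s z) \<le> cosh z, the denominators may be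
  replaced by those at s = 1, which makes the constant uniform in w. The power of
  \<open>dot d w w\<close> matches the one that Stein's identity produces in
  \<open>dsig_moment_bounds\<close>, where it cancels however small w is.\<close>

lemma gap_scaled_le:
  fixes w :: "nat \<Rightarrow> real"
  assumes w: "dot d w w \<le> 1" and m: "0 \<le> m"
  shows "integral\<^sup>L (gauss_vec d) (\<lambda>x. (dot d w x) ^ (2 * j) * (((dot d w x)\<^sup>2 - m * dot d w w) * (dsig 1 (dot d w x) - dsig 1 (sqrt (m * dot d w w)))))
     \<le> - (dot d w w ^ (j + 2) * integral\<^sup>L gauss1 (gap j m))"
proof -
  define s where "s = sqrt (dot d w w)"
  have s: "0 \<le> s" "s \<le> 1" "s\<^sup>2 = dot d w w" unfolding s_def using w dot_self_nonneg[of d w] by auto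
  define f where "f t = t ^ (2 * j) * ((t\<^sup>2 - m * dot d w w) * (dsig 1 t - dsig 1 (sqrt (m * dot d w w))))" for t
  have [measurable]: "f \<in> borel_measurable borel" unfolding f_def[abs_def] by measurable
  have pt: "f (s * z) \<le> - (dot d w w ^ (j + 2) * gap j m z)" for z
  proof -
    define b where "b = s * sqrt m"
    have b: "sqrt (m * dot d w w) = b" "m * dot d w w = b\<^sup>2" "b\<^sup>2 = s\<^sup>2 * m"
      unfolding b_def s_def using m dot_self_nonneg[of d w] by (auto simp: real_sqrt_mult power_mult_distrib mult_ac)
    have sq: "(s * z)\<^sup>2 - b\<^sup>2 = s\<^sup>2 * (z\<^sup>2 - m)" unfolding b(3) by (simp add: power_mult_distrib algebra_simps)
    have c1: "cosh (s * z) \<le> cosh z"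
    proof -
      have "\<bar>s * z\<bar> \<le> \<bar>z\<bar>" unfolding abs_mult using s by (simp add: mult_left_le_one_le)
      from cosh_minus_cosh_ge[OF this] have "(z\<^sup>2 - (s * z)\<^sup>2) / 2 \<le> cosh z - cosh (s * z)" .
      moreover have "(s * z)\<^sup>2 \<le> z\<^sup>2" using \<open>\<bar>s * z\<bar> \<le> \<bar>z\<bar>\<close> by (simp add: abs_le_square_iff)
      ultimately show ?thesis by simp
    qed
    have c2: "cosh b \<le> cosh (sqrt m)"
    proof -
      have "\<bar>b\<bar> \<le> \<bar>sqrt m\<bar>" unfolding b_def abs_mult using s by (simp add: mult_left_le_one_le)
      from cosh_minus_cosh_ge[OF this] have "((sqrt m)\<^sup>2 - b\<^sup>2) / 2 \<le> cosh (sqrt m) - cosh b" .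
      moreover have "b\<^sup>2 \<le> (sqrt m)\<^sup>2" using \<open>\<bar>b\<bar> \<le> \<bar>sqrt m\<bar>\<close> by (simp only: abs_le_square_iff)
      ultimately show ?thesis by simp
    qed
    have den: "4 * (1 + cosh (s * z)) * (1 + cosh b) \<le> 4 * (1 + cosh z) * (1 + cosh (sqrt m))"
      using c1 c2 one_plus_cosh_pos[of "s * z"] one_plus_cosh_pos[of b] by (intro mult_mono) auto
    have "((s * z)\<^sup>2 - b\<^sup>2) * (dsig 1 (s * z) - dsig 1 b) \<le> - (((s * z)\<^sup>2 - b\<^sup>2)\<^sup>2 / (4 * (1 + cosh (s * z)) * (1 + cosh b)))"
      by (rule dsig_1_chebyshev)
    also have "\<dots> \<le> - (((s * z)\<^sup>2 - b\<^sup>2)\<^sup>2 / (4 * (1 + cosh z) * (1 + cosh (sqrt m))))"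
      using den one_plus_cosh_pos[of "s * z"] one_plus_cosh_pos[of b] one_plus_cosh_pos[of z] one_plus_cosh_pos[of "sqrt m"]
      by (intro le_imp_neg_le divide_left_mono mult_pos_pos) auto
    finally have "f (s * z) \<le> (s * z) ^ (2 * j) * (- (((s * z)\<^sup>2 - b\<^sup>2)\<^sup>2 / (4 * (1 + cosh z) * (1 + cosh (sqrt m)))))"
      unfolding f_def b(1) unfolding b(2) by (intro mult_left_mono) (simp_all add: power_mult)
    also have "\<dots> = - ((s\<^sup>2) ^ (j + 2) * gap j m z)"
      unfolding sq gap_def by (simp add: power_mult_distrib power_mult power_add)
    finally show ?thesis unfolding s(3) .
  qed
  have ig: "integrable (gauss_vec d) (\<lambda>x. f (dot d w x))"
    unfolding f_def by (intro expgrow_integrable expgrow_mult expgrow_power expgrow_diff expgrow_dot expgrow_const expgrow_dsig) measurable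
  have ig1: "integrable gauss1 (\<lambda>z. f (s * z))"
    using ig integrable_gauss_dot[of f d w] unfolding s_def by simp
  have "integral\<^sup>L (gauss_vec d) (\<lambda>x. f (dot d w x)) = integral\<^sup>L gauss1 (\<lambda>z. f (s * z))"
    unfolding s_def by (rule integral_gauss_dot) measurable
  also have "\<dots> \<le> integral\<^sup>L gauss1 (\<lambda>z. - (dot d w w ^ (j + 2) * gap j m z))"
    using integrable_gap[of j m] by (intro integral_mono[OF ig1 _ pt]) simp
  also have "\<dots> = - (dot d w w ^ (j + 2) * integral\<^sup>L gauss1 (gap j m))" using integrable_gap[of j m] by simp
  finally show ?thesis unfolding f_def .
qed

text \<open>Stein's identity read backwards, with t = w . x: \<open>s2 ^ 2 * m 2\<close> is the mean
  of (t^2 - s2) phi'(t), and the second combination times \<open>s2 ^ 3\<close> is that of (t^4 - 3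
  s2 t^2) phi'(t). In the main estimate the first is the coefficient of |v_j|^2 and the second the
  denominator of \<open>\<mu> j\<close>.\<close>

lemma dsig_moment_bounds:
  fixes w :: "nat \<Rightarrow> real" and d :: nat
  assumes w: "0 < dot d w w" "dot d w w \<le> 1"
  defines "m \<equiv> gmom d (\<lambda>r. dsig (Suc r)) w []"
  shows "m 2 \<le> - gap0" "3 * m 2 + dot d w w * m 4 \<le> - gap0"
proof -
  define s2 where "s2 = dot d w w"
  let ?g = "gmom d (\<lambda>r. dsig (Suc r)) w"
  let ?l = "\<lambda>ls x. lprod d ls x * dsig (Suc 0) (dot d w x)"
  let ?o = "\<lambda>ls x. lprod d ls x * one_seq 0 (dot d (\<lambda>_. 0) x)"
  let ?h = "\<lambda>ls. gmom d one_seq (\<lambda>_. 0) ls 0"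
  have "s2 ^ 2 * m 2 = ?g [w, w] 0 - s2 * ?g [] 0"
    unfolding m_def s2_def by (simp add: dsig_stein.gmom_Cons eval_nat_numeral algebra_simps)
  \<comment> \<open>The polynomial has Gaussian mean 0, so a constant multiple of it may be
    subtracted; taking phi' at the root of the polynomial as the constant gives the integrand one
    sign.\<close>
  also have "\<dots> = ?g [w, w] 0 - s2 * ?g [] 0 - dsig 1 (sqrt (1 * s2)) * (?h [w, w] - s2 * ?h [])"
    by (simp add: one_stein.gmom_Cons gmom_one_Nil dot_zero_right s2_def)
  also have "\<dots> = integral\<^sup>L (gauss_vec d) (\<lambda>x. ?l [w, w] x - s2 * ?l [] x - dsig 1 (sqrt (1 * s2)) * (?o [w, w] x - s2 * ?o [] x))"
    unfolding gmom_def
    using dsig_stein.integrable_gmom[of d _ 0 w] one_stein.integrable_gmom[of d _ 0 "\<lambda>_. 0"]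
    by (simp del: lprod_simps)
  also have "\<dots> = integral\<^sup>L (gauss_vec d) (\<lambda>x. (dot d w x) ^ (2 * 0) * (((dot d w x)\<^sup>2 - 1 * dot d w w) * (dsig 1 (dot d w x) - dsig 1 (sqrt (1 * dot d w w)))))"
    by (intro Bochner_Integration.integral_cong refl) (simp add: s2_def one_seq_def power2_eq_square algebra_simps)
  also have "\<dots> \<le> - (dot d w w ^ (0 + 2) * integral\<^sup>L gauss1 (gap 0 1))"
    by (rule gap_scaled_le[OF w(2)]) simp
  also have "\<dots> \<le> - (s2 ^ 2 * gap0)"
  proof -
    have "s2 ^ 2 * gap0 \<le> s2 ^ 2 * integral\<^sup>L gauss1 (gap 0 1)"
      by (rule mult_left_mono) (simp_all add: gap0_def)
    moreover have "dot d w w ^ (0 + 2) = s2 ^ 2" by (simp only: s2_def add_0)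
    ultimately show ?thesis by simp
  qed
  finally have "s2 ^ 2 * m 2 \<le> s2 ^ 2 * (- gap0)" by simp
  then show "m 2 \<le> - gap0" by (rule mult_left_le_imp_le) (use w in \<open>simp add: s2_def\<close>)
  have "s2 ^ 3 * (3 * m 2 + s2 * m 4) = ?g [w, w, w, w] 0 - 3 * s2 * ?g [w, w] 0"
    unfolding m_def s2_def by (simp add: dsig_stein.gmom_Cons eval_nat_numeral algebra_simps)
  also have "\<dots> = ?g [w, w, w, w] 0 - 3 * s2 * ?g [w, w] 0 - dsig 1 (sqrt (3 * s2)) * (?h [w, w, w, w] - 3 * s2 * ?h [w, w])"
    by (simp add: one_stein.gmom_Cons gmom_one_Nil dot_zero_right s2_def)
  also have "\<dots> = integral\<^sup>L (gauss_vec d) (\<lambda>x. ?l [w, w, w, w] x - 3 * s2 * ?l [w, w] x - dsig 1 (sqrt (3 * s2)) * (?o [w, w, w, w] x - 3 * s2 * ?o [w, w] x))"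
    unfolding gmom_def
    using dsig_stein.integrable_gmom[of d _ 0 w] one_stein.integrable_gmom[of d _ 0 "\<lambda>_. 0"]
    by (simp del: lprod_simps)
  also have "\<dots> = integral\<^sup>L (gauss_vec d) (\<lambda>x. (dot d w x) ^ (2 * 1) * (((dot d w x)\<^sup>2 - 3 * dot d w w) * (dsig 1 (dot d w x) - dsig 1 (sqrt (3 * dot d w w)))))"
    by (intro Bochner_Integration.integral_cong refl) (simp add: s2_def one_seq_def power2_eq_square algebra_simps)
  also have "\<dots> \<le> - (dot d w w ^ (1 + 2) * integral\<^sup>L gauss1 (gap 1 3))"
    by (rule gap_scaled_le[OF w(2)]) simp
  also have "\<dots> \<le> - (s2 ^ 3 * gap0)"
  proof -
    have "s2 ^ 3 * gap0 \<le> s2 ^ 3 * integral\<^sup>L gauss1 (gap 1 3)"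
      using w by (intro mult_left_mono) (simp_all add: gap0_def s2_def)
    moreover have "dot d w w ^ (1 + 2) = s2 ^ 3" by (simp add: s2_def eval_nat_numeral)
    ultimately show ?thesis by simp
  qed
  finally have "s2 ^ 3 * (3 * m 2 + s2 * m 4) \<le> s2 ^ 3 * (- gap0)" by simp
  then show "3 * m 2 + dot d w w * m 4 \<le> - gap0"
    unfolding s2_def[symmetric] by (rule mult_left_le_imp_le) (use w in \<open>simp add: s2_def\<close>)
qed

lemma gmom_dsig_bounded: "\<exists>B\<ge>0. \<forall>d w. \<bar>gmom d (\<lambda>r. dsig (Suc r)) w [] r\<bar> \<le> B"
proof -
  obtain B where B: "\<And>x. \<bar>dsig (Suc r) x\<bar> \<le> B" using dsig_bounded by blast
  have "\<bar>gmom d (\<lambda>r. dsig (Suc r)) w [] r\<bar> \<le> B" for d w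
  proof -
    interpret prob_space "gauss_vec d" by (rule prob_space_gauss_vec)
    have i: "integrable (gauss_vec d) (\<lambda>x. dsig (Suc r) (dot d w x))"
      by (intro expgrow_integrable expgrow_dsig) measurable
    have "\<bar>gmom d (\<lambda>r. dsig (Suc r)) w [] r\<bar> \<le> integral\<^sup>L (gauss_vec d) (\<lambda>x. \<bar>dsig (Suc r) (dot d w x)\<bar>)"
      unfolding gmom_def by simp
    also have "\<dots> \<le> integral\<^sup>L (gauss_vec d) (\<lambda>x. B)" using i B by (intro integral_mono) auto
    finally show ?thesis by (simp add: prob_space)
  qed
  moreover have "0 \<le> B" using B[of 0] by linarith
  ultimately show ?thesis by blast
qed

text \<open>In the application s is 1 / sigma_K^2, which bounds the Gram matrix of the dual vectors,
  and \<kappa>2 is the squared condition number. The latter pays for the component of b_j along a_j,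
  whose square is of order |w_j|^2 |a_j|^2 |v_j|^2.\<close>

theorem grad_sum_square_lower_bound:
  "\<exists>c>0. \<forall>(d::nat) (K::nat) W V a s \<kappa>2.
     (\<forall>j<K. dot d (wcol W j) (wcol W j) \<le> 1) \<longrightarrow>
     (\<forall>j<K. \<forall>k<K. dot d (a j) (wcol W k) = (if j = k then 1 else 0)) \<longrightarrow>
     (\<forall>c. dot d (\<lambda>i. \<Sum>j<K. c j * a j i) (\<lambda>i. \<Sum>j<K. c j * a j i) \<le> s * (\<Sum>j<K. (c j)\<^sup>2)) \<longrightarrow>
     0 < s \<longrightarrow> 1 \<le> \<kappa>2 \<longrightarrow> (\<forall>j<K. dot d (wcol W j) (wcol W j) * s \<le> \<kappa>2) \<longrightarrow>
     c / (s\<^sup>2 * \<kappa>2) * fro2 d K V \<le> integral\<^sup>L (gauss_vec d) (\<lambda>x. (grad_sum d K W V x)\<^sup>2)"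
proof -
  obtain B2 where B2: "B2 \<ge> 0" "\<And>d w. \<bar>gmom d (\<lambda>r. dsig (Suc r)) w [] 2\<bar> \<le> B2" using gmom_dsig_bounded by blast
  obtain B4 where B4: "B4 \<ge> 0" "\<And>d w. \<bar>gmom d (\<lambda>r. dsig (Suc r)) w [] 4\<bar> \<le> B4" using gmom_dsig_bounded by blast
  \<comment> \<open>The 3 comes from splitting b_j into three summands. The other terms bound its
    parts along a_j and w_j, using that \<open>\<mu> j\<close> is at most |w_j| |v_j| / gap0 in
    size.\<close>
  define C where "C = 3 * (1 + (4 * B2\<^sup>2 + B4\<^sup>2) / gap0\<^sup>2)"
  have C: "C > 0" unfolding C_def using gap0_pos by (intro mult_pos_pos add_pos_nonneg) auto
  show ?thesis
  proof (rule exI[of _ "gap0\<^sup>2 / (6 * C)"], intro conjI allI impI)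
    show "0 < gap0\<^sup>2 / (6 * C)" using gap0_pos C by simp
    fix d K :: nat and W V :: "nat \<times> nat \<Rightarrow> real" and a :: "nat \<Rightarrow> nat \<Rightarrow> real" and s \<kappa>2 :: real
    assume W: "\<forall>j<K. dot d (wcol W j) (wcol W j) \<le> 1"
      and dual: "\<forall>j<K. \<forall>k<K. dot d (a j) (wcol W k) = (if j = k then 1 else 0)"
      and s: "\<forall>c. dot d (\<lambda>i. \<Sum>j<K. c j * a j i) (\<lambda>i. \<Sum>j<K. c j * a j i) \<le> s * (\<Sum>j<K. (c j)\<^sup>2)"
      and s0: "0 < s" and \<kappa>2: "1 \<le> \<kappa>2" "\<forall>j<K. dot d (wcol W j) (wcol W j) * s \<le> \<kappa>2"
    define w where "w = wcol W"
    define v where "v = wcol V"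
    define c2 where "c2 j = gmom d (\<lambda>r. dsig (Suc r)) (w j) [] 2" for j
    define c4 where "c4 j = gmom d (\<lambda>r. dsig (Suc r)) (w j) [] 4" for j
    \<comment> \<open>\<open>b\<close> cancels the terms along \<open>a j\<close> and \<open>w j\<close> in \<open>integral_cubic_dsig\<close>; pairing the equation for \<open>b j\<close>
      with \<open>w j\<close> determines \<open>\<mu> j\<close>.\<close>
    define \<mu> where "\<mu> j = dot d (w j) (v j) / (3 * c2 j + dot d (w j) (w j) * c4 j)" for j
    define b where "b j = (\<lambda>i. v j i - \<mu> j * (2 * c2 j * a j i + c4 j * w j i))" for j
    define h where "h x = (\<Sum>j<K. cubic d (a j) (b j) x)" for x
    define F where "F = grad_sum d K W V"
    define f where "f = fro2 d K V"
    have fv: "f = (\<Sum>j<K. dot d (v j) (v j))" unfolding f_def fro2_col v_def ..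
    have aj: "dot d (a j) (a j) \<le> s" if "j < K" for j
    proof -
      have "(\<lambda>i. \<Sum>k<K. (if k = j then 1 else 0) * a k i) = a j"
        using that by (auto simp: fun_eq_iff if_distrib[of "\<lambda>c. c * _"] cong: if_cong)
      moreover have "(\<Sum>k<K. (if k = j then 1 else 0 :: real)\<^sup>2) = 1"
        using that by (simp add: if_distrib[of "\<lambda>c. c\<^sup>2"] cong: if_cong)
      ultimately show ?thesis using s[rule_format, of "\<lambda>k. if k = j then 1 else 0"] by simp
    qed
    have ww: "0 < dot d (w j) (w j)" "dot d (w j) (w j) \<le> 1" if j: "j < K" for j
    proof -
      show "dot d (w j) (w j) \<le> 1" using W j unfolding w_def by simp
      have "\<bar>dot d (a j) (w j)\<bar> \<le> sqrt (dot d (a j) (a j)) * sqrt (dot d (w j) (w j))" by (rule abs_dot_le)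
      moreover have "dot d (a j) (w j) = 1" using dual j unfolding w_def by simp
      ultimately have "dot d (w j) (w j) \<noteq> 0" by auto
      then show "0 < dot d (w j) (w j)" using dot_self_nonneg[of d "w j"] by simp
    qed
    have cc: "c2 j \<le> - gap0" "3 * c2 j + dot d (w j) (w j) * c4 j \<le> - gap0" if "j < K" for j
      using dsig_moment_bounds[OF ww[OF that]] unfolding c2_def c4_def by auto
    have EFh: "integral\<^sup>L (gauss_vec d) (\<lambda>x. F x * h x) = (\<Sum>j<K. c2 j * dot d (v j) (v j))"
    proof -
      have i: "integrable (gauss_vec d) (\<lambda>x. dsig 1 (dot d (w k) x) * dot d (v k) x * cubic d (a j) (b j) x)" for j k
        by (intro expgrow_integrable expgrow_mult expgrow_cubic expgrow_dsig expgrow_dot) measurable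
      have "integral\<^sup>L (gauss_vec d) (\<lambda>x. F x * h x) = integral\<^sup>L (gauss_vec d)
         (\<lambda>x. \<Sum>k<K. \<Sum>j<K. dsig 1 (dot d (w k) x) * dot d (v k) x * cubic d (a j) (b j) x)"
        unfolding F_def grad_sum_def h_def pre_def w_def v_def sum_product ..
      also have "\<dots> = (\<Sum>k<K. \<Sum>j<K. integral\<^sup>L (gauss_vec d) (\<lambda>x. dsig 1 (dot d (w k) x) * dot d (v k) x * cubic d (a j) (b j) x))"
        using i by (simp add: Bochner_Integration.integral_sum Bochner_Integration.integrable_sum del: One_nat_def)
      also have "\<dots> = (\<Sum>k<K. \<Sum>j<K. if j = k then c2 k * dot d (v k) (v k) else 0)"
      proof (intro sum.cong refl)
        fix k j assume "k \<in> {..<K}" "j \<in> {..<K}"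
        then have k: "k < K" and j: "j < K" by auto
        show "integral\<^sup>L (gauss_vec d) (\<lambda>x. dsig 1 (dot d (w k) x) * dot d (v k) x * cubic d (a j) (b j) x)
           = (if j = k then c2 k * dot d (v k) (v k) else 0)"
        proof (cases "j = k")
          case False
          then have "dot d (a j) (w k) = 0" using dual j k unfolding w_def by simp
          then show ?thesis using False unfolding integral_cubic_dsig by simp
        next
          case True
          have 1: "dot d (a k) (w k) = 1" using dual k unfolding w_def by simp
          define N where "N = 3 * c2 k + dot d (w k) (w k) * c4 k"
          have N: "N \<noteq> 0" using cc(2)[OF k] gap0_pos unfolding N_def by linarith
          have \<mu>: "dot d (w k) (v k) = \<mu> k * N" unfolding \<mu>_def N_def[symmetric] using N by simp
          have bw: "dot d (b k) (w k) = \<mu> k * c2 k"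
            unfolding b_def dot_diff_left dot_scale_left dot_add_left
            using \<mu> 1 by (simp add: dot_scale_left dot_commute[of d "v k"] N_def algebra_simps)
          have bv: "dot d (b k) (v k) = dot d (v k) (v k) - \<mu> k * (2 * c2 k * dot d (a k) (v k) + c4 k * dot d (w k) (v k))"
            unfolding b_def dot_diff_left dot_scale_left dot_add_left by simp
          show ?thesis unfolding True integral_cubic_dsig 1 bw bv c2_def[symmetric] c4_def[symmetric]
            by (simp add: dot_commute[of d "v k" "w k"] algebra_simps)
        qed
      qed
      also have "\<dots> = (\<Sum>j<K. c2 j * dot d (v j) (v j))" by simp
      finally show ?thesis .
    qed
    have G: "gap0 * f \<le> - integral\<^sup>L (gauss_vec d) (\<lambda>x. F x * h x)"
    proof -
      have "(\<Sum>j<K. c2 j * dot d (v j) (v j)) \<le> (\<Sum>j<K. - gap0 * dot d (v j) (v j))"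
        using cc by (intro sum_mono mult_right_mono) (auto simp: dot_self_nonneg)
      then show ?thesis unfolding EFh fv by (simp add: sum_distrib_left sum_negf)
    qed
    have bb: "dot d (b j) (b j) \<le> C * \<kappa>2 * dot d (v j) (v j)" if j: "j < K" for j
    proof -
      define vv where "vv = dot d (v j) (v j)"
      define wj where "wj = dot d (w j) (w j)"
      define aa where "aa = dot d (a j) (a j)"
      have nn: "0 \<le> vv" "0 < wj" "0 \<le> aa" "wj \<le> 1" unfolding vv_def wj_def aa_def using ww[OF j] by (auto simp: dot_self_nonneg)
      have \<mu>2: "(\<mu> j)\<^sup>2 \<le> wj * vv / gap0\<^sup>2"
      proof -
        have "(dot d (w j) (v j))\<^sup>2 \<le> wj * vv"
          using power_mono[OF abs_dot_le[of d "w j" "v j"] abs_ge_zero, of 2] unfolding wj_def vv_def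
          by (simp add: power_mult_distrib dot_self_nonneg)
        moreover have "gap0\<^sup>2 \<le> (3 * c2 j + wj * c4 j)\<^sup>2"
proof -
          have "gap0 \<le> \<bar>3 * c2 j + wj * c4 j\<bar>" using cc(2)[OF j] gap0_pos unfolding wj_def by linarith
          from power_mono[OF this, of 2] show ?thesis using gap0_pos by simp
        qed
        ultimately show ?thesis unfolding \<mu>_def power_divide wj_def[symmetric]
          using gap0_pos nn by (intro frac_le) auto
      qed
      have tri: "dot d (\<lambda>i. x i - m * (p * y i + q * z i)) (\<lambda>i. x i - m * (p * y i + q * z i))
         \<le> 3 * (dot d x x + m\<^sup>2 * (p\<^sup>2 * dot d y y) + m\<^sup>2 * (q\<^sup>2 * dot d z z))" for x y z m p q
      proof -
        have "(X - m * (p * Y + q * Z))\<^sup>2 \<le> 3 * (X\<^sup>2 + m\<^sup>2 * (p\<^sup>2 * Y\<^sup>2) + m\<^sup>2 * (q\<^sup>2 * Z\<^sup>2))" for X Y Z :: real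
        proof -
          have "(A - B - D)\<^sup>2 \<le> 3 * (A\<^sup>2 + B\<^sup>2 + D\<^sup>2)" for A B D :: real
          proof -
            have "0 \<le> (A + B)\<^sup>2 + (A + D)\<^sup>2 + (B - D)\<^sup>2" by simp
            then show ?thesis by (simp add: power2_eq_square algebra_simps)
          qed
          from this[of X "m * p * Y" "m * q * Z"] show ?thesis by (simp add: power_mult_distrib algebra_simps)
        qed
        then have "(\<Sum>i<d. (x i - m * (p * y i + q * z i))\<^sup>2) \<le> (\<Sum>i<d. 3 * ((x i)\<^sup>2 + m\<^sup>2 * (p\<^sup>2 * (y i)\<^sup>2) + m\<^sup>2 * (q\<^sup>2 * (z i)\<^sup>2)))"
          by (intro sum_mono)
        then show ?thesis unfolding dot_self by (simp add: sum.distrib sum_distrib_left algebra_simps)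
      qed
      have "dot d (b j) (b j) \<le> 3 * (vv + (\<mu> j)\<^sup>2 * ((2 * c2 j)\<^sup>2 * aa) + (\<mu> j)\<^sup>2 * ((c4 j)\<^sup>2 * wj))"
        unfolding b_def vv_def aa_def wj_def by (rule tri)
      also have "\<dots> \<le> 3 * (vv + (wj * vv / gap0\<^sup>2) * ((4 * B2\<^sup>2) * aa) + (wj * vv / gap0\<^sup>2) * (B4\<^sup>2 * wj))"
      proof -
        have "(2 * c2 j)\<^sup>2 \<le> 4 * B2\<^sup>2" using power_mono[OF B2(2)[of d "w j"] abs_ge_zero, of 2] unfolding c2_def by (simp add: power_mult_distrib)
        moreover have "(c4 j)\<^sup>2 \<le> B4\<^sup>2" using power_mono[OF B4(2)[of d "w j"] abs_ge_zero, of 2] unfolding c4_def by simp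
        ultimately show ?thesis using \<mu>2 nn by (intro mult_left_mono add_mono mult_mono order_refl) auto
      qed
      also have "\<dots> = 3 * (vv + (4 * B2\<^sup>2 * (wj * aa) + B4\<^sup>2 * (wj * wj)) / gap0\<^sup>2 * vv)"
        by (simp add: add_divide_distrib distrib_right distrib_left mult_ac)
      also have "\<dots> \<le> 3 * (\<kappa>2 * vv + (4 * B2\<^sup>2 * \<kappa>2 + B4\<^sup>2 * \<kappa>2) / gap0\<^sup>2 * vv)"
      proof -
        have "wj * aa \<le> wj * s" using aj[OF j] nn unfolding aa_def by (intro mult_left_mono) auto
        then have "wj * aa \<le> \<kappa>2" using \<kappa>2(2) j unfolding wj_def w_def by fastforce
        moreover have "wj * wj \<le> 1 * 1" using nn by (intro mult_mono) auto
        then have "wj * wj \<le> \<kappa>2" using \<kappa>2 by simp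
        moreover have "vv \<le> \<kappa>2 * vv" using \<kappa>2(1) nn mult_right_mono[of 1 \<kappa>2 vv] by simp
        ultimately show ?thesis using nn by (intro mult_left_mono add_mono mult_right_mono divide_right_mono) auto
      qed
      also have "\<dots> = C * \<kappa>2 * vv" unfolding C_def by (simp add: field_simps)
      finally show ?thesis unfolding vv_def .
    qed
    define M where "M = 6 * s\<^sup>2 * (C * \<kappa>2)"
    have M: "0 < M" unfolding M_def using s0 C \<kappa>2 by simp
    have Eh: "integral\<^sup>L (gauss_vec d) (\<lambda>x. (h x)\<^sup>2) \<le> M * f"
    proof -
      have "integral\<^sup>L (gauss_vec d) (\<lambda>x. (h x)\<^sup>2) \<le> 6 * s\<^sup>2 * (\<Sum>j<K. dot d (b j) (b j))"
        unfolding h_def using s s0 by (intro integral_cubic_sum_le) auto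
      also have "\<dots> \<le> 6 * s\<^sup>2 * (\<Sum>j<K. C * \<kappa>2 * dot d (v j) (v j))" using bb by (intro mult_left_mono sum_mono) auto
      finally show ?thesis unfolding M_def fv by (simp add: sum_distrib_left mult_ac)
    qed
    have hm [measurable]: "h \<in> borel_measurable (gauss_vec d)" unfolding h_def[abs_def] by measurable
    have hg: "expgrow d h" unfolding h_def[abs_def] by (intro expgrow_sum expgrow_cubic)
    have Fm [measurable]: "F \<in> borel_measurable (gauss_vec d)" unfolding F_def by measurable
    have Fg: "expgrow d F" unfolding F_def by (rule expgrow_grad_sum)
    have iFF: "integrable (gauss_vec d) (\<lambda>x. (F x)\<^sup>2)" by (intro expgrow_integrable expgrow_power Fg) measurable
    have ihh: "integrable (gauss_vec d) (\<lambda>x. (h x)\<^sup>2)" by (intro expgrow_integrable expgrow_power hg) measurable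
    have iFh: "integrable (gauss_vec d) (\<lambda>x. F x * h x)" by (intro expgrow_integrable expgrow_mult Fg hg) measurable
    \<comment> \<open>Maximises 2 l gap0 f - l^2 M f, so that E (F + l h)^2 \<ge> 0 yields the
      Cauchy-Schwarz bound. The sign is + because E F h is nonpositive.\<close>
    define l where "l = gap0 / M"
    have l: "0 \<le> l" unfolding l_def using gap0_pos M by simp
    have "0 \<le> integral\<^sup>L (gauss_vec d) (\<lambda>x. (F x + l * h x)\<^sup>2)" by simp
    also have "(\<lambda>x. (F x + l * h x)\<^sup>2) = (\<lambda>x. (F x)\<^sup>2 + 2 * l * (F x * h x) + l\<^sup>2 * (h x)\<^sup>2)"
      by (rule ext) (simp add: power2_eq_square algebra_simps)
    also have "integral\<^sup>L (gauss_vec d) \<dots> = integral\<^sup>L (gauss_vec d) (\<lambda>x. (F x)\<^sup>2) + 2 * l * integral\<^sup>L (gauss_vec d) (\<lambda>x. F x * h x)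
       + l\<^sup>2 * integral\<^sup>L (gauss_vec d) (\<lambda>x. (h x)\<^sup>2)"
      using iFF ihh iFh by simp
    finally have "integral\<^sup>L (gauss_vec d) (\<lambda>x. (F x)\<^sup>2) \<ge> 2 * l * (- integral\<^sup>L (gauss_vec d) (\<lambda>x. F x * h x))
       - l\<^sup>2 * integral\<^sup>L (gauss_vec d) (\<lambda>x. (h x)\<^sup>2)" by simp
    moreover have "2 * l * (gap0 * f) \<le> 2 * l * (- integral\<^sup>L (gauss_vec d) (\<lambda>x. F x * h x))"
      using G l by (intro mult_left_mono) auto
    moreover have "l\<^sup>2 * integral\<^sup>L (gauss_vec d) (\<lambda>x. (h x)\<^sup>2) \<le> l\<^sup>2 * (M * f)" using Eh by (intro mult_left_mono) auto
    moreover have "2 * l * (gap0 * f) - l\<^sup>2 * (M * f) = gap0\<^sup>2 / (6 * C) / (s\<^sup>2 * \<kappa>2) * f"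
    proof -
      have "2 * l * (gap0 * f) - l\<^sup>2 * (M * f) = gap0\<^sup>2 / M * f"
        unfolding l_def using M by (simp add: field_simps power2_eq_square)
      then show ?thesis unfolding M_def by (simp add: mult_ac)
    qed
    ultimately show "gap0\<^sup>2 / (6 * C) / (s\<^sup>2 * \<kappa>2) * fro2 d K V \<le> integral\<^sup>L (gauss_vec d) (\<lambda>x. (grad_sum d K W V x)\<^sup>2)"
      unfolding f_def[symmetric] F_def[symmetric] by linarith
  qed
qed

section \<open>Extreme singular values and dual vectors\<close>

text \<open>A square system with only the trivial solution has nonzero determinant. Index functions
  keep the matrix type out of the later arguments.\<close>

lemma real_matrix_inverse:
  fixes f :: "nat \<Rightarrow> nat \<Rightarrow> real"
  assumes inj: "\<And>c. (\<And>i. i < K \<Longrightarrow> (\<Sum>j<K. f i j * c j) = 0) \<Longrightarrow> (\<forall>j<K. c j = 0)"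
  shows "\<exists>g. \<forall>i<K. \<forall>k<K. (\<Sum>j<K. f i j * g j k) = (if i = k then 1 else 0)"
proof -
  define A where "A = Matrix.mat K K (\<lambda>(i, j). f i j)"
  have A: "A \<in> carrier_mat K K" unfolding A_def by simp
  have "Determinant.det A \<noteq> 0"
  proof
    assume "Determinant.det A = 0"
    then obtain v where v: "v \<in> carrier_vec K" "v \<noteq> 0\<^sub>v K" "A *\<^sub>v v = 0\<^sub>v K"
      unfolding det_0_iff_vec_prod_zero[OF A] by blast
    have "(\<Sum>j<K. f i j * vec_index v j) = 0" if i: "i < K" for i
    proof -
      have "vec_index (A *\<^sub>v v) i = (\<Sum>j<K. f i j * vec_index v j)"
        using i v(1) by (simp add: A_def scalar_prod_def lessThan_atLeast0)
      then show ?thesis unfolding v(3) using i by simp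
    qed
    from inj[OF this] have "\<forall>j<K. vec_index v j = 0" by blast
    then have "v = 0\<^sub>v K" using v(1) by (intro eq_vecI) auto
    then show False using v(2) by simp
  qed
  from det_non_zero_imp_unit[OF A this, of "()"] obtain B where B: "B \<in> carrier_mat K K" "A * B = 1\<^sub>m K"
    unfolding Units_def ring_mat_def by auto
  show ?thesis
  proof (intro exI allI impI)
    fix i k assume i: "i < K" "k < K"
    have "index_mat (A * B) (i, k) = (\<Sum>j<K. f i j * index_mat B (j, k))"
      using i B(1) by (simp add: A_def scalar_prod_def lessThan_atLeast0)
    then show "(\<Sum>j<K. f i j * index_mat B (j, k)) = (if i = k then 1 else 0)" unfolding B(2) using i by simp
  qed
qed

section \<open>Symmetric bilinear forms and the smallest Rayleigh quotient\<close>

definition bform :: "nat \<Rightarrow> (nat \<Rightarrow> nat \<Rightarrow> real) \<Rightarrow> (nat \<Rightarrow> real) \<Rightarrow> (nat \<Rightarrow> real) \<Rightarrow> real" where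
  "bform K f u v = (\<Sum>i<K. \<Sum>j<K. u i * f i j * v j)"

lemma bform_eq: "bform K f u v = (\<Sum>i<K. u i * (\<Sum>j<K. f i j * v j))"
  unfolding bform_def by (simp add: sum_distrib_left mult.assoc)

lemma bform_sym: "(\<And>i j. f i j = f j i) \<Longrightarrow> bform K f u v = bform K f v u"
  unfolding bform_def by (subst sum.swap) (auto intro!: sum.cong simp: mult_ac)

lemma bform_scale: "bform K f (\<lambda>i. c * u i) (\<lambda>i. c * u i) = c\<^sup>2 * bform K f u u"
  unfolding bform_def by (simp add: sum_distrib_left power2_eq_square mult_ac)

lemma bform_diff:
  assumes "\<And>i j. f i j = f j i"
  shows "bform K f (\<lambda>i. u i - t * v i) (\<lambda>i. u i - t * v i) = bform K f u u - 2 * t * bform K f u v + t\<^sup>2 * bform K f v v"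
proof -
  have "bform K f (\<lambda>i. u i - t * v i) (\<lambda>i. u i - t * v i)
     = bform K f u u - t * bform K f u v - t * bform K f v u + t\<^sup>2 * bform K f v v"
    unfolding bform_def by (simp add: algebra_simps sum.distrib sum_subtractf sum_distrib_left power2_eq_square)
  moreover have "bform K f v u = bform K f u v" by (rule bform_sym) (rule assms)
  ultimately show ?thesis by simp
qed

text \<open>Cauchy-Schwarz for the form: solve f y = c, so that the form of c and y is N = |c|^2
  while that of y with itself is at most \<Gamma> N, then expand the form at c - t y with t = 1 /
  (\<Gamma> + 1). The added 1 avoids a division by 0.\<close>

lemma psd_nonsingular_coercive:
  fixes f :: "nat \<Rightarrow> nat \<Rightarrow> real"
  assumes sym: "\<And>i j. f i j = f j i" and psd: "\<And>c. 0 \<le> bform K f c c"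
    and inj: "\<And>c. (\<And>i. i < K \<Longrightarrow> (\<Sum>j<K. f i j * c j) = 0) \<Longrightarrow> (\<forall>j<K. c j = 0)"
  shows "\<exists>B>0. \<forall>c. (\<Sum>i<K. (c i)\<^sup>2) \<le> B * bform K f c c"
proof -
  have "\<exists>g. \<forall>i<K. \<forall>k<K. (\<Sum>j<K. f i j * g j k) = (if i = k then 1 else 0)"
    by (rule real_matrix_inverse) (rule inj, blast)
  then obtain g where g: "\<And>i k. i < K \<Longrightarrow> k < K \<Longrightarrow> (\<Sum>j<K. f i j * g j k) = (if i = k then 1 else 0)"
    by blast
  define \<Gamma> where "\<Gamma> = (\<Sum>j<K. \<Sum>k<K. \<bar>g j k\<bar>)"
  have \<Gamma>: "0 \<le> \<Gamma>" unfolding \<Gamma>_def by (simp add: sum_nonneg)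
  have "(\<Sum>i<K. (c i)\<^sup>2) \<le> (\<Gamma> + 1) * bform K f c c" for c
  proof -
    define N where "N = (\<Sum>i<K. (c i)\<^sup>2)"
    define y where "y j = (\<Sum>k<K. g j k * c k)" for j
    have fy: "(\<Sum>j<K. f i j * y j) = c i" if "i < K" for i
    proof -
      have "(\<Sum>j<K. f i j * y j) = (\<Sum>k<K. (\<Sum>j<K. f i j * g j k) * c k)"
        unfolding y_def sum_distrib_left sum_distrib_right by (subst sum.swap) (simp add: mult.assoc)
      also have "\<dots> = (\<Sum>k<K. if i = k then c k else 0)" using that by (intro sum.cong) (auto simp: g)
      finally show ?thesis using that by simp
    qed
    have cy: "bform K f c y = N" unfolding bform_eq N_def using fy by (simp add: power2_eq_square)
    have ck: "\<bar>c j\<bar> * \<bar>c k\<bar> \<le> N" if "j < K" "k < K" for j k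
    proof -
      have "(c j)\<^sup>2 \<le> N" "(c k)\<^sup>2 \<le> N" unfolding N_def using that by (auto intro!: member_le_sum)
      then show ?thesis using sum_squares_bound[of "\<bar>c j\<bar>" "\<bar>c k\<bar>"] by simp
    qed
    have yy: "bform K f y y \<le> \<Gamma> * N"
    proof -
      have "bform K f y y = (\<Sum>j<K. \<Sum>k<K. g j k * (c j * c k))"
      proof -
        have "bform K f y y = (\<Sum>j<K. y j * c j)" unfolding bform_eq using fy by simp
        then show ?thesis unfolding y_def by (simp add: sum_distrib_left sum_distrib_right mult_ac)
      qed
      also have "\<dots> \<le> (\<Sum>j<K. \<Sum>k<K. \<bar>g j k\<bar> * N)"
      proof (intro sum_mono)
        fix j k assume "j \<in> {..<K}" "k \<in> {..<K}"
        then have "\<bar>g j k\<bar> * (\<bar>c j\<bar> * \<bar>c k\<bar>) \<le> \<bar>g j k\<bar> * N" using ck by (intro mult_left_mono) auto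
        then show "g j k * (c j * c k) \<le> \<bar>g j k\<bar> * N"
          using abs_ge_self[of "g j k * (c j * c k)"] by (simp add: abs_mult)
      qed
      finally show ?thesis unfolding \<Gamma>_def by (simp add: sum_distrib_right)
    qed
    define t where "t = 1 / (\<Gamma> + 1)"
    have t: "0 < t" "t * (\<Gamma> + 1) = 1" unfolding t_def using \<Gamma> by auto
    have N0: "0 \<le> N" unfolding N_def by (simp add: sum_nonneg)
    have "0 \<le> bform K f c c - 2 * t * N + t\<^sup>2 * bform K f y y"
    proof -
      have "bform K f (\<lambda>i. c i - t * y i) (\<lambda>i. c i - t * y i) = bform K f c c - 2 * t * bform K f c y + t\<^sup>2 * bform K f y y"
        by (rule bform_diff) (rule sym)
      then show ?thesis using psd[of "\<lambda>i. c i - t * y i"] unfolding cy by simp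
    qed
    also have "\<dots> \<le> bform K f c c - 2 * t * N + t\<^sup>2 * (\<Gamma> * N)" using yy by (simp add: mult_left_mono)
    also have "t\<^sup>2 * (\<Gamma> * N) \<le> t * N"
    proof -
      have "t * \<Gamma> \<le> 1" using t \<Gamma> by (simp add: algebra_simps)
      then have "(t * \<Gamma>) * (t * N) \<le> 1 * (t * N)" using t N0 by (intro mult_right_mono) auto
      then show ?thesis by (simp add: power2_eq_square mult_ac)
    qed
    finally have "0 \<le> bform K f c c - 2 * (t * N) + t * N" by (simp only: mult.assoc)
    then have "t * N \<le> bform K f c c" by linarith
    then have "(\<Gamma> + 1) * (t * N) \<le> (\<Gamma> + 1) * bform K f c c" using \<Gamma> by (intro mult_left_mono) auto
    moreover have "(\<Gamma> + 1) * (t * N) = (t * (\<Gamma> + 1)) * N" by (simp only: mult_ac)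
    ultimately show ?thesis unfolding N_def[symmetric] t(2) by simp
  qed
  then show ?thesis using \<Gamma> by (intro exI[of _ "\<Gamma> + 1"]) auto
qed

text \<open>If the smallest Rayleigh quotient \<open>m\<close> were not an eigenvalue, the form shifted by \<open>m\<close> would be
  positive semidefinite and nonsingular, hence coercive, which contradicts minimality of \<open>m\<close>.\<close>

lemma rayleigh_min:
  fixes f :: "nat \<Rightarrow> nat \<Rightarrow> real"
  assumes sym: "\<And>i j. f i j = f j i" and K: "K \<ge> 1"
    and L: "\<And>c. L * (\<Sum>i<K. (c i)\<^sup>2) \<le> bform K f c c"
  shows "\<exists>m c. (\<forall>c. m * (\<Sum>i<K. (c i)\<^sup>2) \<le> bform K f c c) \<and> (\<exists>i<K. c i \<noteq> 0) \<and> (\<forall>i<K. (\<Sum>j<K. f i j * c j) = m * c i)"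
proof -
  define N where "N c = (\<Sum>i<K. (c i)\<^sup>2)" for c :: "nat \<Rightarrow> real"
  have N0: "0 \<le> N c" for c unfolding N_def by (simp add: sum_nonneg)
  have Nscale: "N (\<lambda>i. a * c i) = a\<^sup>2 * N c" for a c unfolding N_def by (simp add: power_mult_distrib sum_distrib_left)
  define R where "R = (\<lambda>c. bform K f c c) ` {c. N c = 1}"
  define e where "e = (\<lambda>i::nat. if i = 0 then 1 else 0 :: real)"
  have "N e = (\<Sum>i<K. if i = 0 then 1 else 0)" unfolding N_def e_def by (intro sum.cong) auto
  then have "N e = 1" using K by simp
  then have R: "R \<noteq> {}" unfolding R_def by blast
  have Rb: "bdd_below R" proof -
    have "L \<le> bform K f c c" if "N c = 1" for c using L[of c] that unfolding N_def by simp
    then show ?thesis unfolding R_def by (intro bdd_belowI[of _ L]) auto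
  qed
  define m where "m = Inf R"
  have m1: "m * N c \<le> bform K f c c" for c
  proof (cases "N c = 0")
    case True
    then show ?thesis using L[of c] unfolding N_def by simp
  next
    case False
    then have p: "0 < N c" using N0[of c] by simp
    have "N (\<lambda>i. (1 / sqrt (N c)) * c i) = 1" unfolding Nscale using p by (simp add: power_divide)
    then have "m \<le> bform K f (\<lambda>i. (1 / sqrt (N c)) * c i) (\<lambda>i. (1 / sqrt (N c)) * c i)"
      unfolding m_def by (intro cInf_lower Rb) (auto simp: R_def)
    also have "\<dots> = bform K f c c / N c" unfolding bform_scale using p by (simp add: power_divide)
    finally show ?thesis using p by (simp add: pos_le_divide_eq)
  qed
  define f' where "f' i j = f i j - (if i = j then m else 0)" for i j
  have f'row: "(\<Sum>j<K. f' i j * c j) = (\<Sum>j<K. f i j * c j) - m * c i" if "i < K" for i c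
  proof -
    have "(\<Sum>j<K. f' i j * c j) = (\<Sum>j<K. f i j * c j - (if j = i then m * c i else 0))"
      unfolding f'_def by (intro sum.cong) (auto simp: algebra_simps)
    then show ?thesis using that by (simp add: sum_subtractf)
  qed
  have f'b: "bform K f' c c = bform K f c c - m * N c" for c
  proof -
    have "bform K f' c c = (\<Sum>i<K. c i * (\<Sum>j<K. f i j * c j) - m * (c i)\<^sup>2)"
      unfolding bform_eq
    proof (intro sum.cong refl)
      fix i assume "i \<in> {..<K}"
      then have i: "i < K" by simp
      show "c i * (\<Sum>j<K. f' i j * c j) = c i * (\<Sum>j<K. f i j * c j) - m * (c i)\<^sup>2"
        unfolding f'row[OF i] by (simp add: power2_eq_square algebra_simps)
    qed
    then show ?thesis unfolding bform_eq N_def by (simp add: sum_subtractf sum_distrib_left)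
  qed
  have "\<exists>c. (\<forall>i<K. (\<Sum>j<K. f' i j * c j) = 0) \<and> (\<exists>j<K. c j \<noteq> 0)"
  proof (rule ccontr)
    assume "\<not> ?thesis"
    then have inj: "(\<forall>j<K. c j = 0)" if "\<And>i. i < K \<Longrightarrow> (\<Sum>j<K. f' i j * c j) = 0" for c using that by blast
    have "\<exists>B>0. \<forall>c. (\<Sum>i<K. (c i)\<^sup>2) \<le> B * bform K f' c c"
    proof (rule psd_nonsingular_coercive)
      show "f' i j = f' j i" for i j unfolding f'_def using sym by auto
      show "0 \<le> bform K f' c c" for c unfolding f'b using m1[of c] by simp
    qed (rule inj, blast)
    then obtain B where B: "B > 0" "\<And>c. N c \<le> B * bform K f' c c" unfolding N_def by blast
    have "m + 1 / B \<le> Inf R"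
    proof (rule cInf_greatest[OF R])
      fix r assume "r \<in> R"
      then obtain c where c: "N c = 1" "r = bform K f c c" unfolding R_def by blast
      have "1 \<le> B * (r - m)" using B(2)[of c] unfolding f'b c by simp
      then show "m + 1 / B \<le> r" using B(1) by (simp add: field_simps)
    qed
    then show False unfolding m_def[symmetric] using B(1) by simp
  qed
  then obtain c where c: "\<And>i. i < K \<Longrightarrow> (\<Sum>j<K. f' i j * c j) = 0" "\<exists>j<K. c j \<noteq> 0" by blast
  have "(\<Sum>j<K. f i j * c j) = m * c i" if "i < K" for i using c(1)[OF that] f'row[OF that] by simp
  then show ?thesis using m1 c(2) unfolding N_def by blast
qed

lemma gram_bform: "bform K (\<lambda>i j. dot d (w i) (w j)) c c = dot d (\<lambda>l. \<Sum>i<K. c i * w i l) (\<lambda>l. \<Sum>i<K. c i * w i l)"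
  unfolding bform_eq dot_sum_left dot_sum_right by (simp add: mult_ac)

lemma eigen_sing_vals:
  assumes e: "\<And>i. i < K \<Longrightarrow> (\<Sum>j<K. dot d (wcol W i) (wcol W j) * c j) = m * c i" and c: "\<exists>i<K. c i \<noteq> 0"
  shows "sqrt m \<in># sing_vals d K W"
proof -
  define A where "A = Matrix.mat d K W"
  define G where "G = transpose_mat A * A"
  have G: "G \<in> carrier_mat K K" unfolding G_def A_def by (rule mult_carrier_mat[of _ K d]) auto
  have Gij: "index_mat G (i, j) = dot d (wcol W i) (wcol W j)" if "i < K" "j < K" for i j
    using that unfolding G_def A_def by (simp add: scalar_prod_def dot_def wcol_def lessThan_atLeast0)
  define v where "v = Matrix.vec K c"
  have v: "v \<in> carrier_vec K" unfolding v_def by simp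
  have "v \<noteq> 0\<^sub>v K"
  proof
    assume "v = 0\<^sub>v K"
    then have "vec_index v i = 0" if "i < K" for i using that by simp
    then show False using c unfolding v_def by auto
  qed
  moreover have "G *\<^sub>v v = m \<cdot>\<^sub>v v"
  proof (rule eq_vecI)
    fix i assume "i < dim_vec (m \<cdot>\<^sub>v v)"
    then have i: "i < K" using v by simp
    have "vec_index (G *\<^sub>v v) i = (\<Sum>j<K. index_mat G (i, j) * c j)"
      using i G v by (simp add: scalar_prod_def v_def lessThan_atLeast0)
    also have "\<dots> = m * c i" using e[OF i] Gij[OF i] by simp
    finally show "vec_index (G *\<^sub>v v) i = vec_index (m \<cdot>\<^sub>v v) i" using i v by (simp add: v_def)
  qed (use G v in auto)
  ultimately have "eigenvalue G m" unfolding eigenvalue_def eigenvector_def using v G by auto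
  then have root: "poly (char_poly G) m = 0" using eigenvalue_root_char_poly[OF G] by simp
  have "char_poly G \<noteq> 0" using degree_monic_char_poly[OF G] by auto
  then have "m \<in># proots (char_poly G)" using root by simp
  then show ?thesis unfolding sing_vals_def Let_def G_def A_def by (auto simp: image_iff)
qed

text \<open>Instead of a full spectral decomposition, the extreme Rayleigh quotients are shown to be
  eigenvalues of the Gram matrix. Their roots are then singular values, hence lie between the
  smallest and the largest one.\<close>

lemma sing_vals_extreme:
  assumes K: "K \<ge> 1" and pos: "\<forall>s\<in>#sing_vals d K W. 0 < s"
  defines "q \<equiv> (\<lambda>c. dot d (\<lambda>l. \<Sum>i<K. c i * wcol W i l) (\<lambda>l. \<Sum>i<K. c i * wcol W i l))"
  shows "0 < sigma_min d K W" "sigma_min d K W \<le> sigma_max d K W"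
    "\<And>c. (sigma_min d K W)\<^sup>2 * (\<Sum>i<K. (c i)\<^sup>2) \<le> q c"
    "\<And>c. q c \<le> (sigma_max d K W)\<^sup>2 * (\<Sum>i<K. (c i)\<^sup>2)"
    "1 \<le> cond_lambda d K W"
proof -
  define f where "f i j = dot d (wcol W i) (wcol W j)" for i j
  have sym: "f i j = f j i" for i j unfolding f_def by (rule dot_commute)
  have qb: "bform K f c c = q c" for c unfolding f_def[abs_def] q_def by (rule gram_bform)
  have q0: "0 \<le> q c" for c unfolding q_def by (rule dot_self_nonneg)
  let ?S = "set_mset (sing_vals d K W)"
  have fin: "finite ?S" by simp
  obtain m c where m: "\<And>c. m * (\<Sum>i<K. (c i)\<^sup>2) \<le> bform K f c c" "\<exists>i<K. c i \<noteq> 0" "\<And>i. i < K \<Longrightarrow> (\<Sum>j<K. f i j * c j) = m * c i"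
  proof -
    have "\<exists>m c. (\<forall>c. m * (\<Sum>i<K. (c i)\<^sup>2) \<le> bform K f c c) \<and> (\<exists>i<K. c i \<noteq> 0) \<and> (\<forall>i<K. (\<Sum>j<K. f i j * c j) = m * c i)"
    proof (rule rayleigh_min[where L = 0])
      show "f i j = f j i" for i j by (rule sym)
      show "0 * (\<Sum>i<K. (c i)\<^sup>2) \<le> bform K f c c" for c using qb q0 by simp
    qed (rule K)
    then show thesis using that by blast
  qed
  have mS: "sqrt m \<in># sing_vals d K W" by (rule eigen_sing_vals[OF m(3)[unfolded f_def] m(2)])
  then have ne: "?S \<noteq> {}" by auto
  have m0: "0 < m" using pos mS by auto
  have min_in: "sigma_min d K W \<in> ?S" unfolding sigma_min_def by (rule Min_in[OF fin ne])
  show s0: "0 < sigma_min d K W" using pos min_in by auto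
  show "sigma_min d K W \<le> sigma_max d K W" unfolding sigma_max_def by (rule Max_ge[OF fin min_in])
  have "sigma_min d K W \<le> sqrt m" unfolding sigma_min_def by (rule Min_le[OF fin mS])
  then have "(sigma_min d K W)\<^sup>2 \<le> (sqrt m)\<^sup>2" using s0 by (intro power_mono) auto
  then have sm: "(sigma_min d K W)\<^sup>2 \<le> m" using m0 by simp
  show "(sigma_min d K W)\<^sup>2 * (\<Sum>i<K. (c i)\<^sup>2) \<le> q c" for c
    using m(1)[of c] mult_right_mono[OF sm, of "\<Sum>i<K. (c i)\<^sup>2"] unfolding qb by (simp add: sum_nonneg)
  \<comment> \<open>The largest Rayleigh quotient is, up to sign, the smallest one of the negated
    form; \<open>ub\<close> supplies the a priori lower bound that \<open>rayleigh_min\<close> asks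
    for.\<close>
  define f' where "f' i j = - f i j" for i j
  have f'b: "bform K f' c c = - q c" for c unfolding qb[symmetric] f'_def bform_def by (simp add: sum_negf)
  have ub: "q c \<le> (\<Sum>i<K. \<Sum>j<K. \<bar>f i j\<bar>) * (\<Sum>i<K. (c i)\<^sup>2)" for c
  proof -
    define N where "N = (\<Sum>i<K. (c i)\<^sup>2)"
    have "bform K f c c \<le> (\<Sum>i<K. \<Sum>j<K. \<bar>f i j\<bar> * N)"
      unfolding bform_def
    proof (intro sum_mono)
      fix i j assume "i \<in> {..<K}" "j \<in> {..<K}"
      then have "(c i)\<^sup>2 \<le> N" "(c j)\<^sup>2 \<le> N" unfolding N_def by (auto intro!: member_le_sum)
      then have "\<bar>c i\<bar> * \<bar>c j\<bar> \<le> N" using sum_squares_bound[of "\<bar>c i\<bar>" "\<bar>c j\<bar>"] by simp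
      then have "\<bar>f i j\<bar> * (\<bar>c i\<bar> * \<bar>c j\<bar>) \<le> \<bar>f i j\<bar> * N" by (intro mult_left_mono) auto
      moreover have "c i * f i j * c j \<le> \<bar>c i * f i j * c j\<bar>" by (rule abs_ge_self)
      ultimately show "c i * f i j * c j \<le> \<bar>f i j\<bar> * N" by (simp add: abs_mult mult_ac)
    qed
    then show ?thesis unfolding qb N_def by (simp add: sum_distrib_right)
  qed
  have "\<exists>m c. (\<forall>c. m * (\<Sum>i<K. (c i)\<^sup>2) \<le> bform K f' c c) \<and> (\<exists>i<K. c i \<noteq> 0) \<and> (\<forall>i<K. (\<Sum>j<K. f' i j * c j) = m * c i)"
  proof (rule rayleigh_min[where L = "- (\<Sum>i<K. \<Sum>j<K. \<bar>f i j\<bar>)"])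
    show "(- (\<Sum>i<K. \<Sum>j<K. \<bar>f i j\<bar>)) * (\<Sum>i<K. (c i)\<^sup>2) \<le> bform K f' c c" for c
      unfolding f'b using ub[of c] by simp
    show "f' i j = f' j i" for i j unfolding f'_def using sym[of i j] by simp
  qed (rule K)
  then obtain m' c' where m': "\<And>c. m' * (\<Sum>i<K. (c i)\<^sup>2) \<le> bform K f' c c" "\<exists>i<K. c' i \<noteq> 0" "\<And>i. i < K \<Longrightarrow> (\<Sum>j<K. f' i j * c' j) = m' * c' i"
    by blast
  have "(\<Sum>j<K. f i j * c' j) = (- m') * c' i" if "i < K" for i
    using m'(3)[OF that] unfolding f'_def by (simp add: sum_negf)
  from eigen_sing_vals[OF this[unfolded f_def] m'(2)] have m'S: "sqrt (- m') \<in># sing_vals d K W" .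
  then have "0 < - m'" using pos by auto
  have "sqrt (- m') \<le> sigma_max d K W" unfolding sigma_max_def by (rule Max_ge[OF fin m'S])
  then have "(sqrt (- m'))\<^sup>2 \<le> (sigma_max d K W)\<^sup>2" using \<open>0 < - m'\<close> by (intro power_mono) auto
  then have sM: "- m' \<le> (sigma_max d K W)\<^sup>2" using \<open>0 < - m'\<close> by simp
  show "q c \<le> (sigma_max d K W)\<^sup>2 * (\<Sum>i<K. (c i)\<^sup>2)" for c
    using m'(1)[of c] mult_right_mono[OF sM, of "\<Sum>i<K. (c i)\<^sup>2"] unfolding f'b by (simp add: sum_nonneg)
  have "1 \<le> (\<Prod>s\<in>#M. s / sigma_min d K W)" if "\<forall>s\<in>#M. sigma_min d K W \<le> s" for M
    using that
  proof (induction M)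
    case (add s M)
    have "1 * 1 \<le> (s / sigma_min d K W) * (\<Prod>s\<in>#M. s / sigma_min d K W)"
      using add s0 by (intro mult_mono) auto
    then show ?case by simp
  qed simp
  then show "1 \<le> cond_lambda d K W" unfolding cond_lambda_def
    using Min_le[OF fin] unfolding sigma_min_def by blast
qed

text \<open>The columns of W times the inverse of their Gram matrix G; the Gram matrix of the result
  is that inverse. Its norm is bounded as follows: for G y = c, 2 sigma^2 y.c \<le> |sigma^2 y|^2 +
  |c|^2, and the hypothesis bounds the first square by sigma^2 y.c.\<close>

lemma dual_vectors:
  fixes w :: "nat \<Rightarrow> nat \<Rightarrow> real"
  assumes \<sigma>: "0 < \<sigma>" and lb: "\<And>c. \<sigma>\<^sup>2 * (\<Sum>i<K. (c i)\<^sup>2) \<le> dot d (\<lambda>l. \<Sum>i<K. c i * w i l) (\<lambda>l. \<Sum>i<K. c i * w i l)"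
  shows "\<exists>a. (\<forall>j<K. \<forall>k<K. dot d (a j) (w k) = (if j = k then 1 else 0)) \<and>
     (\<forall>c. dot d (\<lambda>i. \<Sum>j<K. c j * a j i) (\<lambda>i. \<Sum>j<K. c j * a j i) \<le> 1 / \<sigma>\<^sup>2 * (\<Sum>j<K. (c j)\<^sup>2))"
proof -
  define f where "f i j = dot d (w i) (w j)" for i j
  define q where "q c = dot d (\<lambda>l. \<Sum>i<K. c i * w i l) (\<lambda>l. \<Sum>i<K. c i * w i l)" for c
  have qb: "bform K f c c = q c" for c unfolding f_def[abs_def] q_def by (rule gram_bform)
  have \<sigma>2: "0 < \<sigma>\<^sup>2" using \<sigma> by simp
  have inj: "(\<forall>j<K. c j = 0)" if "\<And>i. i < K \<Longrightarrow> (\<Sum>j<K. f i j * c j) = 0" for c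
  proof -
    have "q c = 0" unfolding qb[symmetric] bform_eq using that by simp
    then have "\<sigma>\<^sup>2 * (\<Sum>i<K. (c i)\<^sup>2) \<le> 0" using lb[of c] unfolding q_def by simp
    then have "(\<Sum>i<K. (c i)\<^sup>2) \<le> 0" using \<sigma>2 by (simp add: mult_le_0_iff)
    then have "(\<Sum>i<K. (c i)\<^sup>2) = 0" by (simp add: sum_nonneg antisym)
    then show ?thesis by (subst (asm) sum_nonneg_eq_0_iff) auto
  qed
  have "\<exists>g. \<forall>i<K. \<forall>k<K. (\<Sum>j<K. f i j * g j k) = (if i = k then 1 else 0)"
    by (rule real_matrix_inverse) (rule inj, blast)
  then obtain g where g: "\<And>i k. i < K \<Longrightarrow> k < K \<Longrightarrow> (\<Sum>j<K. f i j * g j k) = (if i = k then 1 else 0)"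
    by blast
  define a where "a j = (\<lambda>l. \<Sum>i<K. g i j * w i l)" for j
  show ?thesis
  proof (intro exI[of _ a] conjI allI impI)
    fix j k assume jk: "j < K" "k < K"
    have "dot d (a j) (w k) = (\<Sum>i<K. f k i * g i j)"
      unfolding a_def dot_sum_left f_def by (simp add: mult.commute dot_commute[of d "w k"])
    then show "dot d (a j) (w k) = (if j = k then 1 else 0)" using g[OF jk(2,1)] by auto
  next
    fix c
    define y where "y i = (\<Sum>j<K. g i j * c j)" for i
    have "(\<lambda>i. \<Sum>j<K. c j * a j i) = (\<lambda>l. \<Sum>i<K. y i * w i l)"
      unfolding a_def y_def sum_distrib_left sum_distrib_right by (rule ext, subst sum.swap) (simp add: mult_ac)
    then have e: "dot d (\<lambda>i. \<Sum>j<K. c j * a j i) (\<lambda>i. \<Sum>j<K. c j * a j i) = q y" unfolding q_def by simp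
    have fy: "(\<Sum>j<K. f i j * y j) = c i" if "i < K" for i
    proof -
      have "(\<Sum>j<K. f i j * y j) = (\<Sum>k<K. (\<Sum>j<K. f i j * g j k) * c k)"
        unfolding y_def sum_distrib_left sum_distrib_right by (subst sum.swap) (simp add: mult.assoc)
      also have "\<dots> = (\<Sum>k<K. if i = k then c k else 0)" using that by (intro sum.cong) (auto simp: g)
      finally show ?thesis using that by simp
    qed
    have qy: "q y = (\<Sum>i<K. y i * c i)" unfolding qb[symmetric] bform_eq using fy by simp
    have "(2 * \<sigma>\<^sup>2) * q y = (\<Sum>i<K. 2 * (\<sigma>\<^sup>2 * y i) * c i)" unfolding qy by (simp add: sum_distrib_left mult_ac)
    also have "\<dots> \<le> (\<Sum>i<K. (\<sigma>\<^sup>2 * y i)\<^sup>2 + (c i)\<^sup>2)" by (intro sum_mono sum_squares_bound)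
    also have "\<dots> = \<sigma>\<^sup>2 * (\<sigma>\<^sup>2 * (\<Sum>i<K. (y i)\<^sup>2)) + (\<Sum>i<K. (c i)\<^sup>2)"
      by (simp add: sum.distrib sum_distrib_left power_mult_distrib power2_eq_square mult_ac)
    also have "\<dots> \<le> \<sigma>\<^sup>2 * q y + (\<Sum>i<K. (c i)\<^sup>2)" unfolding q_def by (intro add_right_mono mult_left_mono[OF lb]) simp
    finally have "2 * (\<sigma>\<^sup>2 * q y) \<le> \<sigma>\<^sup>2 * q y + (\<Sum>i<K. (c i)\<^sup>2)" by (simp only: mult.assoc)
    then have "\<sigma>\<^sup>2 * q y \<le> (\<Sum>i<K. (c i)\<^sup>2)" by linarith
    then show "dot d (\<lambda>i. \<Sum>j<K. c j * a j i) (\<lambda>i. \<Sum>j<K. c j * a j i) \<le> 1 / \<sigma>\<^sup>2 * (\<Sum>j<K. (c j)\<^sup>2)"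
    proof -
      have "q y * \<sigma>\<^sup>2 \<le> (\<Sum>i<K. (c i)\<^sup>2)" using \<open>\<sigma>\<^sup>2 * q y \<le> (\<Sum>i<K. (c i)\<^sup>2)\<close> by (simp only: mult.commute)
      then show ?thesis unfolding e using pos_le_divide_eq[OF \<sigma>2, of "q y" "\<Sum>i<K. (c i)\<^sup>2"] by simp
    qed
  qed
qed

text \<open>If d < K, padding the vectors with zero coordinates gives an injective square matrix
  with a zero row. The conclusion makes d K at most d^2 in the union bound.\<close>

lemma full_column_rank_le:
  fixes w :: "nat \<Rightarrow> nat \<Rightarrow> real"
  assumes \<sigma>: "0 < \<sigma>" and lb: "\<And>c. \<sigma>\<^sup>2 * (\<Sum>i<K. (c i)\<^sup>2) \<le> dot d (\<lambda>l. \<Sum>i<K. c i * w i l) (\<lambda>l. \<Sum>i<K. c i * w i l)"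
  shows "K \<le> d"
proof (rule ccontr)
  assume "\<not> K \<le> d"
  then have dK: "d < K" by simp
  define f where "f i j = (if i < d then w j i else 0)" for i j
  have inj: "(\<forall>j<K. c j = 0)" if h: "\<And>i. i < K \<Longrightarrow> (\<Sum>j<K. f i j * c j) = 0" for c
  proof -
    have "(\<Sum>j<K. c j * w j l) = 0" if "l < d" for l
      using h[of l] that dK unfolding f_def by (simp add: mult.commute)
    then have "dot d (\<lambda>l. \<Sum>i<K. c i * w i l) (\<lambda>l. \<Sum>i<K. c i * w i l) = 0" unfolding dot_def by simp
    then have "\<sigma>\<^sup>2 * (\<Sum>i<K. (c i)\<^sup>2) \<le> 0" using lb[of c] by simp
    then have "(\<Sum>i<K. (c i)\<^sup>2) \<le> 0" using \<sigma> by (simp add: mult_le_0_iff)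
    then have "(\<Sum>i<K. (c i)\<^sup>2) = 0" by (simp add: sum_nonneg antisym)
    then show ?thesis by (subst (asm) sum_nonneg_eq_0_iff) auto
  qed
  have "\<exists>g. \<forall>i<K. \<forall>k<K. (\<Sum>j<K. f i j * g j k) = (if i = k then 1 else 0)"
    by (rule real_matrix_inverse) (rule inj, blast)
  then obtain g where g: "\<And>i k. i < K \<Longrightarrow> k < K \<Longrightarrow> (\<Sum>j<K. f i j * g j k) = (if i = k then 1 else 0)"
    by blast
  have "(\<Sum>j<K. f d j * g j d) = 0" unfolding f_def by simp
  then show False using g[OF dK dK] by simp
qed

section \<open>Comparison of rho with the fourth power of sigma, and the population bound it
  yields\<close>

lemma integral_gauss1_lborel:
  assumes [measurable]: "f \<in> borel_measurable borel"
  shows "integral\<^sup>L gauss1 (f :: real \<Rightarrow> real) = (LINT z|lborel. std_normal_density z * f z)"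
  by (subst integral_density) auto

text \<open>beta_0 - alpha_0^2 is the variance of phi'(sigma z), hence at most its second moment
  about phi'(0) = 1/4, and phi'(t) - 1/4 = -(phi(t) - 1/2)^2 is at most t^2 in size. The 3 is the
  fourth moment of a standard normal.\<close>

lemma rho_fcn_le: "rho_fcn \<sigma> \<le> 3 * \<sigma> ^ 4"
proof -
  interpret prob_space gauss1 by (rule prob_space_gauss1)
  define D where "D z = dsig 1 (\<sigma> * z)" for z
  have [measurable]: "D \<in> borel_measurable borel" unfolding D_def[abs_def] by measurable
  have Db: "\<bar>D z\<bar> \<le> 1" for z unfolding D_def using dsig_1_pos[of "\<sigma> * z"] dsig_1_le_quarter[of "\<sigma> * z"] by simp
  have iD: "integrable gauss1 D" by (rule integrable_const_bound[of _ 1]) (use Db in auto)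
  have iD2: "integrable gauss1 (\<lambda>z. (D z)\<^sup>2)"
    by (rule integrable_const_bound[of _ 1]) (use Db in \<open>auto simp: abs_square_le_1\<close>)
  have b0: "beta 0 \<sigma> = integral\<^sup>L gauss1 (\<lambda>z. (D z)\<^sup>2)"
    unfolding beta_def deriv_sigmoid D_def by (subst integral_gauss1_lborel) simp_all
  have a0: "alpha 0 \<sigma> = integral\<^sup>L gauss1 D"
    unfolding alpha_def deriv_sigmoid D_def[abs_def] by (subst integral_gauss1_lborel) simp_all
  have pt: "(D z - 1/4)\<^sup>2 \<le> \<sigma> ^ 4 * z ^ 4" for z
  proof -
    define t where "t = \<sigma> * z"
    have "\<bar>sigmoid t - sigmoid 0\<bar> \<le> \<bar>t - 0\<bar>"
    proof -
      have "norm (sigmoid t - sigmoid 0) \<le> 1 * norm (t - 0)"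
      proof (rule field_differentiable_bound[where S = UNIV])
        show "(sigmoid has_field_derivative dsig 1 z) (at z within UNIV)" for z
          using DERIV_sigmoid[of z] by (simp add: dsig_1 del: One_nat_def)
        show "norm (dsig 1 z) \<le> 1" for z
          using dsig_1_pos[of z] dsig_1_le_quarter[of z] by (simp del: One_nat_def)
      qed auto
      then show ?thesis by simp
    qed
    then have "\<bar>sigmoid t - 1/2\<bar> \<le> \<bar>t\<bar>" by (simp add: sigmoid_def)
    then have "\<bar>sigmoid t - 1/2\<bar> ^ 4 \<le> \<bar>t\<bar> ^ 4" by (intro power_mono) auto
    moreover have "(D z - 1/4)\<^sup>2 = (sigmoid t - 1/2) ^ 4"
    proof -
      have "D z - 1/4 = - ((sigmoid t - 1/2)\<^sup>2)"
        unfolding D_def t_def[symmetric] dsig_1 by (simp add: power2_eq_square field_simps)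
      then show ?thesis by (simp add: power_mult[symmetric])
    qed
    ultimately show ?thesis unfolding t_def by (simp add: power_mult_distrib power_even_abs)
  qed
  have m4: "has_bochner_integral lborel (\<lambda>x. std_normal_density x * x ^ (2 * 2)) (fact (2 * 2) / (2 ^ 2 * fact 2))"
    by (rule std_normal_moment_even)
  have i4: "integrable gauss1 (\<lambda>z. z ^ 4)" "integral\<^sup>L gauss1 (\<lambda>z. z ^ 4) = 3"
  proof -
    show "integrable gauss1 (\<lambda>z. z ^ 4)"
      using m4 by (subst integrable_density) (auto simp: has_bochner_integral_iff)
    show "integral\<^sup>L gauss1 (\<lambda>z. z ^ 4) = 3"
      using m4 by (subst integral_gauss1_lborel) (auto simp: has_bochner_integral_iff fact_numeral)
  qed
  have e: "(\<lambda>z. (D z - 1/4)\<^sup>2) = (\<lambda>z. (D z)\<^sup>2 - 1/2 * D z + 1/16)"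
    by (rule ext) (simp add: power2_eq_square algebra_simps)
  have "integral\<^sup>L gauss1 (\<lambda>z. (D z - 1/4)\<^sup>2) \<le> integral\<^sup>L gauss1 (\<lambda>z. \<sigma> ^ 4 * z ^ 4)"
    using iD iD2 i4 pt by (intro integral_mono) (auto simp: e)
  also have "\<dots> = 3 * \<sigma> ^ 4" using i4 by simp
  finally have "integral\<^sup>L gauss1 (\<lambda>z. (D z - 1/4)\<^sup>2) \<le> 3 * \<sigma> ^ 4" .
  then have "integral\<^sup>L gauss1 (\<lambda>z. (D z)\<^sup>2) - 1/2 * integral\<^sup>L gauss1 D + 1/16 \<le> 3 * \<sigma> ^ 4"
  proof -
    have "measure gauss1 UNIV = 1" using prob_space by simp
    then show ?thesis using \<open>integral\<^sup>L gauss1 (\<lambda>z. (D z - 1/4)\<^sup>2) \<le> 3 * \<sigma> ^ 4\<close> iD iD2 unfolding e by simp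
  qed
  moreover have "0 \<le> (integral\<^sup>L gauss1 D - 1/4)\<^sup>2" by simp
  ultimately have "beta 0 \<sigma> - (alpha 0 \<sigma>)\<^sup>2 \<le> 3 * \<sigma> ^ 4"
    unfolding a0 b0 by (simp add: power2_eq_square algebra_simps)
  moreover have "rho_fcn \<sigma> \<le> beta 0 \<sigma> - (alpha 0 \<sigma>)\<^sup>2"
    using min.cobounded1[of "beta 0 \<sigma> - (alpha 0 \<sigma>)\<^sup>2" "beta 2 \<sigma> - (alpha 2 \<sigma>)\<^sup>2"] zero_le_power2[of "alpha 1 \<sigma>"]
    unfolding rho_fcn_def by linarith
  ultimately show ?thesis by linarith
qed

text \<open>Besides the lower bound, c \<le> 1/3 and the bound 3 on the ratio make their product an
  admissible level for \<open>empirical_hessian_bounds\<close>, which asks for \<tau> \<le>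
  1.\<close>

theorem fcn_population_lower_bound:
  "\<exists>c>0. c \<le> 1/3 \<and> (\<forall>(d::nat) (K::nat) W. K \<ge> 1 \<longrightarrow> (\<forall>k<K. dot d (wcol W k) (wcol W k) \<le> 1) \<longrightarrow>
      (\<forall>s\<in>#sing_vals d K W. 0 < s) \<longrightarrow> 0 < rho_fcn (sigma_min d K W) \<longrightarrow>
      K \<le> d \<and> 0 < cond_kappa d K W \<and> 1 \<le> cond_lambda d K W \<and>
      rho_fcn (sigma_min d K W) / ((cond_kappa d K W)\<^sup>2 * cond_lambda d K W) \<le> 3 \<and>
      (\<forall>V. c * (rho_fcn (sigma_min d K W) / ((cond_kappa d K W)\<^sup>2 * cond_lambda d K W)) * fro2 d K V
         \<le> integral\<^sup>L (gauss_vec d) (\<lambda>x. (grad_sum d K W V x)\<^sup>2)))"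
proof -
  obtain c0 where c0: "c0 > 0" and main: "\<And>(d::nat) (K::nat) W V a s \<kappa>2.
     (\<forall>j<K. dot d (wcol W j) (wcol W j) \<le> 1) \<Longrightarrow>
     (\<forall>j<K. \<forall>k<K. dot d (a j) (wcol W k) = (if j = k then 1 else 0)) \<Longrightarrow>
     (\<forall>c. dot d (\<lambda>i. \<Sum>j<K. c j * a j i) (\<lambda>i. \<Sum>j<K. c j * a j i) \<le> s * (\<Sum>j<K. (c j)\<^sup>2)) \<Longrightarrow>
     0 < s \<Longrightarrow> 1 \<le> \<kappa>2 \<Longrightarrow> (\<forall>j<K. dot d (wcol W j) (wcol W j) * s \<le> \<kappa>2) \<Longrightarrow>
     c0 / (s\<^sup>2 * \<kappa>2) * fro2 d K V \<le> integral\<^sup>L (gauss_vec d) (\<lambda>x. (grad_sum d K W V x)\<^sup>2)"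
    using grad_sum_square_lower_bound by blast
  define c where "c = min (c0 / 3) (1/3)"
  show ?thesis
  proof (intro exI[of _ c] conjI allI impI)
    show "0 < c" "c \<le> 1/3" unfolding c_def using c0 by auto
    fix d K :: nat and W
    assume K: "K \<ge> 1" and W: "\<forall>k<K. dot d (wcol W k) (wcol W k) \<le> 1"
      and pos: "\<forall>s\<in>#sing_vals d K W. 0 < s" and \<rho>: "0 < rho_fcn (sigma_min d K W)"
    define \<sigma> where "\<sigma> = sigma_min d K W"
    define \<kappa> where "\<kappa> = cond_kappa d K W"
    define lam where "lam = cond_lambda d K W"
    define \<rho>' where "\<rho>' = rho_fcn \<sigma>"
    note ext = sing_vals_extreme[OF K pos]
    have \<sigma>: "0 < \<sigma>" unfolding \<sigma>_def by (rule ext(1))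
    show "K \<le> d" using full_column_rank_le[OF ext(1), where w = "wcol W"] ext(3) by blast
    have \<kappa>1: "1 \<le> \<kappa>" unfolding \<kappa>_def cond_kappa_def using ext(1,2) by simp
    then show "0 < cond_kappa d K W" unfolding \<kappa>_def by simp
    show lam: "1 \<le> cond_lambda d K W" by (rule ext(5))
    have unit: "(\<lambda>l. \<Sum>i<K. (if i = j then 1 else 0) * wcol W i l) = wcol W j" "(\<Sum>i<K. (if i = j then 1 else 0 :: real)\<^sup>2) = 1" if "j < K" for j
    proof -
      show "(\<lambda>l. \<Sum>i<K. (if i = j then 1 else 0) * wcol W i l) = wcol W j"
        using that by (auto simp: fun_eq_iff if_distrib[of "\<lambda>c. c * _"] cong: if_cong)
      show "(\<Sum>i<K. (if i = j then 1 else 0 :: real)\<^sup>2) = 1"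
        using that by (simp add: if_distrib[of "\<lambda>c. c\<^sup>2"] cong: if_cong)
    qed
    have wlo: "\<sigma>\<^sup>2 \<le> dot d (wcol W j) (wcol W j)" and whi: "dot d (wcol W j) (wcol W j) \<le> (sigma_max d K W)\<^sup>2" if "j < K" for j
      using ext(3)[of "\<lambda>i. if i = j then 1 else 0"] ext(4)[of "\<lambda>i. if i = j then 1 else 0"] unit[OF that]
      unfolding \<sigma>_def by simp_all
    have "\<sigma>\<^sup>2 \<le> 1" using wlo[of 0] W K by fastforce
    then have \<sigma>4: "\<sigma> ^ 4 \<le> 1" using power_le_one[of "\<sigma>\<^sup>2" 2] by (simp add: power_mult[symmetric])
    have \<kappa>2: "1 \<le> \<kappa>\<^sup>2" using \<kappa>1 by simp
    have \<kappa>l: "1 \<le> \<kappa>\<^sup>2 * lam" using mult_mono[OF \<kappa>2 lam] \<kappa>1 unfolding lam_def by simp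
    have \<rho>3: "\<rho>' \<le> 3 * \<sigma> ^ 4" unfolding \<rho>'_def by (rule rho_fcn_le)
    have \<rho>0: "0 < \<rho>'" using \<rho> unfolding \<rho>'_def \<sigma>_def .
    have "\<rho>' / (\<kappa>\<^sup>2 * lam) \<le> 3 / 1" using \<rho>3 \<sigma>4 \<kappa>l by (intro frac_le) auto
    then show "rho_fcn (sigma_min d K W) / ((cond_kappa d K W)\<^sup>2 * cond_lambda d K W) \<le> 3"
      unfolding \<rho>'_def \<sigma>_def \<kappa>_def lam_def by simp
    fix V
    obtain a where a: "\<forall>j<K. \<forall>k<K. dot d (a j) (wcol W k) = (if j = k then 1 else 0)"
      "\<forall>c. dot d (\<lambda>i. \<Sum>j<K. c j * a j i) (\<lambda>i. \<Sum>j<K. c j * a j i) \<le> 1 / \<sigma>\<^sup>2 * (\<Sum>j<K. (c j)\<^sup>2)"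
      using dual_vectors[OF \<sigma>, of K d "wcol W"] ext(3) unfolding \<sigma>_def by blast
    have "c0 / ((1 / \<sigma>\<^sup>2)\<^sup>2 * \<kappa>\<^sup>2) * fro2 d K V \<le> integral\<^sup>L (gauss_vec d) (\<lambda>x. (grad_sum d K W V x)\<^sup>2)"
    proof (rule main[OF W a])
      show "0 < 1 / \<sigma>\<^sup>2" using \<sigma> by simp
      show "1 \<le> \<kappa>\<^sup>2" by (rule \<kappa>2)
      show "\<forall>j<K. dot d (wcol W j) (wcol W j) * (1 / \<sigma>\<^sup>2) \<le> \<kappa>\<^sup>2"
        using whi \<sigma> unfolding \<kappa>_def cond_kappa_def \<sigma>_def[symmetric] by (auto simp: power_divide divide_right_mono)
    qed
    moreover have "c * (\<rho>' / (\<kappa>\<^sup>2 * lam)) * fro2 d K V \<le> c0 / ((1 / \<sigma>\<^sup>2)\<^sup>2 * \<kappa>\<^sup>2) * fro2 d K V"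
    proof (rule mult_right_mono[OF _ fro2_nonneg])
      have "\<rho>' / (\<kappa>\<^sup>2 * lam) \<le> (3 * \<sigma> ^ 4) / (\<kappa>\<^sup>2 * 1)"
        using \<rho>3 \<rho>0 \<kappa>2 lam unfolding lam_def by (intro frac_le mult_left_mono) auto
      then have "c * (\<rho>' / (\<kappa>\<^sup>2 * lam)) \<le> (c0 / 3) * ((3 * \<sigma> ^ 4) / (\<kappa>\<^sup>2 * 1))"
        using c0 \<rho>0 \<kappa>l by (intro mult_mono) (auto simp: c_def)
      also have "\<dots> = c0 / ((1 / \<sigma>\<^sup>2)\<^sup>2 * \<kappa>\<^sup>2)" by (simp add: power_divide power_mult[symmetric])
      finally show "c * (\<rho>' / (\<kappa>\<^sup>2 * lam)) \<le> c0 / ((1 / \<sigma>\<^sup>2)\<^sup>2 * \<kappa>\<^sup>2)" .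
    qed
    ultimately show "c * (rho_fcn (sigma_min d K W) / ((cond_kappa d K W)\<^sup>2 * cond_lambda d K W)) * fro2 d K V
         \<le> integral\<^sup>L (gauss_vec d) (\<lambda>x. (grad_sum d K W V x)\<^sup>2)"
      unfolding \<rho>'_def \<sigma>_def \<kappa>_def lam_def by linarith
  qed
qed

section \<open>The convolutional model as a weight-tied fully connected one\<close>

definition tie :: "nat \<Rightarrow> (nat \<Rightarrow> real) \<Rightarrow> nat \<times> nat \<Rightarrow> real" where
  "tie m w = (\<lambda>(i, k). if i div m = k then w (i mod m) else 0)"

lemma sum_tie_block:
  fixes g :: "nat \<Rightarrow> nat \<Rightarrow> real"
  assumes m: "m \<ge> 1" and k: "k < K"
  shows "(\<Sum>i<m * K. if i div m = k then g (i mod m) i else 0) = (\<Sum>j<m. g j (m * k + j))"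
proof -
  have "m * k + m = m * Suc k" by simp
  also have "\<dots> \<le> m * K" using k by (intro mult_le_mono2) simp
  finally have mk: "m * k + m \<le> m * K" .
  have "(\<Sum>i<m * K. if i div m = k then g (i mod m) i else 0) = (\<Sum>i\<in>{i. i < m * K \<and> i div m = k}. g (i mod m) i)"
    by (subst sum.inter_filter[symmetric]) (auto intro!: sum.cong)
  also have "\<dots> = (\<Sum>j<m. g j (m * k + j))"
  proof (rule sum.reindex_bij_witness[where i = "\<lambda>j. m * k + j" and j = "\<lambda>i. i mod m"])
    fix i assume "i \<in> {i. i < m * K \<and> i div m = k}"
    then have ik: "i div m = k" by simp
    have e: "m * (i div m) + i mod m = i" by simp
    show "m * k + i mod m = i" using e unfolding ik .
    show "i mod m \<in> {..<m}" using m by simp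
    show "g (i mod m) (m * k + i mod m) = g (i mod m) i" using e unfolding ik by simp
  next
    fix j assume "j \<in> {..<m}"
    then have j: "j < m" by simp
    show "(m * k + j) mod m = j" using j by simp
    show "m * k + j \<in> {i. i < m * K \<and> i div m = k}" using j mk by simp
  qed
  finally show ?thesis .
qed

lemma pre_tie:
  assumes m: "m \<ge> 1" and k: "k < K"
  shows "pre (m * K) (tie m w) x k = (\<Sum>j<m. w j * x (m * k + j))"
proof -
  have "pre (m * K) (tie m w) x k = (\<Sum>i<m * K. if i div m = k then w (i mod m) * x i else 0)"
    unfolding pre_def dot_def wcol_def tie_def by (intro sum.cong) auto
  then show ?thesis using sum_tie_block[OF m k, of "\<lambda>j i. w j * x i"] by simp
qed

lemma dot_tie:
  assumes m: "m \<ge> 1" and k: "k < K"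
  shows "dot (m * K) (wcol (tie m v) k) (wcol (tie m w) k) = dot m v w"
proof -
  have "dot (m * K) (wcol (tie m v) k) (wcol (tie m w) k) = pre (m * K) (tie m v) (wcol (tie m w) k) k"
    unfolding pre_def ..
  also have "\<dots> = (\<Sum>j<m. v j * tie m w (m * k + j, k))" unfolding pre_tie[OF m k] wcol_def ..
  also have "\<dots> = dot m v w" unfolding dot_def tie_def by (intro sum.cong) auto
  finally show ?thesis .
qed

text \<open>The weights are repeated K times. This factor turns bounds of order 1 / K^2 and 1 into 1
  / K and K for the convolutional Hessian.\<close>

lemma fro2_tie: "m \<ge> 1 \<Longrightarrow> fro2 (m * K) K (tie m v) = real K * (\<Sum>j<m. (v j)\<^sup>2)"
  unfolding fro2_col by (simp add: dot_tie dot_self[of m])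

lemma tie_diff: "tie m (\<lambda>j. v j - w j) = (\<lambda>a. tie m v a - tie m w a)"
  by (rule ext) (auto simp: tie_def split: prod.split)

lemma H_cnn_tie: "m \<ge> 1 \<Longrightarrow> H_cnn m K w = H_fcn (m * K) K (tie m w)"
  unfolding H_cnn_def[abs_def] H_fcn_pre[abs_def] by (simp add: pre_tie)

subsection \<open>Sign flips\<close>

text \<open>Read off from \<open>distr_gauss_dot\<close> in dimension 1, since the coefficients 1
  and -1 have the same norm.\<close>

lemma distr_gauss1_uminus: "distr gauss1 borel uminus = gauss1"
proof -
  have "distr (gauss_vec 1) borel (dot 1 (\<lambda>_. 1)) = distr gauss1 borel (\<lambda>z. z)"
    "distr (gauss_vec 1) borel (dot 1 (\<lambda>_. - 1)) = distr gauss1 borel (\<lambda>z. z)"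
    unfolding distr_gauss_dot by (auto simp: dot_def intro!: distr_cong)
  moreover have "distr gauss1 borel (\<lambda>z. z) = gauss1" by (rule distr_id2) simp
  moreover have "distr (distr (gauss_vec 1) borel (dot 1 (\<lambda>_. 1))) borel uminus = distr (gauss_vec 1) borel (dot 1 (\<lambda>_. - 1))"
    by (subst distr_distr) (auto simp: o_def dot_def[abs_def] sum_negf simp del: One_nat_def)
  ultimately show ?thesis by simp
qed

lemma distr_gauss_vec_flip:
  "distr (gauss_vec d) (gauss_vec d) (\<lambda>x. \<lambda>i\<in>{..<d}. if P i then - x i else x i) = gauss_vec d"
proof -
  interpret product_prob_space "\<lambda>_::nat. gauss1" "{..<d}" by (rule product_prob_space_gauss1)
  let ?T = "\<lambda>x. \<lambda>i\<in>{..<d}. if P i then - x i else x i :: real"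
  have T: "?T \<in> measurable (gauss_vec d) (gauss_vec d)"
  proof -
    have "?T \<in> measurable (gauss_vec d) (PiM {..<d} (\<lambda>_. borel))"
      by (intro measurable_restrict) auto
    then show ?thesis using measurable_cong_sets[OF refl sets_gauss_vec] by blast
  qed
  have em: "emeasure gauss1 (uminus -` B) = emeasure gauss1 B" if "B \<in> sets borel" for B :: "real set"
  proof -
    have "emeasure gauss1 B = emeasure (distr gauss1 borel uminus) B" by (simp only: distr_gauss1_uminus)
    also have "\<dots> = emeasure gauss1 (uminus -` B)" using that by (subst emeasure_distr) auto
    finally show ?thesis by simp
  qed
  show ?thesis unfolding gauss_vec_def
  proof (rule PiM_eqI)
    fix A assume A: "\<And>i. i \<in> {..<d} \<Longrightarrow> A i \<in> sets gauss1"
    define B where "B i = (if P i then uminus -` A i else A i)" for i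
    have B: "B i \<in> sets gauss1" if "i < d" for i
    proof -
      have "uminus -` A i \<inter> space borel \<in> sets borel" using A that by (intro measurable_sets[of uminus borel borel]) auto
      then show ?thesis using A that unfolding B_def by auto
    qed
    have "emeasure (distr (gauss_vec d) (gauss_vec d) ?T) (Pi\<^sub>E {..<d} A) = emeasure (gauss_vec d) (?T -` Pi\<^sub>E {..<d} A \<inter> space (gauss_vec d))"
    proof (rule emeasure_distr[OF T])
      show "Pi\<^sub>E {..<d} A \<in> sets (gauss_vec d)" unfolding gauss_vec_def using A by (intro sets_PiM_I_finite) auto
    qed
    also have "?T -` Pi\<^sub>E {..<d} A \<inter> space (gauss_vec d) = Pi\<^sub>E {..<d} B"
    proof (rule Set.set_eqI)
      fix x :: "nat \<Rightarrow> real"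
      have "?T x \<in> Pi\<^sub>E {..<d} A \<longleftrightarrow> (\<forall>i<d. x i \<in> B i)"
        unfolding PiE_iff B_def by (simp add: Ball_def)
      moreover have "x \<in> space (gauss_vec d) \<longleftrightarrow> x \<in> extensional {..<d}"
        unfolding gauss_vec_def space_PiM by (simp add: PiE_iff)
      ultimately show "x \<in> ?T -` Pi\<^sub>E {..<d} A \<inter> space (gauss_vec d) \<longleftrightarrow> x \<in> Pi\<^sub>E {..<d} B"
        by (simp add: PiE_iff Ball_def)
    qed
    also have "emeasure (gauss_vec d) (Pi\<^sub>E {..<d} B) = (\<Prod>i<d. emeasure gauss1 (B i))"
      unfolding gauss_vec_def using B by (intro emeasure_PiM) auto
    also have "\<dots> = (\<Prod>i<d. emeasure gauss1 (A i))"
      using em A by (intro prod.cong) (auto simp: B_def)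
    finally show "emeasure (distr (Pi\<^sub>M {..<d} (\<lambda>_. gauss1)) (Pi\<^sub>M {..<d} (\<lambda>_. gauss1)) ?T) (Pi\<^sub>E {..<d} A) = (\<Prod>i<d. emeasure gauss1 (A i))"
      unfolding gauss_vec_def .
  qed simp_all
qed

text \<open>As phi' is even, negating block k changes the sign of factor k and fixes factor
  l.\<close>

lemma integral_blocks_zero:
  fixes m K k l :: nat and w v :: "nat \<Rightarrow> real"
  assumes m: "m \<ge> 1" and kl: "k < K" "l < K" "k \<noteq> l"
  defines "f \<equiv> (\<lambda>k x. dsig 1 (pre (m * K) (tie m w) x k) * pre (m * K) (tie m v) x k)"
  shows "integral\<^sup>L (gauss_vec (m * K)) (\<lambda>x. f k x * f l x) = 0"
proof -
  let ?d = "m * K"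
  define T where "T = (\<lambda>x. \<lambda>i\<in>{..<?d}. if i div m = k then - x i else x i :: real)"
  have T: "distr (gauss_vec ?d) (gauss_vec ?d) T = gauss_vec ?d"
    unfolding T_def by (rule distr_gauss_vec_flip)
  have Tm: "T \<in> measurable (gauss_vec ?d) (gauss_vec ?d)"
  proof -
    have "T \<in> measurable (gauss_vec ?d) (PiM {..<?d} (\<lambda>_. borel))"
      unfolding T_def by (intro measurable_restrict) auto
    then show ?thesis using measurable_cong_sets[OF refl sets_gauss_vec] by blast
  qed
  have fm: "(\<lambda>x. f k x * f l x) \<in> borel_measurable (gauss_vec ?d)" unfolding f_def by measurable
  have preT: "pre ?d (tie m u) (T x) j = (if j = k then - pre ?d (tie m u) x j else pre ?d (tie m u) x j)" for u x j
  proof -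
    have "pre ?d (tie m u) (T x) j = (\<Sum>i<?d. if j = k then - (tie m u (i, j) * x i) else tie m u (i, j) * x i)"
      unfolding pre_def dot_def wcol_def T_def tie_def by (intro sum.cong) auto
    then show ?thesis unfolding pre_def dot_def wcol_def by (auto simp: sum_negf)
  qed
  have flip: "f k (T x) * f l (T x) = - (f k x * f l x)" for x
    unfolding f_def preT using kl by (simp add: dsig_1_uminus del: One_nat_def)
  have "integral\<^sup>L (gauss_vec ?d) (\<lambda>x. f k x * f l x) = integral\<^sup>L (distr (gauss_vec ?d) (gauss_vec ?d) T) (\<lambda>x. f k x * f l x)"
    unfolding T ..
  also have "\<dots> = integral\<^sup>L (gauss_vec ?d) (\<lambda>x. f k (T x) * f l (T x))"
    by (rule integral_distr[OF Tm fm])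
  also have "\<dots> = - integral\<^sup>L (gauss_vec ?d) (\<lambda>x. f k x * f l x)" unfolding flip by simp
  finally show ?thesis by simp
qed

subsection \<open>A single neuron\<close>

text \<open>The device of \<open>sigpoly\<close> for the derivatives of the square of phi', so that
  \<open>gmom_Cons\<close> applies to the second moments below.\<close>

fun sqpoly :: "nat \<Rightarrow> real poly" where
  "sqpoly 0 = ([:0, 1:] * [:1, -1:]) * ([:0, 1:] * [:1, -1:])"
| "sqpoly (Suc r) = pderiv (sqpoly r) * [:0, 1, -1:]"

definition dsq :: "nat \<Rightarrow> real \<Rightarrow> real" where
  "dsq r x = poly (sqpoly r) (sigmoid x)"

lemma dsq_0: "dsq 0 x = (dsig 1 x)\<^sup>2"
  unfolding dsq_def dsig_1 by (simp add: power2_eq_square algebra_simps)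

interpretation dsq_stein: stein_family dsq
proof
  show "(dsq r has_real_derivative dsq (Suc r) t) (at t)" for r t
  proof -
    have "((\<lambda>x. poly (sqpoly r) (sigmoid x)) has_real_derivative
            poly (pderiv (sqpoly r)) (sigmoid t) * (sigmoid t * (1 - sigmoid t))) (at t)"
      by (rule DERIV_chain2[OF poly_DERIV DERIV_sigmoid])
    then show ?thesis by (simp add: dsq_def[abs_def] algebra_simps)
  qed
  show "\<exists>B. \<forall>t. \<bar>dsq r t\<bar> \<le> B" for r
  proof -
    have "compact ((\<lambda>y. poly (sqpoly r) y) ` {0..1})"
      by (intro compact_continuous_image continuous_intros) auto
    then obtain B where B: "\<forall>z \<in> (\<lambda>y. poly (sqpoly r) y) ` {0..1}. norm z \<le> B"
      using compact_imp_bounded bounded_iff by blast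
    have "\<bar>dsq r x\<bar> \<le> B" for x
      using B sigmoid_pos[of x] sigmoid_less_1[of x] by (auto simp: dsq_def)
    then show ?thesis by blast
  qed
qed

lemma integral_normal_scaled:
  assumes [measurable]: "f \<in> borel_measurable borel" and \<sigma>: "0 < \<sigma>"
  shows "(LINT z|lborel. normal_density 0 \<sigma> z * f z) = integral\<^sup>L gauss1 (\<lambda>z. f (\<sigma> * z))"
proof -
  interpret G1: prob_space gauss1 by (rule prob_space_gauss1)
  have "distributed gauss1 lborel (\<lambda>z. z) std_normal_density"
    unfolding distributed_def by (auto intro!: distr_id2)
  then have "distributed gauss1 lborel (\<lambda>z. 0 + \<sigma> * z) (normal_density (0 + \<sigma> * 0) (\<bar>\<sigma>\<bar> * 1))"
    using \<sigma> by (intro G1.normal_density_affine) auto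
  then have D: "distr gauss1 lborel (\<lambda>z. \<sigma> * z) = density lborel (normal_density 0 \<sigma>)"
    using \<sigma> by (simp add: distributed_def)
  have "integral\<^sup>L gauss1 (\<lambda>z. f (\<sigma> * z)) = integral\<^sup>L (distr gauss1 lborel (\<lambda>z. \<sigma> * z)) f"
    by (subst integral_distr) auto
  also have "\<dots> = (LINT z|lborel. normal_density 0 \<sigma> z * f z)"
    unfolding D using \<sigma> by (subst integral_density) auto
  finally show ?thesis by simp
qed

text \<open>Write v = c w + u with u orthogonal to w. Under \<open>gmom_Cons\<close> a factor u
  contracts only with another u, so the mixed term vanishes and u contributes |u|^2 E phi'(w.x)^2.
  As |w| \<le> 1, |v|^2 is at most c^2 + |u|^2, which fits the moment of phi'(z) z with z = w.x not
  normalised.\<close>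

lemma neuron_lower_bound:
  fixes w v :: "nat \<Rightarrow> real"
  assumes w: "dot d w w \<le> 1" and \<rho>: "0 < rho_cnn (sqrt (dot d w w))"
  shows "rho_cnn (sqrt (dot d w w)) * dot d v v \<le> integral\<^sup>L (gauss_vec d) (\<lambda>x. (dsig 1 (dot d w x) * dot d v x)\<^sup>2)"
proof -
  define \<sigma> where "\<sigma> = sqrt (dot d w w)"
  define \<rho>' where "\<rho>' = rho_cnn \<sigma>"
  \<comment> \<open>A normal density of standard deviation 0 is 0 by the convention on division, so
    \<open>rho_cnn\<close> vanishes there and its positivity excludes w = 0.\<close>
  have "\<sigma> \<noteq> 0"
  proof
    assume "\<sigma> = 0"
    then have "rho_cnn \<sigma> = 0" by (simp add: rho_cnn_def normal_density_def)
    then show False using \<rho> unfolding \<sigma>_def by simp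
  qed
  then have \<sigma>: "0 < \<sigma>" unfolding \<sigma>_def using dot_self_nonneg[of d w] by simp
  have ww: "0 < dot d w w" "\<sigma>\<^sup>2 = dot d w w" using \<sigma> unfolding \<sigma>_def by (auto simp: dot_self_nonneg)
  let ?g = "\<lambda>ls. gmom d dsq w ls 0"
  have R2: "?g [] = (LINT z|lborel. normal_density 0 \<sigma> z * (deriv sigmoid z)\<^sup>2)"
  proof -
    have "?g [] = integral\<^sup>L (gauss_vec d) (\<lambda>x. (dsig 1 (dot d w x))\<^sup>2)" unfolding gmom_def by (simp add: dsq_0)
    also have "\<dots> = integral\<^sup>L gauss1 (\<lambda>z. (dsig 1 (\<sigma> * z))\<^sup>2)" unfolding \<sigma>_def by (rule integral_gauss_dot) measurable
    also have "\<dots> = (LINT z|lborel. normal_density 0 \<sigma> z * (dsig 1 z)\<^sup>2)" by (rule integral_normal_scaled[OF _ \<sigma>, symmetric]) measurable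
    finally show ?thesis unfolding deriv_sigmoid .
  qed
  have R1: "?g [w, w] = (LINT z|lborel. normal_density 0 \<sigma> z * (deriv sigmoid z * z)\<^sup>2)"
  proof -
    have "?g [w, w] = integral\<^sup>L (gauss_vec d) (\<lambda>x. (dsig 1 (dot d w x) * dot d w x)\<^sup>2)"
      unfolding gmom_def by (simp add: dsq_0 power2_eq_square mult_ac)
    also have "\<dots> = integral\<^sup>L gauss1 (\<lambda>z. (dsig 1 (\<sigma> * z) * (\<sigma> * z))\<^sup>2)"
      unfolding \<sigma>_def by (rule integral_gauss_dot[where f = "\<lambda>t. (dsig 1 t * t)\<^sup>2"]) measurable
    also have "\<dots> = (LINT z|lborel. normal_density 0 \<sigma> z * (dsig 1 z * z)\<^sup>2)"
      by (rule integral_normal_scaled[OF _ \<sigma>, where f = "\<lambda>t. (dsig 1 t * t)\<^sup>2", symmetric]) measurable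
    finally show ?thesis unfolding deriv_sigmoid .
  qed
  have \<rho>le: "\<rho>' \<le> ?g [w, w]" "\<rho>' \<le> ?g []" unfolding \<rho>'_def rho_cnn_def R1 R2 by auto
  have \<rho>0: "0 < \<rho>'" using \<rho> unfolding \<rho>'_def \<sigma>_def .
  define c where "c = dot d v w / dot d w w"
  define u where "u = (\<lambda>i. v i - c * w i)"
  have uw: "dot d u w = 0" unfolding u_def dot_diff_left dot_scale_left c_def using ww by simp
  have vx: "dot d v x = c * dot d w x + dot d u x" for x
    unfolding u_def dot_diff_left dot_scale_left by simp
  have "v = (\<lambda>i. c * w i + u i)" unfolding u_def by simp
  then have vv: "dot d v v = c\<^sup>2 * dot d w w + dot d u u"
    using uw dot_commute[of d w u] by (simp add: dot_add_left dot_add_right dot_scale_left dot_scale_right power2_eq_square)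
  have "integral\<^sup>L (gauss_vec d) (\<lambda>x. (dsig 1 (dot d w x) * dot d v x)\<^sup>2) = integral\<^sup>L (gauss_vec d)
     (\<lambda>x. c\<^sup>2 * (lprod d [w, w] x * dsq 0 (dot d w x)) + 2 * c * (lprod d [u, w] x * dsq 0 (dot d w x)) + lprod d [u, u] x * dsq 0 (dot d w x))"
    by (intro Bochner_Integration.integral_cong refl) (simp add: vx dsq_0 power2_eq_square algebra_simps)
  also have "\<dots> = c\<^sup>2 * ?g [w, w] + 2 * c * ?g [u, w] + ?g [u, u]"
    unfolding gmom_def using dsq_stein.integrable_gmom[of d _ 0 w] by (simp del: lprod_simps)
  also have "\<dots> = c\<^sup>2 * ?g [w, w] + dot d u u * ?g []"
    using uw by (simp add: dsq_stein.gmom_Cons[of d w u])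
  also have "\<dots> \<ge> c\<^sup>2 * \<rho>' + dot d u u * \<rho>'"
    using \<rho>le by (intro add_mono mult_left_mono) (auto simp: dot_self_nonneg)
  finally have "c\<^sup>2 * \<rho>' + dot d u u * \<rho>' \<le> integral\<^sup>L (gauss_vec d) (\<lambda>x. (dsig 1 (dot d w x) * dot d v x)\<^sup>2)" .
  moreover have "\<rho>' * dot d v v \<le> c\<^sup>2 * \<rho>' + dot d u u * \<rho>'"
  proof -
    have "c\<^sup>2 * dot d w w \<le> c\<^sup>2 * 1" using w by (intro mult_left_mono) auto
    then have "dot d v v \<le> c\<^sup>2 + dot d u u" unfolding vv by simp
    then have "\<rho>' * dot d v v \<le> \<rho>' * (c\<^sup>2 + dot d u u)" using \<rho>0 by (intro mult_left_mono) auto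
    then show ?thesis by (simp add: algebra_simps)
  qed
  ultimately show ?thesis unfolding \<rho>'_def \<sigma>_def by linarith
qed

lemma rho_cnn_le_1: "0 < \<sigma> \<Longrightarrow> rho_cnn \<sigma> \<le> 1"
proof -
  assume \<sigma>: "0 < \<sigma>"
  interpret prob_space gauss1 by (rule prob_space_gauss1)
  have b: "(dsig 1 t)\<^sup>2 \<le> 1" for t
    using dsig_1_pos[of t] dsig_1_le_quarter[of t] by (simp add: power_le_one del: One_nat_def)
  have i: "integrable gauss1 (\<lambda>z. (dsig 1 (\<sigma> * z))\<^sup>2)"
    by (rule integrable_const_bound[of _ 1]) (use b in auto)
  have "rho_cnn \<sigma> \<le> (LINT z|lborel. normal_density 0 \<sigma> z * (dsig 1 z)\<^sup>2)"
    unfolding rho_cnn_def deriv_sigmoid by simp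
  also have "\<dots> = integral\<^sup>L gauss1 (\<lambda>z. (dsig 1 (\<sigma> * z))\<^sup>2)" by (rule integral_normal_scaled[OF _ \<sigma>]) measurable
  also have "\<dots> \<le> integral\<^sup>L gauss1 (\<lambda>z. 1)" using i b by (intro integral_mono) auto
  also have "\<dots> = 1" using prob_space by simp
  finally show ?thesis .
qed

lemma cnn_population_lower_bound:
  assumes m: "m \<ge> 1" and w: "dot m w w \<le> 1" and \<rho>: "0 < rho_cnn (sqrt (dot m w w))"
  shows "rho_cnn (sqrt (dot m w w)) * fro2 (m * K) K (tie m v)
     \<le> integral\<^sup>L (gauss_vec (m * K)) (\<lambda>x. (grad_sum (m * K) K (tie m w) (tie m v) x)\<^sup>2)"
proof -
  let ?d = "m * K"
  define f where "f = (\<lambda>k x. dsig 1 (pre ?d (tie m w) x k) * pre ?d (tie m v) x k)"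
  have i: "integrable (gauss_vec ?d) (\<lambda>x. f k x * f l x)" for k l
    unfolding f_def by (intro expgrow_integrable expgrow_mult expgrow_dsig expgrow_pre) measurable
  have "integral\<^sup>L (gauss_vec ?d) (\<lambda>x. (grad_sum ?d K (tie m w) (tie m v) x)\<^sup>2) = integral\<^sup>L (gauss_vec ?d) (\<lambda>x. \<Sum>k<K. \<Sum>l<K. f k x * f l x)"
    unfolding grad_sum_def f_def power2_eq_square sum_product ..
  also have "\<dots> = (\<Sum>k<K. \<Sum>l<K. integral\<^sup>L (gauss_vec ?d) (\<lambda>x. f k x * f l x))"
    using i by (simp add: Bochner_Integration.integral_sum Bochner_Integration.integrable_sum)
  also have "\<dots> = (\<Sum>k<K. \<Sum>l<K. if l = k then integral\<^sup>L (gauss_vec ?d) (\<lambda>x. f k x * f k x) else 0)"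
    by (intro sum.cong refl) (auto simp: f_def intro!: integral_blocks_zero[OF m, unfolded One_nat_def])
  also have "\<dots> = (\<Sum>k<K. integral\<^sup>L (gauss_vec ?d) (\<lambda>x. (f k x)\<^sup>2))" by (simp add: power2_eq_square)
  also have "\<dots> \<ge> (\<Sum>k<K. rho_cnn (sqrt (dot m w w)) * dot m v v)"
  proof (intro sum_mono)
    fix k assume "k \<in> {..<K}"
    then have k: "k < K" by simp
    show "rho_cnn (sqrt (dot m w w)) * dot m v v \<le> integral\<^sup>L (gauss_vec ?d) (\<lambda>x. (f k x)\<^sup>2)"
      using neuron_lower_bound[of ?d "wcol (tie m w) k" "wcol (tie m v) k"] w \<rho>
      unfolding dot_tie[OF m k] f_def pre_def by simp
  qed
  also have "(\<Sum>k<K. rho_cnn (sqrt (dot m w w)) * dot m v v) = rho_cnn (sqrt (dot m w w)) * fro2 ?d K (tie m v)"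
    unfolding fro2_tie[OF m] by (simp add: dot_self)
  finally show ?thesis .
qed

section \<open>Conclusion\<close>

lemma lossq_cong:
  "(\<And>k. k < K \<Longrightarrow> s k = s' k) \<Longrightarrow> (\<And>k. k < K \<Longrightarrow> t k = t' k) \<Longrightarrow> lossq K s y t = lossq K s' y t'"
  unfolding lossq_def lossq1_def by (cases y) simp_all

lemma hessian_quad_fcn:
  assumes K: "K \<ge> 1"
  shows "(\<Sum>a\<in>{..<d} \<times> {..<K}. \<Sum>b\<in>{..<d} \<times> {..<K}. v a * hessian_at (fn_fcn d K n S) W a b * v b) = avg_hess d K n S W v"
proof -
  define X where "X = (\<lambda>i k (c :: nat \<times> nat). if snd c = k then fst (S i) (fst c) else (0 :: real))"
  have s: "(\<Sum>c\<in>{..<d} \<times> {..<K}. p c * X i k c) = pre d p (fst (S i)) k" if "k < K" for p i k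
  proof -
    have "(\<Sum>c\<in>{..<d} \<times> {..<K}. p c * X i k c) = (\<Sum>j<d. \<Sum>l<K. if l = k then p (j, k) * fst (S i) j else 0)"
      unfolding sum.cartesian_product X_def by (intro sum.cong) auto
    also have "\<dots> = pre d p (fst (S i)) k" using that by (simp add: pre_def dot_def wcol_def)
    finally show ?thesis .
  qed
  have "(\<Sum>a\<in>{..<d} \<times> {..<K}. \<Sum>b\<in>{..<d} \<times> {..<K}. v a * hessian_at (fn_fcn d K n S) W a b * v b)
     = 1 / real n * (\<Sum>i<n. lossq K (\<lambda>k. \<Sum>c\<in>{..<d} \<times> {..<K}. W c * X i k c) (snd (S i)) (\<lambda>k. \<Sum>c\<in>{..<d} \<times> {..<K}. v c * X i k c))"
  proof (rule hessian_quad_xent[OF _ K])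
    show "fn_fcn d K n S p = 1 / real n * (\<Sum>i<n. xent (1 / real K * (\<Sum>k<K. sigmoid (\<Sum>c\<in>{..<d} \<times> {..<K}. p c * X i k c))) (snd (S i)))" for p
      unfolding fn_fcn_def H_fcn_pre by (simp add: s)
  qed simp
  also have "\<dots> = avg_hess d K n S W v"
    unfolding avg_hess_def by (intro arg_cong2[where f = "(*)"] refl sum.cong lossq_cong) (simp_all add: s)
  finally show ?thesis .
qed

lemma hessian_quad_cnn:
  assumes K: "K \<ge> 1" and m: "m \<ge> 1"
  shows "(\<Sum>a<m. \<Sum>b<m. v a * hessian_at (fn_cnn m K n S) w a b * v b) = avg_hess (m * K) K n S (tie m w) (tie m v)"
proof -
  define X where "X = (\<lambda>i k j. fst (S i) (m * k + j) :: real)"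
  have s: "(\<Sum>c<m. p c * X i k c) = pre (m * K) (tie m p) (fst (S i)) k" if "k < K" for p i k
    unfolding pre_tie[OF m that] X_def ..
  have "(\<Sum>a<m. \<Sum>b<m. v a * hessian_at (fn_cnn m K n S) w a b * v b)
     = 1 / real n * (\<Sum>i<n. lossq K (\<lambda>k. \<Sum>c<m. w c * X i k c) (snd (S i)) (\<lambda>k. \<Sum>c<m. v c * X i k c))"
  proof (rule hessian_quad_xent[OF _ K])
    show "fn_cnn m K n S p = 1 / real n * (\<Sum>i<n. xent (1 / real K * (\<Sum>k<K. sigmoid (\<Sum>c<m. p c * X i k c))) (snd (S i)))" for p
      unfolding fn_cnn_def H_cnn_def X_def ..
  qed simp
  also have "\<dots> = avg_hess (m * K) K n S (tie m w) (tie m v)"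
    unfolding avg_hess_def by (intro arg_cong2[where f = "(*)"] refl sum.cong lossq_cong) (simp_all add: s)
  finally show ?thesis .
qed

text \<open>For d = 1 the sample size condition is void because ln 1 = 0, but the required
  probability is 0 as well, so the empty event suffices.\<close>

lemma prob_at_least_trivial: "d = 1 \<Longrightarrow> prob_at_least M E (1 - real d powr (-10))"
  unfolding prob_at_least_def by (intro bexI[of _ "{}"]) auto

lemma fcn_theorem:
  "\<exists>c1 c2 c C :: real. c1 > 0 \<and> c2 > 0 \<and> c > 0 \<and> C > 0 \<and>
     (\<forall>(d::nat) (K::nat) (Wstar :: nat \<times> nat \<Rightarrow> real) (n::nat).
        d \<ge> 1 \<longrightarrow> K \<ge> 1 \<longrightarrow>
        (\<forall>k<K. (\<Sum>i<d. (Wstar (i, k))\<^sup>2) \<le> 1) \<longrightarrow>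
        (\<forall>s \<in># sing_vals d K Wstar. s > 0) \<longrightarrow>
        rho_fcn (sigma_min d K Wstar) > 0 \<longrightarrow>
        real n \<ge> c1 * real d * real K ^ 5 * (ln (real d))\<^sup>2 *
           ((cond_kappa d K Wstar)\<^sup>2 * cond_lambda d K Wstar / rho_fcn (sigma_min d K Wstar))\<^sup>2 \<longrightarrow>
        (let \<rho> = rho_fcn (sigma_min d K Wstar);
             \<kappa> = cond_kappa d K Wstar; lam = cond_lambda d K Wstar;
             r = c2 / sqrt (real K) * (\<rho> / (\<kappa>\<^sup>2 * lam));
             I = {..<d} \<times> {..<K}
         in prob_at_least (sample_dist n d (H_fcn d K Wstar))
              {S. \<forall>W. (\<Sum>a\<in>I. (W a - Wstar a)\<^sup>2) \<le> r\<^sup>2 \<longrightarrow>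
                     hess_between (c * (1 / (real K)\<^sup>2) * (\<rho> / (\<kappa>\<^sup>2 * lam))) C
                        (fn_fcn d K n S) W I}
              (1 - real d powr (-10))))"
proof -
  obtain c' where c': "0 < c'" "c' \<le> 1/3" and pop: "\<And>(d::nat) (K::nat) W. K \<ge> 1 \<Longrightarrow> (\<forall>k<K. dot d (wcol W k) (wcol W k) \<le> 1) \<Longrightarrow>
      (\<forall>s\<in>#sing_vals d K W. 0 < s) \<Longrightarrow> 0 < rho_fcn (sigma_min d K W) \<Longrightarrow>
      K \<le> d \<and> 0 < cond_kappa d K W \<and> 1 \<le> cond_lambda d K W \<and>
      rho_fcn (sigma_min d K W) / ((cond_kappa d K W)\<^sup>2 * cond_lambda d K W) \<le> 3 \<and>
      (\<forall>V. c' * (rho_fcn (sigma_min d K W) / ((cond_kappa d K W)\<^sup>2 * cond_lambda d K W)) * fro2 d K V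
         \<le> integral\<^sup>L (gauss_vec d) (\<lambda>x. (grad_sum d K W V x)\<^sup>2))"
    using fcn_population_lower_bound by blast
  have crad: "0 < crad" unfolding crad_def cpop_def by (simp add: add_pos_pos)
  \<comment> \<open>All constants come from the level \<tau> = c' \<rho> / (\<kappa>^2 lam): its
    square enters the sample size, while the radius and the lower bound are linear in it.\<close>
  show ?thesis
  proof (rule exI[of _ "163840000000 / c'\<^sup>2"], rule exI[of _ "crad * c'"], rule exI[of _ "c' / 8"], rule exI[of _ 22], intro conjI allI impI, goal_cases)
    case (5 d K W n)
    note K = 5(2) and norms = 5(3) and pos = 5(4) and \<rho>pos = 5(5) and n = 5(6)
    define \<rho> where "\<rho> = rho_fcn (sigma_min d K W)"
    define \<kappa> where "\<kappa> = cond_kappa d K W"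
    define lam where "lam = cond_lambda d K W"
    define q where "q = \<rho> / (\<kappa>\<^sup>2 * lam)"
    define \<tau> where "\<tau> = c' * q"
    have W0: "\<forall>k<K. dot d (wcol W k) (wcol W k) \<le> 1" using norms by (simp add: dot_self wcol_def)
    note P = pop[OF K W0 pos \<rho>pos, folded \<rho>_def \<kappa>_def lam_def, folded q_def]
    have q0: "0 < q" unfolding q_def using P \<rho>pos unfolding \<rho>_def by simp
    have \<tau>: "0 < \<tau>" "\<tau> \<le> 1"
    proof -
      show "0 < \<tau>" unfolding \<tau>_def using c' q0 by simp
      have "c' * q \<le> 1/3 * 3" using c' P q0 by (intro mult_mono) auto
      then show "\<tau> \<le> 1" unfolding \<tau>_def by simp
    qed
    show ?case
    proof (cases "d = 1")
      case True
      then show ?thesis unfolding Let_def by (rule prob_at_least_trivial)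
    next
      case False
      then have d: "d \<ge> 2" using 5(1) by simp
      have Kd: "K \<le> d" using P by blast
      have W0': "\<And>k. k < K \<Longrightarrow> dot d (wcol W k) (wcol W k) \<le> 1" using W0 by blast
      have n': "163840000000 * real d * real K ^ 5 * (ln (real d))\<^sup>2 / \<tau>\<^sup>2 \<le> real n"
      proof -
        have "163840000000 * real d * real K ^ 5 * (ln (real d))\<^sup>2 / \<tau>\<^sup>2
          = 163840000000 / c'\<^sup>2 * real d * real K ^ 5 * (ln (real d))\<^sup>2 * (\<kappa>\<^sup>2 * lam / \<rho>)\<^sup>2"
          unfolding \<tau>_def q_def by (simp add: power_mult_distrib power_divide)
        then show ?thesis using n unfolding \<rho>_def \<kappa>_def lam_def by simp
      qed
      obtain A where A: "A \<in> sets (sample_dist n d (H_fcn d K W))" "1 - real d powr (-10) \<le> measure (sample_dist n d (H_fcn d K W)) A"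
        and H: "\<forall>S\<in>A. \<forall>W'. fro2 d K (\<lambda>a. W' a - W a) \<le> (crad * \<tau> / sqrt (real K))\<^sup>2 \<longrightarrow>
          (\<forall>V. avg_hess d K n S W' V \<le> 22 * fro2 d K V) \<and>
          (\<forall>V. \<tau> * fro2 d K V \<le> integral\<^sup>L (gauss_vec d) (\<lambda>x. (grad_sum d K W V x)\<^sup>2) \<longrightarrow>
             \<tau> / (8 * (real K)\<^sup>2) * fro2 d K V \<le> avg_hess d K n S W' V)"
        by (rule bexE[OF empirical_hessian_bounds[OF d K Kd \<tau> _ n']], rule W0', assumption, elim conjE, rule that)
      have "A \<subseteq> {S. \<forall>W'. (\<Sum>a\<in>{..<d} \<times> {..<K}. (W' a - W a)\<^sup>2) \<le> (crad * c' / sqrt (real K) * q)\<^sup>2 \<longrightarrow>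
                     hess_between (c' / 8 * (1 / (real K)\<^sup>2) * q) 22 (fn_fcn d K n S) W' ({..<d} \<times> {..<K})}"
      proof (intro subsetI CollectI allI impI)
        fix S W' assume S: "S \<in> A" and W': "(\<Sum>a\<in>{..<d} \<times> {..<K}. (W' a - W a)\<^sup>2) \<le> (crad * c' / sqrt (real K) * q)\<^sup>2"
        have W'2: "fro2 d K (\<lambda>a. W' a - W a) \<le> (crad * \<tau> / sqrt (real K))\<^sup>2" using W' unfolding fro2_def \<tau>_def by (simp add: mult.assoc)
        have up: "avg_hess d K n S W' V \<le> 22 * fro2 d K V" for V using H S W'2 by blast
        have "\<tau> * fro2 d K V \<le> integral\<^sup>L (gauss_vec d) (\<lambda>x. (grad_sum d K W V x)\<^sup>2)" for V
          using P unfolding \<tau>_def by blast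
        then have lo: "\<tau> / (8 * (real K)\<^sup>2) * fro2 d K V \<le> avg_hess d K n S W' V" for V using H S W'2 by blast
        have e: "c' / 8 * (1 / (real K)\<^sup>2) * q = \<tau> / (8 * (real K)\<^sup>2)" unfolding \<tau>_def by simp
        show "hess_between (c' / 8 * (1 / (real K)\<^sup>2) * q) 22 (fn_fcn d K n S) W' ({..<d} \<times> {..<K})"
          unfolding hess_between_def hessian_quad_fcn[OF K] e fro2_def[symmetric] using up lo by blast
      qed
      then show ?thesis using A unfolding Let_def prob_at_least_def \<rho>_def[symmetric] \<kappa>_def[symmetric] lam_def[symmetric] q_def[symmetric]
        by blast
    qed
  qed (use c' crad in auto)
qed

lemma cnn_theorem:
  "\<exists>c3 c4 c' C' :: real. c3 > 0 \<and> c4 > 0 \<and> c' > 0 \<and> C' > 0 \<and>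
     (\<forall>(m::nat) (K::nat) (wstar :: nat \<Rightarrow> real) (n::nat).
        m \<ge> 1 \<longrightarrow> K \<ge> 1 \<longrightarrow>
        (\<Sum>j<m. (wstar j)\<^sup>2) \<le> 1 \<longrightarrow>
        rho_cnn (sqrt (\<Sum>j<m. (wstar j)\<^sup>2)) > 0 \<longrightarrow>
        real n \<ge> c3 * real (m * K) * real K ^ 5 * (ln (real (m * K)))\<^sup>2 *
           (1 / rho_cnn (sqrt (\<Sum>j<m. (wstar j)\<^sup>2)))\<^sup>2 \<longrightarrow>
        (let \<rho> = rho_cnn (sqrt (\<Sum>j<m. (wstar j)\<^sup>2));
             r = c4 / (real K)\<^sup>2 * \<rho>
         in prob_at_least (sample_dist n (m * K) (H_cnn m K wstar))
              {S. \<forall>w. (\<Sum>j<m. (w j - wstar j)\<^sup>2) \<le> r\<^sup>2 \<longrightarrow>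
                     hess_between (c' * (1 / real K) * \<rho>) (C' * real K)
                        (fn_cnn m K n S) w {..<m}}
              (1 - real (m * K) powr (-10))))"
proof -
  have crad: "0 < crad" unfolding crad_def cpop_def by (simp add: add_pos_pos)
  \<comment> \<open>Here the level is rho itself, so the constants of
    \<open>empirical_hessian_bounds\<close> carry over unchanged.\<close>
  show ?thesis
  proof (rule exI[of _ 163840000000], rule exI[of _ crad], rule exI[of _ "1/8"], rule exI[of _ 22], intro conjI allI impI, goal_cases)
    case (5 m K w n)
    note m = 5(1) and K = 5(2) and n = 5(5)
    define \<rho> where "\<rho> = rho_cnn (sqrt (dot m w w))"
    define d where "d = m * K"
    have dd: "dot m w w = (\<Sum>j<m. (w j)\<^sup>2)" by (rule dot_self)
    have w1: "dot m w w \<le> 1" and \<rho>0: "0 < \<rho>" using 5 unfolding dd \<rho>_def by auto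
    have "dot m w w \<noteq> 0"
    proof
      assume "dot m w w = 0"
      then have "\<rho> = 0" unfolding \<rho>_def by (simp add: rho_cnn_def normal_density_def)
      then show False using \<rho>0 by simp
    qed
    then have "0 < sqrt (dot m w w)" using dot_self_nonneg[of m w] by simp
    then have \<rho>1: "\<rho> \<le> 1" unfolding \<rho>_def by (rule rho_cnn_le_1)
    have Kd: "K \<le> d" unfolding d_def using m by simp
    show ?case
    proof (cases "d = 1")
      case True
      then show ?thesis unfolding Let_def d_def by (rule prob_at_least_trivial)
    next
      case False
      moreover have "d \<ge> 1" using m K unfolding d_def by simp
      ultimately have d: "d \<ge> 2" by simp
      have n': "163840000000 * real d * real K ^ 5 * (ln (real d))\<^sup>2 / \<rho>\<^sup>2 \<le> real n"
        using n unfolding \<rho>_def d_def dd by (simp add: power_divide)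
      have W0: "dot d (wcol (tie m w) k) (wcol (tie m w) k) \<le> 1" if "k < K" for k
        unfolding d_def dot_tie[OF m that] by (rule w1)
      obtain A where A: "A \<in> sets (sample_dist n d (H_fcn d K (tie m w)))" "1 - real d powr (-10) \<le> measure (sample_dist n d (H_fcn d K (tie m w))) A"
        and H: "\<forall>S\<in>A. \<forall>W'. fro2 d K (\<lambda>a. W' a - tie m w a) \<le> (crad * \<rho> / sqrt (real K))\<^sup>2 \<longrightarrow>
          (\<forall>V. avg_hess d K n S W' V \<le> 22 * fro2 d K V) \<and>
          (\<forall>V. \<rho> * fro2 d K V \<le> integral\<^sup>L (gauss_vec d) (\<lambda>x. (grad_sum d K (tie m w) V x)\<^sup>2) \<longrightarrow>
             \<rho> / (8 * (real K)\<^sup>2) * fro2 d K V \<le> avg_hess d K n S W' V)"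
        by (rule bexE[OF empirical_hessian_bounds[OF d K Kd \<rho>0 \<rho>1 _ n']], rule W0, assumption, elim conjE, rule that)
      have "A \<subseteq> {S. \<forall>w'. (\<Sum>j<m. (w' j - w j)\<^sup>2) \<le> (crad / (real K)\<^sup>2 * \<rho>)\<^sup>2 \<longrightarrow>
                     hess_between (1/8 * (1 / real K) * \<rho>) (22 * real K) (fn_cnn m K n S) w' {..<m}}"
      proof (intro subsetI CollectI allI impI)
        fix S w' assume S: "S \<in> A" and w': "(\<Sum>j<m. (w' j - w j)\<^sup>2) \<le> (crad / (real K)\<^sup>2 * \<rho>)\<^sup>2"
        \<comment> \<open>Tying multiplies the squared distance by K, so a radius of order K^-2
          leaves (crad \<rho>)^2 / K^3, within the (crad \<rho>)^2 / K allowed in the fully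
          connected model.\<close>
        have "fro2 d K (\<lambda>a. tie m w' a - tie m w a) = real K * (\<Sum>j<m. (w' j - w j)\<^sup>2)"
          unfolding tie_diff[symmetric] d_def fro2_tie[OF m] ..
        also have "\<dots> \<le> real K * (crad / (real K)\<^sup>2 * \<rho>)\<^sup>2" using w' by (intro mult_left_mono) auto
        also have "\<dots> = (crad * \<rho>)\<^sup>2 / real K ^ 3"
          using K by (simp add: power_mult_distrib power_divide field_simps eval_nat_numeral)
        also have "\<dots> \<le> (crad * \<rho>)\<^sup>2 / real K ^ 1"
          using K by (intro divide_left_mono power_increasing) auto
        also have "\<dots> = (crad * \<rho> / sqrt (real K))\<^sup>2" by (simp add: power_divide)
        finally have W'2: "fro2 d K (\<lambda>a. tie m w' a - tie m w a) \<le> (crad * \<rho> / sqrt (real K))\<^sup>2" .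
        have f: "fro2 d K (tie m v) = real K * (\<Sum>j<m. (v j)\<^sup>2)" for v unfolding d_def by (rule fro2_tie[OF m])
        have up: "avg_hess d K n S (tie m w') (tie m v) \<le> 22 * real K * (\<Sum>j<m. (v j)\<^sup>2)" for v
        proof -
          have "avg_hess d K n S (tie m w') (tie m v) \<le> 22 * fro2 d K (tie m v)" using H S W'2 by blast
          then show ?thesis unfolding f by simp
        qed
        have "\<rho> * fro2 d K (tie m v) \<le> integral\<^sup>L (gauss_vec d) (\<lambda>x. (grad_sum d K (tie m w) (tie m v) x)\<^sup>2)" for v
          unfolding \<rho>_def d_def using cnn_population_lower_bound[OF m w1] \<rho>0 unfolding \<rho>_def by blast
        then have "\<rho> / (8 * (real K)\<^sup>2) * fro2 d K (tie m v) \<le> avg_hess d K n S (tie m w') (tie m v)" for v using H S W'2 by blast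
        moreover have "\<rho> / (8 * (real K)\<^sup>2) * fro2 d K (tie m v) = 1/8 * (1 / real K) * \<rho> * (\<Sum>j<m. (v j)\<^sup>2)" for v
          unfolding f using K by (simp add: power2_eq_square)
        ultimately have lo: "1/8 * (1 / real K) * \<rho> * (\<Sum>j<m. (v j)\<^sup>2) \<le> avg_hess d K n S (tie m w') (tie m v)" for v by simp
        show "hess_between (1/8 * (1 / real K) * \<rho>) (22 * real K) (fn_cnn m K n S) w' {..<m}"
          unfolding hess_between_def hessian_quad_cnn[OF K m] d_def[symmetric] using up lo by blast
      qed
      then show ?thesis using A unfolding Let_def prob_at_least_def dd[symmetric] \<rho>_def[symmetric] H_cnn_tie[OF m] d_def[symmetric]
        by blast
    qed
  qed (use crad in auto)
qed

theorem theorem1: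
  shows
  "(\<exists>c1 c2 c C :: real. c1 > 0 \<and> c2 > 0 \<and> c > 0 \<and> C > 0 \<and>
     (\<forall>(d::nat) (K::nat) (Wstar :: nat \<times> nat \<Rightarrow> real) (n::nat).
        d \<ge> 1 \<longrightarrow> K \<ge> 1 \<longrightarrow>
        (\<forall>k<K. (\<Sum>i<d. (Wstar (i, k))\<^sup>2) \<le> 1) \<longrightarrow>
        (\<forall>s \<in># sing_vals d K Wstar. s > 0) \<longrightarrow>
        rho_fcn (sigma_min d K Wstar) > 0 \<longrightarrow>
        real n \<ge> c1 * real d * real K ^ 5 * (ln (real d))\<^sup>2 *
           ((cond_kappa d K Wstar)\<^sup>2 * cond_lambda d K Wstar / rho_fcn (sigma_min d K Wstar))\<^sup>2 \<longrightarrow>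
        (let \<rho> = rho_fcn (sigma_min d K Wstar);
             \<kappa> = cond_kappa d K Wstar; lam = cond_lambda d K Wstar;
             r = c2 / sqrt (real K) * (\<rho> / (\<kappa>\<^sup>2 * lam));
             I = {..<d} \<times> {..<K}
         in prob_at_least (sample_dist n d (H_fcn d K Wstar))
              {S. \<forall>W. (\<Sum>a\<in>I. (W a - Wstar a)\<^sup>2) \<le> r\<^sup>2 \<longrightarrow>
                     hess_between (c * (1 / (real K)\<^sup>2) * (\<rho> / (\<kappa>\<^sup>2 * lam))) C
                        (fn_fcn d K n S) W I}
              (1 - real d powr (-10)))))
   \<and>
   (\<exists>c3 c4 c' C' :: real. c3 > 0 \<and> c4 > 0 \<and> c' > 0 \<and> C' > 0 \<and>
     (\<forall>(m::nat) (K::nat) (wstar :: nat \<Rightarrow> real) (n::nat).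
        m \<ge> 1 \<longrightarrow> K \<ge> 1 \<longrightarrow>
        (\<Sum>j<m. (wstar j)\<^sup>2) \<le> 1 \<longrightarrow>
        rho_cnn (sqrt (\<Sum>j<m. (wstar j)\<^sup>2)) > 0 \<longrightarrow>
        real n \<ge> c3 * real (m * K) * real K ^ 5 * (ln (real (m * K)))\<^sup>2 *
           (1 / rho_cnn (sqrt (\<Sum>j<m. (wstar j)\<^sup>2)))\<^sup>2 \<longrightarrow>
        (let \<rho> = rho_cnn (sqrt (\<Sum>j<m. (wstar j)\<^sup>2));
             r = c4 / (real K)\<^sup>2 * \<rho>
         in prob_at_least (sample_dist n (m * K) (H_cnn m K wstar))
              {S. \<forall>w. (\<Sum>j<m. (w j - wstar j)\<^sup>2) \<le> r\<^sup>2 \<longrightarrow>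
                     hess_between (c' * (1 / real K) * \<rho>) (C' * real K)
                        (fn_cnn m K n S) w {..<m}}
              (1 - real (m * K) powr (-10)))))"
  using fcn_theorem cnn_theorem by (rule conjI)

end
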